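(* Assume condition (A): there exist $C_A,\gamma_A>0$ and, for all $x,y\in E$, a Markovian coupling $\mathbb{P}_{(x,y)}$ between $\mathbb{P}_x$ and $\mathbb{P}_y$ such that for all $t\in I$, $\mathbb{E}_{(x,y)}[G^X_t\, d(X_t,Y_t)]\le C_A e^{-\gamma_A t}d(x,y)$. Then there exists a $d$-Lipschitz function $\eta:E\to(0,+\infty)$ such that $$\eta(x)=\lim_{t\to+\infty}e^{\lambda_0t}\,\mathbb{E}_xZ_t,\qquad x\in E,$$ where $\lambda_0$ is the absorption rate of the quasi-stationary distribution $\nu_{QS}$, and the convergence holds exponentially fast for the uniform norm on $E$. The function $\eta$ also satisfies $\nu_{QS}(\eta)=1$, $P_t\eta(x)=e^{-\lambda_0t}\eta(x)$ for all $x\in E$ and $t\in I$, and is uniformly bounded away from $0$ on $E$.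
   Context: Setting. $(E,d)$ is a Polish space whose distance satisfies $d\le\bar d$ on $E\times E$ for a finite constant $\bar d$. The time set $I$ is either $[0,+\infty)$ or $\mathbb{Z}_+$. $(\Omega,(\mathcal F_t)_{t\in I},(\mathbb{P}_x)_{x\in E},(X_t)_{t\in I})$ is a time-homogeneous Markov process in $E$ with $\mathbb{P}_x(X_0=x)=1$; $\mathbb{E}_x$ is the expectation under $\mathbb{P}_x$. The function $\rho:E\to\mathbb{R}_+$ is $d$-Lipschitz. The penalization is $Z_t=Z_t(X)=e^{-\int_0^t\rho(X_s)ds}$ if $I=[0,+\infty)$ (the integral being assumed well defined), and $Z_t=Z_t(X)=p(X_0)p(X_1)\cdots p(X_{t-1})$ with $p=e^{-\rho}$ (and $Z_0=1$) if $I=\mathbb{Z}_+$. The penalized semigroup is $P_tf(x)=\mathbb{E}_x[Z_tf(X_t)]$ for bounded measurable $f$, and $\mu P_tf=\int_E P_tf(x)\,\mu(dx)$ for a probability measure $\mu$. Couplings. A coupling measure between $\mathbb{P}_x$ and $\mathbb{P}_y$ is a probability measure $\mathbb{P}_{(x,y)}$ on a space carrying $(X_t,Y_t)_{t\in I}$ such that $(X_t)$ has the law of $X$ under $\mathbb{P}_x$ and $(Y_t)$ the law of $X$ under $\mathbb{P}_y$. It is Markovian if $(X_t,Y_t)_{t\in I}$ is Markov with respect to its natural filtration; the couplings are understood as a family $(\mathbb{P}_{(x,y)})_{x,y\in E}$ of laws of a time-homogeneous Markov process on $E\times E$ started from $(x,y)$ (conditionally on the past up to time $t$, the process shifted by $t$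 has law $\mathbb{P}_{(X_t,Y_t)}$). Write $Z^X_t=Z_t(X)$ and $G^X_t=Z^X_t/\mathbb{E}_xZ_t$. A quasi-stationary distribution is a probability measure $\nu$ on $E$ with $\frac{\nu P_t}{\nu P_t\mathbf 1}=\nu$ for all $t\in I$; to it is associated a number $\lambda_0\ge0$, its absorption rate, such that $\nu P_t=e^{-\lambda_0t}\nu$ for all $t\in I$. Under (A) there is a unique quasi-stationary distribution, denoted $\nu_{QS}$. *)

theory Defs
  imports "HOL-Probability.Probability"
begin

text \<open>
  The time set \<open>I\<close> is a set of reals, either \<open>{0..}\<close> or \<open>\<nat>\<close> (the copy of the natural numbers in the
  reals); processes are indexed by all reals but are only ever evaluated at times in \<open>I\<close>.
  The state space is a type of class \<open>polish_space\<close>, so \<open>dist\<close> is a complete separable metric.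
\<close>

definition path_law ::
  "real set \<Rightarrow> (real \<Rightarrow> 'w \<Rightarrow> 's::topological_space) \<Rightarrow> 'w measure \<Rightarrow> (real \<Rightarrow> 's) measure" where
  "path_law I X Q = distr Q (PiM I (\<lambda>_. borel)) (\<lambda>\<omega>. \<lambda>t\<in>I. X t \<omega>)"

definition natural_filtration ::
  "real set \<Rightarrow> 'w measure \<Rightarrow> (real \<Rightarrow> 'w \<Rightarrow> 's::topological_space) \<Rightarrow> real \<Rightarrow> 'w measure" where
  "natural_filtration I M X t =
     sigma (space M) (\<Union>s\<in>{s \<in> I. s \<le> t}. {X s -` B \<inter> space M | B. B \<in> sets borel})"

text \<open>
  \<open>M\<close> only carries the measurable space on which all the laws \<open>P x\<close> live; its measure is irrelevant.
  The Markov property is: conditionally on \<open>F t\<close>, the process shifted by \<open>t\<close> has law \<open>P (X t)\<close>.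
\<close>

locale markov_process =
  fixes I :: "real set"
    and M :: "'w measure"
    and F :: "real \<Rightarrow> 'w measure"
    and P :: "'s::topological_space \<Rightarrow> 'w measure"
    and X :: "real \<Rightarrow> 'w \<Rightarrow> 's"
  assumes time_set: "I = {0..} \<or> I = \<nat>"
    and prob_P: "prob_space (P x)"
    and sets_P: "sets (P x) = sets M"
    and subalgebra_F: "t \<in> I \<Longrightarrow> subalgebra M (F t)"
    and mono_F: "s \<in> I \<Longrightarrow> t \<in> I \<Longrightarrow> s \<le> t \<Longrightarrow> sets (F s) \<subseteq> sets (F t)"
    and adapted: "t \<in> I \<Longrightarrow> X t \<in> F t \<rightarrow>\<^sub>M borel"
    and start: "AE \<omega> in P x. X 0 \<omega> = x"
    and kernel: "(\<lambda>x. path_law I X (P x)) \<in> borel \<rightarrow>\<^sub>M prob_algebra (PiM I (\<lambda>_. borel))"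
    and markov: "t \<in> I \<Longrightarrow> A \<in> sets (PiM I (\<lambda>_. borel)) \<Longrightarrow>
      AE \<omega> in P x.
        real_cond_exp (P x) (F t) (indicator {\<omega> \<in> space M. (\<lambda>s\<in>I. X (t + s) \<omega>) \<in> A}) \<omega>
          = measure (path_law I X (P (X t \<omega>))) A"

text \<open>
  In continuous time, the integral of \<open>\<rho>\<close> along the process is a well defined random variable: \<open>\<rho>\<close>
  evaluated along the process is jointly measurable in time and randomness. In discrete time there
  is nothing to require.
\<close>

definition penalization_well_defined ::
  "real set \<Rightarrow> ('e \<Rightarrow> real) \<Rightarrow> 'w measure \<Rightarrow> (real \<Rightarrow> 'w \<Rightarrow> 'e) \<Rightarrow> bool" where
  "penalization_well_defined I \<rho> M X \<longleftrightarrow>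
     (I = {0..} \<longrightarrow>
        (\<lambda>(s, \<omega>). \<rho> (X s \<omega>)) \<in> borel_measurable (restrict_space borel {0..} \<Otimes>\<^sub>M M))"

definition penalization ::
  "real set \<Rightarrow> ('e \<Rightarrow> real) \<Rightarrow> (real \<Rightarrow> 'w \<Rightarrow> 'e) \<Rightarrow> real \<Rightarrow> 'w \<Rightarrow> real" where
  "penalization I \<rho> X t \<omega> =
     (if I = {0..} then exp (- (LBINT s:{0..t}. \<rho> (X s \<omega>)))
      else (\<Prod>k<nat \<lfloor>t\<rfloor>. exp (- \<rho> (X (real k) \<omega>))))"

definition penalized_semigroup ::
  "real set \<Rightarrow> ('e \<Rightarrow> real) \<Rightarrow> ('e \<Rightarrow> 'w measure) \<Rightarrow> (real \<Rightarrow> 'w \<Rightarrow> 'e) \<Rightarrow> real \<Rightarrow>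
     ('e \<Rightarrow> real) \<Rightarrow> 'e \<Rightarrow> real" where
  "penalized_semigroup I \<rho> P X t f x = (\<integral>\<omega>. penalization I \<rho> X t \<omega> * f (X t \<omega>) \<partial>P x)"

text \<open>The action \<open>\<mu> P\<^sub>t f\<close> of the semigroup on measures.\<close>

definition penalized_action ::
  "real set \<Rightarrow> ('e \<Rightarrow> real) \<Rightarrow> ('e \<Rightarrow> 'w measure) \<Rightarrow> (real \<Rightarrow> 'w \<Rightarrow> 'e) \<Rightarrow> 'e measure \<Rightarrow> real \<Rightarrow>
     ('e \<Rightarrow> real) \<Rightarrow> real" where
  "penalized_action I \<rho> P X \<mu> t f = (\<integral>x. penalized_semigroup I \<rho> P X t f x \<partial>\<mu>)"

text \<open>Equalities between finite measures are expressed by testing against bounded measurable functions.\<close>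

definition quasi_stationary ::
  "real set \<Rightarrow> ('e::topological_space \<Rightarrow> real) \<Rightarrow> ('e \<Rightarrow> 'w measure) \<Rightarrow> (real \<Rightarrow> 'w \<Rightarrow> 'e) \<Rightarrow>
     'e measure \<Rightarrow> bool" where
  "quasi_stationary I \<rho> P X \<nu> \<longleftrightarrow>
     prob_space \<nu> \<and> sets \<nu> = sets borel \<and>
     (\<forall>t\<in>I. \<forall>f\<in>borel_measurable borel. bounded (range f) \<longrightarrow>
        penalized_action I \<rho> P X \<nu> t f / penalized_action I \<rho> P X \<nu> t (\<lambda>_. 1) = (\<integral>x. f x \<partial>\<nu>))"

definition absorption_rate ::
  "real set \<Rightarrow> ('e::topological_space \<Rightarrow> real) \<Rightarrow> ('e \<Rightarrow> 'w measure) \<Rightarrow> (real \<Rightarrow> 'w \<Rightarrow> 'e) \<Rightarrow>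
     'e measure \<Rightarrow> real" where
  "absorption_rate I \<rho> P X \<nu> =
     (THE l. 0 \<le> l \<and>
        (\<forall>t\<in>I. \<forall>f\<in>borel_measurable borel. bounded (range f) \<longrightarrow>
           penalized_action I \<rho> P X \<nu> t f = exp (- l * t) * (\<integral>x. f x \<partial>\<nu>)))"

text \<open>
  The quasi-stationary distribution, meaningful when it exists and is unique, as is the case under
  the contraction condition.
\<close>

definition qsd ::
  "real set \<Rightarrow> ('e::topological_space \<Rightarrow> real) \<Rightarrow> ('e \<Rightarrow> 'w measure) \<Rightarrow> (real \<Rightarrow> 'w \<Rightarrow> 'e) \<Rightarrow>
     'e measure" where
  "qsd I \<rho> P X = (THE \<nu>. quasi_stationary I \<rho> P X \<nu>)"

text \<open>
  A family \<open>Q (x, y)\<close> of Markovian couplings between \<open>P x\<close> and \<open>P y\<close>: the laws of a time-homogeneous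
  Markov process \<open>(X', Y')\<close>, with respect to its natural filtration, started from \<open>(x, y)\<close>.
\<close>

definition markovian_coupling ::
  "real set \<Rightarrow> ('e::topological_space \<Rightarrow> 'w measure) \<Rightarrow> (real \<Rightarrow> 'w \<Rightarrow> 'e) \<Rightarrow>
     'v measure \<Rightarrow> ('e \<times> 'e \<Rightarrow> 'v measure) \<Rightarrow> (real \<Rightarrow> 'v \<Rightarrow> 'e) \<Rightarrow> (real \<Rightarrow> 'v \<Rightarrow> 'e) \<Rightarrow> bool" where
  "markovian_coupling I P X N Q X' Y' \<longleftrightarrow>
     markov_process I N (natural_filtration I N (\<lambda>t \<omega>. (X' t \<omega>, Y' t \<omega>))) Q
       (\<lambda>t \<omega>. (X' t \<omega>, Y' t \<omega>)) \<and>
     (\<forall>x y. path_law I X' (Q (x, y)) = path_law I X (P x) \<and>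
            path_law I Y' (Q (x, y)) = path_law I X (P y))"

end

(*
  Let m_t(x) = E_x Z_t and let M_t be its supremum over x. For integers n the coupling and the Markov
  property give a Lasota-Yorke inequality for P_n, with error terms e^{-gamma k} m_k(x) M_{n-1-k}, k < n,
  and Jensen's inequality gives
    m_n(y) >= m_n(x) exp (- c * sum over k < n of e^{-gamma k} m_k(x) M_{n-1-k} / m_n(x)).
  Let lambda = sup (- ln M_n / n), so that M_n e^{lambda n} >= 1 grows subexponentially. At a record time
  of M_n e^{lambda n} e^{gamma n / 2} the Jensen exponent is bounded, which gives M_n <= H inf m_n there;
  submultiplicativity then bounds M_n e^{lambda n} at all times, and a second use of Jensen gives the
  Harnack inequality for all n. With it, the Lasota-Yorke inequality and the mixing of the coupling make
  f |-> P_n f / m_n contract geometrically on Lipschitz functions. Hence e^{lambda t} m_t converges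
  uniformly to eta, and the normalized laws converge to the quasi-stationary distribution, whose
  absorption rate is lambda.

  The limit law is a measure rather than only a functional on Lipschitz functions: the law of the sequence
  of indicators of countably many balls has a projective limit on R^N, which is carried by the codes of
  points of E, since the Lipschitz Cauchy estimate makes the approximating laws tight.
*)

theory Submission
  imports Defs
begin

section \<open>Limits of probability measures tested on Lipschitz functions\<close>

text \<open>Condition (A) weights the distance by the penalization of the first process alone, so
  the error terms compare \<open>m_k(x) M_{n-1-k}\<close> with \<open>m_n(x)\<close>. Bounding them
  requires a comparison of masses at different points, which is what they are meant to prove. Record
  times break this circle: there the masses at earlier times are controlled by \<open>M_n\<close> at
  the price of only half of the decay \<gamma>. The second obstacle is measurability. Path laws live
  on the product sigma-algebra, for which the time integral of \<rho> is in general not measurable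
  in continuous time; so neither the equality of marginal laws nor the Markov property speaks
  directly about \<open>Z\<close>. Both are used at finitely many randomly sampled times, followed
  by a limit. Likewise \<rho> along the process is jointly but not progressively measurable, so the
  integral up to time \<open>t\<close> is replaced by a version that is measurable for the past.
  Lasota-Yorke and Jensen are needed at integer times only; the semigroup property reaches the other
  times in \<open>I\<close>.\<close>

lemma diagonal_convergent_subsequence:
  fixes f :: "nat \<Rightarrow> nat \<Rightarrow> real"
  assumes bdd: "\<And>n i. \<bar>f n i\<bar> \<le> B"
  obtains s :: "nat \<Rightarrow> nat" where "strict_mono s" "\<And>i. convergent (\<lambda>n. f (s n) i)"
proof -
  let ?P = "\<lambda>i s. convergent (\<lambda>k. f (s k) i)"
  interpret nat: subseqs ?P
  proof
    fix i and s :: "nat \<Rightarrow> nat" assume "strict_mono s"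
    have "f (s k) i \<in> {-B..B}" for k using bdd by (simp add: abs_le_iff minus_le_iff)
    then obtain l r where "strict_mono r" "((\<lambda>k. f (s k) i) \<circ> r) \<longlonglongrightarrow> l"
      using compact_Icc compact_imp_seq_compact seq_compactE by metis
    then show "\<exists>r. strict_mono r \<and> convergent (\<lambda>k. f ((s \<circ> r) k) i)"
      by (auto simp: comp_def convergent_def)
  qed
  \<comment> \<open>The diagonal sequence is a subsequence of the \<open>i\<close>-th extracted one
    only from index \<open>Suc i\<close> on, so convergence is shown for this tail and then
    transferred.\<close>
  have "?P i nat.diagseq" for i
  proof -
    have "?P i (nat.diagseq \<circ> (+) (Suc i))"
    proof (rule nat.diagseq_holds)
      fix r s :: "nat \<Rightarrow> nat" and n assume "strict_mono r" "convergent (\<lambda>k. f (s k) n)"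
      then show "convergent (\<lambda>k. f ((s \<circ> r) k) n)"
        using convergent_subseq_convergent[of "\<lambda>k. f (s k) n" r] by (simp add: comp_def)
    qed
    then show ?thesis
      using convergent_ignore_initial_segment[of "\<lambda>k. f (nat.diagseq k) i" "Suc i"] by (simp add: comp_def add.commute)
  qed
  then show ?thesis using that nat.subseq_diagseq by blast
qed

text \<open>The masses of all cells cut out by finitely many of the sets \<open>B j\<close> converge
  along one diagonal subsequence. Their limits are consistent finite-dimensional laws, and
  Kolmogorov's extension theorem joins them into a law on sequences. No tightness enters here: mass
  that escapes from the space reappears on sequences that are not the code of a point.\<close>

lemma limit_law_of_indicators:
  fixes \<mu> :: "nat \<Rightarrow> 'a measure" and B :: "nat \<Rightarrow> 'a set"
  assumes prob: "\<And>n. prob_space (\<mu> n)" and sets_\<mu>: "\<And>n. sets (\<mu> n) = sets N" and B: "\<And>j. B j \<in> sets N"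
  obtains s and \<Lambda> :: "(nat \<Rightarrow> real) measure" where "strict_mono s" "prob_space \<Lambda>"
    "sets \<Lambda> = sets (PiM UNIV (\<lambda>_. borel))"
    "\<forall>J g. finite J \<longrightarrow> g \<in> borel_measurable (PiM UNIV (\<lambda>_. borel)) \<longrightarrow>
      (\<forall>y y'. (\<forall>j\<in>J. y j = y' j) \<longrightarrow> g y = (g y' :: real)) \<longrightarrow>
      (\<lambda>n. \<integral>x. g (\<lambda>j. indicator (B j) x) \<partial>\<mu> (s n)) \<longlonglongrightarrow> (\<integral>y. g y \<partial>\<Lambda>)"
proof -
  define code where "code J x = {j \<in> J. x \<in> B j}" for J x
  \<comment> \<open>The cells are the atoms, some of them possibly empty, of the finite algebra
    generated by the \<open>B j\<close> with \<open>j \<in> J\<close>.\<close>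
  define cell where "cell J A = {x \<in> space N. code J x = A}" for J A
  have space_\<mu>: "space (\<mu> n) = space N" for n using sets_eq_imp_space_eq[OF sets_\<mu>] .
  have code_sets: "{x \<in> space N. code J x \<in> S} \<in> sets N" if "finite J" for J S
  proof -
    have cell_eq: "cell J A = (\<Inter>j\<in>J. if j \<in> A then B j \<inter> space N else space N - B j) \<inter> space N" if "A \<subseteq> J" for A
      unfolding cell_def code_def using that by (auto split: if_splits)
    have "cell J A \<in> sets N" if "A \<subseteq> J" for A
      unfolding cell_eq[OF that]
    proof (cases "J = {}")
      case False
      then show "(\<Inter>j\<in>J. if j \<in> A then B j \<inter> space N else space N - B j) \<inter> space N \<in> sets N"
        using B \<open>finite J\<close> by (intro sets.Int sets.finite_INT) auto
    qed simp
    then have "(\<Union>A\<in>S \<inter> Pow J. cell J A) \<in> sets N" using \<open>finite J\<close> by (intro sets.finite_UN) auto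
    also have "(\<Union>A\<in>S \<inter> Pow J. cell J A) = {x \<in> space N. code J x \<in> S}"
      unfolding cell_def code_def by auto
    finally show ?thesis .
  qed
  have cell_sets: "cell J A \<in> sets N" if "finite J" for J A
    using code_sets[OF that, of "{A}"] unfolding cell_def by simp
  \<comment> \<open>One index \<open>i\<close> encodes a pair of finite sets \<open>(J, A)\<close>,
    so the diagonal lemma treats all cells at once.\<close>
  define f where "f n i = measure (\<mu> n) (cell (set_decode (fst (prod_decode i))) (set_decode (snd (prod_decode i))))" for n i
  have "\<bar>f n i\<bar> \<le> 1" for n i unfolding f_def using prob_space.prob_le_1[OF prob] by simp
  then obtain s where s: "strict_mono s" "\<And>i. convergent (\<lambda>n. f (s n) i)"
    using diagonal_convergent_subsequence by blast
  define c where "c J A = lim (\<lambda>n. measure (\<mu> (s n)) (cell J A))" for J A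
  have c: "(\<lambda>n. measure (\<mu> (s n)) (cell J A)) \<longlonglongrightarrow> c J A" if "finite J" "A \<subseteq> J" for J A
    using s(2)[of "prod_encode (set_encode J, set_encode A)"] that finite_subset[OF that(2,1)]
    unfolding f_def c_def convergent_LIMSEQ_iff by simp
  have dec: "measure (\<mu> n) {x \<in> space N. code J x \<in> S} = (\<Sum>A\<in>S \<inter> Pow J. measure (\<mu> n) (cell J A))"
    if J: "finite J" for n J S
  proof -
    interpret prob_space "\<mu> n" by (rule prob)
    have "measure (\<mu> n) (\<Union>A\<in>S \<inter> Pow J. cell J A) = (\<Sum>A\<in>S \<inter> Pow J. measure (\<mu> n) (cell J A))"
      using J cell_sets[OF J] sets_\<mu> by (intro finite_measure_finite_Union) (auto simp: disjoint_family_on_def cell_def)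
    also have "(\<Union>A\<in>S \<inter> Pow J. cell J A) = {x \<in> space N. code J x \<in> S}"
      unfolding cell_def code_def by auto
    finally show ?thesis .
  qed
  define Q where "Q J = embed_pmf (\<lambda>A. if A \<subseteq> J then c J A else 0)" for J
  have c0: "0 \<le> c J A" if "finite J" "A \<subseteq> J" for J A
    by (rule LIMSEQ_le_const[OF c[OF that]]) auto
  have csum: "(\<Sum>A\<in>Pow J. c J A) = 1" if J: "finite J" for J
  proof (rule LIMSEQ_unique)
    show "(\<lambda>n. \<Sum>A\<in>Pow J. measure (\<mu> (s n)) (cell J A)) \<longlonglongrightarrow> (\<Sum>A\<in>Pow J. c J A)"
      using c J by (intro tendsto_sum) auto
    have "(\<Sum>A\<in>Pow J. measure (\<mu> n) (cell J A)) = 1" for n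
      using dec[OF J, of n UNIV] prob_space.prob_space[OF prob, of n] space_\<mu> by simp
    then show "(\<lambda>n. \<Sum>A\<in>Pow J. measure (\<mu> (s n)) (cell J A)) \<longlonglongrightarrow> 1" by simp
  qed
  have pmf_Q: "pmf (Q J) A = (if A \<subseteq> J then c J A else 0)" if J: "finite J" for J A
    unfolding Q_def
  proof (rule pmf_embed_pmf)
    show "0 \<le> (if A \<subseteq> J then c J A else 0)" for A using c0[OF J] by simp
    have "(\<integral>\<^sup>+A. ennreal (if A \<subseteq> J then c J A else 0) \<partial>count_space UNIV) = (\<Sum>A\<in>Pow J. ennreal (if A \<subseteq> J then c J A else 0))"
      using J by (intro nn_integral_count_space') auto
    also have "\<dots> = (\<Sum>A\<in>Pow J. ennreal (c J A))" by (intro sum.cong) auto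
    also have "\<dots> = ennreal (\<Sum>A\<in>Pow J. c J A)" using c0[OF J] by (intro sum_ennreal) auto
    finally show "(\<integral>\<^sup>+A. ennreal (if A \<subseteq> J then c J A else 0) \<partial>count_space UNIV) = 1" using csum[OF J] by simp
  qed
  have set_Q: "set_pmf (Q J) \<subseteq> Pow J" if "finite J" for J
    using pmf_Q[OF that] by (auto simp: set_pmf_iff split: if_splits)
  have meas_Q: "(\<lambda>n. measure (\<mu> (s n)) {x \<in> space N. code J x \<in> S}) \<longlonglongrightarrow> measure (measure_pmf (Q J)) S"
    if J: "finite J" for J S
  proof -
    have "measure (measure_pmf (Q J)) S = measure (measure_pmf (Q J)) (S \<inter> Pow J)"
      using set_Q[OF J] by (intro measure_pmf.finite_measure_eq_AE) (auto simp: AE_measure_pmf_iff)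
    also have "\<dots> = (\<Sum>A\<in>S \<inter> Pow J. pmf (Q J) A)" using J by (intro measure_measure_pmf_finite) auto
    also have "\<dots> = (\<Sum>A\<in>S \<inter> Pow J. c J A)" using pmf_Q[OF J] by (intro sum.cong) auto
    finally show ?thesis unfolding dec[OF J] using c J by (auto intro!: tendsto_sum)
  qed
  \<comment> \<open>Consistency holds before the limit, where both sides are the mass of one and the
    same event; uniqueness of limits carries it over.\<close>
  have Q_map: "Q J = map_pmf (\<lambda>A. A \<inter> J) (Q H)" if "J \<subseteq> H" "finite H" for J H
  proof (rule pmf_eqI)
    have J: "finite J" using that finite_subset by blast
    fix A
    have "code H x \<inter> J = code J x" for x using that unfolding code_def by auto
    then have eq: "{x \<in> space N. code H x \<in> (\<lambda>A. A \<inter> J) -` {A}} = {x \<in> space N. code J x \<in> {A}}" by auto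
    have "measure (measure_pmf (Q J)) {A} = measure (measure_pmf (Q H)) ((\<lambda>A. A \<inter> J) -` {A})"
      using meas_Q[OF J, of "{A}"] meas_Q[OF that(2), of "(\<lambda>A. A \<inter> J) -` {A}"] unfolding eq
      by (rule LIMSEQ_unique)
    then show "pmf (Q J) A = pmf (map_pmf (\<lambda>A. A \<inter> J) (Q H)) A"
      by (simp add: pmf_map measure_pmf_single)
  qed
  define PJ :: "nat set \<Rightarrow> (nat \<Rightarrow> real) measure" where
    "PJ J = distr (measure_pmf (Q J)) (PiM J (\<lambda>_. borel)) (\<lambda>A. \<lambda>j\<in>J. indicator A j)" for J
  have meas_code: "(\<lambda>A. \<lambda>j\<in>J. indicator A j) \<in> measurable (measure_pmf q) (PiM J (\<lambda>_. borel :: real measure))" for J q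
    by (auto simp: space_PiM)
  have PJ_restrict: "PJ J = distr (PJ H) (PiM J (\<lambda>_. borel)) (\<lambda>f. restrict f J)"
    if JH: "J \<subseteq> H" "finite H" for J H
  proof -
    have "distr (PJ H) (PiM J (\<lambda>_. borel)) (\<lambda>f. restrict f J)
      = distr (measure_pmf (Q H)) (PiM J (\<lambda>_. borel)) ((\<lambda>f. restrict f J) \<circ> (\<lambda>A. \<lambda>j\<in>H. indicator A j))"
      unfolding PJ_def using JH meas_code by (intro distr_distr measurable_restrict_subset) auto
    also have "(\<lambda>f. restrict f J) \<circ> (\<lambda>A. \<lambda>j\<in>H. indicator A j) = (\<lambda>A. \<lambda>j\<in>J. indicator A j :: real) \<circ> (\<lambda>A. A \<inter> J)"
      using JH by (auto simp: fun_eq_iff restrict_def indicator_def)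
    also have "distr (measure_pmf (Q H)) (PiM J (\<lambda>_. borel)) \<dots> = PJ J"
      unfolding PJ_def Q_map[OF JH] map_pmf_rep_eq
      by (rule distr_distr[symmetric]) (auto simp: space_PiM)
    finally show ?thesis by (rule sym)
  qed
  interpret polish_projective UNIV PJ
  proof (intro polish_projective.intro projective_family.intro)
    show "PJ J = distr (PJ H) (PiM J (\<lambda>_. borel)) (\<lambda>f. restrict f J)" if "J \<subseteq> H" "finite H" for J H
      by (rule PJ_restrict[OF that])
    show "prob_space (PJ J)" for J unfolding PJ_def
      by (rule measure_pmf.prob_space_distr[OF meas_code])
  qed
  show ?thesis
  proof (rule that[of s lim])
    show "strict_mono s" by (rule s)
    show "prob_space lim" by (rule P.prob_space_axioms)
    show "sets lim = sets (PiM UNIV (\<lambda>_. borel))" by simp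
  next
    have "(\<lambda>n. \<integral>x. g (\<lambda>j. indicator (B j) x) \<partial>\<mu> (s n)) \<longlonglongrightarrow> (\<integral>y. g y \<partial>lim)"
      if J: "finite J" and g: "g \<in> borel_measurable (PiM UNIV (\<lambda>_. borel))"
      and dep': "\<forall>y y'. (\<forall>j\<in>J. y j = y' j) \<longrightarrow> g y = g y'"
      for J and g :: "(nat \<Rightarrow> real) \<Rightarrow> real"
    proof -
      have dep: "g y = g y'" if "\<And>j. j \<in> J \<Longrightarrow> y j = y' j" for y y' using dep' that by blast
      \<comment> \<open>Padding with zeros turns \<open>g\<close>, which reads only the coordinates
        in \<open>J\<close>, into a function on the finite product.\<close>
      define e :: "(nat \<Rightarrow> real) \<Rightarrow> nat \<Rightarrow> real" where "e z j = (if j \<in> J then z j else 0)" for z j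
      have e_meas: "e \<in> measurable (PiM J (\<lambda>_. borel)) (PiM UNIV (\<lambda>_. borel))"
      proof (rule measurable_PiM_single')
        show "(\<lambda>z. e z j) \<in> borel_measurable (PiM J (\<lambda>_. borel))" for j
          by (cases "j \<in> J") (auto simp: e_def)
      qed (auto simp: space_PiM)
      have ge: "(\<lambda>z. g (e z)) \<in> borel_measurable (PiM J (\<lambda>_. borel))" using measurable_compose[OF e_meas g] .
      have restr: "(\<lambda>y. restrict y J) \<in> measurable lim (PiM J (\<lambda>_. borel))"
        unfolding measurable_cong_sets[OF sets_lim refl] by (rule measurable_restrict_subset) simp
      have "distr lim (PiM J (\<lambda>_. borel)) (\<lambda>y. restrict y J) = PJ J"
      proof (rule measure_eqI)
        show "sets (distr lim (PiM J (\<lambda>_. borel)) (\<lambda>y. restrict y J)) = sets (PJ J)" unfolding PJ_def by simp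
        fix X assume "X \<in> sets (distr lim (PiM J (\<lambda>_. borel)) (\<lambda>y. restrict y J))"
        then have X: "X \<in> sets (PiM J (\<lambda>_. borel :: real measure))" by simp
        have "emeasure (distr lim (PiM J (\<lambda>_. borel)) (\<lambda>y. restrict y J)) X = emeasure lim (prod_emb UNIV (\<lambda>_. borel) J X)"
          using X by (subst emeasure_distr[OF restr]) (auto simp: prod_emb_def space_PiM vimage_def)
        also have "\<dots> = emeasure (PJ J) X" using J X by (intro emeasure_lim_emb) auto
        finally show "emeasure (distr lim (PiM J (\<lambda>_. borel)) (\<lambda>y. restrict y J)) X = emeasure (PJ J) X" .
      qed
      then have "(\<integral>z. g (e z) \<partial>PJ J) = (\<integral>z. g (e z) \<partial>distr lim (PiM J (\<lambda>_. borel)) (\<lambda>y. restrict y J))" by simp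
      also have "\<dots> = (\<integral>y. g (e (restrict y J)) \<partial>lim)"
        by (rule integral_distr[OF restr ge])
      also have "\<dots> = (\<integral>y. g y \<partial>lim)" by (intro Bochner_Integration.integral_cong dep) (auto simp: e_def)
      finally have "(\<integral>y. g y \<partial>lim) = (\<integral>A. g (e (\<lambda>j\<in>J. indicator A j)) \<partial>measure_pmf (Q J))"
        unfolding PJ_def using ge meas_code by (subst (asm) integral_distr) auto
      also have "\<dots> = (\<Sum>A\<in>Pow J. g (e (\<lambda>j\<in>J. indicator A j)) * pmf (Q J) A)"
        using set_Q[OF J] J by (intro integral_measure_pmf_real) auto
      also have "\<dots> = (\<Sum>A\<in>Pow J. g (indicator A) * c J A)"
        using pmf_Q[OF J] by (intro sum.cong arg_cong2[where f="(*)"] dep) (auto simp: e_def)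
      finally have lim_eq: "(\<integral>y. g y \<partial>lim) = (\<Sum>A\<in>Pow J. g (indicator A) * c J A)" .
      \<comment> \<open>On each cell the integrand is the constant \<open>g (indicator A)\<close>,
        so the integral is a finite sum that converges term by term.\<close>
      have "(\<integral>x. g (\<lambda>j. indicator (B j) x) \<partial>\<mu> n) = (\<Sum>A\<in>Pow J. g (indicator A) * measure (\<mu> n) (cell J A))" for n
      proof -
        interpret prob_space "\<mu> n" by (rule prob)
        have "(\<integral>x. g (\<lambda>j. indicator (B j) x) \<partial>\<mu> n) = (\<integral>x. (\<Sum>A\<in>Pow J. g (indicator A) * indicator (cell J A) x) \<partial>\<mu> n)"
        proof (rule Bochner_Integration.integral_cong)
          fix x assume x: "x \<in> space (\<mu> n)"
          have "(\<Sum>A\<in>Pow J. g (indicator A) * indicator (cell J A) x) = (\<Sum>A\<in>Pow J. if A = code J x then g (indicator A) else 0)"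
            using x space_\<mu> by (intro sum.cong) (auto simp: cell_def indicator_def)
          also have "\<dots> = g (indicator (code J x))" using J by (simp add: code_def)
          also have "\<dots> = g (\<lambda>j. indicator (B j) x)" by (rule dep) (simp add: code_def indicator_def)
          finally show "g (\<lambda>j. indicator (B j) x) = (\<Sum>A\<in>Pow J. g (indicator A) * indicator (cell J A) x)" by simp
        qed simp
        also have "\<dots> = (\<Sum>A\<in>Pow J. \<integral>x. g (indicator A) * indicator (cell J A) x \<partial>\<mu> n)"
          using cell_sets[OF J] sets_\<mu> by (intro Bochner_Integration.integral_sum integrable_mult_right) (simp add: integrable_indicator_iff fmeasurable_eq_sets less_top[symmetric])
        also have "\<dots> = (\<Sum>A\<in>Pow J. g (indicator A) * measure (\<mu> n) (cell J A))"
          using cell_sets[OF J] sets_\<mu> by (intro sum.cong) (auto simp: sets.Int_space_eq2)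
        finally show ?thesis .
      qed
      then show ?thesis
        unfolding lim_eq using c J by (auto intro!: tendsto_intros)
    qed
    then show "\<forall>J g. finite J \<longrightarrow> g \<in> borel_measurable (PiM UNIV (\<lambda>_. borel)) \<longrightarrow>
      (\<forall>y y'. (\<forall>j\<in>J. y j = y' j) \<longrightarrow> g y = (g y' :: real)) \<longrightarrow>
      (\<lambda>n. \<integral>x. g (\<lambda>j. indicator (B j) x) \<partial>\<mu> (s n)) \<longlonglongrightarrow> (\<integral>y. g y \<partial>lim)" by blast
  qed
qed

text \<open>Points are encoded by the balls of radius \<open>(1/2) ^ k\<close> around a dense
  sequence that contain them. The limit law of the codes charges only sequences from which a point
  can be decoded as a limit of centres, and \<nu> is its image under decoding. The estimate
  \<open>cauchy\<close> is used twice: for tightness, and for passing from the subsequence to the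
  whole sequence.\<close>

lemma lipschitz_limit_measure:
  fixes \<mu> :: "nat \<Rightarrow> 'e::polish_space measure" and e :: "nat \<Rightarrow> real"
  assumes prob: "\<And>n. prob_space (\<mu> n)" and sets_\<mu>: "\<And>n. sets (\<mu> n) = sets borel"
    and e: "e \<longlonglongrightarrow> 0"
    and cauchy: "\<And>L f b n k. L-lipschitz_on UNIV (f :: 'e \<Rightarrow> real) \<Longrightarrow> (\<And>z. \<bar>f z\<bar> \<le> b) \<Longrightarrow>
      \<bar>(\<integral>x. f x \<partial>\<mu> (n + k)) - (\<integral>x. f x \<partial>\<mu> n)\<bar> \<le> (L + b) * e n"
  obtains \<nu> where "prob_space \<nu>" "sets \<nu> = sets borel"
    "\<And>L f b. L-lipschitz_on UNIV (f :: 'e \<Rightarrow> real) \<Longrightarrow> (\<And>z. \<bar>f z\<bar> \<le> b) \<Longrightarrow>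
      (\<lambda>n. \<integral>x. f x \<partial>\<mu> n) \<longlonglongrightarrow> (\<integral>x. f x \<partial>\<nu>)"
proof -
  obtain S :: "'e set" where "countable S" and dense: "\<And>U. open U \<Longrightarrow> U \<noteq> {} \<Longrightarrow> \<exists>d\<in>S. d \<in> U"
    using countable_dense_setE by blast
  then have "S \<noteq> {}" using dense[of UNIV] by auto
  define q where "q = from_nat_into S"
  have q_dense: "\<exists>i. dist (q i) x < r" if "0 < r" for x r
  proof -
    have "x \<in> ball x r" using that by simp
    then obtain d where "d \<in> S" "d \<in> ball x r" using dense[of "ball x r"] by blast
    then show ?thesis using \<open>countable S\<close> from_nat_into_surj[of S d] unfolding q_def by (auto simp: dist_commute)
  qed
  define r where "r k = (1/2 :: real) ^ k" for k
  have r_pos: "0 < r k" for k unfolding r_def by simp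
  define B where "B j = ball (q (fst (prod_decode j))) (r (snd (prod_decode j)))" for j
  have B_sets: "B j \<in> sets borel" for j unfolding B_def by simp
  obtain s and \<Lambda> :: "(nat \<Rightarrow> real) measure" where s: "strict_mono s" and prob_\<Lambda>: "prob_space \<Lambda>"
    and sets_\<Lambda>: "sets \<Lambda> = sets (PiM UNIV (\<lambda>_. borel))"
    and lim': "\<forall>J g. finite J \<longrightarrow> g \<in> borel_measurable (PiM UNIV (\<lambda>_. borel)) \<longrightarrow>
      (\<forall>y y'. (\<forall>j\<in>J. y j = y' j) \<longrightarrow> g y = (g y' :: real)) \<longrightarrow>
      (\<lambda>n. \<integral>x. g (\<lambda>j. indicator (B j) x) \<partial>\<mu> (s n)) \<longlonglongrightarrow> (\<integral>y. g y \<partial>\<Lambda>)"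
    by (rule limit_law_of_indicators[where \<mu> = \<mu> and N = borel and B = B, OF prob sets_\<mu> B_sets])
  have lim: "(\<lambda>n. \<integral>x. g (\<lambda>j. indicator (B j) x) \<partial>\<mu> (s n)) \<longlonglongrightarrow> (\<integral>y. g y \<partial>\<Lambda>)"
    if "finite J" "g \<in> borel_measurable (PiM UNIV (\<lambda>_. borel))"
      "\<And>y y'. (\<And>j. j \<in> J \<Longrightarrow> y j = y' j) \<Longrightarrow> g y = g y'" for J and g :: "(nat \<Rightarrow> real) \<Rightarrow> real"
    by (rule lim'[rule_format]) (fact that(1), fact that(2), rule that(3), blast)
  interpret \<Lambda>: prob_space \<Lambda> by (rule prob_\<Lambda>)
  let ?PM = "PiM UNIV (\<lambda>_::nat. borel :: real measure)"
  have sp_\<Lambda>: "space \<Lambda> = UNIV" using sets_eq_imp_space_eq[OF sets_\<Lambda>] by (simp add: space_PiM)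
  have meas_\<Lambda>: "measurable \<Lambda> N = measurable ?PM N" for N :: "'x measure" using sets_\<Lambda> by (rule measurable_cong_sets) simp
  define code :: "'e \<Rightarrow> nat \<Rightarrow> real" where "code x = (\<lambda>j. indicator (B j) x)" for x
  define hit :: "nat \<Rightarrow> (nat \<Rightarrow> real) \<Rightarrow> nat \<Rightarrow> bool" where "hit k y i \<longleftrightarrow> y (prod_encode (i, k)) = 1" for k y i
  have hit_code: "hit k (code x) i \<longleftrightarrow> dist (q i) x < r k" for k x i
    unfolding hit_def code_def B_def by (simp add: indicator_def)
  have meas_hit [measurable]: "Measurable.pred ?PM (\<lambda>y. hit k y i)" for k i unfolding hit_def by measurable
  \<comment> \<open>Without any hit the value of \<open>idx\<close> is meaningless;
    \<open>miss\<close> and \<open>good\<close> screen this case off.\<close>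
  define idx where "idx k y = (LEAST i. hit k y i)" for k y
  have meas_idx [measurable]: "idx k \<in> measurable ?PM (count_space UNIV)" for k unfolding idx_def by measurable
  have meas_qidx: "(\<lambda>y. q (idx k y)) \<in> borel_measurable ?PM" for k
    by (rule measurable_compose[OF meas_idx]) simp
  define miss where "miss k I y \<longleftrightarrow> (\<forall>i<I. \<not> hit k y i)" for k I y
  have meas_miss [measurable]: "Measurable.pred ?PM (miss k I)" for k I unfolding miss_def by measurable
  have meas_miss_set: "{y. miss k I y} \<in> sets ?PM" for k I
    using meas_miss[of k I] by (simp add: pred_def space_PiM)
  have meas_code: "code \<in> measurable borel ?PM"
    unfolding code_def
    by (rule measurable_PiM_single') (auto simp: space_PiM intro!: borel_measurable_indicator B_sets)
  \<comment> \<open>Tightness: a Lipschitz function vanishing on the first \<open>I\<close> centres dominates the missed mass.\<close>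
  have tight: "\<exists>I. \<forall>n. measure (\<mu> n) {x. miss k I (code x)} \<le> \<epsilon>" if \<epsilon>: "0 < \<epsilon>" for k \<epsilon>
  proof -
    define h where "h I x = min 1 (infdist x (q ` {..<Suc I}) / r k)" for I x
    have h0: "0 \<le> h I x" for I x unfolding h_def using r_pos[of k] by (simp add: infdist_nonneg)
    have h1: "h I x \<le> 1" for I x unfolding h_def by simp
    have h_lip: "(1 / r k)-lipschitz_on UNIV (h I)" for I
    proof (rule lipschitz_onI)
      fix x y :: 'e
      have "\<bar>infdist x (q ` {..<Suc I}) - infdist y (q ` {..<Suc I})\<bar> \<le> dist x y" by (rule infdist_triangle_abs)
      then have "\<bar>infdist x (q ` {..<Suc I}) / r k - infdist y (q ` {..<Suc I}) / r k\<bar> \<le> dist x y / r k"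
        using r_pos[of k] divide_right_mono[of _ "dist x y" "r k"]
        by (simp only: diff_divide_distrib[symmetric] abs_divide) (simp add: less_imp_le)
      then show "dist (h I x) (h I y) \<le> 1 / r k * dist x y" unfolding h_def dist_real_def by (simp add: min_def) linarith
    qed (use r_pos[of k] in simp)
    have h_meas: "h I \<in> borel_measurable borel" for I
      using borel_measurable_continuous_onI lipschitz_on_continuous_on[OF h_lip] by blast
    have h_tend: "(\<lambda>I. h I x) \<longlonglongrightarrow> 0" for x
    proof (rule LIMSEQ_I)
      fix d :: real assume d: "0 < d"
      obtain i where i: "dist (q i) x < r k * d" using q_dense[of "r k * d" x] d r_pos[of k] by auto
      have "norm (h I x - 0) < d" if "i \<le> I" for I
      proof -
        have "infdist x (q ` {..<Suc I}) \<le> dist x (q i)" using that by (intro infdist_le) auto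
        then have "infdist x (q ` {..<Suc I}) / r k < d" using i r_pos[of k] by (simp add: dist_commute field_simps)
        then show ?thesis using h0[of I x] unfolding h_def by simp
      qed
      then show "\<exists>no. \<forall>I\<ge>no. norm (h I x - 0) < d" by blast
    qed
    have int_h: "(\<lambda>I. \<integral>x. h I x \<partial>\<mu> n) \<longlonglongrightarrow> 0" for n
    proof -
      interpret prob_space "\<mu> n" by (rule prob)
      have "(\<lambda>I. \<integral>x. h I x \<partial>\<mu> n) \<longlonglongrightarrow> (\<integral>x. 0 \<partial>\<mu> n)"
        using h_meas h_tend h0 h1 sets_\<mu>[of n]
        by (intro integral_dominated_convergence[where w = "\<lambda>_. 1"]) (auto cong: measurable_cong_sets)
      then show ?thesis by simp
    qed
    have miss_le: "measure (\<mu> n) {x. miss k (Suc I) (code x)} \<le> (\<integral>x. h I x \<partial>\<mu> n)" for n I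
    proof -
      interpret prob_space "\<mu> n" by (rule prob)
      have sp: "space (\<mu> n) = UNIV" using sets_eq_imp_space_eq[OF sets_\<mu>] by simp
      have ms: "{x. miss k (Suc I) (code x)} \<in> sets (\<mu> n)"
        using measurable_sets[OF meas_code meas_miss_set[of k "Suc I"]] sets_\<mu> by (simp add: vimage_def)
      have "measure (\<mu> n) {x. miss k (Suc I) (code x)} = (\<integral>x. indicator {x. miss k (Suc I) (code x)} x \<partial>\<mu> n)"
        using ms by simp
      also have "\<dots> \<le> (\<integral>x. h I x \<partial>\<mu> n)"
      proof (rule integral_mono)
        show "integrable (\<mu> n) (h I)" using h_meas h0 h1 sets_\<mu>[of n]
          by (intro integrable_const_bound[where B = 1]) (auto cong: measurable_cong_sets)
        fix x
        have "1 \<le> infdist x (q ` {..<Suc I}) / r k" if "miss k (Suc I) (code x)"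
        proof -
          have "r k \<le> infdist x (q ` {..<Suc I})"
            using that unfolding miss_def hit_code infdist_def by (auto intro!: cINF_greatest simp: dist_commute not_less)
          then show ?thesis using r_pos[of k] by simp
        qed
        then show "indicator {x. miss k (Suc I) (code x)} x \<le> h I x"
          using h0[of I x] by (simp add: indicator_def h_def)
      qed (use ms in \<open>simp add: integrable_indicator_iff less_top[symmetric]\<close>)
      finally show ?thesis .
    qed
    \<comment> \<open>Uniformity in \<open>n\<close>: \<open>cauchy\<close>, applied to
      \<open>h I\<close> with Lipschitz constant \<open>1 / r k\<close> and bound \<open>1\<close>,
      compares all later indices with \<open>n0\<close>; a common \<open>I\<close> serves the
      finitely many earlier ones.\<close>
    have "(\<lambda>n. (1 / r k + 1) * e n) \<longlonglongrightarrow> (1 / r k + 1) * 0" by (intro tendsto_intros e)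
    then have "\<forall>\<^sub>F n in sequentially. (1 / r k + 1) * e n < \<epsilon> / 2" using \<epsilon> by (intro order_tendstoD) auto
    then obtain n0 where n0: "(1 / r k + 1) * e n0 < \<epsilon> / 2" by (auto simp: eventually_sequentially)
    have "\<forall>\<^sub>F I in sequentially. \<forall>n\<in>{..n0}. (\<integral>x. h I x \<partial>\<mu> n) < \<epsilon> / 2"
      using \<epsilon> by (intro eventually_ball_finite ballI order_tendstoD(2)[OF int_h]) auto
    then obtain I where I: "\<And>n. n \<le> n0 \<Longrightarrow> (\<integral>x. h I x \<partial>\<mu> n) < \<epsilon> / 2" by (auto simp: eventually_sequentially)
    have "(\<integral>x. h I x \<partial>\<mu> n) \<le> \<epsilon>" for n
    proof (cases "n \<le> n0")
      case True then show ?thesis using I[of n] \<epsilon> by simp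
    next
      case False
      then obtain j where j: "n = n0 + j" using le_Suc_ex nat_le_linear by blast
      have "\<bar>h I z\<bar> \<le> 1" for z using h0[of I z] h1[of I z] by simp
      then have "\<bar>(\<integral>x. h I x \<partial>\<mu> (n0 + j)) - (\<integral>x. h I x \<partial>\<mu> n0)\<bar> \<le> (1 / r k + 1) * e n0"
        by (intro cauchy h_lip)
      then show ?thesis using n0 I[of n0] unfolding j by linarith
    qed
    then show ?thesis using miss_le order_trans by blast
  qed
  \<comment> \<open>\<open>miss k I\<close> reads only \<open>I\<close> coordinates, so the bound
    survives the passage to \<Lambda>.\<close>
  have miss_\<Lambda>: "measure \<Lambda> {y. miss k I y} \<le> \<epsilon>" if le: "\<And>n. measure (\<mu> n) {x. miss k I (code x)} \<le> \<epsilon>" for k I \<epsilon>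
  proof (rule LIMSEQ_le_const2)
    have "(\<lambda>n. \<integral>x. indicat_real {y. miss k I y} (\<lambda>j. indicator (B j) x) \<partial>\<mu> (s n)) \<longlonglongrightarrow> (\<integral>y. indicat_real {y. miss k I y} y \<partial>\<Lambda>)"
      by (rule lim[of "(\<lambda>i. prod_encode (i, k)) ` {..<I}"])
        (use meas_miss_set in \<open>auto simp: indicator_def miss_def hit_def\<close>)
    moreover have "(\<integral>x. indicat_real {y. miss k I y} (\<lambda>j. indicator (B j) x) \<partial>\<mu> n) = measure (\<mu> n) {x. miss k I (code x)}" for n
    proof -
      have "{x. miss k I (code x)} \<in> sets (\<mu> n)"
        using measurable_sets[OF meas_code meas_miss_set[of k I]] sets_\<mu> by (simp add: vimage_def)
      moreover have "(\<integral>x. indicat_real {y. miss k I y} (\<lambda>j. indicator (B j) x) \<partial>\<mu> n) = (\<integral>x. indicator {x. miss k I (code x)} x \<partial>\<mu> n)"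
        by (simp add: code_def indicator_def)
      moreover have "space (\<mu> n) = UNIV" using sets_eq_imp_space_eq[OF sets_\<mu>] by simp
      ultimately show ?thesis by simp
    qed
    ultimately show "(\<lambda>n. measure (\<mu> (s n)) {x. miss k I (code x)}) \<longlonglongrightarrow> measure \<Lambda> {y. miss k I y}"
      using meas_miss_set[of k I] sp_\<Lambda> by simp
    show "\<exists>N. \<forall>n\<ge>N. measure (\<mu> (s n)) {x. miss k I (code x)} \<le> \<epsilon>" using le by blast
  qed
  \<comment> \<open>Balls of radii \<open>r k\<close> and \<open>r (Suc k)\<close> whose centres are
    at least \<open>2 * r k\<close> apart are disjoint, so no genuine code hits both; the event has
    mass zero before the limit and hence in the limit.\<close>
  have far: "AE y in \<Lambda>. \<not> (hit k y i \<and> hit (Suc k) y i')" if "\<not> dist (q i) (q i') < 2 * r k" for k i i'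
  proof -
    let ?E = "{y. hit k y i \<and> hit (Suc k) y i'}"
    have E: "?E \<in> sets ?PM"
    proof -
      have "Measurable.pred ?PM (\<lambda>y. hit k y i \<and> hit (Suc k) y i')" by measurable
      then show ?thesis by (simp add: pred_def space_PiM)
    qed
    have "(\<lambda>n. \<integral>x. indicat_real ?E (\<lambda>j. indicator (B j) x) \<partial>\<mu> (s n)) \<longlonglongrightarrow> (\<integral>y. indicat_real ?E y \<partial>\<Lambda>)"
      by (rule lim[of "{prod_encode (i, k), prod_encode (i', Suc k)}"])
        (use E in \<open>auto simp: indicator_def hit_def\<close>)
    moreover have "indicat_real ?E (\<lambda>j. indicator (B j) x) = (0::real)" for x
    proof -
      have "\<not> (hit k (code x) i \<and> hit (Suc k) (code x) i')"
      proof
        assume "hit k (code x) i \<and> hit (Suc k) (code x) i'"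
        then have "dist (q i) x < r k" "dist (q i') x < r (Suc k)" unfolding hit_code by auto
        moreover have "r (Suc k) \<le> r k" unfolding r_def by simp
        ultimately have "dist (q i) (q i') < 2 * r k" using dist_triangle2[of "q i" "q i'" x] by linarith
        with that show False ..
      qed
      then show ?thesis by (simp add: code_def)
    qed
    ultimately have "measure \<Lambda> ?E = 0" using E sp_\<Lambda> LIMSEQ_unique[OF _ tendsto_const] by fastforce
    then have "?E \<in> null_sets \<Lambda>" using E sets_\<Lambda> by (auto simp: null_sets_def \<Lambda>.emeasure_eq_measure)
    then show ?thesis by (intro AE_I'[of ?E]) auto
  qed
  have AE_hit: "AE y in \<Lambda>. \<exists>i. hit k y i" for k
  proof -
    have E: "{y. \<not> (\<exists>i. hit k y i)} \<in> sets ?PM"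
    proof -
      have "Measurable.pred ?PM (\<lambda>y. \<not> (\<exists>i. hit k y i))" by measurable
      then show ?thesis by (simp add: pred_def space_PiM)
    qed
    have "measure \<Lambda> {y. \<not> (\<exists>i. hit k y i)} \<le> \<epsilon>" if \<epsilon>: "0 < \<epsilon>" for \<epsilon>
    proof -
      obtain I where I: "\<And>n. measure (\<mu> n) {x. miss k I (code x)} \<le> \<epsilon>" using tight[OF \<epsilon>] by blast
      have "measure \<Lambda> {y. \<not> (\<exists>i. hit k y i)} \<le> measure \<Lambda> {y. miss k I y}"
        using meas_miss_set[of k I] sets_\<Lambda> by (intro \<Lambda>.finite_measure_mono) (auto simp: miss_def)
      also have "\<dots> \<le> \<epsilon>" by (rule miss_\<Lambda>[OF I])
      finally show ?thesis .
    qed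
    note le_eps = this
    have "measure \<Lambda> {y. \<not> (\<exists>i. hit k y i)} \<le> 0"
      by (rule field_le_epsilon) (use le_eps in auto)
    then have "{y. \<not> (\<exists>i. hit k y i)} \<in> null_sets \<Lambda>" using E sets_\<Lambda> by (auto simp: null_sets_def \<Lambda>.emeasure_eq_measure measure_le_0_iff)
    then show ?thesis by (intro AE_I'[of "{y. \<not> (\<exists>i. hit k y i)}"]) auto
  qed
  define good where "good y \<longleftrightarrow> (\<forall>k. (\<exists>i. hit k y i) \<and> dist (q (idx k y)) (q (idx (Suc k) y)) < 2 * r k)" for y
  have AE_good: "AE y in \<Lambda>. good y"
  proof -
    have "AE y in \<Lambda>. \<forall>k i i'. \<not> dist (q i) (q i') < 2 * r k \<longrightarrow> \<not> (hit k y i \<and> hit (Suc k) y i')"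
      using far by (auto simp: AE_all_countable)
    moreover have "AE y in \<Lambda>. \<forall>k. \<exists>i. hit k y i" using AE_hit by (simp add: AE_all_countable)
    ultimately show ?thesis
    proof eventually_elim
      case (elim y)
      then have "hit k y (idx k y)" for k unfolding idx_def by (metis LeastI_ex)
      then show ?case unfolding good_def using elim by blast
    qed
  qed
  have meas_good: "Measurable.pred ?PM good"
    unfolding good_def using meas_qidx by measurable
  have good_dist: "dist (q (idx k y)) (q (idx (k + j) y)) \<le> 4 * r k" if "good y" for k j y
  proof -
    \<comment> \<open>The steps telescope because
      \<open>2 * r (k + j) = 4 * r (k + j) - 4 * r (k + j + 1)\<close>.\<close>
    have "dist (q (idx k y)) (q (idx (k + j) y)) \<le> 4 * r k - 4 * r (k + j)" for j
    proof (induction j)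
      case (Suc j)
      have "dist (q (idx k y)) (q (idx (k + Suc j) y)) \<le> dist (q (idx k y)) (q (idx (k + j) y)) + dist (q (idx (k + j) y)) (q (idx (Suc (k + j)) y))"
        using dist_triangle by simp
      also have "\<dots> \<le> 4 * r k - 4 * r (k + j) + 2 * r (k + j)" 
      proof -
        have "dist (q (idx (k + j) y)) (q (idx (Suc (k + j)) y)) < 2 * r (k + j)"
          using \<open>good y\<close> unfolding good_def by blast
        then show ?thesis using Suc by linarith
      qed
      also have "\<dots> = 4 * r k - 4 * r (k + Suc j)" unfolding r_def by simp
      finally show ?case .
    qed simp
    from this[of j] r_pos[of "k + j"] show ?thesis by linarith
  qed
  have r_tend: "r \<longlonglongrightarrow> 0" unfolding r_def by (intro LIMSEQ_power_zero) simp
  \<comment> \<open>\<open>D\<close> decodes a sequence into a point; the default \<open>q 0\<close>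
    is taken on a null set only, by \<open>AE_good\<close>.\<close>
  define D where "D y = (if good y then lim (\<lambda>k. q (idx k y)) else q 0)" for y
  have D_lim: "(\<lambda>k. q (idx k y)) \<longlonglongrightarrow> D y" if "good y" for y
  proof -
    have "Cauchy (\<lambda>k. q (idx k y))"
    proof (rule metric_CauchyI)
      fix d :: real assume "0 < d"
      then have "\<forall>\<^sub>F k in sequentially. r k < d / 8" using r_tend by (intro order_tendstoD) auto
      then obtain k where k: "r k < d / 8" by (auto simp: eventually_sequentially)
      have "dist (q (idx m y)) (q (idx n y)) < d" if "k \<le> m" "k \<le> n" for m n
      proof -
        obtain a b where "m = k + a" "n = k + b" using \<open>k \<le> m\<close> \<open>k \<le> n\<close> le_Suc_ex by metis
        then have "dist (q (idx k y)) (q (idx m y)) \<le> 4 * r k" "dist (q (idx k y)) (q (idx n y)) \<le> 4 * r k"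
          using good_dist[OF \<open>good y\<close>] by auto
        then show ?thesis using k dist_triangle3[of "q (idx m y)" "q (idx n y)" "q (idx k y)"] by linarith
      qed
      then show "\<exists>M. \<forall>m\<ge>M. \<forall>n\<ge>M. dist (q (idx m y)) (q (idx n y)) < d" by blast
    qed
    then show ?thesis unfolding D_def using that by (simp add: Cauchy_convergent_iff convergent_LIMSEQ_iff)
  qed
  have D_dist: "dist (q (idx k y)) (D y) \<le> 4 * r k" if "good y" for k y
  proof (rule LIMSEQ_le_const2)
    show "(\<lambda>j. dist (q (idx k y)) (q (idx (k + j) y))) \<longlonglongrightarrow> dist (q (idx k y)) (D y)"
      using LIMSEQ_ignore_initial_segment[OF D_lim[OF that], of k] by (intro tendsto_dist tendsto_const) (simp add: add.commute)
    show "\<exists>N. \<forall>n\<ge>N. dist (q (idx k y)) (q (idx (k + n) y)) \<le> 4 * r k" using good_dist[OF that] by blast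
  qed
  have D_meas: "D \<in> measurable ?PM borel"
  proof (rule borel_measurable_LIMSEQ_metric)
    show "(\<lambda>y. if good y then q (idx k y) else q 0) \<in> borel_measurable ?PM" for k
      using meas_good meas_qidx by measurable
    show "(\<lambda>k. if good y then q (idx k y) else q 0) \<longlonglongrightarrow> D y" for y
      using D_lim by (cases "good y") (auto simp: D_def)
  qed
  have D_meas': "D \<in> measurable \<Lambda> borel" unfolding meas_\<Lambda> by (rule D_meas)
  define \<nu> where "\<nu> = distr \<Lambda> borel D"
  show ?thesis
  proof (rule that[of \<nu>])
    show "prob_space \<nu>" unfolding \<nu>_def by (rule \<Lambda>.prob_space_distr[OF D_meas'])
    show "sets \<nu> = sets borel" unfolding \<nu>_def by simp
    fix L b and f :: "'e \<Rightarrow> real"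
    assume f: "L-lipschitz_on UNIV f" and fb: "\<And>z. \<bar>f z\<bar> \<le> b"
    have b: "0 \<le> b" using fb[of undefined] by linarith
    have L: "0 \<le> L" using f by (simp add: lipschitz_on_def)
    have f_meas: "f \<in> borel_measurable borel"
      using borel_measurable_continuous_onI lipschitz_on_continuous_on[OF f] by blast
    have Lr: "0 \<le> L * r k" for k using L r_pos[of k] by (intro mult_nonneg_nonneg) auto
    have f_lip: "\<bar>f x - f y\<bar> \<le> L * d" if "dist x y \<le> d" for x y d
    proof -
      have "\<bar>f x - f y\<bar> \<le> L * dist x y" using f by (auto simp: lipschitz_on_def dist_real_def)
      also have "\<dots> \<le> L * d" using that L by (rule mult_left_mono)
      finally show ?thesis .
    qed
    \<comment> \<open>The bound collects \<open>L * r k\<close> on the side of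
      \<open>\<mu> (s n)\<close>, \<open>4 * L * r k\<close> on the side of \<nu>, a term
      \<open>2 * b * \<epsilon>\<close> for the missed mass on each side, and one \<epsilon> from
      the convergence of the integrals of \<open>G\<close>.\<close>
    have near: "\<exists>N. \<forall>n\<ge>N. \<bar>(\<integral>x. f x \<partial>\<mu> (s n)) - (\<integral>x. f x \<partial>\<nu>)\<bar> \<le> 5 * L * r k + (4 * b + 1) * \<epsilon>" if \<epsilon>: "0 < \<epsilon>" for k \<epsilon>
    proof -
      obtain I where I: "\<And>n. measure (\<mu> n) {x. miss k I (code x)} \<le> \<epsilon>" using tight[OF \<epsilon>] by blast
      \<comment> \<open>\<open>G\<close> evaluates \<open>f\<close> at the selected centre. The
        value \<open>0\<close> on \<open>miss k I\<close> makes it a function of finitely many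
        coordinates, since otherwise the least hit is found among the first \<open>I\<close>
        centres.\<close>
      define G where "G y = (if miss k I y then 0 else f (q (idx k y)))" for y
      have G_meas: "G \<in> borel_measurable ?PM"
        unfolding G_def using meas_miss measurable_compose[OF meas_qidx f_meas] by measurable
      have Gb: "\<bar>G y\<bar> \<le> b" for y unfolding G_def using fb b by simp
      have "(\<lambda>n. \<integral>x. G (\<lambda>j. indicator (B j) x) \<partial>\<mu> (s n)) \<longlonglongrightarrow> (\<integral>y. G y \<partial>\<Lambda>)"
      proof (rule lim[of "(\<lambda>i. prod_encode (i, k)) ` {..<I}"])
        fix y y' :: "nat \<Rightarrow> real"
        assume eq: "\<And>j. j \<in> (\<lambda>i. prod_encode (i, k)) ` {..<I} \<Longrightarrow> y j = y' j"
        then have hit_eq: "hit k y i \<longleftrightarrow> hit k y' i" if "i < I" for i using that unfolding hit_def by auto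
        then have miss_eq: "miss k I y \<longleftrightarrow> miss k I y'" unfolding miss_def by auto
        have "idx k y = idx k y'" if nm: "\<not> miss k I y"
        proof -
          obtain i where i: "i < I" "hit k y i" using nm unfolding miss_def by auto
          have le: "idx k y \<le> i" "idx k y' \<le> i" unfolding idx_def using i hit_eq by (auto intro: Least_le)
          have "hit k y (idx k y)" "hit k y' (idx k y')" unfolding idx_def using i hit_eq LeastI by metis+
          then have "hit k y' (idx k y)" "hit k y (idx k y')" using hit_eq le i(1) by auto
          then show ?thesis unfolding idx_def by (intro antisym Least_le) (auto simp: idx_def)
        qed
        then show "G y = G y'" unfolding G_def using miss_eq by auto
      qed (use G_meas in auto)
      then have "\<forall>\<^sub>F n in sequentially. \<bar>(\<integral>x. G (code x) \<partial>\<mu> (s n)) - (\<integral>y. G y \<partial>\<Lambda>)\<bar> < \<epsilon>"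
        unfolding code_def[symmetric] using \<epsilon> by (auto simp: tendsto_iff dist_real_def)
      then obtain N where N: "\<And>n. n \<ge> N \<Longrightarrow> \<bar>(\<integral>x. G (code x) \<partial>\<mu> (s n)) - (\<integral>y. G y \<partial>\<Lambda>)\<bar> < \<epsilon>"
        by (auto simp: eventually_sequentially)
      have \<mu>_G: "\<bar>(\<integral>x. f x \<partial>\<mu> n) - (\<integral>x. G (code x) \<partial>\<mu> n)\<bar> \<le> L * r k + 2 * b * \<epsilon>" for n
      proof -
        interpret \<mu>: prob_space "\<mu> n" by (rule prob)
        have sp: "space (\<mu> n) = UNIV" using sets_eq_imp_space_eq[OF sets_\<mu>] by simp
        have ms: "{x. miss k I (code x)} \<in> sets (\<mu> n)"
          using measurable_sets[OF meas_code meas_miss_set[of k I]] sets_\<mu> by (simp add: vimage_def)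
        have int_f: "integrable (\<mu> n) f" using f_meas fb sets_\<mu>[of n]
          by (intro \<mu>.integrable_const_bound[where B = b]) (auto cong: measurable_cong_sets)
        have int_G: "integrable (\<mu> n) (\<lambda>x. G (code x))" using measurable_compose[OF meas_code G_meas] Gb sets_\<mu>[of n]
          by (intro \<mu>.integrable_const_bound[where B = b]) (auto cong: measurable_cong_sets)
        have int_m: "integrable (\<mu> n) (\<lambda>x. L * r k + 2 * b * indicator {x. miss k I (code x)} x)"
          using ms by (intro Bochner_Integration.integrable_add integrable_mult_right) (auto simp: integrable_indicator_iff less_top[symmetric])
        have "\<bar>(\<integral>x. f x \<partial>\<mu> n) - (\<integral>x. G (code x) \<partial>\<mu> n)\<bar> = \<bar>\<integral>x. f x - G (code x) \<partial>\<mu> n\<bar>" using int_f int_G by simp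
        also have "\<dots> \<le> (\<integral>x. \<bar>f x - G (code x)\<bar> \<partial>\<mu> n)" by (rule integral_abs_bound)
        also have "\<dots> \<le> (\<integral>x. L * r k + 2 * b * indicator {x. miss k I (code x)} x \<partial>\<mu> n)"
        proof (rule integral_mono)
          fix x
          show "\<bar>f x - G (code x)\<bar> \<le> L * r k + 2 * b * indicator {x. miss k I (code x)} x"
          proof (cases "miss k I (code x)")
            case True
            then have ind: "indicator {x. miss k I (code x)} x = (1 :: real)" and G0: "G (code x) = 0"
              by (simp_all add: G_def)
            show ?thesis unfolding ind G0 using fb[of x] b Lr[of k] by linarith
          next
            case False
            then obtain i where "hit k (code x) i" unfolding miss_def by auto
            then have "hit k (code x) (idx k (code x))" unfolding idx_def by (rule LeastI)
            then have "dist x (q (idx k (code x))) \<le> r k" unfolding hit_code by (simp add: dist_commute less_imp_le)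
            then show ?thesis using f_lip False by (simp add: G_def)
          qed
        qed (use int_f int_G int_m in auto)
        also have "\<dots> = L * r k + 2 * b * measure (\<mu> n) {x. miss k I (code x)}"
          using ms sp \<mu>.prob_space[unfolded sp] by (subst Bochner_Integration.integral_add) (auto simp: \<mu>.prob_space integrable_indicator_iff less_top[symmetric])
        also have "\<dots> \<le> L * r k + 2 * b * \<epsilon>" using I[of n] b by (intro add_left_mono mult_left_mono) auto
        finally show ?thesis .
      qed
      have \<nu>_G: "\<bar>(\<integral>x. f x \<partial>\<nu>) - (\<integral>y. G y \<partial>\<Lambda>)\<bar> \<le> L * (4 * r k) + 2 * b * \<epsilon>"
      proof -
        have ms: "{y. miss k I y} \<in> sets \<Lambda>" using meas_miss_set sets_\<Lambda> by simp
        have int_f: "integrable \<Lambda> (\<lambda>y. f (D y))" using measurable_compose[OF D_meas' f_meas] fb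
          by (intro \<Lambda>.integrable_const_bound[where B = b]) auto
        have int_G: "integrable \<Lambda> G" using G_meas Gb unfolding meas_\<Lambda>[symmetric]
          by (intro \<Lambda>.integrable_const_bound[where B = b]) auto
        have int_m: "integrable \<Lambda> (\<lambda>y. L * (4 * r k) + 2 * b * indicator {y. miss k I y} y)"
          using ms by (intro Bochner_Integration.integrable_add integrable_mult_right) (auto simp: integrable_indicator_iff less_top[symmetric])
        have "(\<integral>x. f x \<partial>\<nu>) = (\<integral>y. f (D y) \<partial>\<Lambda>)" unfolding \<nu>_def by (rule integral_distr[OF D_meas' f_meas])
        then have "\<bar>(\<integral>x. f x \<partial>\<nu>) - (\<integral>y. G y \<partial>\<Lambda>)\<bar> = \<bar>\<integral>y. f (D y) - G y \<partial>\<Lambda>\<bar>" using int_f int_G by simp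
        also have "\<dots> \<le> (\<integral>y. \<bar>f (D y) - G y\<bar> \<partial>\<Lambda>)" by (rule integral_abs_bound)
        also have "\<dots> \<le> (\<integral>y. L * (4 * r k) + 2 * b * indicator {y. miss k I y} y \<partial>\<Lambda>)"
        proof (rule integral_mono_AE)
          show "AE y in \<Lambda>. \<bar>f (D y) - G y\<bar> \<le> L * (4 * r k) + 2 * b * indicator {y. miss k I y} y"
            using AE_good
          proof eventually_elim
            case (elim y)
            show ?case
            proof (cases "miss k I y")
              case True
              then have ind: "indicator {y. miss k I y} y = (1 :: real)" and G0: "G y = 0" by (simp_all add: G_def)
              show ?thesis unfolding ind G0 using fb[of "D y"] b Lr[of k] by linarith
            next
              case False
              then show ?thesis using f_lip[OF D_dist[OF elim, of k, unfolded dist_commute[of "q _"]]] by (simp add: G_def)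
            qed
          qed
        qed (use int_f int_G int_m in auto)
        also have "\<dots> = L * (4 * r k) + 2 * b * measure \<Lambda> {y. miss k I y}"
          using ms sp_\<Lambda> \<Lambda>.prob_space[unfolded sp_\<Lambda>] by (subst Bochner_Integration.integral_add) (auto simp: \<Lambda>.prob_space integrable_indicator_iff less_top[symmetric])
        also have "\<dots> \<le> L * (4 * r k) + 2 * b * \<epsilon>" using miss_\<Lambda>[OF I] b by (intro add_left_mono mult_left_mono) auto
        finally show ?thesis .
      qed
      have "\<bar>(\<integral>x. f x \<partial>\<mu> (s n)) - (\<integral>x. f x \<partial>\<nu>)\<bar> \<le> 5 * L * r k + (4 * b + 1) * \<epsilon>" if "N \<le> n" for n
        using \<mu>_G[of "s n"] \<nu>_G N[OF that] by (simp add: algebra_simps)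
      then show ?thesis by blast
    qed
    have "(\<lambda>n. \<integral>x. f x \<partial>\<mu> (s n)) \<longlonglongrightarrow> (\<integral>x. f x \<partial>\<nu>)"
    proof (rule LIMSEQ_I)
      fix d :: real assume d: "0 < d"
      have "(\<lambda>k. 5 * L * r k) \<longlonglongrightarrow> 5 * L * 0" by (intro tendsto_intros r_tend)
      then have "\<forall>\<^sub>F k in sequentially. 5 * L * r k < d / 2" using d by (intro order_tendstoD) auto
      then obtain k where k: "5 * L * r k < d / 2" by (auto simp: eventually_sequentially)
      have \<epsilon>: "0 < d / (4 * (4 * b + 1))" using d b by (intro divide_pos_pos) auto
      have eq: "(4 * b + 1) * (d / (4 * (4 * b + 1))) = d / 4" using b by (simp add: field_simps)
      from near[OF \<epsilon>, of k] obtain N where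
        N: "\<And>n. N \<le> n \<Longrightarrow> \<bar>(\<integral>x. f x \<partial>\<mu> (s n)) - (\<integral>x. f x \<partial>\<nu>)\<bar> \<le> 5 * L * r k + d / 4" unfolding eq by blast
      have "norm ((\<integral>x. f x \<partial>\<mu> (s n)) - (\<integral>x. f x \<partial>\<nu>)) < d" if "N \<le> n" for n
        using N[OF that] k d unfolding real_norm_def by linarith
      then show "\<exists>no. \<forall>n\<ge>no. norm ((\<integral>x. f x \<partial>\<mu> (s n)) - (\<integral>x. f x \<partial>\<nu>)) < d"
        by blast
    qed
    note sub_lim = this
    \<comment> \<open>The subsequence has identified the limit; the estimate \<open>cauchy\<close>
      makes the full sequence converge, necessarily to the same value.\<close>
    have "Cauchy (\<lambda>n. \<integral>x. f x \<partial>\<mu> n)"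
    proof (rule metric_CauchyI)
      fix d :: real assume "0 < d"
      have "(\<lambda>n. (L + b) * e n) \<longlonglongrightarrow> (L + b) * 0" by (intro tendsto_intros e)
      then have "\<forall>\<^sub>F n in sequentially. (L + b) * e n < d / 2" using \<open>0 < d\<close> by (intro order_tendstoD) auto
      then obtain n0 where n0: "(L + b) * e n0 < d / 2" by (auto simp: eventually_sequentially)
      have near_n0: "\<bar>(\<integral>x. f x \<partial>\<mu> n) - (\<integral>x. f x \<partial>\<mu> n0)\<bar> < d / 2" if "n0 \<le> n" for n
        using cauchy[OF f fb, of n0 "n - n0"] n0 that by simp
      have "dist (\<integral>x. f x \<partial>\<mu> m) (\<integral>x. f x \<partial>\<mu> n) < d" if "n0 \<le> m" "n0 \<le> n" for m n
        using near_n0[OF that(1)] near_n0[OF that(2)] unfolding dist_real_def by linarith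
      then show "\<exists>M. \<forall>m\<ge>M. \<forall>n\<ge>M. dist (\<integral>x. f x \<partial>\<mu> m) (\<integral>x. f x \<partial>\<mu> n) < d" by blast
    qed
    then obtain l where l: "(\<lambda>n. \<integral>x. f x \<partial>\<mu> n) \<longlonglongrightarrow> l" by (auto simp: Cauchy_convergent_iff convergent_def)
    have "(\<lambda>n. \<integral>x. f x \<partial>\<mu> (s n)) \<longlonglongrightarrow> l" using LIMSEQ_subseq_LIMSEQ[OF l s] by (simp add: comp_def)
    with sub_lim have "l = (\<integral>x. f x \<partial>\<nu>)" by (rule LIMSEQ_unique[symmetric])
    with l show "(\<lambda>n. \<integral>x. f x \<partial>\<mu> n) \<longlonglongrightarrow> (\<integral>x. f x \<partial>\<nu>)" by simp
  qed
qed

section \<open>Borel measures are determined by Lipschitz functions\<close>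

lemma lipschitz_approx_closed:
  fixes S :: "'e::metric_space set"
  assumes "closed S"
  obtains h :: "nat \<Rightarrow> 'e \<Rightarrow> real" where "\<And>n x. 0 \<le> h n x \<and> h n x \<le> 1" "\<And>n. (real n)-lipschitz_on UNIV (h n)"
    "\<And>x. (\<lambda>n. h n x) \<longlonglongrightarrow> indicator S x"
proof (cases "S = {}")
  \<comment> \<open>\<open>infdist\<close> to the empty set is \<open>0\<close>, so the formula of
    the other case would produce the constant \<open>1\<close> here.\<close>
  case True
  then show ?thesis by (intro that[of "\<lambda>_ _. 0"]) (auto simp: lipschitz_on_def)
next
  case False
  define h where "h n x = max 0 (1 - real n * infdist x S)" for n x
  show ?thesis
  proof (rule that[of h])
    show "0 \<le> h n x \<and> h n x \<le> 1" for n x unfolding h_def by (simp add: infdist_nonneg)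
    show "(real n)-lipschitz_on UNIV (h n)" for n
    proof (rule lipschitz_onI)
      fix x y
      have "\<bar>real n * infdist x S - real n * infdist y S\<bar> = real n * \<bar>infdist x S - infdist y S\<bar>"
        by (simp only: right_diff_distrib[symmetric] abs_mult abs_of_nat)
      also have "\<dots> \<le> real n * dist x y" by (intro mult_left_mono infdist_triangle_abs) simp
      finally show "dist (h n x) (h n y) \<le> real n * dist x y" unfolding h_def dist_real_def by (simp add: max_def) linarith
    qed simp
    show "(\<lambda>n. h n x) \<longlonglongrightarrow> indicator S x" for x
    proof (cases "x \<in> S")
      case True
      then show ?thesis by (simp add: h_def)
    next
      case x: False
      then have pos: "0 < infdist x S" using assms False in_closed_iff_infdist_zero[of S x] infdist_nonneg[of x S] by linarith
      obtain m :: nat where m: "1 < real m * infdist x S" using reals_Archimedean3[OF pos] by blast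
      have "h n x = 0" if "m \<le> n" for n
      proof -
        have "real m * infdist x S \<le> real n * infdist x S" using that pos by (intro mult_right_mono) auto
        then show ?thesis unfolding h_def using m by simp
      qed
      then have "\<forall>\<^sub>F n in sequentially. h n x = indicator S x" using x by (auto simp: eventually_sequentially)
      then show ?thesis by (rule tendsto_eventually)
    qed
  qed
qed

lemma integral_tendsto_measure:
  fixes h :: "nat \<Rightarrow> 'e::metric_space \<Rightarrow> real"
  assumes "finite_measure M" "sets M = sets borel" "S \<in> sets borel"
    and h01: "\<And>n x. 0 \<le> h n x \<and> h n x \<le> 1" and lip: "\<And>n. (real n)-lipschitz_on UNIV (h n)"
    and tend: "\<And>x. (\<lambda>n. h n x) \<longlonglongrightarrow> indicator S x"
  shows "(\<lambda>n. \<integral>x. h n x \<partial>M) \<longlonglongrightarrow> measure M S"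
proof -
  interpret finite_measure M by fact
  have h_meas: "h n \<in> borel_measurable borel" for n
    using borel_measurable_continuous_onI lipschitz_on_continuous_on[OF lip] by blast
  have sp: "space M = UNIV" using sets_eq_imp_space_eq[OF assms(2)] by simp
  have "(\<lambda>n. \<integral>x. h n x \<partial>M) \<longlonglongrightarrow> (\<integral>x. indicator S x \<partial>M)"
    using h_meas tend h01 assms(2,3)
    by (intro integral_dominated_convergence[where w = "\<lambda>_. 1"]) (auto cong: measurable_cong_sets)
  then show ?thesis using assms(2,3) sp by simp
qed

text \<open>Indicators of closed sets are pointwise limits of Lipschitz functions with values
  between \<open>0\<close> and \<open>1\<close>, and the closed sets are a pi-system that generates
  the Borel sets.\<close>

lemma measure_eqI_lipschitz:
  fixes \<mu> \<nu> :: "'e::metric_space measure"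
  assumes fin: "finite_measure \<mu>" "finite_measure \<nu>" and sets: "sets \<mu> = sets borel" "sets \<nu> = sets borel"
    and eq: "\<And>L f. L-lipschitz_on UNIV (f :: 'e \<Rightarrow> real) \<Longrightarrow> (\<And>z. 0 \<le> f z \<and> f z \<le> 1) \<Longrightarrow> (\<integral>x. f x \<partial>\<mu>) = (\<integral>x. f x \<partial>\<nu>)"
  shows "\<mu> = \<nu>"
proof (rule measure_eqI_generator_eq[where E = "{S. closed S}" and \<Omega> = UNIV and A = "\<lambda>_. UNIV"])
  show "Int_stable {S :: 'e set. closed S}" by (auto simp: Int_stable_def)
  show "sets \<mu> = sigma_sets UNIV {S. closed S}" "sets \<nu> = sigma_sets UNIV {S. closed S}"
    using sets by (simp_all add: borel_eq_closed)
  show "range (\<lambda>_::nat. UNIV :: 'e set) \<subseteq> {S. closed S}" by auto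
  show "emeasure \<mu> UNIV \<noteq> \<infinity>" using finite_measure.emeasure_finite[OF fin(1)] by simp
  fix S :: "'e set" assume "S \<in> {S. closed S}"
  then have S: "closed S" by simp
  obtain h :: "nat \<Rightarrow> 'e \<Rightarrow> real" where h: "\<And>n x. 0 \<le> h n x \<and> h n x \<le> 1" "\<And>n. (real n)-lipschitz_on UNIV (h n)"
    "\<And>x. (\<lambda>n. h n x) \<longlonglongrightarrow> indicator S x" using lipschitz_approx_closed[OF S] by blast
  have "(\<integral>x. h n x \<partial>\<mu>) = (\<integral>x. h n x \<partial>\<nu>)" for n by (rule eq[OF h(2,1)])
  then have eq_h: "(\<lambda>n. \<integral>x. h n x \<partial>\<mu>) = (\<lambda>n. \<integral>x. h n x \<partial>\<nu>)" by simp
  have "(\<lambda>n. \<integral>x. h n x \<partial>\<mu>) \<longlonglongrightarrow> measure \<mu> S"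
    by (rule integral_tendsto_measure[OF fin(1) sets(1) borel_closed[OF S] h])
  moreover have "(\<lambda>n. \<integral>x. h n x \<partial>\<nu>) \<longlonglongrightarrow> measure \<nu> S"
    by (rule integral_tendsto_measure[OF fin(2) sets(2) borel_closed[OF S] h])
  ultimately have "measure \<mu> S = measure \<nu> S" unfolding eq_h by (rule LIMSEQ_unique)
  then show "emeasure \<mu> S = emeasure \<nu> S"
    by (simp add: finite_measure.emeasure_eq_measure[OF fin(1)] finite_measure.emeasure_eq_measure[OF fin(2)])
qed auto

section \<open>Harnack inequality for contracting kernels\<close>

lemma sum_exp_le:
  fixes a :: real
  assumes "0 < a"
  shows "(\<Sum>k<n. exp (- a * real k)) \<le> 1 / (1 - exp (- a))"
proof -
  have eq: "exp (- a * real k) = exp (- a) ^ k" for k :: nat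
    by (metis exp_of_nat_mult mult.commute)
  have lt: "norm (exp (- a)) < 1" using assms by simp
  have "(\<Sum>k<n. exp (- a) ^ k) \<le> (\<Sum>k. exp (- a) ^ k)"
    using lt by (intro sum_le_suminf summable_geometric) auto
  then show ?thesis unfolding eq using suminf_geometric[OF lt] by simp
qed

text \<open>Removes a multiplicative constant from a bound that holds for all powers.\<close>

lemma le_of_power_le:
  fixes x y B :: real
  assumes "0 \<le> x" "0 < y" "\<And>j. x ^ j \<le> B * y ^ j"
  shows "x \<le> y"
proof (rule ccontr)
  assume "\<not> x \<le> y"
  then have "1 < x / y" using assms by simp
  then obtain j where "B < (x / y) ^ j" using real_arch_pow by blast
  then have "B * y ^ j < x ^ j" using assms(2) by (simp add: power_divide field_simps)
  with assms(3)[of j] show False by simp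
qed

text \<open>Fekete's argument for \<open>- ln (a n)\<close>. Taking the supremum of the quotients as
  the rate gives the lower bound without a constant, and the upper bound up to an arbitrarily small
  loss in the exponent.\<close>

lemma submultiplicative_rate:
  fixes a :: "nat \<Rightarrow> real"
  assumes sub: "\<And>i j. a (i + j) \<le> a i * a j"
    and lower: "\<And>n. exp (- R * real n) \<le> a n"
    and upper: "\<And>n. a n \<le> 1"
  obtains l where "0 \<le> l" "\<And>n. exp (- l * real n) \<le> a n"
    "\<And>e. 0 < e \<Longrightarrow> \<exists>B. \<forall>n. a n \<le> B * exp ((e - l) * real n)"
proof
  have pos: "0 < a n" for n using lower[of n] exp_gt_zero less_le_trans by blast
  let ?S = "(\<lambda>n. - ln (a n) / real n) ` {1..}"
  define l where "l = Sup ?S"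
  have le_R: "- ln (a n) / real n \<le> R" if "1 \<le> n" for n
  proof -
    have "- R * real n \<le> ln (a n)" using lower[of n] pos[of n] by (simp add: ln_ge_iff)
    then show ?thesis using that by (simp add: field_simps)
  qed
  have bdd: "bdd_above ?S" using le_R by (auto intro!: bdd_aboveI2)
  have le_l: "- ln (a n) / real n \<le> l" if "1 \<le> n" for n
    unfolding l_def using that by (intro cSup_upper bdd) auto
  have "0 \<le> - ln (a 1) / real 1" using upper[of 1] pos[of 1] by simp
  also have "\<dots> \<le> l" using le_l[of 1] by simp
  finally show "0 \<le> l" .
  show "exp (- l * real n) \<le> a n" for n
  proof (cases "n = 0")
    case True then show ?thesis using lower[of 0] by simp
  next
    case False
    then have "- l * real n \<le> ln (a n)" using le_l[of n] by (simp add: field_simps)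
    then show ?thesis using pos[of n] by (simp add: ln_ge_iff)
  qed
  show "\<exists>B. \<forall>n. a n \<le> B * exp ((e - l) * real n)" if e: "0 < e" for e
  proof -
    have "\<exists>y\<in>?S. l - e < y" using e bdd unfolding l_def
      by (subst less_cSup_iff[symmetric]) auto
    then obtain N :: nat where N: "1 \<le> N" "l - e < - ln (a N) / real N" by auto
    then have "ln (a N) \<le> (e - l) * real N" by (simp add: field_simps)
    then have aN: "a N \<le> exp ((e - l) * real N)" using pos[of N]
      by (metis exp_le_cancel_iff exp_ln)
    have pw: "a (N * q) \<le> a N ^ q" for q
    proof (induction q)
      case (Suc q)
      have "a (N * Suc q) \<le> a N * a (N * q)" using sub[of N "N * q"] by simp
      also have "\<dots> \<le> a N * a N ^ q" using Suc pos[of N] by simp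
      finally show ?case by simp
    qed (use upper in simp)
    \<comment> \<open>The constant absorbs the remainder of \<open>n\<close> modulo
      \<open>N\<close>, over which only \<open>a \<le> 1\<close> is used.\<close>
    have "a n \<le> exp (\<bar>e - l\<bar> * real N) * exp ((e - l) * real n)" for n
    proof -
      have n: "n = N * (n div N) + n mod N" by simp
      have "a n \<le> a (N * (n div N)) * a (n mod N)" using sub n by metis
      also have "\<dots> \<le> a (N * (n div N)) * 1" using upper pos by (intro mult_left_mono) (auto simp: less_imp_le)
      also have "\<dots> \<le> a N ^ (n div N)" using pw by simp
      also have "\<dots> \<le> exp ((e - l) * real N) ^ (n div N)" using aN pos[of N] by (intro power_mono) auto
      also have "\<dots> = exp ((e - l) * (real N * real (n div N)))"
        by (simp add: exp_of_nat_mult[symmetric] algebra_simps)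
      also have "\<dots> \<le> exp (\<bar>e - l\<bar> * real N + (e - l) * real n)"
      proof -
        have rn: "real n = real N * real (n div N) + real (n mod N)" using n by (metis of_nat_add of_nat_mult)
        have "- (e - l) * real (n mod N) \<le> \<bar>e - l\<bar> * real N"
          using N(1) by (intro mult_mono) auto
        then show ?thesis unfolding rn by (simp add: algebra_simps)
      qed
      finally show ?thesis by (simp add: exp_add)
    qed
    then show ?thesis by blast
  qed
qed

section \<open>Abstract kernels carrying the estimates of the coupling\<close>

definition top_mass :: "(real \<Rightarrow> 'e \<Rightarrow> 'e measure) \<Rightarrow> real \<Rightarrow> real" where
  "top_mass \<kappa> t = (SUP x. measure (\<kappa> t x) UNIV)"

text \<open>Measures the effect of the different penalizations paid by two coupled processes: a
  discrepancy produced between times \<open>k\<close> and \<open>k + 1\<close> is weighted by the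
  mass and the contraction at time \<open>k\<close>, and then survives the remaining
  \<open>n - 1 - k\<close> steps.\<close>

definition mass_convolution :: "(real \<Rightarrow> 'e \<Rightarrow> 'e measure) \<Rightarrow> real \<Rightarrow> nat \<Rightarrow> 'e \<Rightarrow> real" where
  "mass_convolution \<kappa> \<gamma> n x =
     (\<Sum>k<n. exp (- \<gamma> * real k) * measure (\<kappa> (real k) x) UNIV * top_mass \<kappa> (real (n - 1 - k)))"

text \<open>All that the spectral argument uses of the process and the coupling. The estimates that
  come from the coupling concern integer times; at general times in \<open>I\<close> the mass
  bounds, the semigroup property and the preservation of Lipschitz functions suffice.
  \<open>R\<close> bounds the penalization rate, \<open>C\<close> and \<gamma> come from the
  contraction, \<open>D\<close> bounds the diameter, and \<open>K\<close> is the constant in front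
  of the convolution.\<close>

locale contracting_kernels =
  fixes I :: "real set" and \<kappa> :: "real \<Rightarrow> 'e::polish_space \<Rightarrow> 'e measure" and R C K \<gamma> D :: real
  assumes time_set: "I = {0..} \<or> I = \<nat>"
    and dist_le: "dist x (y :: 'e) \<le> D"
    and pos: "0 < R" "0 < C" "0 < K" "0 < \<gamma>" "0 < D"
    and sets_\<kappa>: "t \<in> I \<Longrightarrow> sets (\<kappa> t x) = sets borel"
    and finite_\<kappa>: "t \<in> I \<Longrightarrow> finite_measure (\<kappa> t x)"
    and mass_ge: "t \<in> I \<Longrightarrow> exp (- R * t) \<le> measure (\<kappa> t x) UNIV"
    and mass_le: "t \<in> I \<Longrightarrow> measure (\<kappa> t x) UNIV \<le> 1"
    and semigroup: "s \<in> I \<Longrightarrow> t \<in> I \<Longrightarrow> L-lipschitz_on UNIV f \<Longrightarrow>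
      (\<integral>z. f z \<partial>\<kappa> (s + t) x) = (\<integral>y. (\<integral>z. f z \<partial>\<kappa> t y) \<partial>\<kappa> s x)"
    and lipschitz: "t \<in> I \<Longrightarrow> L-lipschitz_on UNIV f \<Longrightarrow>
      \<exists>L'. L'-lipschitz_on UNIV (\<lambda>x. \<integral>z. f z \<partial>\<kappa> t x)"
    and lasota_yorke: "L-lipschitz_on UNIV f \<Longrightarrow> (\<And>z. \<bar>f z\<bar> \<le> b) \<Longrightarrow>
      \<bar>(\<integral>z. f z \<partial>\<kappa> (real n) x) - (\<integral>z. f z \<partial>\<kappa> (real n) y)\<bar> \<le> dist x y *
        (C * L * exp (- \<gamma> * real n) * measure (\<kappa> (real n) x) UNIV + b * K * mass_convolution \<kappa> \<gamma> n x)"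
    and mass_ratio: "measure (\<kappa> (real n) x) UNIV *
      exp (- (K * D * mass_convolution \<kappa> \<gamma> n x / measure (\<kappa> (real n) x) UNIV))
        \<le> measure (\<kappa> (real n) y) UNIV"
    and mixing: "L-lipschitz_on UNIV f \<Longrightarrow> (\<And>z. 0 \<le> f z) \<Longrightarrow>
      exp (- R * real n) * ((\<integral>z. f z \<partial>\<kappa> (real n) x)
          - C * L * D * exp (- \<gamma> * real n) * measure (\<kappa> (real n) x) UNIV)
        \<le> (\<integral>z. f z \<partial>\<kappa> (real n) y)"
begin

definition p :: "real \<Rightarrow> ('e \<Rightarrow> real) \<Rightarrow> 'e \<Rightarrow> real" where "p t f x = (\<integral>z. f z \<partial>\<kappa> t x)"
definition m :: "real \<Rightarrow> 'e \<Rightarrow> real" where "m t x = measure (\<kappa> t x) UNIV"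

lemma nat_in_I [simp]: "real n \<in> I" using time_set by auto
lemma zero_in_I [simp]: "0 \<in> I" using nat_in_I[of 0] by simp
lemma nonneg_I: "t \<in> I \<Longrightarrow> 0 \<le> t" using time_set by (auto elim: Nats_cases)
lemma add_in_I [simp]: "s \<in> I \<Longrightarrow> t \<in> I \<Longrightarrow> s + t \<in> I" using time_set by auto

lemma space_\<kappa> [simp]: "t \<in> I \<Longrightarrow> space (\<kappa> t x) = UNIV"
  using sets_eq_imp_space_eq[OF sets_\<kappa>] by simp

lemma lipschitz_bounded:
  assumes "L-lipschitz_on UNIV (f :: 'e \<Rightarrow> real)" shows "\<bar>f z\<bar> \<le> \<bar>f undefined\<bar> + L * D"
proof -
  have "dist (f z) (f undefined) \<le> L * dist z undefined" using assms by (auto simp: lipschitz_on_def)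
  also have "\<dots> \<le> L * D" using dist_le assms by (intro mult_left_mono) (auto simp: lipschitz_on_def)
  finally show ?thesis by (auto simp: dist_real_def)
qed

lemma lipschitz_measurable: "L-lipschitz_on UNIV (f :: 'e \<Rightarrow> real) \<Longrightarrow> f \<in> borel_measurable borel"
  using borel_measurable_continuous_onI lipschitz_on_continuous_on by blast

lemma integrable_bounded:
  assumes "t \<in> I" "f \<in> borel_measurable borel" "\<And>z. \<bar>f z\<bar> \<le> (b :: real)"
  shows "integrable (\<kappa> t x) f"
proof -
  interpret finite_measure "\<kappa> t x" using assms finite_\<kappa> by blast
  show ?thesis using assms sets_\<kappa>[OF assms(1)]
    by (intro integrable_const_bound[where B = b]) (auto cong: measurable_cong_sets)
qed

lemma integrable_lipschitz: "t \<in> I \<Longrightarrow> L-lipschitz_on UNIV f \<Longrightarrow> integrable (\<kappa> t x) (f :: 'e \<Rightarrow> real)"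
  using integrable_bounded lipschitz_bounded lipschitz_measurable by blast

lemma p_const: "t \<in> I \<Longrightarrow> p t (\<lambda>_. c) x = c * m t x"
  by (simp add: p_def m_def)

lemma p_diff:
  assumes "t \<in> I" "L-lipschitz_on UNIV f" "L'-lipschitz_on UNIV g"
  shows "p t (\<lambda>z. c * f z - d * g z) x = c * p t f x - d * p t g x"
  unfolding p_def using integrable_lipschitz[OF assms(1,2)] integrable_lipschitz[OF assms(1,3)] by simp

lemma p_mono:
  assumes "t \<in> I" "L-lipschitz_on UNIV f" "L'-lipschitz_on UNIV g" "\<And>z. f z \<le> g z"
  shows "p t f x \<le> p t g x"
  unfolding p_def using assms integrable_lipschitz by (intro integral_mono) auto

lemma m_pos: "t \<in> I \<Longrightarrow> 0 < m t x"
  using mass_ge[of t x] exp_gt_zero[of "- R * t"] unfolding m_def by linarith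

lemma p_add: "s \<in> I \<Longrightarrow> t \<in> I \<Longrightarrow> L-lipschitz_on UNIV f \<Longrightarrow> p (s + t) f x = p s (p t f) x"
  using semigroup unfolding p_def by simp

lemma lipschitz_p: "t \<in> I \<Longrightarrow> L-lipschitz_on UNIV f \<Longrightarrow> \<exists>L'. L'-lipschitz_on UNIV (p t f)"
  using lipschitz unfolding p_def by simp

lemma lipschitz_const: "0-lipschitz_on UNIV (\<lambda>_::'e. c :: real)" by (simp add: lipschitz_on_def)

lemma m_eq_p: "t \<in> I \<Longrightarrow> m t = p t (\<lambda>_. 1)"
  by (rule ext) (simp add: p_const)

lemma lipschitz_m: "t \<in> I \<Longrightarrow> \<exists>L. L-lipschitz_on UNIV (m t)"
  using lipschitz_p[OF _ lipschitz_const[of 1]] m_eq_p by simp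

lemma m_add: "s \<in> I \<Longrightarrow> t \<in> I \<Longrightarrow> m (s + t) x = p s (m t) x"
  using p_add[OF _ _ lipschitz_const[of 1]] m_eq_p by simp

lemma m_add_le: assumes "s \<in> I" "t \<in> I" "\<And>y. m t y \<le> c" shows "m (s + t) x \<le> c * m s x"
proof -
  obtain L where "L-lipschitz_on UNIV (m t)" using lipschitz_m assms by blast
  then have "p s (m t) x \<le> p s (\<lambda>_. c) x" using assms by (intro p_mono[OF _ _ lipschitz_const]) auto
  then show ?thesis using assms by (simp add: m_add p_const)
qed

lemma m_add_ge: assumes "s \<in> I" "t \<in> I" "\<And>y. c \<le> m t y" shows "c * m s x \<le> m (s + t) x"
proof -
  obtain L where "L-lipschitz_on UNIV (m t)" using lipschitz_m assms by blast
  then have "p s (\<lambda>_. c) x \<le> p s (m t) x" using assms by (intro p_mono[OF _ lipschitz_const]) auto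
  then show ?thesis using assms by (simp add: m_add p_const)
qed

definition M :: "nat \<Rightarrow> real" where "M n = top_mass \<kappa> (real n)"

lemma m_le_M: "m (real n) x \<le> M n"
  unfolding m_def M_def top_mass_def
  by (rule cSUP_upper) (auto intro!: bdd_aboveI2[where M = 1] mass_le)

lemma M_le: "(\<And>x. m (real n) x \<le> c) \<Longrightarrow> M n \<le> c"
  unfolding m_def M_def top_mass_def by (rule cSUP_least) auto

lemma M_le_1: "M n \<le> 1" using mass_le by (intro M_le) (simp add: m_def)

lemma M_ge: "exp (- R * real n) \<le> M n"
  using mass_ge[of "real n" undefined] m_le_M[of n undefined] unfolding m_def by simp

lemma M_pos: "0 < M n" using M_ge[of n] exp_gt_zero[of "- R * real n"] by linarith

lemma M_sub: "M (i + j) \<le> M i * M j"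
proof (rule M_le)
  fix x
  have "m (real i + real j) x \<le> M j * m (real i) x" by (intro m_add_le) (auto intro: m_le_M)
  also have "\<dots> \<le> M j * M i" using m_le_M M_pos[of j] by (intro mult_left_mono) auto
  finally show "m (real (i + j)) x \<le> M i * M j" by (simp add: mult.commute)
qed

text \<open>The supremum need not be attained; half of it is enough and costs a factor
  \<open>2\<close> in the Harnack constant.\<close>

lemma M_near_max: "\<exists>x. M n / 2 \<le> m (real n) x"
proof (rule ccontr)
  assume "\<not> ?thesis"
  then have "m (real n) x \<le> M n / 2" for x by (meson linear)
  from M_le[OF this] M_pos[of n] show False by simp
qed

definition S :: "nat \<Rightarrow> 'e \<Rightarrow> real" where "S n x = mass_convolution \<kappa> \<gamma> n x"

lemma S_eq: "S n x = (\<Sum>k<n. exp (- \<gamma> * real k) * m (real k) x * M (n - 1 - k))"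
  unfolding S_def mass_convolution_def m_def M_def ..

lemma S_nonneg: "0 \<le> S n x"
  unfolding S_eq using m_pos M_pos by (intro sum_nonneg mult_nonneg_nonneg) (auto simp: less_imp_le)

text \<open>At a point \<open>x\<close> that carries at least half of the top mass, the Jensen
  exponent is at most \<open>2 * K * D * B\<close>; hence every point carries a fixed fraction of
  \<open>M n\<close>.\<close>

lemma harnack_of_S:
  assumes "\<And>x. M n / 2 \<le> m (real n) x \<Longrightarrow> S n x \<le> B * M n"
  shows "M n \<le> 2 * exp (2 * K * D * B) * m (real n) y"
proof -
  obtain x where x: "M n / 2 \<le> m (real n) x" using M_near_max by blast
  have "S n x / m (real n) x \<le> B * M n / (M n / 2)"
    using assms[OF x] x M_pos[of n] S_nonneg[of n x] by (intro frac_le) auto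
  then have "S n x / m (real n) x \<le> 2 * B" using M_pos[of n] by simp
  then have "K * D * (S n x / m (real n) x) \<le> K * D * (2 * B)" using pos by (intro mult_left_mono) auto
  then have "exp (- (2 * K * D * B)) \<le> exp (- (K * D * S n x / m (real n) x))" by (simp add: mult_ac)
  then have "M n / 2 * exp (- (2 * K * D * B)) \<le> m (real n) x * exp (- (K * D * S n x / m (real n) x))"
    using x M_pos[of n] m_pos[of "real n" x] by (intro mult_mono) auto
  also have "\<dots> \<le> m (real n) y" using mass_ratio unfolding m_def S_def .
  finally show ?thesis by (simp add: exp_minus field_simps)
qed

text \<open>The factor \<open>exp l\<close> pays for the unit of time missing in
  \<open>k + (n - 1 - k) = n - 1\<close>; what remains is a geometric sum in \<gamma>.\<close>

lemma S_le:
  assumes "1 \<le> H" and bound: "\<And>n. M n \<le> H * exp (- l * real n)"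
  shows "S n x \<le> H * H * exp l / (1 - exp (- \<gamma>)) * exp (- l * real n)"
proof -
  have "exp (- \<gamma> * real k) * m (real k) x * M (n - 1 - k) \<le> H * H * exp l * exp (- l * real n) * exp (- \<gamma> * real k)"
    if k: "k < n" for k
  proof -
    have r: "real (n - 1 - k) = real n - 1 - real k" using k by simp
    have "m (real k) x * M (n - 1 - k) \<le> (H * exp (- l * real k)) * (H * exp (- l * real (n - 1 - k)))"
      using bound[of k] m_le_M[of k x] bound[of "n - 1 - k"] M_pos[of "n - 1 - k"] assms(1)
      by (intro mult_mono) auto
    also have "\<dots> = H * H * (exp (- l * real k) * exp (- l * real (n - 1 - k)))" by (simp add: mult_ac)
    also have "exp (- l * real k) * exp (- l * real (n - 1 - k)) = exp l * exp (- l * real n)"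
      unfolding r by (simp add: exp_add[symmetric]) (simp add: algebra_simps)
    finally have "exp (- \<gamma> * real k) * (m (real k) x * M (n - 1 - k)) \<le> exp (- \<gamma> * real k) * (H * H * (exp l * exp (- l * real n)))"
      by (intro mult_left_mono) auto
    then show ?thesis by (simp add: mult_ac)
  qed
  then have "S n x \<le> (\<Sum>k<n. H * H * exp l * exp (- l * real n) * exp (- \<gamma> * real k))"
    unfolding S_eq by (intro sum_mono) auto
  also have "\<dots> = H * H * exp l * exp (- l * real n) * (\<Sum>k<n. exp (- \<gamma> * real k))" by (simp add: sum_distrib_left)
  also have "\<dots> \<le> H * H * exp l * exp (- l * real n) * (1 / (1 - exp (- \<gamma>)))"
    using assms(1) pos by (intro mult_left_mono sum_exp_le mult_nonneg_nonneg) auto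
  finally show ?thesis by simp
qed

text \<open>\<open>harnack_of_S\<close> is used twice: first at record times, where \<open>M\<close>
  is known only up to subexponential factors, and then at all times, once \<open>M n\<close> is
  known to be of the exact order \<open>exp (- l * n)\<close>.\<close>

theorem harnack:
  obtains l H where "0 \<le> l" "1 \<le> H" "\<And>n. exp (- l * real n) \<le> M n" "\<And>n. M n \<le> H * exp (- l * real n)"
    "\<And>n x. M n \<le> H * m (real n) x"
proof -
  obtain l where l: "0 \<le> l" "\<And>n. exp (- l * real n) \<le> M n"
    and sub: "\<And>e. 0 < e \<Longrightarrow> \<exists>B. \<forall>n. M n \<le> B * exp ((e - l) * real n)"
    using submultiplicative_rate[of M, OF M_sub M_ge M_le_1] by blast
  obtain B where B: "\<And>n. M n \<le> B * exp ((\<gamma>/4 - l) * real n)" using sub[of "\<gamma>/4"] pos by auto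
  have B0: "0 \<le> B" using B[of 0] M_pos[of 0] by simp
  \<comment> \<open>The decay \<gamma> is split: \<gamma>/2 pays for comparing
    \<open>M (n - 1 - k)\<close> with \<open>M n\<close> at a record, \<gamma>/4 for the
    subexponential growth of \<open>M k\<close>, and \<gamma>/4 is left to sum the series.\<close>
  define rec where "rec n \<longleftrightarrow> (\<forall>k\<le>n. M k * exp ((l + \<gamma>/2) * real k) \<le> M n * exp ((l + \<gamma>/2) * real n))" for n
  define B1 where "B1 = B * exp (l + \<gamma>/2) * (1 / (1 - exp (- (\<gamma>/4))))"
  define H0 where "H0 = 2 * exp (2 * K * D * B1)"
  have gpos: "0 < 1 / (1 - exp (- (\<gamma>/4)))" using pos by simp
  have B1: "0 \<le> B1" unfolding B1_def using B0 gpos by (intro mult_nonneg_nonneg) auto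
  have "0 \<le> 2 * K * D * B1" using pos B1 by (intro mult_nonneg_nonneg) auto
  then have "1 \<le> exp (2 * K * D * B1)" by simp
  then have H0: "1 \<le> H0" unfolding H0_def by linarith
  have rec_harnack: "M n \<le> H0 * m (real n) y" if "rec n" for n y
    unfolding H0_def
  proof (rule harnack_of_S)
    fix x
    have "exp (- \<gamma> * real k) * m (real k) x * M (n - 1 - k) \<le> B * exp (l + \<gamma>/2) * M n * exp (- (\<gamma>/4) * real k)"
      if k: "k < n" for k
    proof -
      have r: "real (n - 1 - k) = real n - 1 - real k" using k by simp
      have "M (n - 1 - k) * exp ((l + \<gamma>/2) * real (n - 1 - k)) \<le> M n * exp ((l + \<gamma>/2) * real n)"
        using \<open>rec n\<close> unfolding rec_def by auto
      then have "M (n - 1 - k) \<le> M n * exp ((l + \<gamma>/2) * real n) / exp ((l + \<gamma>/2) * real (n - 1 - k))"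
        by (simp add: field_simps)
      also have "\<dots> = M n * exp ((l + \<gamma>/2) * (1 + real k))"
        unfolding r by (simp add: exp_diff[symmetric] algebra_simps times_divide_eq_right[symmetric] del: times_divide_eq_right)
      finally have 1: "M (n - 1 - k) \<le> M n * exp ((l + \<gamma>/2) * (1 + real k))" .
      have "m (real k) x \<le> B * exp ((\<gamma>/4 - l) * real k)" using B[of k] m_le_M[of k x] by linarith
      then have "m (real k) x * M (n - 1 - k) \<le> B * exp ((\<gamma>/4 - l) * real k) * (M n * exp ((l + \<gamma>/2) * (1 + real k)))"
        using 1 M_pos[of "n - 1 - k"] B0 by (intro mult_mono) auto
      then have "exp (- \<gamma> * real k) * (m (real k) x * M (n - 1 - k)) \<le>
        exp (- \<gamma> * real k) * (B * exp ((\<gamma>/4 - l) * real k) * (M n * exp ((l + \<gamma>/2) * (1 + real k))))"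
        by (intro mult_left_mono) auto
      also have "\<dots> = B * M n * (exp (- \<gamma> * real k) * exp ((\<gamma>/4 - l) * real k) * exp ((l + \<gamma>/2) * (1 + real k)))"
        by (simp add: mult_ac)
      also have "exp (- \<gamma> * real k) * exp ((\<gamma>/4 - l) * real k) * exp ((l + \<gamma>/2) * (1 + real k)) = exp (l + \<gamma>/2) * exp (- (\<gamma>/4) * real k)"
        by (simp add: exp_add[symmetric]) (simp add: algebra_simps)
      finally show ?thesis by (simp add: mult_ac)
    qed
    then have "S n x \<le> (\<Sum>k<n. B * exp (l + \<gamma>/2) * M n * exp (- (\<gamma>/4) * real k))"
      unfolding S_eq by (intro sum_mono) auto
    also have "\<dots> = B * exp (l + \<gamma>/2) * M n * (\<Sum>k<n. exp (- (\<gamma>/4) * real k))" by (simp add: sum_distrib_left)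
    also have "\<dots> \<le> B * exp (l + \<gamma>/2) * M n * (1 / (1 - exp (- (\<gamma>/4))))"
      using B0 M_pos[of n] pos by (intro mult_left_mono sum_exp_le mult_nonneg_nonneg) auto
    finally show "S n x \<le> B1 * M n" unfolding B1_def by (simp add: mult_ac)
  qed
  have rec_bound: "M n \<le> H0 * exp (- l * real n)" if "rec n" for n
  proof -
    \<comment> \<open>Inserted into the semigroup property, the Harnack inequality at time
      \<open>n\<close> yields the converse of \<open>M_sub\<close> up to the factor
      \<open>H0\<close>.\<close>
    have step: "M j * M n \<le> H0 * M (j + n)" for j
    proof -
      have "M n / H0 \<le> m (real n) y" for y using rec_harnack[OF \<open>rec n\<close>, of y] H0 by (simp add: field_simps)
      then have "M n / H0 * m (real j) x \<le> m (real j + real n) x" for x by (intro m_add_ge) auto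
      then have "M n / H0 * m (real j) x \<le> M (j + n)" for x
        using m_le_M[of "j + n" x] by (metis of_nat_add order_trans)
      then have "m (real j) x \<le> M (j + n) * H0 / M n" for x using H0 M_pos[of n] by (simp add: field_simps)
      then have "M j \<le> M (j + n) * H0 / M n" by (rule M_le)
      then show ?thesis using M_pos[of n] by (simp add: field_simps)
    qed
    have pw: "(M n / H0) ^ j \<le> M (j * n)" for j
    proof (induction j)
      case 0 show ?case using M_ge[of 0] by simp
    next
      case (Suc j)
      have "(M n / H0) ^ Suc j \<le> M n / H0 * M (j * n)" using mult_left_mono[OF Suc, of "M n / H0"] H0 M_pos[of n] by simp
      also have "\<dots> \<le> M (j * n + n)" using step[of "j * n"] H0 by (simp add: field_simps)
      finally show ?case by (simp add: add.commute)
    qed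
    \<comment> \<open>The growth of \<open>M (j * n)\<close> in \<open>j\<close> determines the base
      \<open>M n / H0\<close>. The constant \<open>B'\<close> depends on \<open>e\<close> but
      disappears when powers are compared, and afterwards \<open>e\<close> tends to
      \<open>0\<close>.\<close>
    have "M n / H0 \<le> exp ((e - l) * real n)" if e: "0 < e" for e
    proof -
      obtain B' where "\<forall>i. M i \<le> B' * exp ((e - l) * real i)" using sub[OF e] by blast
      then have "M (j * n) \<le> B' * exp ((e - l) * real (j * n))" for j by blast
      moreover have "exp ((e - l) * real (j * n)) = exp ((e - l) * real n) ^ j" for j
        by (simp add: exp_of_nat_mult[symmetric] mult_ac)
      ultimately have "(M n / H0) ^ j \<le> B' * exp ((e - l) * real n) ^ j" for j
        using pw order_trans by metis
      moreover have "0 \<le> M n / H0" using H0 M_pos[of n] by simp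
      ultimately show ?thesis by (intro le_of_power_le[OF _ exp_gt_zero])
    qed
    note le_e = this
    have "M n / H0 \<le> exp (- l * real n)"
    proof (rule tendsto_lowerbound)
      show "((\<lambda>e. exp ((e - l) * real n)) \<longlongrightarrow> exp (- l * real n)) (at_right 0)"
        by (auto intro!: tendsto_eq_intros)
      show "\<forall>\<^sub>F e in at_right 0. M n / H0 \<le> exp ((e - l) * real n)"
        using le_e by (auto simp: eventually_at_filter)
    qed simp
    then show ?thesis using H0 by (simp add: field_simps)
  qed
  have all_bound: "M n \<le> H0 * exp (- l * real n)" for n
  proof -
    \<comment> \<open>A maximizer \<open>r \<le> n\<close> of \<open>g\<close> is a record. The loss
      \<open>exp (\<gamma>/2 * r)\<close> is at most \<open>exp (\<gamma>/2 * n)\<close>, and this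
      factor is also present in the weight of \<open>M n\<close>, so it cancels.\<close>
    define g where "g k = M k * exp ((l + \<gamma>/2) * real k)" for k :: nat
    have "Max (g ` {..n}) \<in> g ` {..n}" by (rule Max_in) simp_all
    then obtain r where "r \<in> {..n}" "Max (g ` {..n}) = g r" by (rule imageE)
    moreover have "g k \<le> Max (g ` {..n})" if "k \<le> n" for k using that by (intro Max_ge) auto
    ultimately have "r \<le> n \<and> (\<forall>k. k \<le> n \<longrightarrow> g k \<le> g r)" by auto
    then have r: "r \<le> n" "rec r" "g n \<le> g r" unfolding rec_def g_def by auto
    have "M n * exp ((l + \<gamma>/2) * real n) \<le> M r * exp ((l + \<gamma>/2) * real r)" using r(3) unfolding g_def .
    also have "\<dots> \<le> H0 * exp (- l * real r) * exp ((l + \<gamma>/2) * real r)" using rec_bound[OF r(2)] by (intro mult_right_mono) auto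
    also have "\<dots> = H0 * exp (\<gamma>/2 * real r)" by (simp add: exp_add[symmetric] mult.assoc) (simp add: algebra_simps)
    also have "\<dots> \<le> H0 * exp (\<gamma>/2 * real n)" using H0 r(1) pos by simp
    also have "\<dots> = H0 * exp (- l * real n) * exp ((l + \<gamma>/2) * real n)" by (simp add: exp_add[symmetric] mult.assoc) (simp add: algebra_simps)
    finally show ?thesis by simp
  qed
  define B2 where "B2 = H0 * H0 * exp l / (1 - exp (- \<gamma>))"
  have harn: "M n \<le> 2 * exp (2 * K * D * B2) * m (real n) y" for n y
  proof (rule harnack_of_S)
    have gpos: "0 < 1 - exp (- \<gamma>)" using pos by simp
    fix x
    have "S n x \<le> B2 * exp (- l * real n)"
      unfolding B2_def using S_le all_bound H0 by simp
    also have "\<dots> \<le> B2 * M n" unfolding B2_def using l(2)[of n] H0 gpos by (intro mult_left_mono) auto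
    finally show "S n x \<le> B2 * M n" .
  qed
  define H where "H = max H0 (2 * exp (2 * K * D * B2))"
  have HH: "H0 \<le> H" "2 * exp (2 * K * D * B2) \<le> H" unfolding H_def by simp_all
  show ?thesis
  proof (rule that[of l H])
    show "M n \<le> H * exp (- l * real n)" for n
      by (rule order_trans[OF all_bound mult_right_mono[OF HH(1) exp_ge_zero]])
    show "M n \<le> H * m (real n) x" for n x
      by (rule order_trans[OF harn mult_right_mono[OF HH(2)]]) (simp add: m_pos less_imp_le)
    show "1 \<le> H" using H0 HH by linarith
  qed (use l in auto)
qed

end

section \<open>Contraction of normalized kernels\<close>

text \<open>Fixes the rate and the Harnack constant supplied by \<open>harnack\<close>, so that
  definitions can refer to them.\<close>

locale contracting_kernels_rate = contracting_kernels I \<kappa> R C K \<gamma> D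
  for I and \<kappa> :: "real \<Rightarrow> 'e::polish_space \<Rightarrow> 'e measure" and R C K \<gamma> D +
  fixes l H :: real
  assumes l_nonneg: "0 \<le> l" and H_ge_1: "1 \<le> H"
    and M_ge_exp: "\<And>n. exp (- l * real n) \<le> M n"
    and M_le_exp: "\<And>n. M n \<le> H * exp (- l * real n)"
    and M_le_m: "\<And>n x. M n \<le> H * m (real n) x"
begin

lemma m_le_exp: "m (real n) x \<le> H * exp (- l * real n)"
  using m_le_M[of n x] M_le_exp[of n] by linarith

lemma exp_le_m: "exp (- l * real n) \<le> H * m (real n) x"
  using M_ge_exp[of n] M_le_m[of n x] by linarith

definition C1 :: real where "C1 = C * H + K * (H * H * exp l / (1 - exp (- \<gamma>)))"

lemma C1_pos: "0 < C1"
proof -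
  have "0 < 1 - exp (- \<gamma>)" using pos by simp
  then show ?thesis unfolding C1_def using pos H_ge_1 by (intro add_pos_pos mult_pos_pos divide_pos_pos) auto
qed

text \<open>The bounds on \<open>m\<close> and \<open>S\<close> bring all error terms to the common
  scale \<open>exp (- l * n)\<close>. Relative to it the Lipschitz part contracts, while the
  supremum part does not.\<close>

lemma p_lasota_yorke:
  assumes f: "L-lipschitz_on UNIV f" "\<And>z. \<bar>f z\<bar> \<le> b"
  shows "\<bar>p (real n) f x - p (real n) f y\<bar> \<le> C1 * exp (- l * real n) * (L * exp (- \<gamma> * real n) + b) * dist x y"
proof -
  have b: "0 \<le> b" using f(2)[of undefined] by linarith
  have L: "0 \<le> L" using f(1) by (simp add: lipschitz_on_def)
  let ?B = "H * H * exp l / (1 - exp (- \<gamma>))"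
  let ?e = "exp (- l * real n)"
  have gpos: "0 < 1 - exp (- \<gamma>)" using pos by simp
  have "\<bar>p (real n) f x - p (real n) f y\<bar> \<le> dist x y *
        (C * L * exp (- \<gamma> * real n) * m (real n) x + b * K * S n x)"
    unfolding p_def m_def S_def by (rule lasota_yorke[OF f])
  also have "\<dots> \<le> dist x y * (C * L * exp (- \<gamma> * real n) * (H * ?e) + b * K * (?B * ?e))"
    using pos b L m_le_exp[of n x] S_le[OF H_ge_1 M_le_exp, of n x]
    by (intro mult_left_mono add_mono) auto
  also have "\<dots> \<le> dist x y * (C1 * (L * exp (- \<gamma> * real n)) * ?e + C1 * b * ?e)"
  proof (intro mult_left_mono add_mono)
    have "C * H \<le> C1" unfolding C1_def using pos H_ge_1 gpos by simp
    then have "C * H * (L * exp (- \<gamma> * real n) * ?e) \<le> C1 * (L * exp (- \<gamma> * real n) * ?e)"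
      using L by (intro mult_right_mono) auto
    then show "C * L * exp (- \<gamma> * real n) * (H * ?e) \<le> C1 * (L * exp (- \<gamma> * real n)) * ?e" by (simp add: mult_ac)
    have "K * ?B \<le> C1" unfolding C1_def using pos H_ge_1 by simp
    then have "K * ?B * (b * ?e) \<le> C1 * (b * ?e)" using b by (intro mult_right_mono) auto
    then show "b * K * (?B * ?e) \<le> C1 * b * ?e" by (simp add: mult_ac)
  qed simp
  finally show ?thesis by (simp add: algebra_simps)
qed

lemma m_lipschitz_exp: "\<bar>m (real n) x - m (real n) y\<bar> \<le> C1 * exp (- l * real n) * dist x y"
  using p_lasota_yorke[OF lipschitz_const[of 1], of 1 n x y] by (simp add: m_eq_p)

text \<open>The ratio of \<open>p n f\<close> and \<open>m n\<close> oscillates by at most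
  \<open>w\<close>, whereas regularity is measured for the difference from \<open>a * m n\<close>,
  on the scale \<open>exp (- l * n)\<close>. Differences, unlike ratios, behave linearly under a
  further application of a kernel.\<close>

definition sandwiched :: "nat \<Rightarrow> ('e \<Rightarrow> real) \<Rightarrow> real \<Rightarrow> real \<Rightarrow> real \<Rightarrow> bool" where
  "sandwiched n f a w L \<longleftrightarrow> 0 \<le> w \<and> 0 \<le> L \<and>
     (L * exp (- l * real n))-lipschitz_on UNIV (\<lambda>x. p (real n) f x - a * m (real n) x) \<and>
     (\<forall>x. a * m (real n) x \<le> p (real n) f x \<and> p (real n) f x \<le> (a + w) * m (real n) x)"

text \<open>Mixing carries mass from the single point \<open>x\<close> to every \<open>y\<close>.
  The constant \<open>e1\<close> is the mixing error written as a multiple of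
  \<open>m (T + n) x\<close>: one factor \<open>H\<close> bounds a mass by an exponential, the other
  bounds an exponential by a mass. The division by \<open>H\<close> in front is the Harnack
  comparison of \<open>y\<close> with \<open>x\<close>.\<close>

lemma minorization:
  fixes T n :: nat
  defines "e1 \<equiv> C * D * H * H * exp (- \<gamma> * real T)"
  assumes lip: "(L * exp (- l * real n))-lipschitz_on UNIV g" and nonneg: "\<And>z. 0 \<le> g z" and L: "0 \<le> L"
    and half: "w / 2 * m (real T + real n) x \<le> p (real T) g x"
  shows "max 0 (exp (- R * real T) / H * (w / 2 - e1 * L)) * m (real T + real n) y \<le> p (real T) g y"
proof (cases "0 \<le> w / 2 - e1 * L")
  case False
  have "0 \<le> p (real T) g y" unfolding p_def using nonneg by (intro integral_nonneg_AE) auto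
  moreover have "exp (- R * real T) / H * (w / 2 - e1 * L) \<le> 0"
    using False H_ge_1 by (intro mult_nonneg_nonpos) auto
  ultimately show ?thesis by (simp add: max_def)
next
  case True
  let ?h = "m (real T + real n)"
  have hnat: "?h = m (real (T + n))" by simp
  have "m (real T) x * exp (- l * real n) \<le> H * exp (- l * real T) * exp (- l * real n)"
    using m_le_exp[of T x] by (intro mult_right_mono) auto
  also have "\<dots> = H * exp (- l * real (T + n))" by (simp add: exp_add[symmetric] mult.assoc) (simp add: algebra_simps)
  also have "\<dots> \<le> H * (H * ?h x)" unfolding hnat using exp_le_m[of "T + n" x] H_ge_1 by (intro mult_left_mono) auto
  finally have "C * L * D * exp (- \<gamma> * real T) * (m (real T) x * exp (- l * real n))
      \<le> C * L * D * exp (- \<gamma> * real T) * (H * (H * ?h x))"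
    using pos L by (intro mult_left_mono) auto
  then have 1: "C * (L * exp (- l * real n)) * D * exp (- \<gamma> * real T) * m (real T) x \<le> e1 * L * ?h x"
    unfolding e1_def by (simp add: mult_ac)
  have "?h y \<le> H * ?h x" unfolding hnat using m_le_M[of "T + n" y] M_le_m[of "T + n" x] by linarith
  then have "(w / 2 - e1 * L) * (?h y / H) \<le> (w / 2 - e1 * L) * ?h x"
    using True H_ge_1 by (intro mult_left_mono) (auto simp: field_simps)
  also have "\<dots> \<le> p (real T) g x - C * (L * exp (- l * real n)) * D * exp (- \<gamma> * real T) * m (real T) x"
    using 1 half by (simp add: algebra_simps)
  finally have "exp (- R * real T) * ((w / 2 - e1 * L) * (?h y / H)) \<le>
    exp (- R * real T) * (p (real T) g x - C * (L * exp (- l * real n)) * D * exp (- \<gamma> * real T) * m (real T) x)"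
    by (intro mult_left_mono) auto
  also have "\<dots> \<le> p (real T) g y" using mixing[OF lip nonneg] unfolding p_def m_def .
  finally have "exp (- R * real T) / H * (w / 2 - e1 * L) * ?h y \<le> p (real T) g y" by simp
  moreover have "0 \<le> exp (- R * real T) / H * (w / 2 - e1 * L)" using True H_ge_1 by (intro mult_nonneg_nonneg) auto
  ultimately show ?thesis by simp
qed

text \<open>A Doeblin dichotomy at one fixed point \<open>x0\<close>: after \<open>T\<close> steps
  either the excess \<open>g\<close> over the lower bound or the defect \<open>w * m - g\<close>
  below the upper bound has at least half of the maximal size. Minorization then raises the lower
  bound or decreases the upper bound.\<close>

lemma contraction_step:
  fixes T n :: nat
  defines "e1 \<equiv> C * D * H * H * exp (- \<gamma> * real T)" and "c0 \<equiv> exp (- R * real T) / H"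
  assumes f: "Lf-lipschitz_on UNIV f" and adm: "sandwiched n f a w L"
  obtains a' w' L' where "sandwiched (T + n) f a' w' L'"
    "w' \<le> w - c0 * (w / 2 - e1 * (L + C1 * w))"
    "L' = C1 * exp (- \<gamma> * real T) * L + C1 * (H + 1) * w"
proof -
  from adm have w: "0 \<le> w" and L: "0 \<le> L"
    and lip: "(L * exp (- l * real n))-lipschitz_on UNIV (\<lambda>x. p (real n) f x - a * m (real n) x)"
    and lo: "\<And>x. a * m (real n) x \<le> p (real n) f x" and hi: "\<And>x. p (real n) f x \<le> (a + w) * m (real n) x"
    unfolding sandwiched_def by auto
  let ?h = "m (real T + real n)" let ?f = "p (real T + real n) f"
  define g where "g x = p (real n) f x - a * m (real n) x" for x
  obtain L1 where L1: "L1-lipschitz_on UNIV (p (real n) f)" using lipschitz_p[OF _ f] nat_in_I by blast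
  obtain L2 where L2: "L2-lipschitz_on UNIV (m (real n))" using lipschitz_m nat_in_I by blast
  have lipg: "(L * exp (- l * real n))-lipschitz_on UNIV g" using lip unfolding g_def .
  have g0: "0 \<le> g z" for z using lo[of z] unfolding g_def by simp
  have gw: "g z \<le> w * m (real n) z" for z using hi[of z] unfolding g_def by (simp add: algebra_simps)
  have pg: "p (real T) g x = ?f x - a * ?h x" for x
    unfolding g_def using p_diff[OF nat_in_I L1 L2, of T 1 a x] by (simp add: p_add[OF nat_in_I nat_in_I f] m_add)
  have pwg: "p (real T) (\<lambda>z. w * m (real n) z - g z) x = w * ?h x - p (real T) g x" for x
    using p_diff[OF nat_in_I L2 lipg, of T w 1 x] by (simp add: m_add)
  have pg_lip: "\<bar>p (real T) g x - p (real T) g y\<bar> \<le>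
      C1 * (L * exp (- \<gamma> * real T) + w * H) * exp (- l * real (T + n)) * dist x y" for x y
  proof -
    have "\<bar>g z\<bar> \<le> w * (H * exp (- l * real n))" for z
      using g0[of z] gw[of z] mult_left_mono[OF m_le_exp[of n z] w] by linarith
    from p_lasota_yorke[OF lipg this, of T x y]
    have "\<bar>p (real T) g x - p (real T) g y\<bar> \<le>
      C1 * (L * exp (- \<gamma> * real T) + w * H) * (exp (- l * real T) * exp (- l * real n)) * dist x y"
      by (simp add: algebra_simps)
    moreover have "exp (- l * real T) * exp (- l * real n) = exp (- l * real (T + n))"
      by (simp add: exp_add[symmetric] algebra_simps)
    ultimately show ?thesis by simp
  qed
  have h_lip: "\<bar>?h x - ?h y\<bar> \<le> C1 * exp (- l * real (T + n)) * dist x y" for x y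
    using m_lipschitz_exp[of "T + n" x y] by simp
  have hpos: "0 < ?h x" for x by (intro m_pos) auto
  \<comment> \<open>The gain is computed with \<open>L + C1 * w\<close>, the Lipschitz constant of
    the defect and the worse of the two cases, so that both cases give the same
    \<open>s\<close>.\<close>
  define s where "s = max 0 (c0 * (w / 2 - e1 * (L + C1 * w)))"
  have c0: "0 < c0" unfolding c0_def using H_ge_1 by (intro divide_pos_pos) auto
  have e1: "0 \<le> e1" unfolding e1_def using pos H_ge_1 by simp
  have s0: "0 \<le> s" unfolding s_def by simp
  have c01: "c0 \<le> 1"
  proof -
    have "exp (- R * real T) \<le> 1" using pos by simp
    then have "exp (- R * real T) \<le> H" using H_ge_1 by linarith
    then show ?thesis unfolding c0_def using H_ge_1 by simp
  qed
  have sw: "s \<le> w"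
  proof -
    have "0 \<le> e1 * (L + C1 * w)" using e1 L w C1_pos by simp
    then have "w / 2 - e1 * (L + C1 * w) \<le> w" using w by linarith
    then have "c0 * (w / 2 - e1 * (L + C1 * w)) \<le> c0 * w"
      using c0 by (intro mult_left_mono) auto
    also have "\<dots> \<le> w" using c01 w by (simp add: mult_left_le_one_le c0 less_imp_le)
    finally show ?thesis unfolding s_def using w by simp
  qed
  define L' where "L' = C1 * exp (- \<gamma> * real T) * L + C1 * (H + 1) * w"
  have L'0: "0 \<le> L'" unfolding L'_def using C1_pos L w H_ge_1 by simp
  \<comment> \<open>On the scale \<open>exp (- l * n)\<close> the function \<open>g\<close> is
    bounded by \<open>w * H\<close>, which contributes \<open>C1 * H * w\<close>; the shift by at
    most \<open>w\<close> times the mass function contributes another \<open>C1 * w\<close>.\<close>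
  have lip_shift: "(L' * exp (- l * real (T + n)))-lipschitz_on UNIV (\<lambda>x. ?f x - (a + s') * ?h x)"
    if s': "0 \<le> s'" "s' \<le> w" for s'
  proof (rule lipschitz_onI)
    fix x y
    have "dist (?f x - (a + s') * ?h x) (?f y - (a + s') * ?h y) = \<bar>(p (real T) g x - p (real T) g y) - s' * (?h x - ?h y)\<bar>"
      unfolding pg dist_real_def by (simp add: algebra_simps)
    also have "\<dots> \<le> \<bar>p (real T) g x - p (real T) g y\<bar> + s' * \<bar>?h x - ?h y\<bar>"
      using s' abs_triangle_ineq4[of "p (real T) g x - p (real T) g y" "s' * (?h x - ?h y)"] by (simp add: abs_mult)
    also have "\<dots> \<le> C1 * (L * exp (- \<gamma> * real T) + w * H) * exp (- l * real (T + n)) * dist x y + w * (C1 * exp (- l * real (T + n)) * dist x y)"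
      using pg_lip h_lip s' w by (intro add_mono mult_mono) auto
    also have "\<dots> = L' * exp (- l * real (T + n)) * dist x y" unfolding L'_def by (simp add: algebra_simps)
    finally show "dist (?f x - (a + s') * ?h x) (?f y - (a + s') * ?h y) \<le> L' * exp (- l * real (T + n)) * dist x y" .
  qed (use L'0 in simp)
  have bounds: "0 \<le> p (real T) g x" "p (real T) g x \<le> w * ?h x" for x
  proof -
    show "0 \<le> p (real T) g x" unfolding p_def using g0 by (intro integral_nonneg_AE) auto
    have "0 \<le> p (real T) (\<lambda>z. w * m (real n) z - g z) x" unfolding p_def using gw by (intro integral_nonneg_AE) auto
    then show "p (real T) g x \<le> w * ?h x" unfolding pwg by simp
  qed
  have ws: "w - s \<le> w - c0 * (w / 2 - e1 * (L + C1 * w))" unfolding s_def by simp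
  define x0 :: 'e where "x0 = undefined"
  show ?thesis
  proof (cases "w / 2 * ?h x0 \<le> p (real T) g x0")
    case True
    have min: "s * ?h y \<le> p (real T) g y" for y
    proof -
      have "c0 * (w / 2 - e1 * (L + C1 * w)) \<le> c0 * (w / 2 - e1 * L)"
        using c0 e1 w C1_pos by (intro mult_left_mono diff_left_mono) auto
      then have "s \<le> max 0 (c0 * (w / 2 - e1 * L))" unfolding s_def by simp
      then have "s * ?h y \<le> max 0 (c0 * (w / 2 - e1 * L)) * ?h y" using hpos[of y] by (intro mult_right_mono) auto
      also have "\<dots> \<le> p (real T) g y" using minorization[OF lipg g0 L True, of y] unfolding c0_def e1_def .
      finally show ?thesis .
    qed
    have "sandwiched (T + n) f (a + s) (w - s) L'"
      unfolding sandwiched_def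
    proof (intro conjI allI)
      show "(L' * exp (- l * real (T + n)))-lipschitz_on UNIV (\<lambda>x. p (real (T + n)) f x - (a + s) * m (real (T + n)) x)"
        using lip_shift[OF s0 sw] by simp
      fix x
      show "(a + s) * m (real (T + n)) x \<le> p (real (T + n)) f x"
        using min[of x] unfolding pg distrib_right of_nat_add by linarith
      show "p (real (T + n)) f x \<le> (a + s + (w - s)) * m (real (T + n)) x"
        using bounds(2)[of x] unfolding pg of_nat_add by (simp add: distrib_right)
    qed (use sw L'0 in auto)
    from that[OF this ws L'_def] show ?thesis .
  next
    case False
    have lipk: "((L + C1 * w) * exp (- l * real n))-lipschitz_on UNIV (\<lambda>z. w * m (real n) z - g z)"
    proof (rule lipschitz_onI)
      fix x y
      have "dist (w * m (real n) x - g x) (w * m (real n) y - g y) \<le> w * \<bar>m (real n) x - m (real n) y\<bar> + \<bar>g x - g y\<bar>"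
      proof -
        have "dist (w * m (real n) x - g x) (w * m (real n) y - g y) = \<bar>w * (m (real n) x - m (real n) y) - (g x - g y)\<bar>"
          unfolding dist_real_def by (simp add: algebra_simps)
        also have "\<dots> \<le> \<bar>w * (m (real n) x - m (real n) y)\<bar> + \<bar>g x - g y\<bar>" by (rule abs_triangle_ineq4)
        finally show ?thesis using w by (simp add: abs_mult)
      qed
      also have "\<dots> \<le> w * (C1 * exp (- l * real n) * dist x y) + L * exp (- l * real n) * dist x y"
        using m_lipschitz_exp lipg w by (intro add_mono mult_left_mono) (auto simp: lipschitz_on_def dist_real_def)
      finally show "dist (w * m (real n) x - g x) (w * m (real n) y - g y) \<le> (L + C1 * w) * exp (- l * real n) * dist x y"
        by (simp add: algebra_simps)
    qed (use L w C1_pos in simp)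
    have half: "w / 2 * ?h x0 \<le> p (real T) (\<lambda>z. w * m (real n) z - g z) x0"
      unfolding pwg using False by (simp add: field_simps)
    have min: "s * ?h y \<le> w * ?h y - p (real T) g y" for y
      using minorization[OF lipk _ _ half, of y] gw L w C1_pos unfolding pwg s_def c0_def e1_def by simp
    have "sandwiched (T + n) f a (w - s) L'"
      unfolding sandwiched_def
    proof (intro conjI allI)
      show "(L' * exp (- l * real (T + n)))-lipschitz_on UNIV (\<lambda>x. p (real (T + n)) f x - a * m (real (T + n)) x)"
        using lip_shift[of 0] w by simp
      fix x
      show "a * m (real (T + n)) x \<le> p (real (T + n)) f x"
        using bounds(1)[of x] unfolding pg of_nat_add by linarith
      show "p (real (T + n)) f x \<le> (a + (w - s)) * m (real (T + n)) x"
        using min[of x] unfolding pg distrib_right left_diff_distrib of_nat_add by linarith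
    qed (use sw L'0 in auto)
    from that[OF this ws L'_def] show ?thesis .
  qed
qed

text \<open>The oscillation and the Lipschitz constant feed into each other, but
  \<open>w + \<beta> * L\<close> contracts for large \<open>T\<close> and small \<beta>. Although
  \<open>c0\<close> decreases with \<open>T\<close> there is no circularity: \<beta> is proportional
  to \<open>c0\<close>, so the cross term \<open>c0 * e1\<close> is \<beta> times a quantity free of
  \<open>c0\<close>.\<close>

lemma exists_contraction:
  obtains T :: nat and \<beta> q :: real where "0 < T" "0 < \<beta>" "0 < q" "q < 1"
    "\<And>Lf f n a w L. Lf-lipschitz_on UNIV f \<Longrightarrow> sandwiched n f a w L \<Longrightarrow>
       \<exists>a' w' L'. sandwiched (T + n) f a' w' L' \<and> w' + \<beta> * L' \<le> q * (w + \<beta> * L)"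
proof -
  define A where "A = C * D * H * H"
  define C2 where "C2 = C1 * (H + 1)"
  have A: "0 < A" unfolding A_def using pos H_ge_1 by simp
  have C2: "0 < C2" unfolding C2_def using C1_pos H_ge_1 by simp
  \<comment> \<open>The first bound yields \<open>e1 * C1 \<le> 1/4\<close>, the second makes the
    total coefficient of \<open>L\<close> at most \<open>\<beta> / 2\<close>.\<close>
  define d where "d = min (1 / (4 * A * C1)) (1 / (2 * (8 * C2 * A + C1)))"
  have d: "0 < d" unfolding d_def using A C1_pos C2 by (auto intro!: add_pos_pos)
  have "(\<lambda>n. exp (- \<gamma>) ^ n) \<longlonglongrightarrow> 0" using pos by (intro LIMSEQ_power_zero) auto
  then have "\<forall>\<^sub>F n in sequentially. exp (- \<gamma>) ^ n < d" using d by (rule order_tendstoD)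
  then obtain T0 where T0: "\<And>n. n \<ge> T0 \<Longrightarrow> exp (- \<gamma>) ^ n < d" unfolding eventually_sequentially by blast
  define T where "T = Suc T0"
  have "exp (- \<gamma> * real T) = exp (- \<gamma>) ^ T" by (metis exp_of_nat_mult mult.commute)
  then have eT: "exp (- \<gamma> * real T) \<le> d" using T0[of T] unfolding T_def by simp
  let ?E = "exp (- \<gamma> * real T)"
  define e1 where "e1 = C * D * H * H * ?E"
  define c0 where "c0 = exp (- R * real T) / H"
  have e1A: "e1 = A * ?E" unfolding e1_def A_def by simp
  have E1: "?E * (4 * A * C1) \<le> 1"
  proof -
    have "?E \<le> 1 / (4 * A * C1)" using eT unfolding d_def by linarith
    then show ?thesis using A C1_pos by (simp add: field_simps)
  qed
  have E2: "?E * (2 * (8 * C2 * A + C1)) \<le> 1"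
  proof -
    have "?E \<le> 1 / (2 * (8 * C2 * A + C1))" using eT unfolding d_def by linarith
    moreover have "0 < 2 * (8 * C2 * A + C1)" using A C1_pos C2 by (intro mult_pos_pos add_pos_pos) auto
    ultimately show ?thesis by (simp add: pos_le_divide_eq)
  qed
  have c0: "0 < c0" unfolding c0_def using H_ge_1 by (intro divide_pos_pos) auto
  have c01: "c0 \<le> 1"
  proof -
    have "exp (- R * real T) \<le> 1" using pos by simp
    then have "exp (- R * real T) \<le> H" using H_ge_1 by linarith
    then show ?thesis unfolding c0_def using H_ge_1 by simp
  qed
  define \<beta> where "\<beta> = c0 / (8 * C2)"
  define q where "q = 1 - c0 / 8"
  have \<beta>: "0 < \<beta>" unfolding \<beta>_def using c0 C2 by simp
  have c0\<beta>: "c0 = 8 * C2 * \<beta>" unfolding \<beta>_def using C2 by simp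
  show ?thesis
  proof (rule that[of T \<beta> q])
    show "0 < T" "0 < \<beta>" "0 < q" "q < 1" using T_def \<beta> c0 c01 unfolding q_def by auto
    fix Lf f n a w L assume f: "Lf-lipschitz_on UNIV f" and adm: "sandwiched n f a w L"
    then have w: "0 \<le> w" and L: "0 \<le> L" unfolding sandwiched_def by auto
    obtain a' w' L' where r: "sandwiched (T + n) f a' w' L'"
      "w' \<le> w - c0 * (w / 2 - e1 * (L + C1 * w))" "L' = C1 * ?E * L + C1 * (H + 1) * w"
      using contraction_step[OF f adm, of T] unfolding e1_def c0_def by blast
    have "w' + \<beta> * L' \<le> w - c0 * (w / 2) + c0 * (e1 * C1) * w + c0 * e1 * L + \<beta> * (C1 * ?E) * L + \<beta> * C2 * w"
      using r(2,3) unfolding C2_def by (simp add: algebra_simps)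
    also have "\<dots> \<le> w - c0 * (w / 2) + c0 * (1/4) * w + (c0 * e1 + \<beta> * (C1 * ?E)) * L + c0 / 8 * w"
    proof -
      have "e1 * C1 \<le> 1/4" unfolding e1A using E1 by (simp add: algebra_simps)
      then have "c0 * (e1 * C1) * w \<le> c0 * (1/4) * w" using c0 w by (intro mult_right_mono mult_left_mono) auto
      moreover have "\<beta> * C2 * w = c0 / 8 * w" unfolding \<beta>_def using C2 by simp
      ultimately show ?thesis unfolding distrib_right by linarith
    qed
    \<comment> \<open>The coefficient of \<open>w\<close> is
      \<open>1 - c0/2 + c0/4 + c0/8 = q\<close>, and \<open>1/2 \<le> q\<close> takes care of
      \<open>L\<close> in the step after this one.\<close>
    also have "\<dots> \<le> q * w + 1 / 2 * (\<beta> * L)"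
    proof -
      have "c0 * e1 + \<beta> * (C1 * ?E) = \<beta> * (?E * (8 * C2 * A + C1))" unfolding c0\<beta> e1A by (simp add: algebra_simps)
      also have "\<dots> \<le> \<beta> * (1/2)"
      proof (rule mult_left_mono)
        show "?E * (8 * C2 * A + C1) \<le> 1/2" using E2 by (simp add: algebra_simps)
      qed (use \<beta> in simp)
      finally have "(c0 * e1 + \<beta> * (C1 * ?E)) * L \<le> \<beta> * (1/2) * L" using L by (rule mult_right_mono)
      then show ?thesis unfolding q_def by (simp add: algebra_simps)
    qed
    also have "\<dots> \<le> q * (w + \<beta> * L)"
    proof -
      have "1/2 * (\<beta> * L) \<le> q * (\<beta> * L)" unfolding q_def using c01 \<beta> L by (intro mult_right_mono) auto
      then show ?thesis by (simp add: algebra_simps)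
    qed
    finally show "\<exists>a' w' L'. sandwiched (T + n) f a' w' L' \<and> w' + \<beta> * L' \<le> q * (w + \<beta> * L)" using r(1) by blast
  qed
qed

text \<open>One number \<open>a\<close> serves all later times \<open>s + t\<close>, because
  inequalities between functions persist when a positive kernel is applied. This uniformity makes
  ratios at different times and starting points comparable.\<close>

theorem ratio_contraction:
  obtains A \<delta> where "0 < A" "0 < \<delta>"
    "\<And>L f b t. L-lipschitz_on UNIV (f :: 'e \<Rightarrow> real) \<Longrightarrow> (\<And>z. \<bar>f z\<bar> \<le> b) \<Longrightarrow> t \<in> I \<Longrightarrow>
       \<exists>a. \<forall>s\<in>I. \<forall>x. a * m (s + t) x \<le> p (s + t) f x \<and> p (s + t) f x \<le> (a + A * (L + b) * exp (- \<delta> * t)) * m (s + t) x"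
proof -
  obtain T :: nat and \<beta> q :: real where T: "0 < T" and \<beta>: "0 < \<beta>" and q: "0 < q" "q < 1"
    and step: "\<And>Lf f n a w L. Lf-lipschitz_on UNIV f \<Longrightarrow> sandwiched n f a w L \<Longrightarrow>
       \<exists>a' w' L'. sandwiched (T + n) f a' w' L' \<and> w' + \<beta> * L' \<le> q * (w + \<beta> * L)"
    using exists_contraction by blast
  define V where "V = 2 + \<beta> * (2 * C1)"
  have V: "0 < V" unfolding V_def using \<beta> C1_pos by (intro add_pos_nonneg) auto
  define \<delta> where "\<delta> = - ln q / real T"
  have \<delta>: "0 < \<delta>" unfolding \<delta>_def using q T by (intro divide_pos_pos) auto
  show ?thesis
  proof (rule that[of "V / q" \<delta>])
    show "0 < V / q" "0 < \<delta>" using V q \<delta> by auto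
    fix L and f :: "'e \<Rightarrow> real" and b t assume f: "L-lipschitz_on UNIV f" "\<And>z. \<bar>f z\<bar> \<le> b" and t: "t \<in> I"
    have b: "0 \<le> b" using f(2)[of undefined] by linarith
    have L: "0 \<le> L" using f(1) by (simp add: lipschitz_on_def)
    have "\<exists>a w L'. sandwiched (T * j) f a w L' \<and> w + \<beta> * L' \<le> q ^ j * (V * (L + b))" for j
    proof (induction j)
      case 0
      \<comment> \<open>The locale does not identify \<open>p 0\<close> with the identity, so the
        initial regularity is read off from the Lasota-Yorke inequality with \<open>n = 0\<close>.
        \<open>V\<close> collects the initial oscillation and Lipschitz constants.\<close>
      have "sandwiched 0 f (- b) (2 * b) (2 * C1 * (L + b))"
        unfolding sandwiched_def
      proof (intro conjI allI)
        show "0 \<le> 2 * b" "0 \<le> 2 * C1 * (L + b)" using b L C1_pos by auto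
        fix x
        have "p 0 (\<lambda>_. - b) x \<le> p 0 f x" "p 0 f x \<le> p 0 (\<lambda>_. b) x"
          using f(2) by (auto intro!: p_mono[OF zero_in_I lipschitz_const f(1)] p_mono[OF zero_in_I f(1) lipschitz_const] simp: abs_le_iff minus_le_iff)
        then show "- b * m (real 0) x \<le> p (real 0) f x" "p (real 0) f x \<le> (- b + 2 * b) * m (real 0) x"
          by (simp_all add: p_const)
      next
        show "(2 * C1 * (L + b) * exp (- l * real 0))-lipschitz_on UNIV (\<lambda>x. p (real 0) f x - - b * m (real 0) x)"
        proof (rule lipschitz_onI)
          fix x y
          have "dist (p (real 0) f x - - b * m (real 0) x) (p (real 0) f y - - b * m (real 0) y)
            = \<bar>(p (real 0) f x - p (real 0) f y) + b * (m (real 0) x - m (real 0) y)\<bar>"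
            by (simp add: dist_real_def algebra_simps)
          also have "\<dots> \<le> \<bar>p (real 0) f x - p (real 0) f y\<bar> + b * \<bar>m (real 0) x - m (real 0) y\<bar>"
            using b by (metis abs_mult abs_of_nonneg abs_triangle_ineq)
          also have "\<dots> \<le> C1 * exp (- l * real 0) * (L * exp (- \<gamma> * real 0) + b) * dist x y + b * (C1 * exp (- l * real 0) * dist x y)"
            using b by (intro add_mono p_lasota_yorke[OF f] mult_left_mono m_lipschitz_exp) auto
          also have "\<dots> \<le> 2 * C1 * (L + b) * exp (- l * real 0) * dist x y"
            using C1_pos L b by (simp add: algebra_simps)
          finally show "dist (p (real 0) f x - - b * m (real 0) x) (p (real 0) f y - - b * m (real 0) y)
            \<le> 2 * C1 * (L + b) * exp (- l * real 0) * dist x y" .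
        qed (use C1_pos L b in simp)
      qed
      moreover have "2 * b + \<beta> * (2 * C1 * (L + b)) \<le> q ^ 0 * (V * (L + b))"
        unfolding V_def using L by (simp add: algebra_simps)
      ultimately show ?case by auto
    next
      case (Suc j)
      then obtain a w L' where "sandwiched (T * j) f a w L'" and le: "w + \<beta> * L' \<le> q ^ j * (V * (L + b))" by blast
      then obtain a' w' L'' where "sandwiched (T + T * j) f a' w' L''" "w' + \<beta> * L'' \<le> q * (w + \<beta> * L')"
        using step[OF f(1)] by blast
      moreover have "q * (w + \<beta> * L') \<le> q ^ Suc j * (V * (L + b))" using mult_left_mono[OF le, of q] q by (simp add: mult_ac)
      ultimately show ?case by (metis mult_Suc_right order_trans)
    qed
    note iter = this
    define j where "j = nat \<lfloor>t / real T\<rfloor>"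
    have t0: "0 \<le> t" using nonneg_I t .
    have j1: "real j \<le> t / real T" "t / real T - 1 < real j" unfolding j_def using t0 T by (auto simp: of_nat_floor)
    obtain a w L' where adm: "sandwiched (T * j) f a w L'" and le: "w + \<beta> * L' \<le> q ^ j * (V * (L + b))" using iter by blast
    \<comment> \<open>Rounding \<open>t\<close> down to a multiple of \<open>T\<close> loses at most
      one factor \<open>q\<close>.\<close>
    have qj: "q ^ j \<le> exp (- \<delta> * t) / q"
    proof -
      have "q ^ j = exp (real j * ln q)" using q by (simp add: exp_of_nat_mult)
      also have "\<dots> \<le> exp ((t / real T - 1) * ln q)"
        using j1(2) q by (auto intro!: mult_right_mono_neg)
      also have "\<dots> = exp (- \<delta> * t - ln q)" unfolding \<delta>_def by (simp add: algebra_simps)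
      also have "\<dots> = exp (- \<delta> * t) / q" using q by (simp add: exp_diff)
      finally show ?thesis .
    qed
    have w: "0 \<le> w" "0 \<le> L'" using adm unfolding sandwiched_def by auto
    have "w \<le> q ^ j * (V * (L + b))" using le w(1) mult_nonneg_nonneg[OF less_imp_le[OF \<beta>] w(2)] by linarith
    also have "\<dots> \<le> exp (- \<delta> * t) / q * (V * (L + b))" using qj V L b by (intro mult_right_mono) auto
    finally have wle: "w \<le> V / q * (L + b) * exp (- \<delta> * t)" by (simp add: mult_ac)
    define u where "u = t - real (T * j)"
    have u0: "0 \<le> u" unfolding u_def using j1(1) T by (simp add: field_simps)
    have uI: "u \<in> I" using time_set
    proof
      assume "I = {0..}" then show ?thesis using u0 by simp
    next
      assume I: "I = \<nat>"
      then obtain k where k: "t = real k" using t Nats_cases by blast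
      then have "real (T * j) \<le> real k" using u0 unfolding u_def by simp
      then have "T * j \<le> k" by (simp only: of_nat_le_iff)
      then have "u = real (k - T * j)" unfolding u_def k by (simp only: of_nat_diff)
      then show ?thesis by simp
    qed
    obtain L1 where L1: "L1-lipschitz_on UNIV (p (real (T * j)) f)" using lipschitz_p[OF _ f(1)] nat_in_I by blast
    obtain L2 where L2: "L2-lipschitz_on UNIV (m (real (T * j)))" using lipschitz_m nat_in_I by blast
    show "\<exists>a. \<forall>s\<in>I. \<forall>x. a * m (s + t) x \<le> p (s + t) f x \<and> p (s + t) f x \<le> (a + V / q * (L + b) * exp (- \<delta> * t)) * m (s + t) x"
    proof (rule exI[of _ a], intro ballI allI)
      fix s x assume s: "s \<in> I"
      let ?n = "real (T * j)"
      have st: "s + t = (s + u) + ?n" unfolding u_def by simp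
      have suI: "s + u \<in> I" using s uI by simp
      have pf: "p (s + t) f x = p (s + u) (p ?n f) x" unfolding st by (rule p_add[OF suI nat_in_I f(1)])
      have pm: "m (s + t) x = p (s + u) (m ?n) x" unfolding st by (rule m_add[OF suI nat_in_I])
      have "0 \<le> p (s + u) (\<lambda>z. 1 * p ?n f z - a * m ?n z) x" unfolding p_def
        using adm unfolding sandwiched_def p_def by (intro integral_nonneg_AE) auto
      then have 1: "a * m (s + t) x \<le> p (s + t) f x" using p_diff[OF suI L1 L2, of 1 a x] pf pm by simp
      have "0 \<le> p (s + u) (\<lambda>z. (a + w) * m ?n z - 1 * p ?n f z) x" unfolding p_def
        using adm unfolding sandwiched_def p_def by (intro integral_nonneg_AE) auto
      then have "p (s + t) f x \<le> (a + w) * m (s + t) x" using p_diff[OF suI L2 L1, of "a + w" 1 x] pf pm by simp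
      also have "\<dots> \<le> (a + V / q * (L + b) * exp (- \<delta> * t)) * m (s + t) x"
        using wle m_pos[of "s + t" x] s t by (intro mult_right_mono) auto
      finally show "a * m (s + t) x \<le> p (s + t) f x \<and> p (s + t) f x \<le> (a + V / q * (L + b) * exp (- \<delta> * t)) * m (s + t) x"
        using 1 by blast
    qed
  qed
qed

end

section \<open>Spectral limit and quasi-stationary measure\<close>

context contracting_kernels
begin

lemma subprob_\<kappa>: "t \<in> I \<Longrightarrow> subprob_space (\<kappa> t x)"
  using finite_measure.emeasure_eq_measure[OF finite_\<kappa>] mass_le[of t x]
  by (intro subprob_spaceI) (auto simp: ennreal_le_1)

text \<open>The integral of a Lipschitz function is Lipschitz in the starting point; masses of
  closed sets are limits of such integrals, and closed sets generate the Borel sets.\<close>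

lemma measurable_\<kappa>:
  assumes "t \<in> I" shows "\<kappa> t \<in> measurable borel (subprob_algebra borel)"
proof (rule measurable_subprob_algebra_generated[where \<Omega> = UNIV and G = "{S. closed S}"])
  show "sets borel = sigma_sets UNIV {S :: 'e set. closed S}" by (simp add: borel_eq_closed)
  show "Int_stable {S :: 'e set. closed S}" by (auto simp: Int_stable_def)
  show "subprob_space (\<kappa> t x)" for x using subprob_\<kappa> assms .
  show "sets (\<kappa> t x) = sets borel" for x using sets_\<kappa> assms .
  have meas: "(\<lambda>x. emeasure (\<kappa> t x) S) \<in> borel_measurable borel" if S: "closed S" for S
  proof -
    obtain h :: "nat \<Rightarrow> 'e \<Rightarrow> real" where h: "\<And>n x. 0 \<le> h n x \<and> h n x \<le> 1" "\<And>n. (real n)-lipschitz_on UNIV (h n)"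
      "\<And>x. (\<lambda>n. h n x) \<longlonglongrightarrow> indicator S x" using lipschitz_approx_closed[OF S] by blast
    have "(\<lambda>x. measure (\<kappa> t x) S) \<in> borel_measurable borel"
    proof (rule borel_measurable_LIMSEQ_real)
      show "(\<lambda>n. p t (h n) x) \<longlonglongrightarrow> measure (\<kappa> t x) S" for x
        unfolding p_def using S by (intro integral_tendsto_measure finite_\<kappa> sets_\<kappa> assms h) auto
      show "p t (h n) \<in> borel_measurable borel" for n
        using lipschitz_p[OF assms h(2)] lipschitz_measurable by blast
    qed
    then show ?thesis by (simp add: finite_measure.emeasure_eq_measure[OF finite_\<kappa>[OF assms]])
  qed
  then show "(\<lambda>x. emeasure (\<kappa> t x) S) \<in> borel_measurable borel" if "S \<in> {S. closed S}" for S using that by simp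
  show "(\<lambda>x. emeasure (\<kappa> t x) UNIV) \<in> borel_measurable borel" using meas[of UNIV] by simp
qed simp

end

context contracting_kernels_rate
begin

lemma split_time:
  assumes "t \<in> I" obtains n r where "t = real n + r" "r \<in> I" "r \<le> 1"
proof
  have "0 \<le> t" using nonneg_I assms .
  then show "t = real (nat \<lfloor>t\<rfloor>) + (t - real (nat \<lfloor>t\<rfloor>))" "t - real (nat \<lfloor>t\<rfloor>) \<le> 1" by linarith+
  show "t - real (nat \<lfloor>t\<rfloor>) \<in> I" using time_set
  proof
    assume "I = {0..}" then show ?thesis using \<open>0 \<le> t\<close> by (simp add: of_nat_floor)
  next
    assume "I = \<nat>" then show ?thesis using assms by (auto elim!: Nats_cases)
  qed
qed

text \<open>A time in \<open>I\<close> exceeds an integer by at most one unit, over which the mass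
  changes by a factor between \<open>exp (- R)\<close> and \<open>1\<close>.\<close>

lemma m_bounds:
  assumes "t \<in> I"
  shows "exp (- l * t) \<le> H * exp R * m t x" "m t x \<le> H * exp l * exp (- l * t)"
proof -
  obtain n r where t: "t = real n + r" and r: "r \<in> I" "r \<le> 1" using split_time[OF assms] by blast
  have r0: "0 \<le> r" using nonneg_I r by blast
  have "m r y \<le> 1" for y using mass_le[OF r(1)] unfolding m_def .
  then have 1: "m t x \<le> 1 * m (real n) x" unfolding t using r by (intro m_add_le) auto
  also have "\<dots> \<le> H * exp (- l * real n)" using m_le_exp by simp
  also have "\<dots> \<le> H * (exp l * exp (- l * t))"
  proof -
    have "- l * real n \<le> l + - l * t" unfolding t using l_nonneg r mult_left_mono[of r 1 l] by (simp add: algebra_simps)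
    then show ?thesis unfolding exp_add[symmetric] using H_ge_1 by simp
  qed
  finally show "m t x \<le> H * exp l * exp (- l * t)" by (simp add: mult.assoc)
  have "exp (- R) \<le> m r y" for y
  proof -
    have "- R \<le> - R * r" using r r0 pos mult_left_mono[of r 1 R] by simp
    then have "exp (- R) \<le> exp (- R * r)" by simp
    also have "\<dots> \<le> m r y" using mass_ge[OF r(1)] unfolding m_def .
    finally show ?thesis .
  qed
  then have 2: "exp (- R) * m (real n) x \<le> m t x" unfolding t using r by (intro m_add_ge) auto
  have "exp (- l * t) \<le> exp (- l * real n)" unfolding t using l_nonneg r0 by (simp add: mult_left_mono)
  also have "\<dots> \<le> H * m (real n) x" by (rule exp_le_m)
  also have "\<dots> \<le> H * (exp R * m t x)"
    using 2 H_ge_1 by (intro mult_left_mono) (auto simp: exp_minus field_simps)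
  finally show "exp (- l * t) \<le> H * exp R * m t x" by (simp add: mult.assoc)
qed

definition normalized :: "'e \<Rightarrow> nat \<Rightarrow> 'e measure" where
  "normalized x n = density (\<kappa> (real n) x) (\<lambda>_. ennreal (1 / m (real n) x))"

lemma prob_normalized: "prob_space (normalized x n)"
proof
  have "emeasure (normalized x n) (space (normalized x n)) = (\<integral>\<^sup>+z. ennreal (1 / m (real n) x) * indicator UNIV z \<partial>\<kappa> (real n) x)"
    unfolding normalized_def using sets_\<kappa>[of "real n"] by (subst emeasure_density) auto
  also have "\<dots> = ennreal (1 / m (real n) x) * emeasure (\<kappa> (real n) x) UNIV"
    by (simp add: nn_integral_const)
  also have "\<dots> = 1"
    using m_pos[of "real n" x] finite_measure.emeasure_eq_measure[OF finite_\<kappa>, of "real n" x]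
    by (simp add: m_def ennreal_mult[symmetric])
  finally show "emeasure (normalized x n) (space (normalized x n)) = 1" .
qed

lemma sets_normalized: "sets (normalized x n) = sets borel"
  unfolding normalized_def using sets_\<kappa> by simp

lemma integral_normalized:
  "L-lipschitz_on UNIV f \<Longrightarrow> (\<integral>z. f z \<partial>normalized x n) = p (real n) f x / m (real n) x"
  unfolding normalized_def p_def using m_pos[of "real n" x] lipschitz_measurable[of L f] sets_\<kappa>[of "real n" x]
  by (subst integral_density) (auto cong: measurable_cong_sets)

text \<open>The law \<nu> is built from one starting point \<open>x0\<close>, but the intervals of
  \<open>ratio_contraction\<close> are the same for all starting points, and this makes the limit
  universal. The bounds on \<open>m\<close> and the multiplicativity of \<open>\<theta>\<close>
  identify the eigenvalue.\<close>

theorem spectral: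
  obtains \<nu> \<eta> where "prob_space \<nu>" "sets \<nu> = sets borel"
    "\<forall>t\<in>I. \<forall>f\<in>borel_measurable borel. bounded (range f) \<longrightarrow> (\<integral>x. p t f x \<partial>\<nu>) = exp (- l * t) * (\<integral>x. f x \<partial>\<nu>)"
    "\<forall>\<nu>'. prob_space \<nu>' \<and> sets \<nu>' = sets borel \<and>
      (\<forall>t\<in>I. \<forall>f\<in>borel_measurable borel. bounded (range f) \<longrightarrow>
        (\<integral>x. p t f x \<partial>\<nu>') / (\<integral>x. p t (\<lambda>_. 1) x \<partial>\<nu>') = (\<integral>x. f x \<partial>\<nu>')) \<longrightarrow> \<nu>' = \<nu>"
    "\<exists>L. L-lipschitz_on UNIV \<eta>" "\<exists>c>0. \<forall>x. c \<le> \<eta> x"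
    "\<exists>C>0. \<exists>\<delta>>0. \<forall>t\<in>I. \<forall>x. \<bar>exp (l * t) * m t x - \<eta> x\<bar> \<le> C * exp (- \<delta> * t)"
    "(\<integral>x. \<eta> x \<partial>\<nu>) = 1" "\<forall>t\<in>I. \<forall>x. p t \<eta> x = exp (- l * t) * \<eta> x"
proof -
  obtain A \<delta> where A: "0 < A" and \<delta>: "0 < \<delta>" and rc: "\<And>L f b t. L-lipschitz_on UNIV (f :: 'e \<Rightarrow> real) \<Longrightarrow> (\<And>z. \<bar>f z\<bar> \<le> b) \<Longrightarrow> t \<in> I \<Longrightarrow>
       \<exists>a. \<forall>s\<in>I. \<forall>x. a * m (s + t) x \<le> p (s + t) f x \<and> p (s + t) f x \<le> (a + A * (L + b) * exp (- \<delta> * t)) * m (s + t) x"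
    using ratio_contraction by metis
  define x0 :: 'e where "x0 = undefined"
  define e where "e n = A * exp (- \<delta> * real n)" for n
  have e_tend: "e \<longlonglongrightarrow> 0"
  proof -
    have "(\<lambda>n. A * exp (- \<delta>) ^ n) \<longlonglongrightarrow> A * 0" using \<delta> by (intro tendsto_intros LIMSEQ_power_zero) auto
    moreover have "exp (- \<delta>) ^ n = exp (- \<delta> * real n)" for n by (metis exp_of_nat_mult mult.commute)
    ultimately show ?thesis unfolding e_def by simp
  qed
  \<comment> \<open>Both normalized integrals lie in the same interval of length
    \<open>(L + b) * e n\<close>, because its endpoint \<open>a\<close> is uniform in the added
    time.\<close>
  have cauchy: "\<bar>(\<integral>z. f z \<partial>normalized x0 (n + k)) - (\<integral>z. f z \<partial>normalized x0 n)\<bar> \<le> (L + b) * e n"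
    if f: "L-lipschitz_on UNIV f" "\<And>z. \<bar>f z\<bar> \<le> b" for L f b n k
  proof -
    obtain a where a: "\<And>s x. s \<in> I \<Longrightarrow> a * m (s + real n) x \<le> p (s + real n) f x \<and>
      p (s + real n) f x \<le> (a + A * (L + b) * exp (- \<delta> * real n)) * m (s + real n) x"
      using rc[OF f nat_in_I[of n]] by blast
    have q: "a \<le> p (s + real n) f x0 / m (s + real n) x0 \<and> p (s + real n) f x0 / m (s + real n) x0 \<le> a + A * (L + b) * exp (- \<delta> * real n)"
      if "s \<in> I" for s
      using a[OF that, of x0] m_pos[of "s + real n" x0] that by (simp add: pos_le_divide_eq pos_divide_le_eq)
    have "p (real k + real n) f x0 / m (real k + real n) x0 = (\<integral>z. f z \<partial>normalized x0 (n + k))"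
      "p (0 + real n) f x0 / m (0 + real n) x0 = (\<integral>z. f z \<partial>normalized x0 n)"
      using integral_normalized[OF f(1)] by (simp_all add: add.commute)
    then show ?thesis using q[of "real k"] q[of 0] unfolding e_def by (simp add: algebra_simps abs_le_iff)
  qed
  obtain \<nu> where prob: "prob_space \<nu>" and sets_\<nu>: "sets \<nu> = sets borel"
    and lim': "\<And>L f b. L-lipschitz_on UNIV (f :: 'e \<Rightarrow> real) \<Longrightarrow> (\<And>z. \<bar>f z\<bar> \<le> b) \<Longrightarrow>
      (\<lambda>n. \<integral>z. f z \<partial>normalized x0 n) \<longlonglongrightarrow> (\<integral>z. f z \<partial>\<nu>)"
    using lipschitz_limit_measure[of "normalized x0" e, OF prob_normalized sets_normalized e_tend cauchy] by metis
  interpret \<nu>: prob_space \<nu> by (rule prob)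
  have sp: "space \<nu> = UNIV" using sets_eq_imp_space_eq[OF sets_\<nu>] by simp
  have lim: "(\<lambda>n. p (real n) f x0 / m (real n) x0) \<longlonglongrightarrow> (\<integral>z. f z \<partial>\<nu>)" if "L-lipschitz_on UNIV f" for L f
    using lim'[OF that lipschitz_bounded[OF that]] integral_normalized[OF that] by simp
  have int_bdd: "integrable \<nu> f" if "f \<in> borel_measurable borel" "\<And>z. \<bar>f z\<bar> \<le> b" for f :: "'e \<Rightarrow> real" and b
    using that sets_\<nu> by (intro \<nu>.integrable_const_bound[where B = b]) (auto cong: measurable_cong_sets)
  have int_lip: "integrable \<nu> f" if "L-lipschitz_on UNIV f" for f :: "'e \<Rightarrow> real" and L
    using int_bdd[OF lipschitz_measurable[OF that] lipschitz_bounded[OF that]] .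
  \<comment> \<open>The integral against \<nu> is a limit of ratios at \<open>x0\<close> that
    eventually lie in the interval belonging to \<open>k\<close>, so it lies there as well, next to
    the ratio at \<open>y\<close>.\<close>
  have ratio: "\<bar>p (s + real k) f y - (\<integral>z. f z \<partial>\<nu>) * m (s + real k) y\<bar> \<le> (L + b) * e k * m (s + real k) y"
    if f: "L-lipschitz_on UNIV f" "\<And>z. \<bar>f z\<bar> \<le> b" and s: "s \<in> I" for L f b s k y
  proof -
    obtain a where a: "\<And>s x. s \<in> I \<Longrightarrow> a * m (s + real k) x \<le> p (s + real k) f x \<and>
      p (s + real k) f x \<le> (a + A * (L + b) * exp (- \<delta> * real k)) * m (s + real k) x"
      using rc[OF f nat_in_I[of k]] by blast
    let ?w = "A * (L + b) * exp (- \<delta> * real k)"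
    have q: "a \<le> p (s + real k) f x / m (s + real k) x \<and> p (s + real k) f x / m (s + real k) x \<le> a + ?w"
      if "s \<in> I" for s x
      using a[OF that, of x] m_pos[of "s + real k" x] that by (simp add: pos_le_divide_eq pos_divide_le_eq)
    have q': "a \<le> p (real n) f x0 / m (real n) x0 \<and> p (real n) f x0 / m (real n) x0 \<le> a + ?w" if "k \<le> n" for n
    proof -
      have "real (n - k) + real k = real n" using that by simp
      then show ?thesis using q[OF nat_in_I, of "n - k" x0] by simp
    qed
    have "a \<le> (\<integral>z. f z \<partial>\<nu>)" by (rule LIMSEQ_le_const[OF lim[OF f(1)]]) (use q' in blast)
    moreover have "(\<integral>z. f z \<partial>\<nu>) \<le> a + ?w" by (rule LIMSEQ_le_const2[OF lim[OF f(1)]]) (use q' in blast)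
    ultimately have "\<bar>p (s + real k) f y / m (s + real k) y - (\<integral>z. f z \<partial>\<nu>)\<bar> \<le> ?w" using q[OF s, of y] by linarith
    then have "\<bar>p (s + real k) f y / m (s + real k) y - (\<integral>z. f z \<partial>\<nu>)\<bar> * m (s + real k) y \<le> ?w * m (s + real k) y"
      using m_pos[of "s + real k" y] s by (intro mult_right_mono) auto
    moreover have "\<bar>p (s + real k) f y / m (s + real k) y - (\<integral>z. f z \<partial>\<nu>)\<bar> * m (s + real k) y
      = \<bar>p (s + real k) f y - (\<integral>z. f z \<partial>\<nu>) * m (s + real k) y\<bar>"
    proof -
      have pos: "0 < m (s + real k) y" using m_pos s by simp
      then have "\<bar>p (s + real k) f y / m (s + real k) y - (\<integral>z. f z \<partial>\<nu>)\<bar> * m (s + real k) y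
        = \<bar>(p (s + real k) f y / m (s + real k) y - (\<integral>z. f z \<partial>\<nu>)) * m (s + real k) y\<bar>" by (simp add: abs_mult)
      also have "(p (s + real k) f y / m (s + real k) y - (\<integral>z. f z \<partial>\<nu>)) * m (s + real k) y = p (s + real k) f y - (\<integral>z. f z \<partial>\<nu>) * m (s + real k) y"
        using pos by (simp add: left_diff_distrib)
      finally show ?thesis .
    qed
    ultimately show ?thesis unfolding e_def by (simp add: mult_ac)
  qed
  define \<theta> where "\<theta> t = (\<integral>x. m t x \<partial>\<nu>)" for t
  \<comment> \<open>Testing the approximating laws with \<open>p t f\<close> gives
    \<open>p (t + n) f\<close> over \<open>m n\<close>; by \<open>ratio\<close> its numerator is, up
    to a vanishing relative error, the integral of \<open>f\<close> times
    \<open>m (t + n)\<close>.\<close>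
  have \<nu>_p: "(\<integral>x. p t f x \<partial>\<nu>) = \<theta> t * (\<integral>z. f z \<partial>\<nu>)" if t: "t \<in> I" and f: "L-lipschitz_on UNIV f" for t L f
  proof (rule LIMSEQ_unique)
    obtain L' where L': "L'-lipschitz_on UNIV (p t f)" using lipschitz_p[OF t f] by blast
    obtain L'' where L'': "L''-lipschitz_on UNIV (m t)" using lipschitz_m[OF t] by blast
    show "(\<lambda>n. p (real n) (p t f) x0 / m (real n) x0) \<longlonglongrightarrow> (\<integral>x. p t f x \<partial>\<nu>)" by (rule lim[OF L'])
    define b where "b = \<bar>f undefined\<bar> + L * D"
    have b: "\<bar>f z\<bar> \<le> b" for z unfolding b_def by (rule lipschitz_bounded[OF f])
    have Lb: "0 \<le> L + b" using f b[of undefined] by (auto simp: lipschitz_on_def)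
    have "(\<lambda>n. (\<integral>z. f z \<partial>\<nu>) * (p (real n) (m t) x0 / m (real n) x0)) \<longlonglongrightarrow> (\<integral>z. f z \<partial>\<nu>) * \<theta> t"
      unfolding \<theta>_def by (intro tendsto_mult_left lim[OF L''])
    moreover have "(\<lambda>n. p (real n) (p t f) x0 / m (real n) x0 - (\<integral>z. f z \<partial>\<nu>) * (p (real n) (m t) x0 / m (real n) x0)) \<longlonglongrightarrow> 0"
    proof (rule Lim_null_comparison)
      show "\<forall>\<^sub>F n in sequentially. norm (p (real n) (p t f) x0 / m (real n) x0 - (\<integral>z. f z \<partial>\<nu>) * (p (real n) (m t) x0 / m (real n) x0)) \<le> (L + b) * e n"
      proof (rule always_eventually, rule allI)
        fix n
        have mp: "0 < m (real n) x0" using m_pos by simp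
        have e1: "p (real n) (p t f) x0 = p (t + real n) f x0" using p_add[OF nat_in_I t f, of n x0] by (simp add: add.commute)
        have e2: "p (real n) (m t) x0 = m (t + real n) x0" using m_add[OF nat_in_I t, of n x0] by (simp add: add.commute)
        have "m (t + real n) x0 \<le> 1 * m (real n) x0"
          using m_add_le[OF nat_in_I t, of 1 n x0] mass_le[OF t] by (simp add: add.commute m_def)
        then have r: "m (t + real n) x0 / m (real n) x0 \<le> 1" using mp by simp
        have en: "0 \<le> (L + b) * e n" using Lb A unfolding e_def by simp
        have "norm (p (real n) (p t f) x0 / m (real n) x0 - (\<integral>z. f z \<partial>\<nu>) * (p (real n) (m t) x0 / m (real n) x0))
          = \<bar>p (t + real n) f x0 - (\<integral>z. f z \<partial>\<nu>) * m (t + real n) x0\<bar> / m (real n) x0"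
          unfolding e1 e2 real_norm_def times_divide_eq_right diff_divide_distrib[symmetric] abs_divide using mp by simp
        also have "\<dots> \<le> (L + b) * e n * m (t + real n) x0 / m (real n) x0"
          using ratio[OF f b t, of n x0] mp by (intro divide_right_mono) auto
        also have "\<dots> \<le> (L + b) * e n" using mult_left_mono[OF r en] by simp
        finally show "norm (p (real n) (p t f) x0 / m (real n) x0 - (\<integral>z. f z \<partial>\<nu>) * (p (real n) (m t) x0 / m (real n) x0)) \<le> (L + b) * e n" .
      qed
      show "(\<lambda>n. (L + b) * e n) \<longlonglongrightarrow> 0" using tendsto_mult_left[OF e_tend, of "L + b"] by simp
    qed
    ultimately have "(\<lambda>n. (p (real n) (p t f) x0 / m (real n) x0 - (\<integral>z. f z \<partial>\<nu>) * (p (real n) (m t) x0 / m (real n) x0))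
      + (\<integral>z. f z \<partial>\<nu>) * (p (real n) (m t) x0 / m (real n) x0)) \<longlonglongrightarrow> 0 + (\<integral>z. f z \<partial>\<nu>) * \<theta> t" by (intro tendsto_add)
    then show "(\<lambda>n. p (real n) (p t f) x0 / m (real n) x0) \<longlonglongrightarrow> \<theta> t * (\<integral>z. f z \<partial>\<nu>)" by (simp add: mult.commute)
  qed
  have int_m: "integrable \<nu> (m t)" if "t \<in> I" for t using lipschitz_m[OF that] int_lip by blast
  have \<theta>_bounds: "exp (- l * t) \<le> H * exp R * \<theta> t" "\<theta> t \<le> H * exp l * exp (- l * t)" if t: "t \<in> I" for t
  proof -
    have "(\<integral>x. exp (- l * t) \<partial>\<nu>) \<le> (\<integral>x. H * exp R * m t x \<partial>\<nu>)"
      using m_bounds[OF t] int_m[OF t] by (intro integral_mono) auto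
    then show "exp (- l * t) \<le> H * exp R * \<theta> t" unfolding \<theta>_def using \<nu>.prob_space by simp
    have "(\<integral>x. m t x \<partial>\<nu>) \<le> (\<integral>x. H * exp l * exp (- l * t) \<partial>\<nu>)"
      using m_bounds[OF t] int_m[OF t] by (intro integral_mono) auto
    then show "\<theta> t \<le> H * exp l * exp (- l * t)" unfolding \<theta>_def using \<nu>.prob_space by simp
  qed
  have HR: "0 < H * exp R" using H_ge_1 by simp
  have \<theta>_pos: "0 < \<theta> t" if t: "t \<in> I" for t
    using \<theta>_bounds(1)[OF t] exp_gt_zero[of "- l * t"] HR by (smt (verit) zero_less_mult_pos)
  have \<theta>_add: "\<theta> (s + t) = \<theta> s * \<theta> t" if s: "s \<in> I" and t: "t \<in> I" for s t
  proof -
    obtain L where L: "L-lipschitz_on UNIV (m t)" using lipschitz_m[OF t] by blast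
    have "m (s + t) = p s (m t)" using m_add[OF s t] by (rule ext)
    then show ?thesis using \<nu>_p[OF s L] unfolding \<theta>_def by simp
  qed
  \<comment> \<open>\<open>\<theta>\<close> is multiplicative and within constant factors of
    \<open>exp (- l * t)\<close>. Applied to all multiples of \<open>t\<close>, the constants
    disappear.\<close>
  have \<theta>_eq: "\<theta> t = exp (- l * t)" if t: "t \<in> I" for t
  proof -
    have "real j * t \<in> I \<and> \<theta> (real j * t) = \<theta> t ^ j" for j
    proof (induction j)
      case 0
      have "\<theta> 0 = \<theta> 0 * \<theta> 0" using \<theta>_add[of 0 0] by simp
      then show ?case using \<theta>_pos[of 0] by simp
    next
      case (Suc j)
      then show ?case using \<theta>_add[OF t, of "real j * t"] add_in_I[OF t, of "real j * t"] by (simp add: algebra_simps)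
    qed
    then have jI: "real j * t \<in> I" and pw: "\<theta> (real j * t) = \<theta> t ^ j" for j by auto
    have ex: "exp (- l * (real j * t)) = exp (- l * t) ^ j" for j by (simp add: exp_of_nat_mult[symmetric] mult_ac)
    show ?thesis
    proof (rule antisym)
      show "\<theta> t \<le> exp (- l * t)"
        by (rule le_of_power_le[where B = "H * exp l"]) (use \<theta>_pos[OF t] \<theta>_bounds(2)[OF jI, unfolded pw ex] in auto)
      show "exp (- l * t) \<le> \<theta> t"
        by (rule le_of_power_le[where B = "H * exp R"]) (use \<theta>_pos[OF t] \<theta>_bounds(1)[OF jI, unfolded pw ex] in auto)
    qed
  qed
  \<comment> \<open>Promotes the eigenvalue equation from Lipschitz functions to an equality of
    measures, from which all bounded measurable test functions follow.\<close>
  have bind: "\<nu> \<bind> \<kappa> t = density \<nu> (\<lambda>_. ennreal (exp (- l * t)))" if t: "t \<in> I" for t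
  proof (rule measure_eqI_lipschitz)
    have \<kappa>_meas: "\<kappa> t \<in> measurable \<nu> (subprob_algebra borel)"
      using measurable_\<kappa>[OF t] sets_\<nu> by (simp cong: measurable_cong_sets)
    have ne: "space \<nu> \<noteq> {}" using sp by simp
    show sb: "sets (\<nu> \<bind> \<kappa> t) = sets borel" using sets_bind[OF _ ne] sets_\<kappa>[OF t] by blast
    show "sets (density \<nu> (\<lambda>_. ennreal (exp (- l * t)))) = sets borel" using sets_\<nu> by simp
    show "finite_measure (\<nu> \<bind> \<kappa> t)"
      using subprob_space_bind[OF prob_space_imp_subprob_space[OF prob] \<kappa>_meas] by (simp add: subprob_space_def)
    show "finite_measure (density \<nu> (\<lambda>_. ennreal (exp (- l * t))))"
      by (intro finite_measureI) (simp add: emeasure_density \<nu>.emeasure_space_1)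
    fix L and f :: "'e \<Rightarrow> real" assume f: "L-lipschitz_on UNIV f" and f01: "\<And>z. 0 \<le> f z \<and> f z \<le> 1"
    have "(\<integral>x. f x \<partial>(\<nu> \<bind> \<kappa> t)) = (\<integral>x. p t f x \<partial>\<nu>)"
      unfolding p_def
    proof (rule integral_bind[where K = borel and B = 1 and B' = 1])
      show "f \<in> borel_measurable borel" by (rule lipschitz_measurable[OF f])
      show "\<bar>f x\<bar> \<le> 1" for x using f01[of x] by simp
      show "finite_measure \<nu>" by unfold_locales
      show "AE x in \<nu>. emeasure (\<kappa> t x) (space (\<kappa> t x)) \<le> ennreal 1"
        using subprob_space.subprob_emeasure_le_1[OF subprob_\<kappa>[OF t]] by simp
    qed (rule \<kappa>_meas)
    also have "\<dots> = exp (- l * t) * (\<integral>x. f x \<partial>\<nu>)" using \<nu>_p[OF t f] \<theta>_eq[OF t] by simp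
    also have "\<dots> = (\<integral>x. f x \<partial>density \<nu> (\<lambda>_. ennreal (exp (- l * t))))"
      using lipschitz_measurable[OF f] sets_\<nu> by (subst integral_density) (auto cong: measurable_cong_sets)
    finally show "(\<integral>x. f x \<partial>(\<nu> \<bind> \<kappa> t)) = (\<integral>x. f x \<partial>density \<nu> (\<lambda>_. ennreal (exp (- l * t))))" .
  qed
  have qsd: "(\<integral>x. p t f x \<partial>\<nu>) = exp (- l * t) * (\<integral>x. f x \<partial>\<nu>)"
    if t: "t \<in> I" and f: "f \<in> borel_measurable borel" and bdd: "bounded (range f)" for t f
  proof -
    have \<kappa>_meas: "\<kappa> t \<in> measurable \<nu> (subprob_algebra borel)"
      using measurable_\<kappa>[OF t] sets_\<nu> by (simp cong: measurable_cong_sets)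
    obtain b where b: "\<And>z. \<bar>f z\<bar> \<le> b" using bdd by (auto simp: bounded_iff)
    have "(\<integral>x. p t f x \<partial>\<nu>) = (\<integral>x. f x \<partial>(\<nu> \<bind> \<kappa> t))"
      unfolding p_def
    proof (rule integral_bind[where K = borel and B = b and B' = 1, symmetric])
      show "finite_measure \<nu>" by unfold_locales
      show "AE x in \<nu>. emeasure (\<kappa> t x) (space (\<kappa> t x)) \<le> ennreal 1"
        using subprob_space.subprob_emeasure_le_1[OF subprob_\<kappa>[OF t]] by simp
    qed (use \<kappa>_meas f b in auto)
    also have "\<dots> = exp (- l * t) * (\<integral>x. f x \<partial>\<nu>)"
      unfolding bind[OF t] using f sets_\<nu> by (subst integral_density) (auto cong: measurable_cong_sets)
    finally show ?thesis .
  qed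
  \<comment> \<open>The normalized action of \<open>p n\<close> on a quasi-stationary \<nu>'
    reproduces \<nu>', while integrating \<open>ratio\<close> against \<nu>' puts it within
    \<open>(L + 1) * e n\<close> of \<nu> on test functions.\<close>
  have unique: "\<nu>' = \<nu>" if prob': "prob_space \<nu>'" and sets': "sets \<nu>' = sets borel"
    and qs: "\<forall>t\<in>I. \<forall>f\<in>borel_measurable borel. bounded (range f) \<longrightarrow>
        (\<integral>x. p t f x \<partial>\<nu>') / (\<integral>x. p t (\<lambda>_. 1) x \<partial>\<nu>') = (\<integral>x. f x \<partial>\<nu>')" for \<nu>'
  proof (rule measure_eqI_lipschitz)
    interpret \<nu>': prob_space \<nu>' by (rule prob')
    show "finite_measure \<nu>'" "finite_measure \<nu>" by unfold_locales
    show "sets \<nu>' = sets borel" "sets \<nu> = sets borel" by fact+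
    fix L and f :: "'e \<Rightarrow> real" assume f: "L-lipschitz_on UNIV f" and f01: "\<And>z. 0 \<le> f z \<and> f z \<le> 1"
    have int': "integrable \<nu>' g" if "L'-lipschitz_on UNIV g" for g :: "'e \<Rightarrow> real" and L'
      using lipschitz_measurable[OF that] lipschitz_bounded[OF that] sets'
      by (intro \<nu>'.integrable_const_bound[where B = "\<bar>g undefined\<bar> + L' * D"]) (auto cong: measurable_cong_sets)
    have L0: "0 \<le> L" using f by (simp add: lipschitz_on_def)
    have bf: "\<bar>f z\<bar> \<le> 1" for z using f01[of z] by simp
    have "bounded (range f)" using bf by (auto simp: bounded_iff)
    then have q: "(\<integral>x. p (real n) f x \<partial>\<nu>') / (\<integral>x. p (real n) (\<lambda>_. 1) x \<partial>\<nu>') = (\<integral>x. f x \<partial>\<nu>')" for n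
      using qs lipschitz_measurable[OF f] nat_in_I by blast
    have near: "\<bar>(\<integral>x. f x \<partial>\<nu>') - (\<integral>x. f x \<partial>\<nu>)\<bar> \<le> (L + 1) * e n" for n
    proof -
      define c where "c = (\<integral>x. m (real n) x \<partial>\<nu>')"
      obtain L1 where L1: "L1-lipschitz_on UNIV (p (real n) f)" using lipschitz_p[OF nat_in_I f] by blast
      obtain L2 where L2: "L2-lipschitz_on UNIV (m (real n))" using lipschitz_m[OF nat_in_I] by blast
      have "(\<integral>x. exp (- R * real n) \<partial>\<nu>') \<le> c" unfolding c_def
        using mass_ge[OF nat_in_I] int'[OF L2] by (intro integral_mono) (auto simp: m_def)
      then have "exp (- R * real n) \<le> c" using \<nu>'.prob_space by simp
      then have c: "0 < c" using exp_gt_zero[of "- R * real n"] by linarith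
      have pc: "(\<integral>x. p (real n) f x \<partial>\<nu>') = (\<integral>x. f x \<partial>\<nu>') * c"
        using q[of n] c unfolding c_def m_eq_p[OF nat_in_I] by (simp add: field_simps)
      have "\<bar>(\<integral>x. p (real n) f x \<partial>\<nu>') - (\<integral>x. f x \<partial>\<nu>) * c\<bar> = \<bar>\<integral>x. p (real n) f x - (\<integral>x. f x \<partial>\<nu>) * m (real n) x \<partial>\<nu>'\<bar>"
        unfolding c_def using int'[OF L1] int'[OF L2] by simp
      also have "\<dots> \<le> (\<integral>x. \<bar>p (real n) f x - (\<integral>x. f x \<partial>\<nu>) * m (real n) x\<bar> \<partial>\<nu>')" by (rule integral_abs_bound)
      also have "\<dots> \<le> (\<integral>x. (L + 1) * e n * m (real n) x \<partial>\<nu>')"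
        using ratio[OF f bf zero_in_I, of n] int'[OF L1] int'[OF L2] by (intro integral_mono) auto
      also have "\<dots> = (L + 1) * e n * c" unfolding c_def by simp
      finally have "\<bar>((\<integral>x. f x \<partial>\<nu>') - (\<integral>x. f x \<partial>\<nu>)) * c\<bar> \<le> (L + 1) * e n * c" unfolding pc by (simp add: left_diff_distrib)
      then show ?thesis using c by (simp add: abs_mult)
    qed
    have "(\<lambda>n. (L + 1) * e n) \<longlonglongrightarrow> 0" using tendsto_mult_left[OF e_tend, of "L + 1"] by simp
    then have "\<bar>(\<integral>x. f x \<partial>\<nu>') - (\<integral>x. f x \<partial>\<nu>)\<bar> \<le> 0" by (rule LIMSEQ_le_const) (use near in blast)
    then show "(\<integral>x. f x \<partial>\<nu>') = (\<integral>x. f x \<partial>\<nu>)" by simp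
  qed
  \<comment> \<open>\<open>ratio_contraction\<close> for the function \<open>m s\<close>.
    Integration against \<nu>, on which \<open>p t\<close> acts through the factor
    \<open>\<theta> t\<close>, shows that \<open>exp (- l * s)\<close> lies in the resulting
    interval.\<close>
  have shift: "\<bar>m (t + s) x - exp (- l * s) * m t x\<bar> \<le> A * (L + b) * exp (- \<delta> * t) * m t x"
    if s: "s \<in> I" and t: "t \<in> I" and L: "L-lipschitz_on UNIV (m s)" and b: "\<And>z. m s z \<le> b" for s t L b x
  proof -
    have b': "\<bar>m s z\<bar> \<le> b" for z using b[of z] m_pos[OF s, of z] by simp
    obtain a where a: "\<And>x. a * m t x \<le> p t (m s) x \<and> p t (m s) x \<le> (a + A * (L + b) * exp (- \<delta> * t)) * m t x"
      using rc[OF L b' t] zero_in_I by (metis add_0)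
    let ?w = "A * (L + b) * exp (- \<delta> * t)"
    obtain L1 where L1: "L1-lipschitz_on UNIV (p t (m s))" using lipschitz_p[OF t L] by blast
    have "(\<integral>x. a * m t x \<partial>\<nu>) \<le> (\<integral>x. p t (m s) x \<partial>\<nu>)"
      using a int_m[OF t] int_lip[OF L1] by (intro integral_mono) auto
    moreover have "(\<integral>x. p t (m s) x \<partial>\<nu>) \<le> (\<integral>x. (a + ?w) * m t x \<partial>\<nu>)"
      using a int_m[OF t] int_lip[OF L1] by (intro integral_mono) auto
    ultimately have "a * \<theta> t \<le> \<theta> t * \<theta> s" "\<theta> t * \<theta> s \<le> (a + ?w) * \<theta> t" using \<nu>_p[OF t L] unfolding \<theta>_def by auto
    then have "a \<le> exp (- l * s)" "exp (- l * s) \<le> a + ?w" using \<theta>_pos[OF t] \<theta>_eq[OF s] by (simp_all add: mult.commute)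
    then have "a * m t x \<le> exp (- l * s) * m t x" "exp (- l * s) * m t x \<le> (a + ?w) * m t x"
      using m_pos[OF t, of x] by (auto intro!: mult_right_mono)
    then show ?thesis using a[of x] unfolding m_add[OF t s] by (simp add: distrib_right abs_le_iff)
  qed
  define E where "E t x = exp (l * t) * m t x" for t x
  define C\<^sub>E where "C\<^sub>E = A * (C1 + H) * (H * exp l)"
  have C\<^sub>E: "0 < C\<^sub>E" unfolding C\<^sub>E_def using A C1_pos H_ge_1 by simp
  \<comment> \<open>The bound and the Lipschitz constant of \<open>m n\<close> are both of order
    \<open>exp (- l * n)\<close>, which cancels the growing factor \<open>exp (l * n)\<close>;
    therefore the estimate is uniform in \<open>n\<close>.\<close>
  have E_near: "\<bar>E (t + real n) x - E t x\<bar> \<le> C\<^sub>E * exp (- \<delta> * t)" if t: "t \<in> I" for t n x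
  proof -
    let ?e = "exp (- l * real n)"
    have L: "(C1 * ?e)-lipschitz_on UNIV (m (real n))"
      using m_lipschitz_exp C1_pos by (intro lipschitz_onI) (auto simp: dist_real_def)
    have "\<bar>m (t + real n) x - ?e * m t x\<bar> \<le> A * (C1 * ?e + H * ?e) * exp (- \<delta> * t) * m t x"
      by (rule shift[OF nat_in_I t L m_le_exp])
    also have "\<dots> \<le> A * (C1 * ?e + H * ?e) * exp (- \<delta> * t) * (H * exp l * exp (- l * t))"
      using m_bounds[OF t] A C1_pos H_ge_1 by (intro mult_left_mono) auto
    finally have "exp (l * (t + real n)) * \<bar>m (t + real n) x - ?e * m t x\<bar> \<le>
      exp (l * (t + real n)) * (A * (C1 * ?e + H * ?e) * exp (- \<delta> * t) * (H * exp l * exp (- l * t)))"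
      by (intro mult_left_mono) auto
    also have "\<dots> = C\<^sub>E * exp (- \<delta> * t) * (exp (l * (t + real n)) * ?e * exp (- l * t))"
      unfolding C\<^sub>E_def by (simp add: algebra_simps)
    also have "exp (l * (t + real n)) * ?e * exp (- l * t) = 1" by (simp add: exp_add[symmetric] algebra_simps)
    also have "exp (l * (t + real n)) * \<bar>m (t + real n) x - ?e * m t x\<bar> = \<bar>exp (l * (t + real n)) * (m (t + real n) x - ?e * m t x)\<bar>"
      by (simp add: abs_mult)
    also have "exp (l * (t + real n)) * (m (t + real n) x - ?e * m t x) = E (t + real n) x - (exp (l * (t + real n)) * ?e) * m t x"
      unfolding E_def by (simp add: algebra_simps)
    also have "exp (l * (t + real n)) * ?e = exp (l * t)" by (simp add: exp_add[symmetric] algebra_simps)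
    finally show ?thesis unfolding E_def by simp
  qed
  have \<delta>_tend: "(\<lambda>n. c * exp (- \<delta> * real n)) \<longlonglongrightarrow> 0" for c
    using tendsto_mult_left[OF e_tend, of "c / A"] A unfolding e_def by simp
  have conv: "convergent (\<lambda>n. E (real n) x)" for x
  proof -
    have "Cauchy (\<lambda>n. E (real n) x)"
    proof (rule metric_CauchyI)
      fix d :: real assume "0 < d"
      then have "\<forall>\<^sub>F n in sequentially. C\<^sub>E * exp (- \<delta> * real n) < d / 2" using \<delta>_tend by (intro order_tendstoD) auto
      then obtain k where k: "C\<^sub>E * exp (- \<delta> * real k) < d / 2" by (auto simp: eventually_sequentially)
      have nk: "\<bar>E (real n) x - E (real k) x\<bar> < d / 2" if "k \<le> n" for n
        using E_near[OF nat_in_I[of k], of "n - k" x] k that by (simp add: of_nat_diff)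
      have "dist (E (real a) x) (E (real b) x) < d" if "k \<le> a" "k \<le> b" for a b
        using nk[OF that(1)] nk[OF that(2)] unfolding dist_real_def by linarith
      then show "\<exists>M. \<forall>m\<ge>M. \<forall>n\<ge>M. dist (E (real m) x) (E (real n) x) < d" by blast
    qed
    then show ?thesis by (simp add: Cauchy_convergent_iff)
  qed
  define \<eta> where "\<eta> x = lim (\<lambda>n. E (real n) x)" for x
  have \<eta>_lim: "(\<lambda>n. E (real n) x) \<longlonglongrightarrow> \<eta> x" for x using conv unfolding \<eta>_def by (simp add: convergent_LIMSEQ_iff)
  \<comment> \<open>For a general \<open>t\<close> the Lipschitz constant of \<open>m t\<close> has
    no prescribed size, but a constant that depends on \<open>t\<close> is enough to identify the
    limit.\<close>
  have \<eta>_lim': "(\<lambda>n. E (t + real n) x) \<longlonglongrightarrow> \<eta> x" if t: "t \<in> I" for t x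
  proof -
    obtain L where L: "L-lipschitz_on UNIV (m t)" using lipschitz_m[OF t] by blast
    have L0: "0 \<le> L" using L by (simp add: lipschitz_on_def)
    have b: "m t z \<le> 1" for z using mass_le[OF t] unfolding m_def .
    have "\<bar>E (t + real n) x - E (real n) x\<bar> \<le> A * (L + 1) * exp (l * t) * H * exp (- \<delta> * real n)" for n
    proof -
      have "\<bar>m (real n + t) x - exp (- l * t) * m (real n) x\<bar> \<le> A * (L + 1) * exp (- \<delta> * real n) * m (real n) x"
        by (rule shift[OF t nat_in_I L b])
      also have "\<dots> \<le> A * (L + 1) * exp (- \<delta> * real n) * (H * exp (- l * real n))"
        using m_le_exp A L0 by (intro mult_left_mono) auto
      finally have "exp (l * (real n + t)) * \<bar>m (real n + t) x - exp (- l * t) * m (real n) x\<bar> \<le>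
        exp (l * (real n + t)) * (A * (L + 1) * exp (- \<delta> * real n) * (H * exp (- l * real n)))"
        by (intro mult_left_mono) auto
      also have "\<dots> = A * (L + 1) * H * exp (- \<delta> * real n) * (exp (l * (real n + t)) * exp (- l * real n))" by (simp add: algebra_simps)
      also have "exp (l * (real n + t)) * exp (- l * real n) = exp (l * t)" by (simp add: exp_add[symmetric] algebra_simps)
      also have "exp (l * (real n + t)) * \<bar>m (real n + t) x - exp (- l * t) * m (real n) x\<bar>
        = \<bar>exp (l * (real n + t)) * (m (real n + t) x - exp (- l * t) * m (real n) x)\<bar>" by (simp add: abs_mult)
      also have "exp (l * (real n + t)) * (m (real n + t) x - exp (- l * t) * m (real n) x)
        = E (real n + t) x - (exp (l * (real n + t)) * exp (- l * t)) * m (real n) x"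
        unfolding E_def by (simp add: algebra_simps)
      also have "exp (l * (real n + t)) * exp (- l * t) = exp (l * real n)" by (simp add: exp_add[symmetric] algebra_simps)
      finally show ?thesis unfolding E_def by (simp add: add.commute mult_ac)
    qed
    then have "(\<lambda>n. E (t + real n) x - E (real n) x) \<longlonglongrightarrow> 0"
      by (intro Lim_null_comparison[OF always_eventually \<delta>_tend[of "A * (L + 1) * exp (l * t) * H"]]) auto
    from tendsto_add[OF this \<eta>_lim[of x]] show ?thesis by simp
  qed
  have E_\<eta>: "\<bar>E t x - \<eta> x\<bar> \<le> C\<^sub>E * exp (- \<delta> * t)" if t: "t \<in> I" for t x
  proof (rule LIMSEQ_le_const2)
    show "(\<lambda>n. \<bar>E t x - E (t + real n) x\<bar>) \<longlonglongrightarrow> \<bar>E t x - \<eta> x\<bar>" using \<eta>_lim'[OF t] by (intro tendsto_intros)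
    show "\<exists>N. \<forall>n\<ge>N. \<bar>E t x - E (t + real n) x\<bar> \<le> C\<^sub>E * exp (- \<delta> * t)"
      using E_near[OF t] by (auto simp: abs_minus_commute)
  qed
  have \<eta>_lip: "C1-lipschitz_on UNIV \<eta>"
  proof (rule lipschitz_onI)
    fix x y
    have "\<bar>E (real n) x - E (real n) y\<bar> \<le> C1 * dist x y" for n
    proof -
      have "\<bar>E (real n) x - E (real n) y\<bar> = exp (l * real n) * \<bar>m (real n) x - m (real n) y\<bar>"
        unfolding E_def by (simp add: right_diff_distrib[symmetric] abs_mult)
      also have "\<dots> \<le> exp (l * real n) * (C1 * exp (- l * real n) * dist x y)" by (intro mult_left_mono m_lipschitz_exp) simp
      also have "\<dots> = C1 * dist x y * (exp (l * real n) * exp (- l * real n))" by (simp add: mult_ac)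
      also have "exp (l * real n) * exp (- l * real n) = 1" by (simp add: exp_add[symmetric])
      finally show ?thesis by simp
    qed
    moreover have "(\<lambda>n. \<bar>E (real n) x - E (real n) y\<bar>) \<longlonglongrightarrow> \<bar>\<eta> x - \<eta> y\<bar>" by (intro tendsto_intros \<eta>_lim)
    ultimately show "dist (\<eta> x) (\<eta> y) \<le> C1 * dist x y" unfolding dist_real_def by (intro LIMSEQ_le_const2) auto
  qed (use C1_pos in simp)
  have \<eta>_lower: "1 / H \<le> \<eta> x" for x
  proof (rule LIMSEQ_le_const[OF \<eta>_lim])
    have "1 / H \<le> E (real n) x" for n
    proof -
      have "exp (l * real n) * exp (- l * real n) \<le> exp (l * real n) * (H * m (real n) x)"
        by (intro mult_left_mono exp_le_m) simp
      then show ?thesis unfolding E_def using H_ge_1 by (simp add: exp_add[symmetric] field_simps)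
    qed
    then show "\<exists>N. \<forall>n\<ge>N. 1 / H \<le> E (real n) x" by blast
  qed
  have \<nu>\<eta>: "(\<integral>x. \<eta> x \<partial>\<nu>) = 1"
  proof -
    have "\<bar>1 - (\<integral>x. \<eta> x \<partial>\<nu>)\<bar> \<le> C\<^sub>E * exp (- \<delta> * real n)" for n
    proof -
      have int_E: "integrable \<nu> (E (real n))" unfolding E_def using int_m[OF nat_in_I] by simp
      have "(\<integral>x. E (real n) x \<partial>\<nu>) = 1"
        using \<theta>_eq[OF nat_in_I, of n] unfolding E_def \<theta>_def by (simp add: exp_add[symmetric])
      then have "\<bar>1 - (\<integral>x. \<eta> x \<partial>\<nu>)\<bar> = \<bar>\<integral>x. E (real n) x - \<eta> x \<partial>\<nu>\<bar>"
        using int_E int_lip[OF \<eta>_lip] by simp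
      also have "\<dots> \<le> (\<integral>x. \<bar>E (real n) x - \<eta> x\<bar> \<partial>\<nu>)" by (rule integral_abs_bound)
      also have "\<dots> \<le> (\<integral>x. C\<^sub>E * exp (- \<delta> * real n) \<partial>\<nu>)"
        using int_E int_lip[OF \<eta>_lip] E_\<eta>[OF nat_in_I] by (intro integral_mono) auto
      finally show ?thesis using \<nu>.prob_space by simp
    qed
    then have "\<bar>1 - (\<integral>x. \<eta> x \<partial>\<nu>)\<bar> \<le> 0" by (intro LIMSEQ_le_const[OF \<delta>_tend[of C\<^sub>E]]) blast
    then show ?thesis by simp
  qed
  \<comment> \<open>\<open>p t\<close> maps \<open>E n\<close> exactly to
    \<open>exp (- l * t) * E (t + n)\<close>, and uniform convergence of \<open>E n\<close> allows
    the limit under the kernel.\<close>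
  have p\<eta>: "p t \<eta> x = exp (- l * t) * \<eta> x" if t: "t \<in> I" for t x
  proof (rule LIMSEQ_unique)
    have pE: "p t (E (real n)) x = exp (- l * t) * E (t + real n) x" for n
    proof -
      have "p t (E (real n)) x = exp (l * real n) * m (t + real n) x"
        unfolding E_def m_add[OF t nat_in_I] by (simp add: p_def)
      also have "exp (l * real n) = exp (- l * t) * exp (l * (t + real n))" by (simp add: exp_add[symmetric] algebra_simps)
      finally show ?thesis unfolding E_def by simp
    qed
    show "(\<lambda>n. p t (E (real n)) x) \<longlonglongrightarrow> exp (- l * t) * \<eta> x"
      unfolding pE by (intro tendsto_mult_left \<eta>_lim'[OF t])
    have "\<bar>p t (E (real n)) x - p t \<eta> x\<bar> \<le> C\<^sub>E * exp (- \<delta> * real n)" for n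
    proof -
      interpret finite_measure "\<kappa> t x" using finite_\<kappa>[OF t] .
      obtain L where L: "L-lipschitz_on UNIV (m (real n))" using lipschitz_m[OF nat_in_I] by blast
      have int_E: "integrable (\<kappa> t x) (E (real n))" unfolding E_def using integrable_lipschitz[OF t L] by simp
      have int_\<eta>: "integrable (\<kappa> t x) \<eta>" by (rule integrable_lipschitz[OF t \<eta>_lip])
      have "\<bar>p t (E (real n)) x - p t \<eta> x\<bar> = \<bar>\<integral>z. E (real n) z - \<eta> z \<partial>\<kappa> t x\<bar>" unfolding p_def using int_E int_\<eta> by simp
      also have "\<dots> \<le> (\<integral>z. \<bar>E (real n) z - \<eta> z\<bar> \<partial>\<kappa> t x)" by (rule integral_abs_bound)
      also have "\<dots> \<le> (\<integral>z. C\<^sub>E * exp (- \<delta> * real n) \<partial>\<kappa> t x)"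
        using int_E int_\<eta> E_\<eta>[OF nat_in_I] by (intro integral_mono) auto
      also have "\<dots> = C\<^sub>E * exp (- \<delta> * real n) * measure (\<kappa> t x) UNIV" using t by simp
      also have "\<dots> \<le> C\<^sub>E * exp (- \<delta> * real n) * 1" using mass_le[OF t, of x] C\<^sub>E by (intro mult_left_mono) auto
      finally show ?thesis by simp
    qed
    then have "(\<lambda>n. p t (E (real n)) x - p t \<eta> x) \<longlonglongrightarrow> 0"
      by (intro Lim_null_comparison[OF always_eventually \<delta>_tend[of C\<^sub>E]]) auto
    then show "(\<lambda>n. p t (E (real n)) x) \<longlonglongrightarrow> p t \<eta> x" by (simp add: LIM_zero_iff)
  qed
  show ?thesis
  proof (rule that[of \<nu> \<eta>])
    show "prob_space \<nu>" "sets \<nu> = sets borel" by fact+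
    show "\<exists>L. L-lipschitz_on UNIV \<eta>" using \<eta>_lip by blast
    show "\<exists>c>0. \<forall>x. c \<le> \<eta> x" using \<eta>_lower H_ge_1 by (intro exI[of _ "1 / H"]) auto
    show "\<exists>C>0. \<exists>\<delta>>0. \<forall>t\<in>I. \<forall>x. \<bar>exp (l * t) * m t x - \<eta> x\<bar> \<le> C * exp (- \<delta> * t)"
      using E_\<eta> C\<^sub>E \<delta> unfolding E_def by blast
  qed (use qsd unique \<nu>\<eta> p\<eta> in blast)+
qed

end

section \<open>Integrals over time\<close>

text \<open>One measure on the reals for both time sets, so that the time integral and the finite
  product become instances of the same formula; in discrete time it counts the integers
  \<open>0, 1, 2, ...\<close>.\<close>

definition clock :: "real set \<Rightarrow> real measure" where
  "clock I = (if I = {0..} then lborel else distr (count_space UNIV) borel real)"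

text \<open>Half-open, so that adjacent windows do not overlap and a window from \<open>0\<close> to
  \<open>n\<close> counts exactly the times \<open>0, ..., n - 1\<close> of the discrete
  penalization.\<close>

definition window :: "real set \<Rightarrow> real \<Rightarrow> real \<Rightarrow> real measure" where
  "window I s t = density (clock I) (\<lambda>r. ennreal (indicator {s..<t} r))"

text \<open>The additive functional whose negative exponential is the penalization. The indicator of
  \<open>I\<close> removes the arbitrary values of the process at times outside
  \<open>I\<close>.\<close>

definition cost :: "real set \<Rightarrow> ('e \<Rightarrow> real) \<Rightarrow> (real \<Rightarrow> 'w \<Rightarrow> 'e) \<Rightarrow> real \<Rightarrow> real \<Rightarrow> 'w \<Rightarrow> real" where
  "cost I \<rho> \<xi> s t \<omega> = (\<integral>r. indicator I r * \<rho> (\<xi> r \<omega>) \<partial>window I s t)"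

lemma nats_neq_halfline: "\<nat> \<noteq> {0::real..}"
proof
  assume "\<nat> = {0::real..}"
  moreover have "(1/2 :: real) \<in> {0..}" by simp
  ultimately have "(1/2 :: real) \<in> \<nat>" by blast
  then obtain n :: nat where "1/2 = real n" by (auto elim: Nats_cases)
  then have "real 1 = real (2 * n)" by simp
  then have "1 = 2 * n" by (simp only: of_nat_eq_iff)
  then show False by presburger
qed

lemma sets_clock [simp, measurable_cong]: "sets (clock I) = sets borel" unfolding clock_def by simp
lemma sets_window [simp, measurable_cong]: "sets (window I s t) = sets borel" unfolding window_def by simp
lemma space_clock [simp]: "space (clock I) = UNIV" using sets_eq_imp_space_eq[OF sets_clock] by simp
lemma space_window [simp]: "space (window I s t) = UNIV" unfolding window_def by simp

lemma integral_window:
  fixes f :: "real \<Rightarrow> real"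
  assumes "f \<in> borel_measurable borel"
  shows "(\<integral>r. f r \<partial>window I s t) = (\<integral>r. indicator {s..<t} r * f r \<partial>clock I)"
  unfolding window_def using assms by (subst integral_density) auto

context
  fixes I :: "real set"
  assumes time_set: "I = {0..} \<or> I = \<nat>"
begin

lemma time_nonneg: "t \<in> I \<Longrightarrow> 0 \<le> t" using time_set by (auto elim: Nats_cases)
lemma nat_time [simp]: "real n \<in> I" using time_set by auto
lemma time_add [simp]: "s \<in> I \<Longrightarrow> t \<in> I \<Longrightarrow> s + t \<in> I" using time_set by auto
lemma time_zero [simp]: "0 \<in> I" using nat_time[of 0] by simp
lemma time_borel [measurable]: "I \<in> sets borel" using time_set by (auto intro: closed_Nats borel_closed)

lemma emeasure_clock:
  assumes "s \<in> I" "t \<in> I" "s \<le> t" shows "emeasure (clock I) {s..<t} = ennreal (t - s)"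
  using time_set
proof
  assume "I = {0..}" then show ?thesis using assms unfolding clock_def by simp
next
  assume I: "I = \<nat>"
  obtain a b where ab: "s = real a" "t = real b" using assms I by (auto elim!: Nats_cases)
  have "emeasure (clock I) {s..<t} = emeasure (count_space UNIV) (real -` {s..<t})"
    using I nats_neq_halfline unfolding clock_def by (simp add: emeasure_distr)
  also have "real -` {s..<t} = {a..<b}" unfolding ab by auto
  also have "emeasure (count_space UNIV) {a..<b} = ennreal (t - s)"
    using assms(3) unfolding ab by (simp add: ennreal_of_nat_eq_real_of_nat of_nat_diff)
  finally show ?thesis .
qed

lemma emeasure_window:
  assumes "s \<in> I" "t \<in> I" "s \<le> t" shows "emeasure (window I s t) UNIV = ennreal (t - s)"
  unfolding window_def using emeasure_clock[OF assms]
  by (simp add: emeasure_density ennreal_indicator)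

lemma finite_window: "s \<in> I \<Longrightarrow> t \<in> I \<Longrightarrow> s \<le> t \<Longrightarrow> finite_measure (window I s t)"
  using emeasure_window by (intro finite_measureI) auto

lemma AE_clock: "AE r in clock I. 0 \<le> r \<longrightarrow> r \<in> I"
  using time_set
proof
  assume "I = {0..}" then show ?thesis by simp
next
  assume I: "I = \<nat>"
  then have cl: "clock I = distr (count_space UNIV) borel real" using nats_neq_halfline by (simp add: clock_def)
  have eq: "{r \<in> space borel. 0 \<le> r \<longrightarrow> r \<in> I} = {..<0} \<union> (I :: real set)" using time_nonneg by (auto simp: not_le)
  have "{r \<in> space borel. 0 \<le> r \<longrightarrow> r \<in> I} \<in> sets borel" unfolding eq by measurable
  then show ?thesis unfolding cl by (subst AE_distr_iff) (auto simp: I)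
qed

lemma AE_window:
  assumes "s \<in> I" shows "AE r in window I s t. r \<in> I \<and> s \<le> r \<and> r < t"
proof -
  have "AE r in clock I. 0 < ennreal (indicator {s..<t} r) \<longrightarrow> r \<in> I \<and> s \<le> r \<and> r < t"
    using AE_clock by eventually_elim (use time_nonneg[OF assms] in \<open>auto simp: indicator_def split: if_splits\<close>)
  then show ?thesis unfolding window_def by (subst AE_density) auto
qed

lemma integrable_window:
  fixes f :: "real \<Rightarrow> real"
  assumes "s \<in> I" "t \<in> I" "s \<le> t" "f \<in> borel_measurable borel" "\<And>r. \<bar>f r\<bar> \<le> B"
  shows "integrable (window I s t) f"
proof -
  interpret finite_measure "window I s t" using finite_window assms by blast
  show ?thesis using assms by (intro integrable_const_bound[where B = B]) auto
qed

lemma integral_window_split: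
  fixes f :: "real \<Rightarrow> real"
  assumes "s \<in> I" "t \<in> I" "u \<in> I" "s \<le> t" "t \<le> u" "f \<in> borel_measurable borel" "\<And>r. \<bar>f r\<bar> \<le> B"
  shows "(\<integral>r. f r \<partial>window I s u) = (\<integral>r. f r \<partial>window I s t) + (\<integral>r. f r \<partial>window I t u)"
proof -
  have int: "integrable (clock I) (\<lambda>r. indicator {a..<b} r * f r)" if "a \<in> I" "b \<in> I" "a \<le> b" for a b
    using integrable_window[OF that assms(6,7)] assms(6) unfolding window_def
    by (subst (asm) integrable_density) auto
  have "(\<integral>r. f r \<partial>window I s u) = (\<integral>r. indicator {s..<t} r * f r + indicator {t..<u} r * f r \<partial>clock I)"
    unfolding integral_window[OF assms(6)] using assms(4,5) by (intro Bochner_Integration.integral_cong) (auto simp: indicator_def)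
  then show ?thesis using int assms unfolding integral_window[OF assms(6)] by simp
qed

text \<open>Translation invariance of Lebesgue measure, or, in discrete time, the bijection between
  the integers of the two windows.\<close>

lemma distr_clock_shift:
  assumes "t0 \<in> I" "u \<in> I" shows "distr (window I 0 u) borel ((+) t0) = window I t0 (t0 + u)"
proof (rule measure_eqI)
  fix A assume "A \<in> sets (distr (window I 0 u) borel ((+) t0))"
  then have A: "A \<in> sets borel" by simp
  have vA: "(+) t0 -` A \<in> sets borel" using measurable_sets[of "(+) t0" borel borel A] A by simp
  have "emeasure (distr (window I 0 u) borel ((+) t0)) A = emeasure (clock I) ({0..<u} \<inter> (+) t0 -` A)"
    unfolding window_def using A vA by (simp add: emeasure_distr emeasure_density ennreal_indicator indicator_inter_arith[symmetric])
  also have "\<dots> = emeasure (clock I) ({t0..<t0+u} \<inter> A)"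
    using time_set
  proof
    assume I: "I = {0..}"
    have "emeasure lborel ({t0..<t0+u} \<inter> A) = emeasure (distr lborel borel ((+) t0)) ({t0..<t0+u} \<inter> A)"
      using lborel_distr_plus[of t0] by simp
    also have "\<dots> = emeasure lborel ((+) t0 -` ({t0..<t0+u} \<inter> A))" using A by (subst emeasure_distr) auto
    also have "(+) t0 -` ({t0..<t0+u} \<inter> A) = {0..<u} \<inter> (+) t0 -` A" by auto
    finally show ?thesis using I unfolding clock_def by simp
  next
    assume I: "I = \<nat>"
    obtain a where a: "t0 = real a" using assms I by (auto elim: Nats_cases)
    have cl: "emeasure (clock I) B = emeasure (count_space UNIV) (real -` B)" if "B \<in> sets borel" for B
      using I nats_neq_halfline that unfolding clock_def by (simp add: emeasure_distr)
    have "real -` ({t0..<t0+u} \<inter> A) = (+) a ` (real -` ({0..<u} \<inter> (+) t0 -` A))"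
    proof (intro set_eqI iffI)
      fix k assume k: "k \<in> real -` ({t0..<t0+u} \<inter> A)"
      then have "a \<le> k" unfolding a by simp
      then obtain j where "k = a + j" using le_Suc_ex by blast
      then show "k \<in> (+) a ` (real -` ({0..<u} \<inter> (+) t0 -` A))" using k unfolding a by auto
    qed (auto simp: a)
    then show ?thesis using A vA
      by (simp add: cl emeasure_count_space finite_image_iff card_image)
  qed
  also have "\<dots> = emeasure (window I t0 (t0 + u)) A"
    unfolding window_def using A by (simp add: emeasure_density ennreal_indicator indicator_inter_arith[symmetric])
  finally show "emeasure (distr (window I 0 u) borel ((+) t0)) A = emeasure (window I t0 (t0 + u)) A" .
qed simp

end

text \<open>Joint measurability of a Caratheodory function: \<open>y\<close> is replaced by the
  first point of a dense sequence within \<open>1 / Suc n\<close>, which leaves countably many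
  measurable pieces, and continuity in \<open>y\<close> gives the limit.\<close>

lemma borel_measurable_caratheodory:
  fixes h :: "'b::{metric_space, second_countable_topology} \<Rightarrow> 'r \<Rightarrow> real"
  assumes meas: "\<And>y. h y \<in> borel_measurable R" and cont: "\<And>r. r \<in> space R \<Longrightarrow> continuous_on UNIV (\<lambda>y. h y r)"
  shows "(\<lambda>(y, r). h y r) \<in> borel_measurable (borel \<Otimes>\<^sub>M R)"
proof -
  obtain S :: "'b set" where "countable S" and dense: "\<And>U. open U \<Longrightarrow> U \<noteq> {} \<Longrightarrow> \<exists>d\<in>S. d \<in> U"
    using countable_dense_setE by blast
  then have "S \<noteq> {}" using dense[of UNIV] by auto
  define q where "q = from_nat_into S"
  have q_dense: "\<exists>i. dist (q i) x < \<epsilon>" if "0 < \<epsilon>" for x \<epsilon>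
  proof -
    have "x \<in> ball x \<epsilon>" using that by simp
    then obtain d where "d \<in> S" "d \<in> ball x \<epsilon>" using dense[of "ball x \<epsilon>"] by blast
    then show ?thesis using \<open>countable S\<close> from_nat_into_surj[of S d] unfolding q_def by (auto simp: dist_commute)
  qed
  define idx where "idx n y = (LEAST i. dist (q i) y < 1 / real (Suc n))" for n y
  have idx: "dist (q (idx n y)) y < 1 / real (Suc n)" for n y
    unfolding idx_def by (rule LeastI_ex) (use q_dense in simp)
  have [measurable]: "idx n \<in> measurable borel (count_space UNIV)" for n
    unfolding idx_def by measurable
  show ?thesis
  proof (rule borel_measurable_LIMSEQ_real)
    show "(\<lambda>z. h (q (idx n (fst z))) (snd z)) \<in> borel_measurable (borel \<Otimes>\<^sub>M R)" for n
      by (rule measurable_compose_countable[where f = "\<lambda>i z. h (q i) (snd z)" and g = "\<lambda>z. idx n (fst z)"])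
        (use measurable_compose[OF measurable_snd meas] in measurable)
    fix z :: "'b \<times> 'r" assume "z \<in> space (borel \<Otimes>\<^sub>M R)"
    then have r: "snd z \<in> space R" by (auto simp: space_pair_measure)
    have "(\<lambda>n. q (idx n (fst z))) \<longlonglongrightarrow> fst z"
    proof (rule metric_LIMSEQ_I)
      fix \<epsilon> :: real assume "0 < \<epsilon>"
      then obtain n0 where n0: "1 / real (Suc n0) < \<epsilon>" using nat_approx_posE by blast
      have "dist (q (idx n (fst z))) (fst z) < \<epsilon>" if "n0 \<le> n" for n
      proof -
        have "1 / real (Suc n) \<le> 1 / real (Suc n0)" using that by (simp add: field_simps)
        then show ?thesis using idx[of n "fst z"] n0 by linarith
      qed
      then show "\<exists>no. \<forall>n\<ge>no. dist (q (idx n (fst z))) (fst z) < \<epsilon>" by blast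
    qed
    then show "(\<lambda>n. h (q (idx n (fst z))) (snd z)) \<longlonglongrightarrow> (case z of (y, r) \<Rightarrow> h y r)"
      using continuous_on_tendsto_compose[OF cont[OF r]] by (simp add: case_prod_beta)
  qed
qed

text \<open>
  Sampling times independently turns powers of a time integral into mixtures of products over finitely
  many times; this is how the law of the penalization is read off the law of the path.
\<close>

lemma integral_sampled_product:
  fixes g :: "real \<Rightarrow> 'w \<Rightarrow> real"
  assumes "prob_space U" "prob_space W"
    and g: "(\<lambda>(r, \<omega>). g r \<omega>) \<in> borel_measurable (U \<Otimes>\<^sub>M W)" "\<And>r \<omega>. \<bar>g r \<omega>\<bar> \<le> 1"
    and k: "k \<in> borel_measurable W" "\<And>\<omega>. \<bar>k \<omega>\<bar> \<le> B"
  shows "(\<integral>r. (\<integral>\<omega>. k \<omega> * (\<Prod>i<n. g (r i) \<omega>) \<partial>W) \<partial>PiM {..<n} (\<lambda>_. U)) = (\<integral>\<omega>. k \<omega> * (\<integral>s. g s \<omega> \<partial>U) ^ n \<partial>W)"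
    and "(\<lambda>(r, \<omega>). k \<omega> * (\<Prod>i<n. g (r i) \<omega>)) \<in> borel_measurable (PiM {..<n} (\<lambda>_. U) \<Otimes>\<^sub>M W)"
proof -
  interpret U: prob_space U by fact
  interpret W: prob_space W by fact
  interpret UU: product_prob_space "\<lambda>_. U" "{..<n}" by unfold_locales
  interpret PU: prob_space "PiM {..<n} (\<lambda>_. U)" by (rule prob_space_PiM) (rule assms(1))
  interpret pair_sigma_finite "PiM {..<n} (\<lambda>_. U)" W by unfold_locales
  interpret PP: pair_prob_space "PiM {..<n} (\<lambda>_. U)" W by unfold_locales
  have gi: "(\<lambda>z. g (fst z i) (snd z)) \<in> borel_measurable (PiM {..<n} (\<lambda>_. U) \<Otimes>\<^sub>M W)" if "i < n" for i
  proof -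
    have "(\<lambda>z. (fst z i, snd z)) \<in> measurable (PiM {..<n} (\<lambda>_. U) \<Otimes>\<^sub>M W) (U \<Otimes>\<^sub>M W)"
      using that by (intro measurable_Pair measurable_compose[OF measurable_fst measurable_component_singleton] measurable_snd) auto
    from measurable_compose[OF this g(1)] show ?thesis by simp
  qed
  show meas: "(\<lambda>(r, \<omega>). k \<omega> * (\<Prod>i<n. g (r i) \<omega>)) \<in> borel_measurable (PiM {..<n} (\<lambda>_. U) \<Otimes>\<^sub>M W)"
    unfolding case_prod_beta using gi k(1) by (intro borel_measurable_times borel_measurable_prod) auto
  have prod_le: "\<bar>\<Prod>i<n. g (r i) \<omega>\<bar> \<le> 1" for r \<omega>
    unfolding abs_prod by (intro prod_le_1) (use g(2) in auto)
  have "\<bar>k \<omega> * (\<Prod>i<n. g (r i) \<omega>)\<bar> \<le> B" for r \<omega>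
    using mult_mono[OF k(2)[of \<omega>] prod_le[of r \<omega>]] k(2)[of \<omega>] by (simp add: abs_mult)
  then have "integrable (PiM {..<n} (\<lambda>_. U) \<Otimes>\<^sub>M W) (\<lambda>(r, \<omega>). k \<omega> * (\<Prod>i<n. g (r i) \<omega>))"
    using meas by (intro PP.integrable_const_bound[where B = B]) auto
  from Fubini_integral[OF this]
  have "(\<integral>r. (\<integral>\<omega>. k \<omega> * (\<Prod>i<n. g (r i) \<omega>) \<partial>W) \<partial>PiM {..<n} (\<lambda>_. U)) = (\<integral>\<omega>. (\<integral>r. k \<omega> * (\<Prod>i<n. g (r i) \<omega>) \<partial>PiM {..<n} (\<lambda>_. U)) \<partial>W)"
    by simp
  also have "\<dots> = (\<integral>\<omega>. k \<omega> * (\<integral>s. g s \<omega> \<partial>U) ^ n \<partial>W)"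
  proof (rule Bochner_Integration.integral_cong)
    fix \<omega> assume \<omega>: "\<omega> \<in> space W"
    have "(\<lambda>r. (r, \<omega>)) \<in> measurable U (U \<Otimes>\<^sub>M W)" using \<omega> by measurable
    from measurable_compose[OF this g(1)] have "(\<lambda>r. g r \<omega>) \<in> borel_measurable U" by simp
    then have "integrable U (\<lambda>r. g r \<omega>)" using g(2) by (intro U.integrable_const_bound[where B = 1]) auto
    \<comment> \<open>Independence of the sampled times factorizes the integral of the
      product.\<close>
    then have "(\<integral>r. (\<Prod>i<n. g (r i) \<omega>) \<partial>PiM {..<n} (\<lambda>_. U)) = (\<Prod>i<n. \<integral>s. g s \<omega> \<partial>U)"
      by (intro UU.product_integral_prod) auto
    then show "(\<integral>r. k \<omega> * (\<Prod>i<n. g (r i) \<omega>) \<partial>PiM {..<n} (\<lambda>_. U)) = k \<omega> * (\<integral>s. g s \<omega> \<partial>U) ^ n" by simp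
  qed simp
  finally show "(\<integral>r. (\<integral>\<omega>. k \<omega> * (\<Prod>i<n. g (r i) \<omega>) \<partial>W) \<partial>PiM {..<n} (\<lambda>_. U)) = (\<integral>\<omega>. k \<omega> * (\<integral>s. g s \<omega> \<partial>U) ^ n \<partial>W)" .
qed

text \<open>
  If every \<open>g r\<close> is \<open>G\<close>-measurable then \<open>A = \<integral> g r dr\<close> equals \<open>A' = E[A | G]\<close> almost surely, because
  \<open>E[(A - A')\<^sup>2] = \<integral> E[g r (A - A')] dr - E[A' (A - A')] = 0\<close>.
\<close>

lemma time_integral_measurable_version:
  fixes g :: "real \<Rightarrow> 'w \<Rightarrow> real"
  assumes "finite_measure U" "prob_space W" "subalgebra W G"
    and g: "(\<lambda>(r, \<omega>). g r \<omega>) \<in> borel_measurable (U \<Otimes>\<^sub>M W)" "\<And>r \<omega>. \<bar>g r \<omega>\<bar> \<le> B"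
    and adapted: "AE r in U. g r \<in> borel_measurable G"
  obtains A' where "A' \<in> borel_measurable G" "AE \<omega> in W. (\<integral>r. g r \<omega> \<partial>U) = A' \<omega>"
proof -
  interpret U: finite_measure U by fact
  interpret W: prob_space W by fact
  interpret finite_measure_subalgebra W G by unfold_locales fact
  interpret PP: pair_sigma_finite U W by unfold_locales
  have fin: "finite_measure (U \<Otimes>\<^sub>M W)" by (rule finite_measure_pair_measure) unfold_locales
  define A where "A \<omega> = (\<integral>r. g r \<omega> \<partial>U)" for \<omega>
  define A' where "A' = real_cond_exp W G A"
  have gs: "(\<lambda>\<omega>. g r \<omega>) \<in> borel_measurable W" if "r \<in> space U" for r
    using measurable_compose[OF measurable_Pair1'[OF that] g(1)] by simp
  have gr: "(\<lambda>r. g r \<omega>) \<in> borel_measurable U" if "\<omega> \<in> space W" for \<omega>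
    using measurable_compose[OF measurable_Pair2'[OF that] g(1)] by simp
  have A_meas: "A \<in> borel_measurable W"
    unfolding A_def
  proof (rule U.borel_measurable_lebesgue_integral)
    have "(\<lambda>z. (snd z, fst z)) \<in> measurable (W \<Otimes>\<^sub>M U) (U \<Otimes>\<^sub>M W)" by measurable
    from measurable_compose[OF this g(1)] show "(\<lambda>(\<omega>, r). g r \<omega>) \<in> borel_measurable (W \<Otimes>\<^sub>M U)"
      by (simp add: case_prod_beta)
  qed
  let ?c = "B * measure U (space U)"
  have A_bound: "\<bar>A \<omega>\<bar> \<le> ?c" if "\<omega> \<in> space W" for \<omega>
  proof -
    have "integrable U (\<lambda>r. g r \<omega>)" using gr[OF that] g(2) by (intro U.integrable_const_bound[where B = B]) auto
    then have "(\<integral>r. \<bar>g r \<omega>\<bar> \<partial>U) \<le> (\<integral>r. B \<partial>U)" using g(2) by (intro integral_mono) auto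
    moreover have "\<bar>A \<omega>\<bar> \<le> (\<integral>r. \<bar>g r \<omega>\<bar> \<partial>U)" unfolding A_def by (rule integral_abs_bound)
    ultimately show ?thesis by (simp add: mult.commute)
  qed
  have A_int: "integrable W A" using A_meas A_bound by (intro W.integrable_const_bound[where B = ?c]) auto
  have A'_meas: "A' \<in> borel_measurable G" "A' \<in> borel_measurable W" unfolding A'_def by auto
  have A'_bound: "AE \<omega> in W. \<bar>A' \<omega>\<bar> \<le> ?c"
  proof -
    have "AE \<omega> in W. A' \<omega> \<le> ?c" unfolding A'_def
      by (rule real_cond_exp_le_c[OF A_int]) (use A_bound in \<open>auto simp: abs_le_iff\<close>)
    moreover have "AE \<omega> in W. - ?c \<le> A' \<omega>" unfolding A'_def
      by (rule real_cond_exp_ge_c[OF A_int]) (use A_bound in \<open>auto simp: abs_le_iff minus_le_iff\<close>)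
    ultimately show ?thesis by eventually_elim (simp add: abs_le_iff minus_le_iff)
  qed
  have D_bound: "AE \<omega> in W. \<bar>A \<omega> - A' \<omega>\<bar> \<le> 2 * ?c"
    using A'_bound AE_space by eventually_elim (use A_bound in \<open>fastforce simp: abs_le_iff\<close>)
  have bnd_int: "integrable W f" if "f \<in> borel_measurable W" "AE \<omega> in W. \<bar>f \<omega>\<bar> \<le> b" for f :: "'w \<Rightarrow> real" and b
    using that by (intro W.integrable_const_bound[where B = b]) auto
  have c0: "0 \<le> ?c" using A_bound W.not_empty by (meson abs_ge_zero equals0I order_trans)
  have B0: "0 \<le> B" using g(2) by (meson abs_ge_zero order_trans)
  have prod_int: "integrable W (\<lambda>\<omega>. f \<omega> * h \<omega>)"
    if "f \<in> borel_measurable W" "h \<in> borel_measurable W" "AE \<omega> in W. \<bar>f \<omega>\<bar> \<le> b" "AE \<omega> in W. \<bar>h \<omega>\<bar> \<le> b'" "0 \<le> b" for f h :: "'w \<Rightarrow> real" and b b'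
  proof (rule bnd_int)
    show "AE \<omega> in W. \<bar>f \<omega> * h \<omega>\<bar> \<le> b * b'"
      using that(3,4) by eventually_elim (use that(5) in \<open>auto simp: abs_mult intro!: mult_mono\<close>)
  qed (use that in auto)
  have orth: "(\<integral>\<omega>. f \<omega> * (A \<omega> - A' \<omega>) \<partial>W) = 0" if f: "f \<in> borel_measurable G" and fb: "AE \<omega> in W. \<bar>f \<omega>\<bar> \<le> b" and b: "0 \<le> b" for f b
  proof -
    have fW: "f \<in> borel_measurable W" using f measurable_from_subalg[OF assms(3)] by blast
    have i1: "integrable W (\<lambda>\<omega>. f \<omega> * A \<omega>)" using A_bound by (intro prod_int[OF fW A_meas fb _ b, of ?c]) auto
    have i2: "integrable W (\<lambda>\<omega>. f \<omega> * A' \<omega>)" by (rule prod_int[OF fW A'_meas(2) fb A'_bound b])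
    have "(\<integral>\<omega>. f \<omega> * A' \<omega> \<partial>W) = (\<integral>\<omega>. f \<omega> * A \<omega> \<partial>W)" unfolding A'_def
      by (rule real_cond_exp_intg(2)[OF i1 f A_meas])
    then show ?thesis using i1 i2 by (simp add: right_diff_distrib)
  qed
  \<comment> \<open>\<open>A\<close> itself need not be measurable for \<open>G\<close>, but for
    almost every \<open>r\<close> its integrand \<open>g r\<close> is; Fubini thus extends the
    orthogonality \<open>orth\<close> to \<open>A\<close>.\<close>
  have "(\<integral>\<omega>. A \<omega> * (A \<omega> - A' \<omega>) \<partial>W) = (\<integral>\<omega>. (\<integral>r. g r \<omega> * (A \<omega> - A' \<omega>) \<partial>U) \<partial>W)"
    unfolding A_def[of "_"] by (intro Bochner_Integration.integral_cong) auto
  also have "\<dots> = (\<integral>r. (\<integral>\<omega>. g r \<omega> * (A \<omega> - A' \<omega>) \<partial>W) \<partial>U)"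
  proof (rule PP.Fubini_integral)
    have meas: "(\<lambda>(r, \<omega>). g r \<omega> * (A \<omega> - A' \<omega>)) \<in> borel_measurable (U \<Otimes>\<^sub>M W)"
      using g(1) A_meas A'_meas(2) unfolding case_prod_beta by measurable
    have iD: "integrable W (\<lambda>\<omega>. A \<omega> - A' \<omega>)" using A_meas A'_meas(2) D_bound by (intro bnd_int) auto
    show "integrable (U \<Otimes>\<^sub>M W) (\<lambda>(r, \<omega>). g r \<omega> * (A \<omega> - A' \<omega>))"
    proof (rule Bochner_Integration.integrable_bound)
      show "integrable (U \<Otimes>\<^sub>M W) (\<lambda>(r, \<omega>). B * (A \<omega> - A' \<omega>))"
      proof (rule PP.Fubini_integrable)
        show "(\<lambda>(r, \<omega>). B * (A \<omega> - A' \<omega>)) \<in> borel_measurable (U \<Otimes>\<^sub>M W)"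
          using A_meas A'_meas(2) unfolding case_prod_beta by measurable
      qed (use iD in auto)
      show "AE z in U \<Otimes>\<^sub>M W. norm (case z of (r, \<omega>) \<Rightarrow> g r \<omega> * (A \<omega> - A' \<omega>)) \<le> norm (case z of (r, \<omega>) \<Rightarrow> B * (A \<omega> - A' \<omega>))"
        using g(2) B0 by (intro always_eventually) (auto simp: abs_mult intro!: mult_right_mono)
    qed (rule meas)
  qed
  also have "\<dots> = (\<integral>r. 0 \<partial>U)"
  proof (rule integral_cong_AE)
    show "AE r in U. (\<integral>\<omega>. g r \<omega> * (A \<omega> - A' \<omega>) \<partial>W) = 0"
      using adapted by eventually_elim (rule orth[OF _ _ B0], use g(2) in auto)
  qed (use g(1) A_meas A'_meas(2) in \<open>auto simp: case_prod_beta intro!: W.borel_measurable_lebesgue_integral\<close>)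
  finally have AD: "(\<integral>\<omega>. A \<omega> * (A \<omega> - A' \<omega>) \<partial>W) = 0" by simp
  have A'D: "(\<integral>\<omega>. A' \<omega> * (A \<omega> - A' \<omega>) \<partial>W) = 0" by (rule orth[OF A'_meas(1) A'_bound c0])
  have iA: "integrable W (\<lambda>\<omega>. A \<omega> * (A \<omega> - A' \<omega>))"
    using A_meas A'_meas A_bound D_bound c0 by (intro prod_int[of A _ ?c "2 * ?c"]) auto
  have iA': "integrable W (\<lambda>\<omega>. A' \<omega> * (A \<omega> - A' \<omega>))"
    using A_meas A'_meas A'_bound D_bound c0 by (intro prod_int[of A' _ ?c "2 * ?c"]) auto
  have sq: "(A \<omega> - A' \<omega>)\<^sup>2 = A \<omega> * (A \<omega> - A' \<omega>) - A' \<omega> * (A \<omega> - A' \<omega>)" for \<omega> by (simp add: power2_eq_square algebra_simps)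
  have "(\<integral>\<omega>. (A \<omega> - A' \<omega>)\<^sup>2 \<partial>W) = 0" unfolding sq using iA iA' AD A'D by simp
  moreover have "integrable W (\<lambda>\<omega>. (A \<omega> - A' \<omega>)\<^sup>2)" unfolding sq using iA iA' by simp
  ultimately have "AE \<omega> in W. (A \<omega> - A' \<omega>)\<^sup>2 = 0" using integral_nonneg_eq_0_iff_AE[of W "\<lambda>\<omega>. (A \<omega> - A' \<omega>)\<^sup>2"] by simp
  then have "AE \<omega> in W. A \<omega> = A' \<omega>" by simp
  then show ?thesis using that[OF A'_meas(1)] unfolding A_def by blast
qed

text \<open>Extends joint measurability to all real times by the value \<open>0\<close> outside
  \<open>I\<close>. It refers to the full sigma-algebra of \<open>M\<close> and does not express
  progressive measurability.\<close>

definition cost_measurable :: "real set \<Rightarrow> ('e \<Rightarrow> real) \<Rightarrow> 'w measure \<Rightarrow> (real \<Rightarrow> 'w \<Rightarrow> 'e) \<Rightarrow> bool" where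
  "cost_measurable I \<rho> M \<xi> \<longleftrightarrow> (\<lambda>(r, \<omega>). indicator I r * \<rho> (\<xi> r \<omega>)) \<in> borel_measurable (borel \<Otimes>\<^sub>M M)"

section \<open>Costs along a process: splitting, shifts and adapted versions\<close>

context
  fixes I :: "real set" and \<rho> :: "'e::metric_space \<Rightarrow> real" and R :: real
  assumes time_set: "I = {0..} \<or> I = \<nat>" and rho: "\<And>x. 0 \<le> \<rho> x" "\<And>x. \<rho> x \<le> R"
begin

lemma cost_measurableI:
  assumes wd: "penalization_well_defined I \<rho> M \<xi>" and \<rho>: "\<rho> \<in> borel_measurable borel"
    and \<xi>: "\<And>t. t \<in> I \<Longrightarrow> \<xi> t \<in> measurable M borel"
  shows "cost_measurable I \<rho> M \<xi>"
  using time_set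
proof
  assume I: "I = {0..}"
  let ?R = "restrict_space borel {0::real..}"
  have "(\<lambda>(s, \<omega>). \<rho> (\<xi> s \<omega>)) \<in> borel_measurable (?R \<Otimes>\<^sub>M M)"
    using wd I unfolding penalization_well_defined_def by simp
  \<comment> \<open>Clipping negative times to \<open>0\<close> leads into the half-line on which
    measurability is assumed; the indicator removes these times again.\<close>
  moreover have "(\<lambda>z. (max 0 (fst z), snd z)) \<in> measurable (borel \<Otimes>\<^sub>M M) (?R \<Otimes>\<^sub>M M)"
    by (intro measurable_Pair measurable_restrict_space2) (auto intro!: borel_measurable_max)
  ultimately have "(\<lambda>z. \<rho> (\<xi> (max 0 (fst z)) (snd z))) \<in> borel_measurable (borel \<Otimes>\<^sub>M M)"
    using measurable_compose by fastforce
  moreover have "(\<lambda>z. indicator {0::real..} (fst z) :: real) \<in> borel_measurable (borel \<Otimes>\<^sub>M M)" by measurable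
  ultimately have "(\<lambda>z. indicator {0::real..} (fst z) * \<rho> (\<xi> (max 0 (fst z)) (snd z))) \<in> borel_measurable (borel \<Otimes>\<^sub>M M)"
    by (intro borel_measurable_times)
  also have "(\<lambda>z. indicator {0::real..} (fst z) * \<rho> (\<xi> (max 0 (fst z)) (snd z))) = (\<lambda>(r, \<omega>). indicator I r * \<rho> (\<xi> r \<omega>))"
    unfolding I by (auto simp: fun_eq_iff indicator_def max_def)
  finally show ?thesis unfolding cost_measurable_def .
next
  assume I: "I = \<nat>"
  \<comment> \<open>Rounding time to an integer leaves countably many measurable pieces and changes
    nothing at times in \<nat>.\<close>
  have "(\<lambda>z. \<rho> (\<xi> (real (nat \<lfloor>fst z :: real\<rfloor>)) (snd z))) \<in> borel_measurable (borel \<Otimes>\<^sub>M M)"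
  proof (rule measurable_compose_countable[where f = "\<lambda>k z. \<rho> (\<xi> (real k) (snd z))" and g = "\<lambda>z. nat \<lfloor>fst z :: real\<rfloor>"])
    show "(\<lambda>z. \<rho> (\<xi> (real k) (snd z))) \<in> borel_measurable (borel \<Otimes>\<^sub>M M)" for k
      by (rule measurable_compose[OF measurable_compose[OF measurable_snd \<xi>] \<rho>]) (simp add: I)
  qed measurable
  moreover have "\<nat> \<in> sets (borel :: real measure)" by (simp add: closed_Nats borel_closed)
  then have "(\<lambda>z. indicator (\<nat> :: real set) (fst z) :: real) \<in> borel_measurable (borel \<Otimes>\<^sub>M M)" by measurable
  ultimately have "(\<lambda>z. indicator (\<nat> :: real set) (fst z) * \<rho> (\<xi> (real (nat \<lfloor>fst z\<rfloor>)) (snd z))) \<in> borel_measurable (borel \<Otimes>\<^sub>M M)"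
    by (intro borel_measurable_times)
  also have "(\<lambda>z. indicator (\<nat> :: real set) (fst z) * \<rho> (\<xi> (real (nat \<lfloor>fst z\<rfloor>)) (snd z))) = (\<lambda>(r, \<omega>). indicator I r * \<rho> (\<xi> r \<omega>))"
    unfolding I by (auto simp: fun_eq_iff indicator_def elim!: Nats_cases)
  finally show ?thesis unfolding cost_measurable_def .
qed

lemma rate_bound: "\<bar>indicator I r * \<rho> x\<bar> \<le> R" using rho[of x] by (auto simp: indicator_def)

lemma cost_section:
  assumes "cost_measurable I \<rho> M \<xi>" "\<omega> \<in> space M"
  shows "(\<lambda>r. indicator I r * \<rho> (\<xi> r \<omega>)) \<in> borel_measurable borel"
  using measurable_compose[OF measurable_Pair2'[OF assms(2)] assms(1)[unfolded cost_measurable_def]] by simp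

lemma cost_nonneg: "0 \<le> cost I \<rho> \<xi> s t \<omega>"
  unfolding cost_def using rho by (intro integral_nonneg_AE) auto

lemma cost_le:
  assumes "s \<in> I" "t \<in> I" "s \<le> t" shows "cost I \<rho> \<xi> s t \<omega> \<le> R * (t - s)"
proof -
  interpret finite_measure "window I s t" using finite_window[OF time_set] assms by blast
  have "cost I \<rho> \<xi> s t \<omega> \<le> (\<integral>r. R \<partial>window I s t)"
    unfolding cost_def using rate_bound[of _ "\<xi> _ \<omega>"] rho(1) rho(2) order_trans[OF rho(1) rho(2)]
    by (intro integral_mono') (auto simp: abs_le_iff)
  also have "\<dots> = R * (t - s)"
    using emeasure_window[OF time_set assms] assms(3) by (simp add: measure_def)
  finally show ?thesis .
qed

lemma measurable_cost:
  assumes "cost_measurable I \<rho> M \<xi>" "s \<in> I" "t \<in> I" "s \<le> t"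
  shows "cost I \<rho> \<xi> s t \<in> borel_measurable M"
proof -
  interpret finite_measure "window I s t" using finite_window[OF time_set] assms by blast
  have "(\<lambda>z. (snd z, fst z)) \<in> measurable (M \<Otimes>\<^sub>M window I s t) (borel \<Otimes>\<^sub>M M)"
    by (intro measurable_Pair measurable_fst) (auto intro: measurable_snd simp: measurable_cong_sets[OF refl sets_window[symmetric]])
  from measurable_compose[OF this assms(1)[unfolded cost_measurable_def]]
  have "(\<lambda>(\<omega>, r). indicator I r * \<rho> (\<xi> r \<omega>)) \<in> borel_measurable (M \<Otimes>\<^sub>M window I s t)" by (simp add: case_prod_beta)
  then show ?thesis unfolding cost_def[abs_def] by (rule borel_measurable_lebesgue_integral)
qed

lemma cost_split:
  assumes "cost_measurable I \<rho> M \<xi>" "\<omega> \<in> space M" "s \<in> I" "t \<in> I" "u \<in> I" "s \<le> t" "t \<le> u"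
  shows "cost I \<rho> \<xi> s u \<omega> = cost I \<rho> \<xi> s t \<omega> + cost I \<rho> \<xi> t u \<omega>"
  unfolding cost_def by (rule integral_window_split[OF time_set assms(3-7) cost_section[OF assms(1,2)] rate_bound])

lemma cost_shift:
  assumes "cost_measurable I \<rho> M \<xi>" "\<omega> \<in> space M" "s \<in> I" "u \<in> I"
  shows "cost I \<rho> (\<lambda>r. \<xi> (s + r)) 0 u \<omega> = cost I \<rho> \<xi> s (s + u) \<omega>"
proof -
  have "cost I \<rho> \<xi> s (s + u) \<omega> = (\<integral>r. indicator I (s + r) * \<rho> (\<xi> (s + r) \<omega>) \<partial>window I 0 u)"
    unfolding cost_def distr_clock_shift[OF time_set assms(3,4), symmetric]
    using cost_section[OF assms(1,2)] by (subst integral_distr) auto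
  also have "\<dots> = cost I \<rho> (\<lambda>r. \<xi> (s + r)) 0 u \<omega>"
    unfolding cost_def
  proof (rule integral_cong_AE)
    have m: "(\<lambda>r. indicator I (s + r) * \<rho> (\<xi> (s + r) \<omega>)) \<in> borel_measurable borel"
      using measurable_compose[of "(+) s" borel borel, OF _ cost_section[OF assms(1,2)]] by simp
    then show "(\<lambda>r. indicator I (s + r) * \<rho> (\<xi> (s + r) \<omega>)) \<in> borel_measurable (window I 0 u)" by simp
    have "(\<lambda>r. indicator I r * (indicator I (s + r) * \<rho> (\<xi> (s + r) \<omega>))) \<in> borel_measurable borel"
      by (rule borel_measurable_times[OF borel_measurable_indicator[OF time_borel[OF time_set]] m])
    also have "(\<lambda>r. indicator I r * (indicator I (s + r) * \<rho> (\<xi> (s + r) \<omega>))) = (\<lambda>r. indicator I r * \<rho> (\<xi> (s + r) \<omega>))"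
      using time_add[OF time_set assms(3)] by (auto simp: fun_eq_iff indicator_def)
    finally show "(\<lambda>r. indicator I r * \<rho> (\<xi> (s + r) \<omega>)) \<in> borel_measurable (window I 0 u)" by simp
    show "AE r in window I 0 u. indicator I (s + r) * \<rho> (\<xi> (s + r) \<omega>) = indicator I r * \<rho> (\<xi> (s + r) \<omega>)"
      using AE_window[OF time_set time_zero[OF time_set]]
      by eventually_elim (use time_add[OF time_set assms(3)] in \<open>auto simp: indicator_def\<close>)
  qed
  finally show ?thesis by simp
qed

lemma cost_measurable_shift:
  assumes "cost_measurable I \<rho> M \<xi>" "s \<in> I"
  shows "cost_measurable I \<rho> M (\<lambda>r. \<xi> (s + r))"
proof -
  have "(\<lambda>z. (s + fst z, snd z)) \<in> measurable (borel \<Otimes>\<^sub>M M) (borel \<Otimes>\<^sub>M M)" by measurable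
  from measurable_compose[OF this assms(1)[unfolded cost_measurable_def]]
  have m1: "(\<lambda>z. indicator I (s + fst z) * \<rho> (\<xi> (s + fst z) (snd z))) \<in> borel_measurable (borel \<Otimes>\<^sub>M M)" by (simp add: case_prod_beta)
  have m2: "(\<lambda>z. indicator I (fst z) :: real) \<in> borel_measurable (borel \<Otimes>\<^sub>M M)"
    using time_borel[OF time_set] by measurable
  have "(\<lambda>z. indicator I (fst z) * (indicator I (s + fst z) * \<rho> (\<xi> (s + fst z) (snd z)))) \<in> borel_measurable (borel \<Otimes>\<^sub>M M)"
    by (rule borel_measurable_times[OF m2 m1])
  also have "(\<lambda>z. indicator I (fst z) * (indicator I (s + fst z) * \<rho> (\<xi> (s + fst z) (snd z)))) = (\<lambda>(r, \<omega>). indicator I r * \<rho> (\<xi> (s + r) \<omega>))"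
    using time_add[OF time_set assms(2)] by (auto simp: fun_eq_iff indicator_def)
  finally show ?thesis unfolding cost_measurable_def .
qed

text \<open>In continuous time the closed interval of the penalization exceeds the window by a null
  set; in discrete time the window counts exactly the factors \<open>k < n\<close>.\<close>

lemma penalization_eq_cost:
  assumes "cost_measurable I \<rho> M \<xi>" "\<omega> \<in> space M" "t \<in> I"
  shows "penalization I \<rho> \<xi> t \<omega> = exp (- cost I \<rho> \<xi> 0 t \<omega>)"
  using time_set
proof
  assume I: "I = {0..}"
  have sec: "(\<lambda>r. indicator I r * \<rho> (\<xi> r \<omega>)) \<in> borel_measurable borel" by (rule cost_section[OF assms(1,2)])
  have "cost I \<rho> \<xi> 0 t \<omega> = (\<integral>r. indicator {0..<t} r * (indicator I r * \<rho> (\<xi> r \<omega>)) \<partial>lborel)"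
    unfolding cost_def integral_window[OF sec] clock_def using I by simp
  also have "\<dots> = (\<integral>r. indicator {0..t} r * (indicator I r * \<rho> (\<xi> r \<omega>)) \<partial>lborel)"
  proof (rule integral_cong_AE)
    show "AE r in lborel. indicator {0..<t} r * (indicator I r * \<rho> (\<xi> r \<omega>)) = indicator {0..t} r * (indicator I r * \<rho> (\<xi> r \<omega>))"
      using AE_lborel_singleton[of t] by eventually_elim (auto simp: indicator_def)
  qed (use sec in \<open>auto intro!: borel_measurable_times\<close>)
  also have "\<dots> = (LBINT s:{0..t}. \<rho> (\<xi> s \<omega>))"
    unfolding set_lebesgue_integral_def I by (intro Bochner_Integration.integral_cong) (auto simp: indicator_def)
  finally show ?thesis unfolding penalization_def using I by simp
next
  assume I: "I = \<nat>"
  have sec: "(\<lambda>r. indicator I r * \<rho> (\<xi> r \<omega>)) \<in> borel_measurable borel" by (rule cost_section[OF assms(1,2)])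
  obtain n where t: "t = real n" using assms(3) I by (auto elim: Nats_cases)
  have cl: "clock I = distr (count_space UNIV) borel real" using I nats_neq_halfline by (simp add: clock_def)
  have "cost I \<rho> \<xi> 0 t \<omega> = (\<integral>k. indicator {0..<t} (real k) * (indicator I (real k) * \<rho> (\<xi> (real k) \<omega>)) \<partial>count_space UNIV)"
    unfolding cost_def integral_window[OF sec] cl using sec by (subst integral_distr) (auto intro!: borel_measurable_times)
  also have "\<dots> = (\<Sum>k | k \<in> UNIV \<and> indicator {0..<t} (real k) * (indicator I (real k) * \<rho> (\<xi> (real k) \<omega>)) \<noteq> 0.
    indicator {0..<t} (real k) * (indicator I (real k) * \<rho> (\<xi> (real k) \<omega>)))"
    by (rule lebesgue_integral_count_space_finite_support) (rule finite_subset[of _ "{..<n}"], auto simp: t indicator_def split: if_splits)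
  also have "\<dots> = (\<Sum>k<n. \<rho> (\<xi> (real k) \<omega>))"
    using I by (intro sum.mono_neutral_cong_left) (auto simp: t indicator_def split: if_splits)
  finally show ?thesis unfolding penalization_def using I nats_neq_halfline t by (simp add: exp_minus exp_sum prod_inversef sum_negf[symmetric] del: sum_negf)
qed

text \<open>Without progressive measurability an adapted process may have a time integral that is
  not measurable for the past. An almost surely equal version is enough wherever only expectations
  matter.\<close>

lemma cost_version:
  assumes "cost_measurable I \<rho> W \<xi>" "prob_space W" "subalgebra W G" "s \<in> I" "t \<in> I" "s \<le> t"
    and adapted: "\<And>r. r \<in> I \<Longrightarrow> r \<le> t \<Longrightarrow> \<xi> r \<in> measurable G borel" and \<rho>: "\<rho> \<in> borel_measurable borel"
  obtains A' where "A' \<in> borel_measurable G" "AE \<omega> in W. cost I \<rho> \<xi> s t \<omega> = A' \<omega>"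
proof -
  have m: "(\<lambda>(r, \<omega>). indicator I r * \<rho> (\<xi> r \<omega>)) \<in> borel_measurable (window I s t \<Otimes>\<^sub>M W)"
    using assms(1) unfolding cost_measurable_def
    by (simp add: measurable_cong_sets[OF sets_pair_measure_cong[OF sets_window refl] refl])
  have ad: "AE r in window I s t. (\<lambda>\<omega>. indicator I r * \<rho> (\<xi> r \<omega>)) \<in> borel_measurable G"
    using AE_window[OF time_set assms(4), of t]
    by eventually_elim (use measurable_compose[OF adapted \<rho>] in \<open>auto intro!: borel_measurable_times\<close>)
  show ?thesis
    by (rule time_integral_measurable_version[OF finite_window[OF time_set assms(4-6)] assms(2,3) m rate_bound ad])
      (use that in \<open>auto simp: cost_def\<close>)
qed

end

section \<open>Measurability and path laws of Markov processes\<close>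

lemma (in markov_process) measurable_X: "t \<in> I \<Longrightarrow> X t \<in> measurable M borel"
  using measurable_from_subalg[OF subalgebra_F adapted] by blast

lemma (in markov_process) time_add_in: "s \<in> I \<Longrightarrow> t \<in> I \<Longrightarrow> s + t \<in> I"
  by (rule time_add[OF time_set])

lemma (in markov_process) measurable_P: "measurable (P x) N = measurable M N"
  by (rule measurable_cong_sets[OF sets_P refl])

lemma (in markov_process) space_P: "space (P x) = space M"
  by (rule sets_eq_imp_space_eq[OF sets_P])

lemma (in markov_process) measurable_shift:
  assumes "t \<in> I" shows "(\<lambda>\<omega>. \<lambda>s\<in>I. X (t + s) \<omega>) \<in> measurable M (PiM I (\<lambda>_. borel))"
  using assms by (intro measurable_restrict measurable_X time_add_in) auto

lemma (in markov_process) measurable_path: "(\<lambda>\<omega>. \<lambda>s\<in>I. X s \<omega>) \<in> measurable M (PiM I (\<lambda>_. borel))"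
  by (intro measurable_restrict measurable_X) auto

lemma (in markov_process) integral_path_law:
  fixes \<Phi> :: "(real \<Rightarrow> 's) \<Rightarrow> real"
  assumes "\<Phi> \<in> borel_measurable (PiM I (\<lambda>_. borel))"
  shows "(\<integral>\<pi>. \<Phi> \<pi> \<partial>path_law I X (P x)) = (\<integral>\<omega>. \<Phi> (\<lambda>s\<in>I. X s \<omega>) \<partial>P x)"
  unfolding path_law_def using measurable_path assms by (intro integral_distr) (auto simp: measurable_P)

section \<open>Markov property of the penalized process\<close>

text \<open>The Markov property tested with a weight \<open>H\<close> from the past and a bounded
  functional \<Phi> of the future. Kernel, filtration and process are separate parameters, so that
  it also covers one component of a coupling with respect to the joint past.\<close>

definition markov_at ::
  "real set \<Rightarrow> ('s::topological_space \<Rightarrow> (real \<Rightarrow> 's) measure) \<Rightarrow> 'w measure \<Rightarrow> 'w measure \<Rightarrow> (real \<Rightarrow> 'w \<Rightarrow> 's) \<Rightarrow> real \<Rightarrow> bool" where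
  "markov_at I K W G \<xi> t \<longleftrightarrow> (\<forall>H \<Phi> B. H \<in> borel_measurable G \<longrightarrow> (\<forall>\<omega>. 0 \<le> H \<omega> \<and> H \<omega> \<le> (1::real)) \<longrightarrow>
     \<Phi> \<in> borel_measurable (PiM I (\<lambda>_. borel)) \<longrightarrow> (\<forall>\<pi>. \<bar>\<Phi> \<pi>\<bar> \<le> (B::real)) \<longrightarrow>
     (\<integral>\<omega>. H \<omega> * \<Phi> (\<lambda>s\<in>I. \<xi> (t + s) \<omega>) \<partial>W) = (\<integral>\<omega>. H \<omega> * (\<integral>\<pi>. \<Phi> \<pi> \<partial>K (\<xi> t \<omega>)) \<partial>W))"

text \<open>The weight is absorbed into a density \<open>W\<close>. Under \<open>W\<close> the law
  of the shifted path and the mixture of the kernels agree on each measurable set by the defining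
  property of conditional expectation; hence they agree as measures and can be tested with bounded
  functionals.\<close>

lemma (in markov_process) markov_at:
  assumes t: "t \<in> I" shows "markov_at I (\<lambda>y. path_law I X (P y)) (P x) (F t) X t"
  unfolding markov_at_def
proof (intro allI impI)
  fix H :: "'w \<Rightarrow> real" and \<Phi> :: "(real \<Rightarrow> 's) \<Rightarrow> real" and B :: real
  assume HF: "H \<in> borel_measurable (F t)" and H01: "\<forall>\<omega>. 0 \<le> H \<omega> \<and> H \<omega> \<le> 1"
    and \<Phi>: "\<Phi> \<in> borel_measurable (PiM I (\<lambda>_. borel))" and \<Phi>B: "\<forall>\<pi>. \<bar>\<Phi> \<pi>\<bar> \<le> B"
  let ?K = "\<lambda>y. path_law I X (P y)" and ?S = "\<lambda>\<omega>. \<lambda>s\<in>I. X (t + s) \<omega>" and ?PM = "PiM I (\<lambda>_. borel :: 's measure)"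
  interpret Px: prob_space "P x" by (rule prob_P)
  have sub: "subalgebra (P x) (F t)" using subalgebra_F[OF t] sets_P[of x] space_P[of x] unfolding subalgebra_def by simp
  interpret finite_measure_subalgebra "P x" "F t" by unfold_locales (rule sub)
  have H: "H \<in> borel_measurable M" using measurable_from_subalg[OF subalgebra_F[OF t] HF] .
  have S: "?S \<in> measurable M ?PM" by (rule measurable_shift[OF t])
  define W where "W = density (P x) (\<lambda>\<omega>. ennreal (H \<omega>))"
  have setsW: "sets W = sets M" unfolding W_def by (simp add: sets_P)
  have mW: "measurable W N = measurable M N" for N :: "'x measure" by (rule measurable_cong_sets[OF setsW refl])
  have spW: "space W = space M" unfolding W_def by (simp add: space_P)
  have emW: "emeasure W (space W) \<le> 1"
  proof -
    have "emeasure W (space W) = (\<integral>\<^sup>+\<omega>. ennreal (H \<omega>) \<partial>P x)"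
      unfolding W_def using H by (subst emeasure_density) (auto simp: measurable_P intro!: nn_integral_cong)
    also have "\<dots> \<le> (\<integral>\<^sup>+\<omega>. 1 \<partial>P x)" using H01 by (intro nn_integral_mono) (simp add: ennreal_le_1)
    finally show ?thesis by (simp add: Px.emeasure_space_1)
  qed
  have finW: "finite_measure W" using emW by (intro finite_measureI) (auto simp: top_unique)
  have Kmeas: "(\<lambda>\<omega>. ?K (X t \<omega>)) \<in> measurable M (subprob_algebra ?PM)"
    using measurable_compose[OF measurable_X[OF t] kernel] by (rule measurable_prob_algebraD)
  have Kprob: "prob_space (?K y)" for y
    using measurable_space[OF kernel, of y] by (simp add: space_prob_algebra)
  have Ksets: "sets (?K y) = sets ?PM" for y unfolding path_law_def by simp
  have ne: "space W \<noteq> {}" using Px.not_empty spW space_P by simp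
  have "distr W ?PM ?S = W \<bind> (\<lambda>\<omega>. ?K (X t \<omega>))"
  proof (rule measure_eqI)
    show "sets (distr W ?PM ?S) = sets (W \<bind> (\<lambda>\<omega>. ?K (X t \<omega>)))"
      using sets_bind[OF _ ne, of "\<lambda>\<omega>. ?K (X t \<omega>)" ?PM] Ksets by simp
    fix A assume "A \<in> sets (distr W ?PM ?S)"
    then have A: "A \<in> sets ?PM" by simp
    let ?E = "{\<omega> \<in> space M. ?S \<omega> \<in> A}"
    have E: "?E \<in> sets M" using measurable_sets[OF S A] by (simp add: vimage_def Int_def conj_commute)
    have Em: "(indicator ?E :: 'w \<Rightarrow> real) \<in> borel_measurable (P x)" using E by (simp add: measurable_P)
    have KA: "(\<lambda>\<omega>. measure (?K (X t \<omega>)) A) \<in> borel_measurable M"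
      using measurable_compose[OF Kmeas measurable_measure_subprob_algebra[OF A]] by simp
    have KAe: "(\<lambda>\<omega>. emeasure (?K (X t \<omega>)) A) \<in> borel_measurable M"
      using measurable_compose[OF Kmeas measurable_emeasure_subprob_algebra[OF A]] by simp
    have i1: "integrable (P x) (\<lambda>\<omega>. H \<omega> * indicator ?E \<omega>)"
      using H H01 E by (intro Px.integrable_const_bound[where B = 1]) (auto simp: measurable_P indicator_def)
    have i2: "integrable (P x) (\<lambda>\<omega>. H \<omega> * measure (?K (X t \<omega>)) A)"
      using H H01 KA prob_space.prob_le_1[OF Kprob]
      by (intro Px.integrable_const_bound[where B = 1]) (auto simp: measurable_P abs_mult intro!: mult_le_one)
    have "(\<integral>\<omega>. H \<omega> * indicator ?E \<omega> \<partial>P x) = (\<integral>\<omega>. H \<omega> * real_cond_exp (P x) (F t) (indicator ?E) \<omega> \<partial>P x)"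
      by (rule real_cond_exp_intg(2)[OF i1 HF Em, symmetric])
    also have "\<dots> = (\<integral>\<omega>. H \<omega> * measure (?K (X t \<omega>)) A \<partial>P x)"
    proof (rule integral_cong_AE)
      show "(\<lambda>\<omega>. H \<omega> * real_cond_exp (P x) (F t) (indicator ?E) \<omega>) \<in> borel_measurable (P x)"
        "(\<lambda>\<omega>. H \<omega> * measure (?K (X t \<omega>)) A) \<in> borel_measurable (P x)"
        using H KA by (auto simp: measurable_P[symmetric, of _ x] intro!: borel_measurable_times borel_measurable_cond_exp2)
      show "AE \<omega> in P x. H \<omega> * real_cond_exp (P x) (F t) (indicator ?E) \<omega> = H \<omega> * measure (?K (X t \<omega>)) A"
        using markov[OF t A, of x] by eventually_elim simp
    qed
    finally have eq: "(\<integral>\<omega>. H \<omega> * indicator ?E \<omega> \<partial>P x) = (\<integral>\<omega>. H \<omega> * measure (?K (X t \<omega>)) A \<partial>P x)" .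
    have "emeasure (distr W ?PM ?S) A = emeasure W ?E"
      using A S by (subst emeasure_distr) (auto simp: mW spW vimage_def Int_def conj_commute)
    also have "\<dots> = (\<integral>\<^sup>+\<omega>. ennreal (H \<omega> * indicator ?E \<omega>) \<partial>P x)"
      unfolding W_def using H E sets_P H01
      by (subst emeasure_density) (auto simp: measurable_P ennreal_mult ennreal_indicator intro!: nn_integral_cong)
    also have "\<dots> = ennreal (\<integral>\<omega>. H \<omega> * indicator ?E \<omega> \<partial>P x)"
      using H01 by (intro nn_integral_eq_integral i1) auto
    also have "\<dots> = (\<integral>\<^sup>+\<omega>. ennreal (H \<omega> * measure (?K (X t \<omega>)) A) \<partial>P x)"
      unfolding eq using H01 by (intro nn_integral_eq_integral[symmetric] i2) auto
    also have "\<dots> = (\<integral>\<^sup>+\<omega>. ennreal (H \<omega>) * emeasure (?K (X t \<omega>)) A \<partial>P x)"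
      using H01 by (intro nn_integral_cong) (simp add: ennreal_mult finite_measure.emeasure_eq_measure[OF prob_space.finite_measure[OF Kprob]])
    also have "\<dots> = (\<integral>\<^sup>+\<omega>. emeasure (?K (X t \<omega>)) A \<partial>W)"
      unfolding W_def using H KAe by (subst nn_integral_density) (auto simp: measurable_P)
    also have "\<dots> = emeasure (W \<bind> (\<lambda>\<omega>. ?K (X t \<omega>))) A"
      using Kmeas A ne by (intro emeasure_bind[symmetric]) (auto simp: mW)
    finally show "emeasure (distr W ?PM ?S) A = emeasure (W \<bind> (\<lambda>\<omega>. ?K (X t \<omega>))) A" .
  qed
  note eqm = this
  have KPhi: "(\<lambda>\<omega>. \<integral>\<pi>. \<Phi> \<pi> \<partial>?K (X t \<omega>)) \<in> borel_measurable M"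
    using measurable_compose[OF Kmeas integral_measurable_subprob_algebra[OF \<Phi>]] by simp
  have "(\<integral>\<omega>. H \<omega> * \<Phi> (?S \<omega>) \<partial>P x) = (\<integral>\<omega>. \<Phi> (?S \<omega>) \<partial>W)"
    unfolding W_def using H H01 measurable_compose[OF S \<Phi>]
    by (subst integral_density) (auto simp: measurable_P)
  also have "\<dots> = (\<integral>\<pi>. \<Phi> \<pi> \<partial>distr W ?PM ?S)" 
    using S by (intro integral_distr[symmetric] \<Phi>) (simp only: mW)
  also have "\<dots> = (\<integral>\<omega>. (\<integral>\<pi>. \<Phi> \<pi> \<partial>?K (X t \<omega>)) \<partial>W)"
    unfolding eqm
  proof (rule integral_bind[where K = ?PM and B = B and B' = 1])
    show "AE \<omega> in W. emeasure (?K (X t \<omega>)) (space (?K (X t \<omega>))) \<le> ennreal 1"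
      using prob_space.emeasure_space_1[OF Kprob] by simp
  qed (use \<Phi> \<Phi>B Kmeas finW in \<open>auto simp: mW\<close>)
  also have "\<dots> = (\<integral>\<omega>. H \<omega> * (\<integral>\<pi>. \<Phi> \<pi> \<partial>?K (X t \<omega>)) \<partial>P x)"
    unfolding W_def using H H01 KPhi by (subst integral_density) (auto simp: measurable_P)
  finally show "(\<integral>\<omega>. H \<omega> * \<Phi> (?S \<omega>) \<partial>P x) = (\<integral>\<omega>. H \<omega> * (\<integral>\<pi>. \<Phi> \<pi> \<partial>?K (X t \<omega>)) \<partial>P x)" .
qed

text \<open>\<open>L\<close>, \<open>R\<close> and \<open>D\<close> are strictly positive bounds for
  the Lipschitz constant of \<rho>, for \<rho> itself and for the distance. Such an \<open>R\<close>
  exists because a Lipschitz function on a space of finite diameter is bounded.\<close>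

locale penalized_coupling =
  fixes I :: "real set" and M :: "'w measure" and F :: "real \<Rightarrow> 'w measure"
    and P :: "'e::polish_space \<Rightarrow> 'w measure" and X :: "real \<Rightarrow> 'w \<Rightarrow> 'e" and \<rho> :: "'e \<Rightarrow> real"
    and N :: "'v measure" and Q :: "'e \<times> 'e \<Rightarrow> 'v measure" and X' Y' :: "real \<Rightarrow> 'v \<Rightarrow> 'e"
    and C \<gamma> L R D :: real
  assumes dist_le: "dist x (y :: 'e) \<le> D"
    and process: "markov_process I M F P X"
    and rho_nonneg: "0 \<le> \<rho> x" and rho_le: "\<rho> x \<le> R" and rho_lip: "L-lipschitz_on UNIV \<rho>"
    and well_defined: "penalization_well_defined I \<rho> M X"
    and coupling: "markovian_coupling I P X N Q X' Y'"
    and well_defined_X': "penalization_well_defined I \<rho> N X'"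
    and well_defined_Y': "penalization_well_defined I \<rho> N Y'"
    and pos: "0 < C" "0 < \<gamma>" "0 < L" "0 < R" "0 < D"
    and contraction: "t \<in> I \<Longrightarrow>
      (\<integral>\<omega>. penalization I \<rho> X' t \<omega> / (\<integral>\<omega>'. penalization I \<rho> X t \<omega>' \<partial>P x) * dist (X' t \<omega>) (Y' t \<omega>) \<partial>Q (x, y))
        \<le> C * exp (- \<gamma> * t) * dist x y"
begin

sublocale X: markov_process I M F P X by (rule process)

abbreviation G :: "real \<Rightarrow> 'v measure" where
  "G \<equiv> natural_filtration I N (\<lambda>t \<omega>. (X' t \<omega>, Y' t \<omega>))"

sublocale XY: markov_process I N G Q "\<lambda>t \<omega>. (X' t \<omega>, Y' t \<omega>)"
  using coupling unfolding markovian_coupling_def by blast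

definition K :: "'e \<Rightarrow> (real \<Rightarrow> 'e) measure" where "K y = path_law I X (P y)"

lemma path_law_X': "path_law I X' (Q (x, y)) = K x" and path_law_Y': "path_law I Y' (Q (x, y)) = K y"
  using coupling unfolding markovian_coupling_def K_def by auto

lemmas tI = X.time_set
lemmas cost_measurableI' = cost_measurableI[where I = I and \<rho> = \<rho> and R = R, OF tI rho_nonneg rho_le]
lemmas rate_bound' = rate_bound[where I = I and \<rho> = \<rho> and R = R, OF tI rho_nonneg rho_le]
lemmas cost_section' = cost_section[where I = I and \<rho> = \<rho> and R = R, OF tI rho_nonneg rho_le]
lemmas cost_nonneg' = cost_nonneg[where I = I and \<rho> = \<rho> and R = R, OF tI rho_nonneg rho_le]
lemmas cost_le' = cost_le[where I = I and \<rho> = \<rho> and R = R, OF tI rho_nonneg rho_le]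
lemmas measurable_cost' = measurable_cost[where I = I and \<rho> = \<rho> and R = R, OF tI rho_nonneg rho_le]
lemmas cost_split' = cost_split[where I = I and \<rho> = \<rho> and R = R, OF tI rho_nonneg rho_le]
lemmas cost_shift' = cost_shift[where I = I and \<rho> = \<rho> and R = R, OF tI rho_nonneg rho_le]
lemmas cost_measurable_shift' = cost_measurable_shift[where I = I and \<rho> = \<rho> and R = R, OF tI rho_nonneg rho_le]
lemmas penalization_eq_cost' = penalization_eq_cost[where I = I and \<rho> = \<rho> and R = R, OF tI rho_nonneg rho_le]
lemmas cost_version' = cost_version[where I = I and \<rho> = \<rho> and R = R, OF tI rho_nonneg rho_le]

lemma measurable_fst_borel: "fst \<in> measurable (borel :: ('e \<times> 'e) measure) borel"
  by (intro borel_measurable_continuous_onI continuous_on_fst continuous_on_id)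

lemma measurable_snd_borel: "snd \<in> measurable (borel :: ('e \<times> 'e) measure) borel"
  by (intro borel_measurable_continuous_onI continuous_on_snd continuous_on_id)

lemma measurable_X': "t \<in> I \<Longrightarrow> X' t \<in> measurable N borel"
  and measurable_Y': "t \<in> I \<Longrightarrow> Y' t \<in> measurable N borel"
  using measurable_compose[OF XY.measurable_X measurable_fst_borel] measurable_compose[OF XY.measurable_X measurable_snd_borel] by auto

lemma adapted_X': "t \<in> I \<Longrightarrow> X' t \<in> measurable (G t) borel"
  and adapted_Y': "t \<in> I \<Longrightarrow> Y' t \<in> measurable (G t) borel"
  using measurable_compose[OF XY.adapted measurable_fst_borel] measurable_compose[OF XY.adapted measurable_snd_borel] by auto

lemma measurable_G_mono: "s \<in> I \<Longrightarrow> t \<in> I \<Longrightarrow> s \<le> t \<Longrightarrow> f \<in> measurable (G s) A \<Longrightarrow> f \<in> measurable (G t) A"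
  using XY.mono_F[of s t] XY.subalgebra_F[of s] XY.subalgebra_F[of t]
  unfolding subalgebra_def by (auto simp: measurable_def)

lemma subalgebra_Q: "t \<in> I \<Longrightarrow> subalgebra (Q z) (G t)"
  using XY.subalgebra_F[of t] XY.sets_P[of z] XY.space_P[of z] unfolding subalgebra_def by simp

lemma subalgebra_P: "t \<in> I \<Longrightarrow> subalgebra (P x) (F t)"
  using X.subalgebra_F[of t] X.sets_P[of x] X.space_P[of x] unfolding subalgebra_def by simp

lemma rho_meas: "\<rho> \<in> borel_measurable borel"
  using borel_measurable_continuous_onI lipschitz_on_continuous_on[OF rho_lip] by blast

lemma cost_measurable_X: "cost_measurable I \<rho> M X"
  and cost_measurable_X': "cost_measurable I \<rho> N X'"
  and cost_measurable_Y': "cost_measurable I \<rho> N Y'"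
  using cost_measurableI'[OF well_defined rho_meas X.measurable_X]
    cost_measurableI'[OF well_defined_X' rho_meas measurable_X']
    cost_measurableI'[OF well_defined_Y' rho_meas measurable_Y'] by blast+

lemma cost_measurable_cong: "sets W = sets W' \<Longrightarrow> cost_measurable I \<rho> W \<xi> \<longleftrightarrow> cost_measurable I \<rho> W' \<xi>"
  unfolding cost_measurable_def by (simp cong: measurable_cong_sets sets_pair_measure_cong)

lemma cost_measurable_P: "cost_measurable I \<rho> (P x) X"
  and cost_measurable_QX: "cost_measurable I \<rho> (Q z) X'"
  and cost_measurable_QY: "cost_measurable I \<rho> (Q z) Y'"
  using cost_measurable_cong[OF X.sets_P] cost_measurable_cong[OF XY.sets_P]
    cost_measurable_X cost_measurable_X' cost_measurable_Y' by auto

definition p :: "real \<Rightarrow> ('e \<Rightarrow> real) \<Rightarrow> 'e \<Rightarrow> real" where "p t f x = penalized_semigroup I \<rho> P X t f x"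

lemma p_eq: "t \<in> I \<Longrightarrow> p t f x = (\<integral>\<omega>. exp (- cost I \<rho> X 0 t \<omega>) * f (X t \<omega>) \<partial>P x)"
  unfolding p_def penalized_semigroup_def using penalization_eq_cost'[OF cost_measurable_X]
  by (intro Bochner_Integration.integral_cong) (auto simp: X.space_P)

definition mass :: "real \<Rightarrow> 'e \<Rightarrow> real" where "mass t x = p t (\<lambda>_. 1) x"

lemma exp_cost_bounds:
  assumes "s \<in> I" "t \<in> I" "s \<le> t"
  shows "exp (- R * (t - s)) \<le> exp (- cost I \<rho> \<xi> s t \<omega>)" "exp (- cost I \<rho> \<xi> s t \<omega>) \<le> 1"
  using cost_le'[OF assms, of \<xi> \<omega>] cost_nonneg'[of \<xi> s t \<omega>] by auto

lemma exp_cost_meas: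
  assumes "cost_measurable I \<rho> W \<xi>" "s \<in> I" "t \<in> I" "s \<le> t"
  shows "(\<lambda>\<omega>. exp (- cost I \<rho> \<xi> s t \<omega>)) \<in> borel_measurable W"
  using measurable_cost'[OF assms] by simp

lemma time_nonneg': "t \<in> I \<Longrightarrow> 0 \<le> t" by (rule time_nonneg[OF tI])
lemma zero_I [simp]: "0 \<in> I" by (rule time_zero[OF tI])
lemma nat_I [simp]: "real n \<in> I" by (rule nat_time[OF tI])
lemma add_I [simp]: "s \<in> I \<Longrightarrow> t \<in> I \<Longrightarrow> s + t \<in> I" by (rule time_add[OF tI])

lemma integrable_P: 
  fixes f :: "'w \<Rightarrow> real"
  assumes "f \<in> borel_measurable M" "\<And>\<omega>. \<omega> \<in> space M \<Longrightarrow> \<bar>f \<omega>\<bar> \<le> b" shows "integrable (P x) f"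
proof -
  interpret prob_space "P x" by (rule X.prob_P)
  show ?thesis using assms by (intro integrable_const_bound[where B = b]) (auto simp: X.measurable_P X.space_P)
qed

lemma integrable_Q: 
  fixes f :: "'v \<Rightarrow> real"
  assumes "f \<in> borel_measurable N" "\<And>\<omega>. \<omega> \<in> space N \<Longrightarrow> \<bar>f \<omega>\<bar> \<le> b" shows "integrable (Q z) f"
proof -
  interpret prob_space "Q z" by (rule XY.prob_P)
  show ?thesis using assms by (intro integrable_const_bound[where B = b]) (auto simp: XY.measurable_P XY.space_P)
qed

lemma mass_bounds:
  assumes t: "t \<in> I" shows "exp (- R * t) \<le> mass t x" "mass t x \<le> 1"
proof -
  interpret prob_space "P x" by (rule X.prob_P)
  have t0: "0 \<le> t" using time_nonneg' t .
  have eq: "mass t x = (\<integral>\<omega>. exp (- cost I \<rho> X 0 t \<omega>) \<partial>P x)" unfolding mass_def p_eq[OF t] by simp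
  have b: "exp (- R * t) \<le> exp (- cost I \<rho> X 0 t \<omega>)" "exp (- cost I \<rho> X 0 t \<omega>) \<le> 1" for \<omega>
    using exp_cost_bounds[OF zero_I t t0, of X \<omega>] by auto
  have int: "integrable (P x) (\<lambda>\<omega>. exp (- cost I \<rho> X 0 t \<omega>))"
    using b(2) by (intro integrable_P[where b = 1] exp_cost_meas[OF cost_measurable_X zero_I t t0]) auto
  have "(\<integral>\<omega>. exp (- R * t) \<partial>P x) \<le> mass t x" unfolding eq using int b by (intro integral_mono) auto
  then show "exp (- R * t) \<le> mass t x" using prob_space by simp
  have "mass t x \<le> (\<integral>\<omega>. 1 \<partial>P x)" unfolding eq using int b by (intro integral_mono) auto
  then show "mass t x \<le> 1" using prob_space by simp
qed

lemma mass_pos: "t \<in> I \<Longrightarrow> 0 < mass t x"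
  using mass_bounds(1)[of t x] exp_gt_zero[of "- R * t"] by linarith

lemma dist_meas: "t \<in> I \<Longrightarrow> (\<lambda>\<omega>. dist (X' t \<omega>) (Y' t \<omega>)) \<in> borel_measurable N"
  using measurable_X' measurable_Y' by (intro borel_measurable_dist)

text \<open>The contraction multiplied by its normalizing mass. Unnormalized weights factor along
  time and can therefore be combined with the Markov property.\<close>

lemma weighted_contraction:
  assumes t: "t \<in> I"
  shows "(\<integral>\<omega>. exp (- cost I \<rho> X' 0 t \<omega>) * dist (X' t \<omega>) (Y' t \<omega>) \<partial>Q (x, y)) \<le> C * exp (- \<gamma> * t) * mass t x * dist x y"
proof -
  have m: "mass t x = (\<integral>\<omega>'. penalization I \<rho> X t \<omega>' \<partial>P x)" unfolding mass_def p_def penalized_semigroup_def by simp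
  have "(\<integral>\<omega>. penalization I \<rho> X' t \<omega> / mass t x * dist (X' t \<omega>) (Y' t \<omega>) \<partial>Q (x, y))
    = (\<integral>\<omega>. 1 / mass t x * (exp (- cost I \<rho> X' 0 t \<omega>) * dist (X' t \<omega>) (Y' t \<omega>)) \<partial>Q (x, y))"
    using penalization_eq_cost'[OF cost_measurable_X' _ t]
    by (intro Bochner_Integration.integral_cong) (auto simp: XY.space_P)
  also have "\<dots> = 1 / mass t x * (\<integral>\<omega>. exp (- cost I \<rho> X' 0 t \<omega>) * dist (X' t \<omega>) (Y' t \<omega>) \<partial>Q (x, y))" by simp
  finally have "1 / mass t x * (\<integral>\<omega>. exp (- cost I \<rho> X' 0 t \<omega>) * dist (X' t \<omega>) (Y' t \<omega>) \<partial>Q (x, y)) \<le> C * exp (- \<gamma> * t) * dist x y"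
    using contraction[OF t, of x y] mass_pos[OF t, of x] unfolding m[symmetric] by simp
  then show ?thesis using mass_pos[OF t, of x] by (simp add: field_simps)
qed

text \<open>Dropping the weight costs at most \<open>exp (R * u)\<close>. The bound is poor for long
  times, but it only has to provide regularity in the starting point at a fixed time.\<close>

lemma dist_contraction:
  assumes t: "t \<in> I" and u: "t \<le> u"
  shows "(\<integral>\<omega>. dist (X' t \<omega>) (Y' t \<omega>) \<partial>Q (x, y)) \<le> exp (R * u) * C * dist x y"
proof -
  have t0: "0 \<le> t" using time_nonneg' t .
  have i1: "integrable (Q (x, y)) (\<lambda>\<omega>. dist (X' t \<omega>) (Y' t \<omega>))"
    using dist_le by (intro integrable_Q[where b = D] dist_meas[OF t]) auto
  have i2: "integrable (Q (x, y)) (\<lambda>\<omega>. exp (- cost I \<rho> X' 0 t \<omega>) * dist (X' t \<omega>) (Y' t \<omega>))"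
  proof (rule integrable_Q[where b = "1 * D"])
    show "(\<lambda>\<omega>. exp (- cost I \<rho> X' 0 t \<omega>) * dist (X' t \<omega>) (Y' t \<omega>)) \<in> borel_measurable N"
      by (intro borel_measurable_times dist_meas[OF t] exp_cost_meas[OF cost_measurable_X' zero_I t t0])
    have "exp (- cost I \<rho> X' 0 t \<omega>) * dist (X' t \<omega>) (Y' t \<omega>) \<le> 1 * D" for \<omega>
      using dist_le exp_cost_bounds(2)[OF zero_I t t0] by (intro mult_mono) auto
    then show "\<bar>exp (- cost I \<rho> X' 0 t \<omega>) * dist (X' t \<omega>) (Y' t \<omega>)\<bar> \<le> 1 * D" for \<omega> by simp
  qed
  have "(\<integral>\<omega>. exp (- R * t) * dist (X' t \<omega>) (Y' t \<omega>) \<partial>Q (x, y)) \<le> (\<integral>\<omega>. exp (- cost I \<rho> X' 0 t \<omega>) * dist (X' t \<omega>) (Y' t \<omega>) \<partial>Q (x, y))"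
    using i1 i2 exp_cost_bounds(1)[OF zero_I t t0, of X'] by (intro integral_mono mult_right_mono) auto
  also have "\<dots> \<le> C * exp (- \<gamma> * t) * mass t x * dist x y" by (rule weighted_contraction[OF t])
  also have "\<dots> \<le> C * 1 * 1 * dist x y"
    using mass_bounds(2)[OF t, of x] mass_pos[OF t, of x] pos t0 by (intro mult_right_mono mult_mono) auto
  finally have "exp (- R * t) * (\<integral>\<omega>. dist (X' t \<omega>) (Y' t \<omega>) \<partial>Q (x, y)) \<le> C * dist x y" by simp
  then have "(\<integral>\<omega>. dist (X' t \<omega>) (Y' t \<omega>) \<partial>Q (x, y)) \<le> exp (R * t) * (C * dist x y)"
    by (simp add: exp_minus field_simps)
  also have "\<dots> \<le> exp (R * u) * (C * dist x y)" using pos u by (intro mult_right_mono) auto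
  finally show ?thesis by (simp add: mult.assoc)
qed

section \<open>Path laws and Markov property of the coupled processes\<close>

lemma
  fixes \<Phi> :: "(real \<Rightarrow> 'e) \<Rightarrow> real"
  assumes "\<Phi> \<in> borel_measurable (PiM I (\<lambda>_. borel))"
  shows integral_K_P: "(\<integral>\<pi>. \<Phi> \<pi> \<partial>K x) = (\<integral>\<omega>. \<Phi> (\<lambda>s\<in>I. X s \<omega>) \<partial>P x)"
    and integral_K_X': "(\<integral>\<pi>. \<Phi> \<pi> \<partial>K x) = (\<integral>\<omega>. \<Phi> (\<lambda>s\<in>I. X' s \<omega>) \<partial>Q (x, y))"
    and integral_K_Y': "(\<integral>\<pi>. \<Phi> \<pi> \<partial>K y) = (\<integral>\<omega>. \<Phi> (\<lambda>s\<in>I. Y' s \<omega>) \<partial>Q (x, y))"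
proof -
  show "(\<integral>\<pi>. \<Phi> \<pi> \<partial>K x) = (\<integral>\<omega>. \<Phi> (\<lambda>s\<in>I. X s \<omega>) \<partial>P x)" unfolding K_def by (rule X.integral_path_law[OF assms])
  have mX: "(\<lambda>\<omega>. \<lambda>s\<in>I. X' s \<omega>) \<in> measurable (Q (x, y)) (PiM I (\<lambda>_. borel))"
    unfolding XY.measurable_P by (intro measurable_restrict measurable_X')
  have mY: "(\<lambda>\<omega>. \<lambda>s\<in>I. Y' s \<omega>) \<in> measurable (Q (x, y)) (PiM I (\<lambda>_. borel))"
    unfolding XY.measurable_P by (intro measurable_restrict measurable_Y')
  show "(\<integral>\<pi>. \<Phi> \<pi> \<partial>K x) = (\<integral>\<omega>. \<Phi> (\<lambda>s\<in>I. X' s \<omega>) \<partial>Q (x, y))"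
    unfolding path_law_X'[symmetric, of x y] path_law_def by (rule integral_distr[OF mX assms])
  show "(\<integral>\<pi>. \<Phi> \<pi> \<partial>K y) = (\<integral>\<omega>. \<Phi> (\<lambda>s\<in>I. Y' s \<omega>) \<partial>Q (x, y))"
    unfolding path_law_Y'[symmetric, of y x] path_law_def by (rule integral_distr[OF mY assms])
qed

lemma markov_at_X: "t \<in> I \<Longrightarrow> markov_at I K (P x) (F t) X t"
  using X.markov_at[of t x] unfolding K_def[abs_def] .

text \<open>Each component of the coupling is Markov with respect to the joint past, with the kernel
  of the original process: given this past, the future pair has the law of the coupling started at
  the current pair, and the marginal of that law depends on the current value of the component
  alone.\<close>

lemma markov_at_projection:
  assumes t: "t \<in> I" and pr: "pr \<in> measurable borel borel" and \<xi>: "\<And>s \<omega>. \<xi> s \<omega> = pr (X' s \<omega>, Y' s \<omega>)"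
    and law: "\<And>\<Phi> z. \<Phi> \<in> borel_measurable (PiM I (\<lambda>_. borel)) \<Longrightarrow> (\<integral>\<pi>. \<Phi> \<pi> \<partial>K (pr z)) = (\<integral>\<omega>. \<Phi> (\<lambda>s\<in>I. \<xi> s \<omega>) \<partial>Q z :: real)"
  shows "markov_at I K (Q z) (G t) \<xi> t"
  unfolding markov_at_def
proof (intro allI impI)
  fix H :: "'v \<Rightarrow> real" and \<Phi> :: "(real \<Rightarrow> 'e) \<Rightarrow> real" and B :: real
  assume H: "H \<in> borel_measurable (G t)" "\<forall>\<omega>. 0 \<le> H \<omega> \<and> H \<omega> \<le> 1"
    and \<Phi>: "\<Phi> \<in> borel_measurable (PiM I (\<lambda>_. borel))" and B: "\<forall>\<pi>. \<bar>\<Phi> \<pi>\<bar> \<le> B"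
  have mp: "(\<lambda>\<pi>. \<lambda>s\<in>I. pr (\<pi> s)) \<in> measurable (PiM I (\<lambda>_. borel)) (PiM I (\<lambda>_. borel))"
    by (intro measurable_restrict) (rule measurable_compose[OF _ pr], simp)
  have \<Phi>2: "(\<lambda>\<pi>. \<Phi> (\<lambda>s\<in>I. pr (\<pi> s))) \<in> borel_measurable (PiM I (\<lambda>_. borel))"
    by (rule measurable_compose[OF mp \<Phi>])
  have e: "(\<lambda>s\<in>I. pr ((\<lambda>s\<in>I. (X' (r + s) \<omega>, Y' (r + s) \<omega>)) s)) = (\<lambda>s\<in>I. \<xi> (r + s) \<omega>)" for r \<omega>
    by (auto simp: \<xi> restrict_def)
  have e0: "(\<lambda>s\<in>I. pr ((\<lambda>s\<in>I. (X' s \<omega>, Y' s \<omega>)) s)) = (\<lambda>s\<in>I. \<xi> s \<omega>)" for \<omega>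
    by (auto simp: \<xi> restrict_def)
  have "(\<integral>\<omega>. H \<omega> * \<Phi> (\<lambda>s\<in>I. pr ((\<lambda>s\<in>I. (X' (t + s) \<omega>, Y' (t + s) \<omega>)) s)) \<partial>Q z)
    = (\<integral>\<omega>. H \<omega> * (\<integral>\<pi>. \<Phi> (\<lambda>s\<in>I. pr (\<pi> s)) \<partial>path_law I (\<lambda>t \<omega>. (X' t \<omega>, Y' t \<omega>)) (Q (X' t \<omega>, Y' t \<omega>))) \<partial>Q z)"
    using XY.markov_at[OF t, of z] H \<Phi>2 B unfolding markov_at_def by blast
  then show "(\<integral>\<omega>. H \<omega> * \<Phi> (\<lambda>s\<in>I. \<xi> (t + s) \<omega>) \<partial>Q z) = (\<integral>\<omega>. H \<omega> * (\<integral>\<pi>. \<Phi> \<pi> \<partial>K (\<xi> t \<omega>)) \<partial>Q z)"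
    unfolding e XY.integral_path_law[OF \<Phi>2] e0 \<xi>[of t] law[OF \<Phi>] .
qed

lemma markov_at_X': "t \<in> I \<Longrightarrow> markov_at I K (Q z) (G t) X' t"
  by (rule markov_at_projection[where pr = fst]) (use integral_K_X' in \<open>auto simp: measurable_fst_borel\<close>)

lemma markov_at_Y': "t \<in> I \<Longrightarrow> markov_at I K (Q z) (G t) Y' t"
  by (rule markov_at_projection[where pr = snd]) (use integral_K_Y' in \<open>auto simp: measurable_snd_borel\<close>)

text \<open>Scaled so that its mean over one sampled time is the cost on \<open>[0, u)\<close>
  divided by \<open>n\<close>; the factor \<open>u + 1\<close> compensates the density of the
  sampling law.\<close>

definition rate :: "real \<Rightarrow> nat \<Rightarrow> (real \<Rightarrow> 'x \<Rightarrow> 'e) \<Rightarrow> real \<Rightarrow> 'x \<Rightarrow> real" where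
  "rate u n \<xi> s \<omega> = (u + 1) / real n * (indicator {0..<u} s * (indicator I s * \<rho> (\<xi> s \<omega>)))"

text \<open>The uniform law on the times in \<open>[0, u + 1)\<close>. The window
  \<open>[0, u)\<close> would be empty for \<open>u = 0\<close> and could not be normalized.\<close>

definition sampler :: "real \<Rightarrow> real measure" where
  "sampler u = density (window I 0 (u + 1)) (\<lambda>_. ennreal (1 / (u + 1)))"

text \<open>Depends on finitely many path coordinates, hence is measurable for the product
  sigma-algebra, as the penalization in continuous time need not be. Averaging over \<open>r\<close>
  turns the product into the \<open>n\<close>-th power of \<open>1 - cost / n\<close>.\<close>

definition sampled :: "real \<Rightarrow> nat \<Rightarrow> (nat \<Rightarrow> real) \<Rightarrow> ('e \<Rightarrow> real) \<Rightarrow> (real \<Rightarrow> 'e) \<Rightarrow> real" where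
  "sampled u n r f \<pi> = f (\<pi> u) * (\<Prod>i<n. 1 - rate u n (\<lambda>s \<pi>. \<pi> s) (r i) \<pi>)"

lemma sampled_path: "u \<in> I \<Longrightarrow> sampled u n r f (\<lambda>s\<in>I. \<xi> s \<omega>) = f (\<xi> u \<omega>) * (\<Prod>i<n. 1 - rate u n \<xi> (r i) \<omega>)"
  unfolding sampled_def rate_def by (auto simp: indicator_def intro!: prod.cong)

lemma rate_bounds:
  assumes u: "u \<in> I" and n: "(u + 1) * R \<le> real n"
  shows "0 \<le> rate u n \<xi> s \<omega>" "rate u n \<xi> s \<omega> \<le> 1"
proof -
  have u0: "0 \<le> u" using time_nonneg' u .
  then have "0 < (u + 1) * R" using pos by simp
  then have n0: "0 < real n" using n by linarith
  show "0 \<le> rate u n \<xi> s \<omega>" unfolding rate_def using u0 rho_nonneg by simp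
  have "indicator {0..<u} s * (indicator I s * \<rho> (\<xi> s \<omega>)) \<le> R"
    using rho_le[of "\<xi> s \<omega>"] pos by (auto simp: indicator_def)
  then have "rate u n \<xi> s \<omega> \<le> (u + 1) / real n * R" unfolding rate_def using u0 by (intro mult_left_mono) auto
  also have "\<dots> \<le> 1" using n n0 by (simp add: field_simps)
  finally show "rate u n \<xi> s \<omega> \<le> 1" .
qed

lemma sets_sampler [simp, measurable_cong]: "sets (sampler u) = sets borel" unfolding sampler_def by simp

lemma space_sampler [simp]: "space (sampler u) = UNIV" unfolding sampler_def by simp

lemma prob_sampler: assumes u: "u \<in> I" shows "prob_space (sampler u)"
proof
  have u0: "0 \<le> u" using time_nonneg' u .
  have "emeasure (sampler u) UNIV = ennreal (1 / (u + 1)) * emeasure (window I 0 (u + 1)) UNIV"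
    unfolding sampler_def by (subst emeasure_density) (auto simp: nn_integral_const)
  also have "emeasure (window I 0 (u + 1)) UNIV = ennreal (u + 1)"
    using emeasure_window[OF tI zero_I, of "u + 1"] u0 u nat_I[of 1] by (simp del: ennreal_plus)
  also have "ennreal (1 / (u + 1)) * ennreal (u + 1) = ennreal (1 / (u + 1) * (u + 1))"
    using u0 by (intro ennreal_mult[symmetric]) auto
  also have "\<dots> = 1" using u0 by simp
  finally show "emeasure (sampler u) (space (sampler u)) = 1" by simp
qed

lemma rate_section:
  assumes "cost_measurable I \<rho> W \<xi>" "\<omega> \<in> space W"
  shows "(\<lambda>s. rate u n \<xi> s \<omega>) \<in> borel_measurable borel"
  unfolding rate_def
  by (rule borel_measurable_times[OF borel_measurable_const borel_measurable_times[OF _ cost_section'[OF assms]]]) simp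

lemma rate_measurable:
  assumes "cost_measurable I \<rho> W \<xi>"
  shows "(\<lambda>(s, \<omega>). 1 - rate u n \<xi> s \<omega>) \<in> borel_measurable (sampler u \<Otimes>\<^sub>M W)"
proof -
  have "(\<lambda>z. (u + 1) / real n * (indicator {0..<u} (fst z) * (case z of (s, \<omega>) \<Rightarrow> indicator I s * \<rho> (\<xi> s \<omega>)))) \<in> borel_measurable (borel \<Otimes>\<^sub>M W)"
    using assms unfolding cost_measurable_def by (intro borel_measurable_times) auto
  then have "(\<lambda>z. 1 - (u + 1) / real n * (indicator {0..<u} (fst z) * (case z of (s, \<omega>) \<Rightarrow> indicator I s * \<rho> (\<xi> s \<omega>)))) \<in> borel_measurable (sampler u \<Otimes>\<^sub>M W)"
    by (subst measurable_cong_sets[OF sets_pair_measure_cong[OF sets_sampler refl] refl]) (intro borel_measurable_diff, auto)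
  then show ?thesis unfolding rate_def by (simp add: case_prod_beta)
qed

lemma integral_sampler:
  assumes \<xi>: "cost_measurable I \<rho> W \<xi>" "\<omega> \<in> space W" and u: "u \<in> I" and n: "(u + 1) * R \<le> real n"
  shows "(\<integral>s. 1 - rate u n \<xi> s \<omega> \<partial>sampler u) = 1 - cost I \<rho> \<xi> 0 u \<omega> / real n"
proof -
  interpret U: prob_space "sampler u" by (rule prob_sampler[OF u])
  have u0: "0 \<le> u" using time_nonneg' u .
  let ?g = "\<lambda>s. indicator I s * \<rho> (\<xi> s \<omega>)"
  have sec: "?g \<in> borel_measurable borel" by (rule cost_section'[OF \<xi>])
  have rs: "(\<lambda>s. rate u n \<xi> s \<omega>) \<in> borel_measurable borel" by (rule rate_section[OF \<xi>])
  have "\<bar>rate u n \<xi> s \<omega>\<bar> \<le> 1" for s using rate_bounds[OF u n, of \<xi> s \<omega>] by simp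
  then have int: "integrable (sampler u) (\<lambda>s. rate u n \<xi> s \<omega>)"
    using rs by (intro U.integrable_const_bound[where B = 1]) auto
  have "(\<integral>s. rate u n \<xi> s \<omega> \<partial>sampler u) = (\<integral>s. 1 / (u + 1) * rate u n \<xi> s \<omega> \<partial>window I 0 (u + 1))"
    unfolding sampler_def using rs u0 by (subst integral_density) auto
  also have "\<dots> = (\<integral>s. indicator {0..<u + 1} s * (1 / (u + 1) * rate u n \<xi> s \<omega>) \<partial>clock I)"
    using rs by (intro integral_window) auto
  also have "\<dots> = (\<integral>s. 1 / real n * (indicator {0..<u} s * ?g s) \<partial>clock I)"
  proof (rule Bochner_Integration.integral_cong)
    have c: "1 / (u + 1) * ((u + 1) / real n * z) = 1 / real n * z" for z using u0 by simp
    show "indicator {0..<u + 1} s * (1 / (u + 1) * rate u n \<xi> s \<omega>) = 1 / real n * (indicator {0..<u} s * ?g s)" for s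
      unfolding rate_def c by (simp add: indicator_def)
  qed simp
  also have "\<dots> = cost I \<rho> \<xi> 0 u \<omega> / real n"
    unfolding cost_def integral_window[OF sec] by simp
  finally show ?thesis using int U.prob_space by simp
qed

lemma integral_sampled:
  assumes W: "prob_space W" and \<xi>: "cost_measurable I \<rho> W \<xi>" and u: "u \<in> I" and n: "(u + 1) * R \<le> real n"
    and k: "k \<in> borel_measurable W" "\<And>\<omega>. \<bar>k \<omega>\<bar> \<le> B"
  shows "(\<integral>r. (\<integral>\<omega>. k \<omega> * (\<Prod>i<n. 1 - rate u n \<xi> (r i) \<omega>) \<partial>W) \<partial>PiM {..<n} (\<lambda>_. sampler u))
      = (\<integral>\<omega>. k \<omega> * (1 - cost I \<rho> \<xi> 0 u \<omega> / real n) ^ n \<partial>W)"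
    and "(\<lambda>(r, \<omega>). k \<omega> * (\<Prod>i<n. 1 - rate u n \<xi> (r i) \<omega>)) \<in> borel_measurable (PiM {..<n} (\<lambda>_. sampler u) \<Otimes>\<^sub>M W)"
proof -
  have b: "\<bar>1 - rate u n \<xi> s \<omega>\<bar> \<le> 1" for s \<omega> using rate_bounds[OF u n, of \<xi> s \<omega>] by auto
  note s = integral_sampled_product[OF prob_sampler[OF u] W rate_measurable[OF \<xi>, of u n] b k, where n = n]
  show "(\<lambda>(r, \<omega>). k \<omega> * (\<Prod>i<n. 1 - rate u n \<xi> (r i) \<omega>)) \<in> borel_measurable (PiM {..<n} (\<lambda>_. sampler u) \<Otimes>\<^sub>M W)" by (rule s(2))
  show "(\<integral>r. (\<integral>\<omega>. k \<omega> * (\<Prod>i<n. 1 - rate u n \<xi> (r i) \<omega>) \<partial>W) \<partial>PiM {..<n} (\<lambda>_. sampler u))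
      = (\<integral>\<omega>. k \<omega> * (1 - cost I \<rho> \<xi> 0 u \<omega> / real n) ^ n \<partial>W)"
    unfolding s(1) by (intro Bochner_Integration.integral_cong refl) (simp add: integral_sampler[OF \<xi> _ u n])
qed

lemma power_limit:
  assumes u: "u \<in> I" shows "(\<lambda>n. (1 - cost I \<rho> \<xi> 0 u \<omega> / real n) ^ n) \<longlonglongrightarrow> exp (- cost I \<rho> \<xi> 0 u \<omega>)"
  using tendsto_exp_limit_sequentially[of "- cost I \<rho> \<xi> 0 u \<omega>"] by simp

lemma power_bounds:
  assumes u: "u \<in> I" and n: "(u + 1) * R \<le> real n"
  shows "0 \<le> (1 - cost I \<rho> \<xi> 0 u \<omega> / real n) ^ n" "(1 - cost I \<rho> \<xi> 0 u \<omega> / real n) ^ n \<le> 1"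
proof -
  have u0: "0 \<le> u" using time_nonneg' u .
  have c: "0 \<le> cost I \<rho> \<xi> 0 u \<omega>" "cost I \<rho> \<xi> 0 u \<omega> \<le> R * u"
    using cost_nonneg'[of \<xi> 0 u \<omega>] cost_le'[OF zero_I u u0, of \<xi> \<omega>] by auto
  have "0 < (u + 1) * R" using u0 pos by simp
  then have n0: "0 < real n" using n by linarith
  have "R * u \<le> real n" using n pos by (simp add: algebra_simps)
  then have "cost I \<rho> \<xi> 0 u \<omega> / real n \<le> 1" using c n0 by simp
  moreover have "0 \<le> cost I \<rho> \<xi> 0 u \<omega> / real n" using c by simp
  ultimately show "0 \<le> (1 - cost I \<rho> \<xi> 0 u \<omega> / real n) ^ n" "(1 - cost I \<rho> \<xi> 0 u \<omega> / real n) ^ n \<le> 1"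
    by (auto intro!: power_le_one)
qed

lemma sampled_measurable:
  assumes u: "u \<in> I" and f: "f \<in> borel_measurable borel"
  shows "sampled u n r f \<in> borel_measurable (PiM I (\<lambda>_. borel))"
proof -
  have "(\<lambda>\<pi>. 1 - rate u n (\<lambda>s \<pi>. \<pi> s) (r i) \<pi>) \<in> borel_measurable (PiM I (\<lambda>_. borel))" for i
  proof (cases "r i \<in> I")
    case True
    have "(\<lambda>\<pi>. \<rho> (\<pi> (r i))) \<in> borel_measurable (PiM I (\<lambda>_. borel))"
      using measurable_compose[OF _ rho_meas] measurable_component_singleton[OF True] by fast
    then show ?thesis unfolding rate_def by measurable
  qed (simp add: rate_def)
  moreover have "(\<lambda>\<pi>. f (\<pi> u)) \<in> borel_measurable (PiM I (\<lambda>_. borel))"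
    using measurable_compose[OF _ f] measurable_component_singleton[OF u] by fast
  ultimately show ?thesis unfolding sampled_def[abs_def] by (intro borel_measurable_times borel_measurable_prod) auto
qed

lemma prod_rate_le:
  assumes u: "u \<in> I" and n: "(u + 1) * R \<le> real n"
  shows "\<bar>\<Prod>i<n. 1 - rate u n \<xi> (r i) \<omega>\<bar> \<le> 1"
proof -
  have "\<bar>1 - rate u n \<xi> (r i) \<omega>\<bar> \<le> 1" for i using rate_bounds[OF u n, of \<xi> "r i" \<omega>] by simp
  then show ?thesis unfolding abs_prod by (intro prod_le_1) auto
qed

lemma sampled_bound:
  assumes u: "u \<in> I" and n: "(u + 1) * R \<le> real n" and b: "\<And>z. \<bar>f z\<bar> \<le> b"
  shows "\<bar>sampled u n r f \<pi>\<bar> \<le> b"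
proof -
  have "\<bar>f (\<pi> u)\<bar> * \<bar>\<Prod>i<n. 1 - rate u n (\<lambda>s \<pi>. \<pi> s) (r i) \<pi>\<bar> \<le> b * 1"
    using b[of "\<pi> u"] prod_rate_le[OF u n] by (intro mult_mono) auto
  then show ?thesis unfolding sampled_def by (simp add: abs_mult)
qed

lemma rate_le_dist:
  assumes "u \<in> I"
  shows "\<bar>rate u n X' s \<omega> - rate u n Y' s \<omega>\<bar> \<le> (u + 1) / real n * (L * (indicator (I \<inter> {0..<u}) s * dist (X' s \<omega>) (Y' s \<omega>)))"
proof -
  have u0: "0 \<le> u" using time_nonneg' assms .
  have "\<bar>\<rho> (X' s \<omega>) - \<rho> (Y' s \<omega>)\<bar> \<le> L * dist (X' s \<omega>) (Y' s \<omega>)"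
    using rho_lip by (auto simp: lipschitz_on_def dist_real_def)
  then have "(u + 1) / real n * \<bar>indicator (I \<inter> {0..<u}) s * (\<rho> (X' s \<omega>) - \<rho> (Y' s \<omega>))\<bar>
    \<le> (u + 1) / real n * (L * (indicator (I \<inter> {0..<u}) s * dist (X' s \<omega>) (Y' s \<omega>)))"
    using u0 by (intro mult_left_mono) (auto simp: indicator_def)
  moreover have "rate u n X' s \<omega> - rate u n Y' s \<omega> = (u + 1) / real n * (indicator (I \<inter> {0..<u}) s * (\<rho> (X' s \<omega>) - \<rho> (Y' s \<omega>)))"
    unfolding rate_def by (simp add: indicator_def right_diff_distrib)
  ultimately show ?thesis using u0 by (simp add: abs_mult)
qed

text \<open>The \<open>n\<close> factors of the product contribute \<open>b * ((u + 1) * L)\<close>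
  together, whatever \<open>n\<close> is, and the final function contributes \<open>l\<close>; both
  are multiplied by the constant of \<open>dist_contraction\<close>.\<close>

definition lip_const :: "real \<Rightarrow> real \<Rightarrow> real \<Rightarrow> real" where
  "lip_const u b l = (b * ((u + 1) * L) + l) * (exp (R * u) * C)"

text \<open>Each of the \<open>n\<close> factors changes by a multiple of the distance at its time
  divided by \<open>n\<close>, so the constant depends neither on \<open>n\<close> nor on the
  sampled times and survives the limit.\<close>

lemma sampled_lipschitz:
  assumes u: "u \<in> I" and n: "(u + 1) * R \<le> real n" and f: "l-lipschitz_on UNIV f" and b: "\<And>z. \<bar>f z\<bar> \<le> b"
  shows "\<bar>(\<integral>\<pi>. sampled u n r f \<pi> \<partial>K x) - (\<integral>\<pi>. sampled u n r f \<pi> \<partial>K y)\<bar> \<le> lip_const u b l * dist x y"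
proof -
  have u0: "0 \<le> u" using time_nonneg' u .
  have b0: "0 \<le> b" using b[of undefined] by linarith
  have l0: "0 \<le> l" using f by (simp add: lipschitz_on_def)
  have "0 < (u + 1) * R" using u0 pos by simp
  then have n0: "0 < real n" using n by linarith
  have f_meas: "f \<in> borel_measurable borel"
    using borel_measurable_continuous_onI lipschitz_on_continuous_on[OF f] by blast
  let ?S = "sampled u n r f"
  let ?d = "\<lambda>s \<omega>. dist (X' s \<omega>) (Y' s \<omega>)"
  let ?W = "\<lambda>\<omega>. b * (\<Sum>i<n. (u + 1) / real n * (L * (indicator (I \<inter> {0..<u}) (r i) * ?d (r i) \<omega>))) + l * ?d u \<omega>"
  have Sm: "?S \<in> borel_measurable (PiM I (\<lambda>_. borel))" by (rule sampled_measurable[OF u f_meas])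
  have mX: "(\<lambda>\<omega>. ?S (\<lambda>s\<in>I. X' s \<omega>)) \<in> borel_measurable N"
    by (rule measurable_compose[OF _ Sm]) (intro measurable_restrict measurable_X')
  have mY: "(\<lambda>\<omega>. ?S (\<lambda>s\<in>I. Y' s \<omega>)) \<in> borel_measurable N"
    by (rule measurable_compose[OF _ Sm]) (intro measurable_restrict measurable_Y')
  have iX: "integrable (Q (x, y)) (\<lambda>\<omega>. ?S (\<lambda>s\<in>I. X' s \<omega>))" by (rule integrable_Q[OF mX sampled_bound[OF u n b]])
  have iY: "integrable (Q (x, y)) (\<lambda>\<omega>. ?S (\<lambda>s\<in>I. Y' s \<omega>))" by (rule integrable_Q[OF mY sampled_bound[OF u n b]])
  have id: "integrable (Q (x, y)) (\<lambda>\<omega>. ?d s \<omega>)" if "s \<in> I" for s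
    using dist_le by (intro integrable_Q[where b = D] dist_meas[OF that]) auto
  have idi: "integrable (Q (x, y)) (\<lambda>\<omega>. indicator (I \<inter> {0..<u}) s * ?d s \<omega>)" for s
    by (cases "s \<in> I") (use id in auto)
  have iW: "integrable (Q (x, y)) ?W"
    by (intro Bochner_Integration.integrable_add integrable_mult_right Bochner_Integration.integrable_sum idi id[OF u])
  have ptw: "\<bar>?S (\<lambda>s\<in>I. X' s \<omega>) - ?S (\<lambda>s\<in>I. Y' s \<omega>)\<bar> \<le> ?W \<omega>" for \<omega>
  proof -
    let ?PX = "\<Prod>i<n. 1 - rate u n X' (r i) \<omega>" and ?PY = "\<Prod>i<n. 1 - rate u n Y' (r i) \<omega>"
    have "norm (?PX - ?PY) \<le> (\<Sum>i<n. norm ((1 - rate u n X' (r i) \<omega>) - (1 - rate u n Y' (r i) \<omega>)))"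
    proof (intro norm_prod_diff)
      show "norm (1 - rate u n X' (r i) \<omega>) \<le> 1" "norm (1 - rate u n Y' (r i) \<omega>) \<le> 1" for i
        using rate_bounds[OF u n, of X' "r i" \<omega>] rate_bounds[OF u n, of Y' "r i" \<omega>] by simp_all
    qed
    also have "\<dots> \<le> (\<Sum>i<n. (u + 1) / real n * (L * (indicator (I \<inter> {0..<u}) (r i) * ?d (r i) \<omega>)))"
    proof (rule sum_mono)
      fix i
      have "norm ((1 - rate u n X' (r i) \<omega>) - (1 - rate u n Y' (r i) \<omega>)) = \<bar>rate u n X' (r i) \<omega> - rate u n Y' (r i) \<omega>\<bar>" by simp
      also have "\<dots> \<le> (u + 1) / real n * (L * (indicator (I \<inter> {0..<u}) (r i) * ?d (r i) \<omega>))" by (rule rate_le_dist[OF u])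
      finally show "norm ((1 - rate u n X' (r i) \<omega>) - (1 - rate u n Y' (r i) \<omega>)) \<le> (u + 1) / real n * (L * (indicator (I \<inter> {0..<u}) (r i) * ?d (r i) \<omega>))" .
    qed
    finally have P: "\<bar>?PX - ?PY\<bar> \<le> (\<Sum>i<n. (u + 1) / real n * (L * (indicator (I \<inter> {0..<u}) (r i) * ?d (r i) \<omega>)))" by simp
    have fd: "\<bar>f (X' u \<omega>) - f (Y' u \<omega>)\<bar> \<le> l * ?d u \<omega>" using f by (auto simp: lipschitz_on_def dist_real_def)
    have "f (X' u \<omega>) * ?PX - f (Y' u \<omega>) * ?PY = f (X' u \<omega>) * (?PX - ?PY) + (f (X' u \<omega>) - f (Y' u \<omega>)) * ?PY" by (simp add: algebra_simps)
    then have "\<bar>f (X' u \<omega>) * ?PX - f (Y' u \<omega>) * ?PY\<bar> \<le> \<bar>f (X' u \<omega>)\<bar> * \<bar>?PX - ?PY\<bar> + \<bar>f (X' u \<omega>) - f (Y' u \<omega>)\<bar> * \<bar>?PY\<bar>"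
      by (simp only: abs_mult[symmetric] abs_triangle_ineq)
    also have "\<dots> \<le> b * (\<Sum>i<n. (u + 1) / real n * (L * (indicator (I \<inter> {0..<u}) (r i) * ?d (r i) \<omega>))) + l * ?d u \<omega> * 1"
      using P fd b b0 l0 prod_rate_le[OF u n] by (intro add_mono mult_mono) auto
    finally show ?thesis unfolding sampled_path[OF u] by simp
  qed
  have "(\<integral>\<pi>. ?S \<pi> \<partial>K x) - (\<integral>\<pi>. ?S \<pi> \<partial>K y) = (\<integral>\<omega>. ?S (\<lambda>s\<in>I. X' s \<omega>) - ?S (\<lambda>s\<in>I. Y' s \<omega>) \<partial>Q (x, y))"
    unfolding integral_K_X'[OF Sm, of x y] integral_K_Y'[OF Sm, of y x] using iX iY by simp
  then have "\<bar>(\<integral>\<pi>. ?S \<pi> \<partial>K x) - (\<integral>\<pi>. ?S \<pi> \<partial>K y)\<bar> \<le> (\<integral>\<omega>. \<bar>?S (\<lambda>s\<in>I. X' s \<omega>) - ?S (\<lambda>s\<in>I. Y' s \<omega>)\<bar> \<partial>Q (x, y))"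
    by (simp only: integral_abs_bound)
  also have "\<dots> \<le> (\<integral>\<omega>. ?W \<omega> \<partial>Q (x, y))" using iX iY iW ptw by (intro integral_mono) auto
  also have "\<dots> = b * (\<Sum>i<n. (u + 1) / real n * (L * (\<integral>\<omega>. indicator (I \<inter> {0..<u}) (r i) * ?d (r i) \<omega> \<partial>Q (x, y)))) + l * (\<integral>\<omega>. ?d u \<omega> \<partial>Q (x, y))"
    using idi id[OF u] by (simp del: integral_mult_right_zero add: integral_mult_right integrable_mult_right)
  also have "\<dots> \<le> b * (\<Sum>i<n. (u + 1) / real n * (L * (exp (R * u) * C * dist x y))) + l * (exp (R * u) * C * dist x y)"
  proof (intro add_mono mult_left_mono sum_mono)
    fix i
    show "(\<integral>\<omega>. indicator (I \<inter> {0..<u}) (r i) * ?d (r i) \<omega> \<partial>Q (x, y)) \<le> exp (R * u) * C * dist x y"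
    proof (cases "r i \<in> I \<inter> {0..<u}")
      case True then show ?thesis using dist_contraction[of "r i" u x y] by simp
    next
      case False then show ?thesis using pos by simp
    qed
    show "(\<integral>\<omega>. ?d u \<omega> \<partial>Q (x, y)) \<le> exp (R * u) * C * dist x y" by (rule dist_contraction[OF u order_refl])
  qed (use b0 l0 u0 pos in auto)
  also have "\<dots> = lip_const u b l * dist x y"
    unfolding lip_const_def using n0 by (simp add: field_simps)
  finally show ?thesis .
qed

text \<open>The approximation of \<open>p u f\<close> that results from averaging
  \<open>sampled\<close> over the sampled times.\<close>

definition q :: "real \<Rightarrow> nat \<Rightarrow> ('e \<Rightarrow> real) \<Rightarrow> 'e \<Rightarrow> real" where
  "q u n f y = (\<integral>\<omega>. f (X u \<omega>) * (1 - cost I \<rho> X 0 u \<omega> / real n) ^ n \<partial>P y)"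

lemma K_sampled_measurable:
  assumes u: "u \<in> I" and n: "(u + 1) * R \<le> real n" and f: "f \<in> borel_measurable borel" and b: "\<And>z. \<bar>f z\<bar> \<le> b"
  shows "(\<lambda>r. \<integral>\<pi>. sampled u n r f \<pi> \<partial>K y) \<in> borel_measurable (PiM {..<n} (\<lambda>_. sampler u))"
    and "(\<integral>r. (\<integral>\<pi>. sampled u n r f \<pi> \<partial>K y) \<partial>PiM {..<n} (\<lambda>_. sampler u)) = q u n f y"
proof -
  interpret Py: prob_space "P y" by (rule X.prob_P)
  have k: "(\<lambda>\<omega>. f (X u \<omega>)) \<in> borel_measurable (P y)"
    unfolding X.measurable_P by (rule measurable_compose[OF X.measurable_X[OF u] f])
  have kb: "\<bar>f (X u \<omega>)\<bar> \<le> b" for \<omega> by (rule b)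
  have eq: "(\<integral>\<pi>. sampled u n r f \<pi> \<partial>K y) = (\<integral>\<omega>. f (X u \<omega>) * (\<Prod>i<n. 1 - rate u n X (r i) \<omega>) \<partial>P y)" for r
    unfolding integral_K_P[OF sampled_measurable[OF u f]] sampled_path[OF u] ..
  show "(\<lambda>r. \<integral>\<pi>. sampled u n r f \<pi> \<partial>K y) \<in> borel_measurable (PiM {..<n} (\<lambda>_. sampler u))"
    unfolding eq
    by (rule Py.borel_measurable_lebesgue_integral[OF integral_sampled(2)[OF X.prob_P cost_measurable_P u n k kb]])
  show "(\<integral>r. (\<integral>\<pi>. sampled u n r f \<pi> \<partial>K y) \<partial>PiM {..<n} (\<lambda>_. sampler u)) = q u n f y"
    unfolding eq q_def by (rule integral_sampled(1)[OF X.prob_P cost_measurable_P u n k kb])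
qed

lemma K_sampled_bound:
  assumes u: "u \<in> I" and n: "(u + 1) * R \<le> real n" and f: "f \<in> borel_measurable borel" and b: "\<And>z. \<bar>f z\<bar> \<le> b"
  shows "\<bar>\<integral>\<pi>. sampled u n r f \<pi> \<partial>K y\<bar> \<le> b"
proof -
  interpret Py: prob_space "P y" by (rule X.prob_P)
  have "(\<lambda>\<omega>. sampled u n r f (\<lambda>s\<in>I. X s \<omega>)) \<in> borel_measurable M"
    by (rule measurable_compose[OF X.measurable_path sampled_measurable[OF u f]])
  then have int: "integrable (P y) (\<lambda>\<omega>. sampled u n r f (\<lambda>s\<in>I. X s \<omega>))"
    by (rule integrable_P[OF _ sampled_bound[OF u n b]])
  have "\<bar>\<integral>\<omega>. sampled u n r f (\<lambda>s\<in>I. X s \<omega>) \<partial>P y\<bar> \<le> (\<integral>\<omega>. \<bar>sampled u n r f (\<lambda>s\<in>I. X s \<omega>)\<bar> \<partial>P y)" by (rule integral_abs_bound)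
  also have "\<dots> \<le> (\<integral>\<omega>. b \<partial>P y)" using int sampled_bound[OF u n b] by (intro integral_mono) auto
  finally show ?thesis unfolding integral_K_P[OF sampled_measurable[OF u f]] using Py.prob_space by simp
qed

lemma prob_samples: "u \<in> I \<Longrightarrow> prob_space (PiM {..<n::nat} (\<lambda>_. sampler u))"
  by (rule prob_space_PiM) (rule prob_sampler)

lemma q_lipschitz:
  assumes u: "u \<in> I" and n: "(u + 1) * R \<le> real n" and f: "l-lipschitz_on UNIV f" and b: "\<And>z. \<bar>f z\<bar> \<le> b"
  shows "\<bar>q u n f x - q u n f y\<bar> \<le> lip_const u b l * dist x y"
proof -
  interpret S: prob_space "PiM {..<n} (\<lambda>_. sampler u)" by (rule prob_samples[OF u])
  have f_meas: "f \<in> borel_measurable borel"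
    using borel_measurable_continuous_onI lipschitz_on_continuous_on[OF f] by blast
  have int: "integrable (PiM {..<n} (\<lambda>_. sampler u)) (\<lambda>r. \<integral>\<pi>. sampled u n r f \<pi> \<partial>K z)" for z
    using K_sampled_measurable(1)[OF u n f_meas b] K_sampled_bound[OF u n f_meas b]
    by (intro S.integrable_const_bound[where B = b]) auto
  have "\<bar>q u n f x - q u n f y\<bar> = \<bar>\<integral>r. (\<integral>\<pi>. sampled u n r f \<pi> \<partial>K x) - (\<integral>\<pi>. sampled u n r f \<pi> \<partial>K y) \<partial>PiM {..<n} (\<lambda>_. sampler u)\<bar>"
    unfolding K_sampled_measurable(2)[OF u n f_meas b, symmetric] using int by simp
  also have "\<dots> \<le> (\<integral>r. \<bar>(\<integral>\<pi>. sampled u n r f \<pi> \<partial>K x) - (\<integral>\<pi>. sampled u n r f \<pi> \<partial>K y)\<bar> \<partial>PiM {..<n} (\<lambda>_. sampler u))"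
    by (rule integral_abs_bound)
  also have "\<dots> \<le> (\<integral>r. lip_const u b l * dist x y \<partial>PiM {..<n} (\<lambda>_. sampler u))"
    using int sampled_lipschitz[OF u n f b] by (intro integral_mono) auto
  finally show ?thesis using S.prob_space by simp
qed

lemma large_index: "\<forall>\<^sub>F n in sequentially. c \<le> real n"
  using filterlim_real_sequentially by (auto simp: filterlim_at_top)

lemma q_tendsto:
  assumes u: "u \<in> I" and f: "f \<in> borel_measurable borel" and b: "\<And>z. \<bar>f z\<bar> \<le> b"
  shows "(\<lambda>n. q u n f y) \<longlonglongrightarrow> p u f y"
proof -
  interpret Py: prob_space "P y" by (rule X.prob_P)
  have u0: "0 \<le> u" using time_nonneg' u .
  have b0: "0 \<le> b" using b[of undefined] by linarith
  have k: "(\<lambda>\<omega>. f (X u \<omega>)) \<in> borel_measurable (P y)"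
    unfolding X.measurable_P by (rule measurable_compose[OF X.measurable_X[OF u] f])
  have c: "cost I \<rho> X 0 u \<in> borel_measurable (P y)"
    unfolding X.measurable_P by (rule measurable_cost'[OF cost_measurable_X zero_I u u0])
  obtain n0 where n0: "\<And>n. n \<ge> n0 \<Longrightarrow> (u + 1) * R \<le> real n" using large_index unfolding eventually_sequentially by blast
  have "(\<lambda>n. q u (n + n0) f y) \<longlonglongrightarrow> (\<integral>\<omega>. f (X u \<omega>) * exp (- cost I \<rho> X 0 u \<omega>) \<partial>P y)"
    unfolding q_def
  proof (rule integral_dominated_convergence[where w = "\<lambda>_. b"])
    show "AE \<omega> in P y. (\<lambda>n. f (X u \<omega>) * (1 - cost I \<rho> X 0 u \<omega> / real (n + n0)) ^ (n + n0)) \<longlonglongrightarrow> f (X u \<omega>) * exp (- cost I \<rho> X 0 u \<omega>)"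
      by (intro always_eventually allI tendsto_mult_left LIMSEQ_ignore_initial_segment[OF power_limit[OF u]])
    show "AE \<omega> in P y. norm (f (X u \<omega>) * (1 - cost I \<rho> X 0 u \<omega> / real (n + n0)) ^ (n + n0)) \<le> b" for n
    proof (intro always_eventually allI)
      fix \<omega>
      have "\<bar>f (X u \<omega>)\<bar> * \<bar>(1 - cost I \<rho> X 0 u \<omega> / real (n + n0)) ^ (n + n0)\<bar> \<le> b * 1"
        using power_bounds[OF u n0, of "n + n0" X \<omega>] b b0 by (intro mult_mono) auto
      then show "norm (f (X u \<omega>) * (1 - cost I \<rho> X 0 u \<omega> / real (n + n0)) ^ (n + n0)) \<le> b" by (simp add: abs_mult)
    qed
  qed (use k c in auto)
  also have "(\<integral>\<omega>. f (X u \<omega>) * exp (- cost I \<rho> X 0 u \<omega>) \<partial>P y) = p u f y" unfolding p_eq[OF u] by (simp add: mult.commute)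
  finally show ?thesis by (rule LIMSEQ_offset)
qed

text \<open>The Lipschitz bounds for \<open>q\<close> are uniform in \<open>n\<close> and pass to
  the limit. They also supply measurability of \<open>p u f\<close> in the starting point, which the
  measurability of the path kernel does not give directly.\<close>

lemma p_lipschitz:
  assumes u: "u \<in> I" and f: "l-lipschitz_on UNIV f" and b: "\<And>z. \<bar>f z\<bar> \<le> b"
  shows "(lip_const u b l)-lipschitz_on UNIV (p u f)"
proof (rule lipschitz_onI)
  have f_meas: "f \<in> borel_measurable borel"
    using borel_measurable_continuous_onI lipschitz_on_continuous_on[OF f] by blast
  fix x y
  have "(\<lambda>n. \<bar>q u n f x - q u n f y\<bar>) \<longlonglongrightarrow> \<bar>p u f x - p u f y\<bar>"
    by (intro tendsto_intros q_tendsto[OF u f_meas b])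
  then show "dist (p u f x) (p u f y) \<le> lip_const u b l * dist x y" unfolding dist_real_def
  proof (rule tendsto_upperbound)
    show "\<forall>\<^sub>F n in sequentially. \<bar>q u n f x - q u n f y\<bar> \<le> lip_const u b l * dist x y"
      using large_index by eventually_elim (rule q_lipschitz[OF u _ f b])
  qed simp
  show "0 \<le> lip_const u b l"
    using f b[of undefined] pos time_nonneg'[OF u] unfolding lip_const_def lipschitz_on_def by simp
qed

text \<open>For frozen sampled times the Markov property applies to a functional of finitely many
  coordinates; averaging over the times and letting \<open>n\<close> tend to infinity turns it into
  a statement about penalizations. It applies to \<open>X\<close> and to both components of the
  coupling, since they satisfy \<open>markov_at\<close> with the same kernel
  \<open>K\<close>.\<close>

theorem penalized_markov:
  assumes W: "prob_space W" and \<xi>: "cost_measurable I \<rho> W \<xi>" "\<And>t. t \<in> I \<Longrightarrow> \<xi> t \<in> measurable W borel"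
    and mk: "markov_at I K W \<G> \<xi> t" and sub: "subalgebra W \<G>" and H: "H \<in> borel_measurable \<G>" "\<And>\<omega>. 0 \<le> H \<omega> \<and> H \<omega> \<le> 1"
    and t: "t \<in> I" and u: "u \<in> I" and f: "l-lipschitz_on UNIV f" and b: "\<And>z. \<bar>f z\<bar> \<le> b"
  shows "(\<integral>\<omega>. H \<omega> * (exp (- cost I \<rho> \<xi> t (t + u) \<omega>) * f (\<xi> (t + u) \<omega>)) \<partial>W) = (\<integral>\<omega>. H \<omega> * p u f (\<xi> t \<omega>) \<partial>W)"
proof -
  interpret W: prob_space W by (rule W)
  have u0: "0 \<le> u" using time_nonneg' u .
  have b0: "0 \<le> b" using b[of undefined] by linarith
  have f_meas: "f \<in> borel_measurable borel"
    using borel_measurable_continuous_onI lipschitz_on_continuous_on[OF f] by blast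
  have HW: "H \<in> borel_measurable W" using measurable_from_subalg[OF sub H(1)] .
  define \<zeta> where "\<zeta> s = \<xi> (t + s)" for s
  have \<zeta>: "cost_measurable I \<rho> W \<zeta>" unfolding \<zeta>_def[abs_def] by (rule cost_measurable_shift'[OF \<xi>(1) t])
  have \<zeta>_meas: "\<zeta> s \<in> measurable W borel" if "s \<in> I" for s unfolding \<zeta>_def using \<xi>(2) t that by simp
  have cost_\<zeta>: "cost I \<rho> \<zeta> 0 u \<omega> = cost I \<rho> \<xi> t (t + u) \<omega>" if "\<omega> \<in> space W" for \<omega>
    unfolding \<zeta>_def[abs_def] by (rule cost_shift'[OF \<xi>(1) that t u])
  define k where "k \<omega> = H \<omega> * f (\<zeta> u \<omega>)" for \<omega>
  have k: "k \<in> borel_measurable W" unfolding k_def[abs_def]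
    using HW measurable_compose[OF \<zeta>_meas[OF u] f_meas] by (rule borel_measurable_times)
  have kb: "\<bar>k \<omega>\<bar> \<le> b" for \<omega>
  proof -
    have "\<bar>H \<omega>\<bar> * \<bar>f (\<zeta> u \<omega>)\<bar> \<le> 1 * b" using H(2)[of \<omega>] b by (intro mult_mono) auto
    then show ?thesis unfolding k_def by (simp add: abs_mult)
  qed
  \<comment> \<open>From \<open>n0\<close> on all factors of the products lie between
    \<open>0\<close> and \<open>1\<close>, so the limits below are taken along sequences shifted by
    \<open>n0\<close>.\<close>
  obtain n0 where n0: "\<And>n. n \<ge> n0 \<Longrightarrow> (u + 1) * R \<le> real n" using large_index unfolding eventually_sequentially by blast
  have c_meas: "cost I \<rho> \<zeta> 0 u \<in> borel_measurable W" by (rule measurable_cost'[OF \<zeta> zero_I u u0])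
  have q_meas: "(\<lambda>\<omega>. q u n f (\<xi> t \<omega>)) \<in> borel_measurable W" if n: "(u + 1) * R \<le> real n" for n
  proof -
    have "(lip_const u b l)-lipschitz_on UNIV (q u n f)"
      using q_lipschitz[OF u n f b] f b0 pos u0
      by (intro lipschitz_onI) (auto simp: dist_real_def lip_const_def lipschitz_on_def)
    then have "q u n f \<in> borel_measurable borel"
      using borel_measurable_continuous_onI lipschitz_on_continuous_on by blast
    then show ?thesis by (rule measurable_compose[OF \<xi>(2)[OF t]])
  qed
  have q_bound: "\<bar>q u n f y\<bar> \<le> b" if n: "(u + 1) * R \<le> real n" for n y
  proof -
    interpret S: prob_space "PiM {..<n} (\<lambda>_. sampler u)" by (rule prob_samples[OF u])
    have int: "integrable (PiM {..<n} (\<lambda>_. sampler u)) (\<lambda>r. \<integral>\<pi>. sampled u n r f \<pi> \<partial>K y)"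
      using K_sampled_measurable(1)[OF u n f_meas b] K_sampled_bound[OF u n f_meas b]
      by (intro S.integrable_const_bound[where B = b]) auto
    have "\<bar>q u n f y\<bar> \<le> (\<integral>r. \<bar>\<integral>\<pi>. sampled u n r f \<pi> \<partial>K y\<bar> \<partial>PiM {..<n} (\<lambda>_. sampler u))"
      unfolding K_sampled_measurable(2)[OF u n f_meas b, symmetric] by (rule integral_abs_bound)
    also have "\<dots> \<le> (\<integral>r. b \<partial>PiM {..<n} (\<lambda>_. sampler u))"
      using int K_sampled_bound[OF u n f_meas b] by (intro integral_mono) auto
    finally show ?thesis using S.prob_space by simp
  qed
  have step: "(\<integral>\<omega>. k \<omega> * (1 - cost I \<rho> \<zeta> 0 u \<omega> / real n) ^ n \<partial>W) = (\<integral>\<omega>. H \<omega> * q u n f (\<xi> t \<omega>) \<partial>W)"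
    if n: "(u + 1) * R \<le> real n" for n
  proof -
    let ?PR = "PiM {..<n} (\<lambda>_. sampler u)"
    interpret S: prob_space ?PR by (rule prob_samples[OF u])
    interpret SW: pair_sigma_finite ?PR W by unfold_locales
    interpret SWp: pair_prob_space ?PR W by unfold_locales
    define h where "h y r = (\<integral>\<pi>. sampled u n r f \<pi> \<partial>K y)" for y r
    have "(\<integral>\<omega>. k \<omega> * (1 - cost I \<rho> \<zeta> 0 u \<omega> / real n) ^ n \<partial>W) = (\<integral>r. (\<integral>\<omega>. k \<omega> * (\<Prod>i<n. 1 - rate u n \<zeta> (r i) \<omega>) \<partial>W) \<partial>?PR)"
      by (rule integral_sampled(1)[OF W \<zeta> u n k kb, symmetric])
    also have "\<dots> = (\<integral>r. (\<integral>\<omega>. H \<omega> * sampled u n r f (\<lambda>s\<in>I. \<xi> (t + s) \<omega>) \<partial>W) \<partial>?PR)"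
    proof -
      have "sampled u n r f (\<lambda>s\<in>I. \<xi> (t + s) \<omega>) = f (\<zeta> u \<omega>) * (\<Prod>i<n. 1 - rate u n \<zeta> (r i) \<omega>)" for r \<omega>
        using sampled_path[OF u, of n r f \<zeta> \<omega>] unfolding \<zeta>_def .
      then show ?thesis unfolding k_def by (simp add: mult.assoc)
    qed
    also have "\<dots> = (\<integral>r. (\<integral>\<omega>. H \<omega> * h (\<xi> t \<omega>) r \<partial>W) \<partial>?PR)"
    proof -
      have Sb: "\<forall>\<pi>. \<bar>sampled u n r f \<pi>\<bar> \<le> b" for r using sampled_bound[where f = f and b = b, OF u n b] by blast
      have "(\<integral>\<omega>. H \<omega> * sampled u n r f (\<lambda>s\<in>I. \<xi> (t + s) \<omega>) \<partial>W) = (\<integral>\<omega>. H \<omega> * h (\<xi> t \<omega>) r \<partial>W)" for r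
        unfolding h_def using mk[unfolded markov_at_def] H sampled_measurable[OF u f_meas, of n r] Sb[of r] by blast
      then show ?thesis by simp
    qed
    also have "\<dots> = (\<integral>\<omega>. (\<integral>r. H \<omega> * h (\<xi> t \<omega>) r \<partial>?PR) \<partial>W)"
    proof (rule SW.Fubini_integral[symmetric])
      \<comment> \<open>Exchanging the two averages requires joint measurability in the state and
        the sampled times; continuity in the state comes from the uniform Lipschitz bound.\<close>
      have hc: "(\<lambda>(y, r). h y r) \<in> borel_measurable (borel \<Otimes>\<^sub>M ?PR)"
      proof (rule borel_measurable_caratheodory)
        show "h y \<in> borel_measurable ?PR" for y
          unfolding h_def[abs_def] by (rule K_sampled_measurable(1)[OF u n f_meas b])
        have "(lip_const u b l)-lipschitz_on UNIV (\<lambda>y. h y r)" for r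
          unfolding h_def using sampled_lipschitz[OF u n f b] f b0 pos u0
          by (intro lipschitz_onI) (auto simp: dist_real_def lip_const_def lipschitz_on_def)
        then show "continuous_on UNIV (\<lambda>y. h y r)" for r by (rule lipschitz_on_continuous_on)
      qed
      have "(\<lambda>z. (\<xi> t (snd z), fst z)) \<in> measurable (?PR \<Otimes>\<^sub>M W) (borel \<Otimes>\<^sub>M ?PR)"
        using measurable_compose[OF measurable_snd \<xi>(2)[OF t]] by (intro measurable_Pair measurable_fst)
      from measurable_compose[OF this hc]
      have m1: "(\<lambda>z. h (\<xi> t (snd z)) (fst z)) \<in> borel_measurable (?PR \<Otimes>\<^sub>M W)" by simp
      have m2: "(\<lambda>z. H (snd z)) \<in> borel_measurable (?PR \<Otimes>\<^sub>M W)" by (rule measurable_compose[OF measurable_snd HW])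
      have "\<bar>H \<omega> * h (\<xi> t \<omega>) r\<bar> \<le> 1 * b" for r \<omega>
        unfolding abs_mult h_def using H(2)[of \<omega>] K_sampled_bound[OF u n f_meas b] by (intro mult_mono) auto
      then show "integrable (?PR \<Otimes>\<^sub>M W) (\<lambda>(r, \<omega>). H \<omega> * h (\<xi> t \<omega>) r)"
        using borel_measurable_times[OF m2 m1] by (intro SWp.integrable_const_bound[where B = b]) (auto simp: case_prod_beta)
    qed
    also have "\<dots> = (\<integral>\<omega>. H \<omega> * q u n f (\<xi> t \<omega>) \<partial>W)"
      unfolding h_def by (simp add: K_sampled_measurable(2)[OF u n f_meas b])
    finally show ?thesis .
  qed
  have "(\<lambda>n. \<integral>\<omega>. k \<omega> * (1 - cost I \<rho> \<zeta> 0 u \<omega> / real (n + n0)) ^ (n + n0) \<partial>W) \<longlonglongrightarrow> (\<integral>\<omega>. k \<omega> * exp (- cost I \<rho> \<zeta> 0 u \<omega>) \<partial>W)"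
  proof (rule integral_dominated_convergence[where w = "\<lambda>_. b"])
    show "AE \<omega> in W. (\<lambda>n. k \<omega> * (1 - cost I \<rho> \<zeta> 0 u \<omega> / real (n + n0)) ^ (n + n0)) \<longlonglongrightarrow> k \<omega> * exp (- cost I \<rho> \<zeta> 0 u \<omega>)"
      by (intro always_eventually allI tendsto_mult_left LIMSEQ_ignore_initial_segment[OF power_limit[OF u]])
    show "AE \<omega> in W. norm (k \<omega> * (1 - cost I \<rho> \<zeta> 0 u \<omega> / real (n + n0)) ^ (n + n0)) \<le> b" for n
    proof (intro always_eventually allI)
      fix \<omega>
      have "\<bar>k \<omega>\<bar> * \<bar>(1 - cost I \<rho> \<zeta> 0 u \<omega> / real (n + n0)) ^ (n + n0)\<bar> \<le> b * 1"
        using power_bounds[OF u n0, of "n + n0" \<zeta> \<omega>] kb b0 by (intro mult_mono) auto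
      then show "norm (k \<omega> * (1 - cost I \<rho> \<zeta> 0 u \<omega> / real (n + n0)) ^ (n + n0)) \<le> b" by (simp add: abs_mult)
    qed
  qed (use k c_meas in auto)
  also have "(\<integral>\<omega>. k \<omega> * exp (- cost I \<rho> \<zeta> 0 u \<omega>) \<partial>W) = (\<integral>\<omega>. H \<omega> * (exp (- cost I \<rho> \<xi> t (t + u) \<omega>) * f (\<xi> (t + u) \<omega>)) \<partial>W)"
    by (intro Bochner_Integration.integral_cong refl) (simp add: k_def cost_\<zeta> \<zeta>_def mult_ac)
  also have "(\<lambda>n. \<integral>\<omega>. k \<omega> * (1 - cost I \<rho> \<zeta> 0 u \<omega> / real (n + n0)) ^ (n + n0) \<partial>W) = (\<lambda>n. \<integral>\<omega>. H \<omega> * q u (n + n0) f (\<xi> t \<omega>) \<partial>W)"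
    using step[OF n0] by (auto simp del: of_nat_add)
  finally have lim1: "(\<lambda>n. \<integral>\<omega>. H \<omega> * q u (n + n0) f (\<xi> t \<omega>) \<partial>W) \<longlonglongrightarrow> (\<integral>\<omega>. H \<omega> * (exp (- cost I \<rho> \<xi> t (t + u) \<omega>) * f (\<xi> (t + u) \<omega>)) \<partial>W)" .
  have lim2: "(\<lambda>n. \<integral>\<omega>. H \<omega> * q u (n + n0) f (\<xi> t \<omega>) \<partial>W) \<longlonglongrightarrow> (\<integral>\<omega>. H \<omega> * p u f (\<xi> t \<omega>) \<partial>W)"
  proof (rule integral_dominated_convergence[where w = "\<lambda>_. b"])
    have "p u f \<in> borel_measurable borel"
      using p_lipschitz[OF u f b] borel_measurable_continuous_onI lipschitz_on_continuous_on by blast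
    then show "(\<lambda>\<omega>. H \<omega> * p u f (\<xi> t \<omega>)) \<in> borel_measurable W"
      using HW measurable_compose[OF \<xi>(2)[OF t]] by (intro borel_measurable_times) auto
    show "(\<lambda>\<omega>. H \<omega> * q u (n + n0) f (\<xi> t \<omega>)) \<in> borel_measurable W" for n
      using HW q_meas[OF n0, of "n + n0"] by (intro borel_measurable_times) auto
    show "AE \<omega> in W. (\<lambda>n. H \<omega> * q u (n + n0) f (\<xi> t \<omega>)) \<longlonglongrightarrow> H \<omega> * p u f (\<xi> t \<omega>)"
      by (intro always_eventually allI tendsto_mult_left LIMSEQ_ignore_initial_segment[OF q_tendsto[OF u f_meas b]])
    show "AE \<omega> in W. norm (H \<omega> * q u (n + n0) f (\<xi> t \<omega>)) \<le> b" for n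
    proof (intro always_eventually allI)
      fix \<omega>
      have "\<bar>H \<omega>\<bar> * \<bar>q u (n + n0) f (\<xi> t \<omega>)\<bar> \<le> 1 * b"
        using q_bound[OF n0, of "n + n0"] H(2)[of \<omega>] by (intro mult_mono) auto
      then show "norm (H \<omega> * q u (n + n0) f (\<xi> t \<omega>)) \<le> b" by (simp add: abs_mult)
    qed
  qed simp
  show ?thesis by (rule LIMSEQ_unique[OF lim1 lim2])
qed

section \<open>The penalized semigroup as a family of contracting kernels\<close>

text \<open>Weights built from past costs are only almost surely equal to functions of the past.
  Rescaling and truncating such a version yields an admissible weight with values between
  \<open>0\<close> and \<open>1\<close>.\<close>

lemma penalized_markov_version:
  assumes W: "prob_space W" and \<xi>: "cost_measurable I \<rho> W \<xi>" "\<And>t. t \<in> I \<Longrightarrow> \<xi> t \<in> measurable W borel"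
    and mk: "markov_at I K W \<G> \<xi> t" and sub: "subalgebra W \<G>"
    and H: "H \<in> borel_measurable W" "\<And>\<omega>. \<omega> \<in> space W \<Longrightarrow> 0 \<le> H \<omega> \<and> H \<omega> \<le> c" "0 < c"
    and H': "H' \<in> borel_measurable \<G>" "AE \<omega> in W. H \<omega> = H' \<omega>"
    and t: "t \<in> I" and u: "u \<in> I" and f: "l-lipschitz_on UNIV f" and b: "\<And>z. \<bar>f z\<bar> \<le> b"
  shows "(\<integral>\<omega>. H \<omega> * (exp (- cost I \<rho> \<xi> t (t + u) \<omega>) * f (\<xi> (t + u) \<omega>)) \<partial>W) = (\<integral>\<omega>. H \<omega> * p u f (\<xi> t \<omega>) \<partial>W)"
proof -
  have u0: "0 \<le> u" using time_nonneg' u .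
  have f_meas: "f \<in> borel_measurable borel"
    using borel_measurable_continuous_onI lipschitz_on_continuous_on[OF f] by blast
  have p_meas: "p u f \<in> borel_measurable borel"
    using p_lipschitz[OF u f b] borel_measurable_continuous_onI lipschitz_on_continuous_on by blast
  define H1 where "H1 \<omega> = max 0 (min 1 (H' \<omega> / c))" for \<omega>
  have H1: "H1 \<in> borel_measurable \<G>" unfolding H1_def using H'(1) by measurable
  have H1_W: "H1 \<in> borel_measurable W" using measurable_from_subalg[OF sub H1] .
  have H101: "0 \<le> H1 \<omega> \<and> H1 \<omega> \<le> 1" for \<omega> unfolding H1_def by simp
  have eq: "AE \<omega> in W. H \<omega> = c * H1 \<omega>"
    using H'(2) AE_space
  proof eventually_elim
    case (elim \<omega>)
    then have "0 \<le> H' \<omega> / c" "H' \<omega> / c \<le> 1" using H(2)[of \<omega>] H(3) by auto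
    then show ?case unfolding H1_def using elim H(3) by simp
  qed
  have m1: "(\<lambda>\<omega>. exp (- cost I \<rho> \<xi> t (t + u) \<omega>) * f (\<xi> (t + u) \<omega>)) \<in> borel_measurable W"
    using u0 t u by (intro borel_measurable_times exp_cost_meas[OF \<xi>(1)] measurable_compose[OF \<xi>(2) f_meas]) auto
  have m2: "(\<lambda>\<omega>. p u f (\<xi> t \<omega>)) \<in> borel_measurable W" by (rule measurable_compose[OF \<xi>(2)[OF t] p_meas])
  have cong: "(\<integral>\<omega>. H \<omega> * g \<omega> \<partial>W) = c * (\<integral>\<omega>. H1 \<omega> * g \<omega> \<partial>W)" if "g \<in> borel_measurable W" for g :: "_ \<Rightarrow> real"
  proof -
    have "(\<integral>\<omega>. H \<omega> * g \<omega> \<partial>W) = (\<integral>\<omega>. c * (H1 \<omega> * g \<omega>) \<partial>W)"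
    proof (rule integral_cong_AE)
      show "AE \<omega> in W. H \<omega> * g \<omega> = c * (H1 \<omega> * g \<omega>)" using eq by eventually_elim simp
    qed (use H(1) H1_W that in auto)
    then show ?thesis by simp
  qed
  show ?thesis
    unfolding cong[OF m1] cong[OF m2] by (simp only: penalized_markov[OF W \<xi> mk sub H1 H101 t u f b])
qed

lemma lipschitz_bound: "l-lipschitz_on UNIV f \<Longrightarrow> \<bar>f z\<bar> \<le> \<bar>f undefined\<bar> + l * D" for f :: "'e \<Rightarrow> real"
proof -
  assume f: "l-lipschitz_on UNIV f"
  have "dist (f z) (f undefined) \<le> l * dist z undefined" using f by (auto simp: lipschitz_on_def)
  also have "\<dots> \<le> l * D" using dist_le f by (intro mult_left_mono) (auto simp: lipschitz_on_def)
  finally show ?thesis by (auto simp: dist_real_def)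
qed

lemma lipschitz_meas: "l-lipschitz_on UNIV f \<Longrightarrow> f \<in> borel_measurable borel" for f :: "'e \<Rightarrow> real"
  using borel_measurable_continuous_onI lipschitz_on_continuous_on by blast

lemma lipschitz_one: "0-lipschitz_on UNIV (\<lambda>_::'e. 1 :: real)" by (simp add: lipschitz_on_def)

text \<open>The cost splits at time \<open>s\<close>, and the exponential of the part before
  \<open>s\<close> serves as the weight in the penalized Markov property.\<close>

lemma p_semigroup:
  assumes s: "s \<in> I" and t: "t \<in> I" and f: "l-lipschitz_on UNIV f"
  shows "p (s + t) f x = p s (p t f) x"
proof -
  have s0: "0 \<le> s" and t0: "0 \<le> t" using time_nonneg' s t by auto
  obtain H' where H': "H' \<in> borel_measurable (F s)" "AE \<omega> in P x. cost I \<rho> X 0 s \<omega> = H' \<omega>"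
  proof (rule cost_version'[OF cost_measurable_P X.prob_P subalgebra_P[OF s] zero_I s s0 _ rho_meas])
    show "X r \<in> measurable (F s) borel" if "r \<in> I" "r \<le> s" for r
      using X.adapted[OF that(1)] X.mono_F[OF that(1) s that(2)] X.subalgebra_F[OF that(1)] X.subalgebra_F[OF s]
      unfolding subalgebra_def by (auto simp: measurable_def)
  qed
  have "p (s + t) f x = (\<integral>\<omega>. exp (- cost I \<rho> X 0 s \<omega>) * (exp (- cost I \<rho> X s (s + t) \<omega>) * f (X (s + t) \<omega>)) \<partial>P x)"
    unfolding p_eq[OF add_I[OF s t]]
  proof (rule Bochner_Integration.integral_cong)
    fix \<omega> assume "\<omega> \<in> space (P x)"
    then have "cost I \<rho> X 0 (s + t) \<omega> = cost I \<rho> X 0 s \<omega> + cost I \<rho> X s (s + t) \<omega>"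
      using s t s0 t0 by (intro cost_split'[OF cost_measurable_P]) auto
    then show "exp (- cost I \<rho> X 0 (s + t) \<omega>) * f (X (s + t) \<omega>) = exp (- cost I \<rho> X 0 s \<omega>) * (exp (- cost I \<rho> X s (s + t) \<omega>) * f (X (s + t) \<omega>))"
      by (simp add: exp_add[symmetric] mult.assoc[symmetric])
  qed simp
  also have "\<dots> = (\<integral>\<omega>. exp (- cost I \<rho> X 0 s \<omega>) * p t f (X s \<omega>) \<partial>P x)"
  proof (rule penalized_markov_version[OF X.prob_P cost_measurable_P _ markov_at_X[OF s] subalgebra_P[OF s] _ _ zero_less_one _ _ s t f lipschitz_bound[OF f]])
    show "X t \<in> measurable (P x) borel" if "t \<in> I" for t using X.measurable_X[OF that] by (simp only: X.measurable_P)
    show "(\<lambda>\<omega>. exp (- cost I \<rho> X 0 s \<omega>)) \<in> borel_measurable (P x)" by (rule exp_cost_meas[OF cost_measurable_P zero_I s s0])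
    show "0 \<le> exp (- cost I \<rho> X 0 s \<omega>) \<and> exp (- cost I \<rho> X 0 s \<omega>) \<le> 1" for \<omega>
      using exp_cost_bounds(2)[OF zero_I s s0] by simp
    show "(\<lambda>\<omega>. exp (- H' \<omega>)) \<in> borel_measurable (F s)" using H'(1) by measurable
    show "AE \<omega> in P x. exp (- cost I \<rho> X 0 s \<omega>) = exp (- H' \<omega>)" using H'(2) by eventually_elim simp
  qed
  also have "\<dots> = p s (p t f) x" unfolding p_eq[OF s] ..
  finally show ?thesis .
qed

text \<open>Equality of path laws alone does not reach the time integral. The penalized Markov
  property at time \<open>0\<close> with weight \<open>1\<close> does, and the process starts at
  \<open>x\<close> almost surely.\<close>

lemma transfer_X':
  assumes t: "t \<in> I" and f: "l-lipschitz_on UNIV f"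
  shows "(\<integral>\<omega>. exp (- cost I \<rho> X' 0 t \<omega>) * f (X' t \<omega>) \<partial>Q (x, y)) = p t f x"
proof -
  interpret Qz: prob_space "Q (x, y)" by (rule XY.prob_P)
  have mX: "X' s \<in> measurable (Q (x, y)) borel" if "s \<in> I" for s using measurable_X'[OF that] by (simp only: XY.measurable_P)
  have "(\<integral>\<omega>. exp (- cost I \<rho> X' 0 t \<omega>) * f (X' t \<omega>) \<partial>Q (x, y)) = (\<integral>\<omega>. p t f (X' 0 \<omega>) \<partial>Q (x, y))"
    using penalized_markov[OF XY.prob_P cost_measurable_QX mX markov_at_X'[OF zero_I] subalgebra_Q[OF zero_I], of "\<lambda>_. 1" t l f, OF _ _ _ zero_I t f lipschitz_bound[OF f]]
    by simp
  also have "\<dots> = (\<integral>\<omega>. p t f x \<partial>Q (x, y))"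
  proof (rule integral_cong_AE)
    show "AE \<omega> in Q (x, y). p t f (X' 0 \<omega>) = p t f x" using XY.start[of "(x, y)"] by eventually_elim simp
    show "(\<lambda>\<omega>. p t f (X' 0 \<omega>)) \<in> borel_measurable (Q (x, y))"
      by (rule measurable_compose[OF mX[OF zero_I] lipschitz_meas[OF p_lipschitz[OF t f lipschitz_bound[OF f]]]])
  qed simp
  finally show ?thesis using Qz.prob_space by simp
qed

lemma transfer_Y':
  assumes t: "t \<in> I" and f: "l-lipschitz_on UNIV f"
  shows "(\<integral>\<omega>. exp (- cost I \<rho> Y' 0 t \<omega>) * f (Y' t \<omega>) \<partial>Q (x, y)) = p t f y"
proof -
  interpret Qz: prob_space "Q (x, y)" by (rule XY.prob_P)
  have mY: "Y' s \<in> measurable (Q (x, y)) borel" if "s \<in> I" for s using measurable_Y'[OF that] by (simp only: XY.measurable_P)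
  have "(\<integral>\<omega>. exp (- cost I \<rho> Y' 0 t \<omega>) * f (Y' t \<omega>) \<partial>Q (x, y)) = (\<integral>\<omega>. p t f (Y' 0 \<omega>) \<partial>Q (x, y))"
    using penalized_markov[OF XY.prob_P cost_measurable_QY mY markov_at_Y'[OF zero_I] subalgebra_Q[OF zero_I], of "\<lambda>_. 1" t l f, OF _ _ _ zero_I t f lipschitz_bound[OF f]]
    by simp
  also have "\<dots> = (\<integral>\<omega>. p t f y \<partial>Q (x, y))"
  proof (rule integral_cong_AE)
    show "AE \<omega> in Q (x, y). p t f (Y' 0 \<omega>) = p t f y" using XY.start[of "(x, y)"] by eventually_elim simp
    show "(\<lambda>\<omega>. p t f (Y' 0 \<omega>)) \<in> borel_measurable (Q (x, y))"
      by (rule measurable_compose[OF mY[OF zero_I] lipschitz_meas[OF p_lipschitz[OF t f lipschitz_bound[OF f]]]])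
  qed simp
  finally show ?thesis using Qz.prob_space by simp
qed

definition \<kappa> :: "real \<Rightarrow> 'e \<Rightarrow> 'e measure" where
  "\<kappa> t x = distr (density (P x) (\<lambda>\<omega>. ennreal (exp (- cost I \<rho> X 0 t \<omega>)))) borel (X t)"

lemma sets_\<kappa>: "sets (\<kappa> t x) = sets borel" unfolding \<kappa>_def by simp

lemma integral_\<kappa>:
  assumes t: "t \<in> I" and f: "f \<in> borel_measurable borel"
  shows "(\<integral>z. f z \<partial>\<kappa> t x) = p t f x"
proof -
  have t0: "0 \<le> t" using time_nonneg' t .
  have Xm: "X t \<in> measurable (P x) borel" using X.measurable_X[OF t] by (simp only: X.measurable_P)
  then have Xd: "X t \<in> measurable (density (P x) (\<lambda>\<omega>. ennreal (exp (- cost I \<rho> X 0 t \<omega>)))) borel" by simp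
  have "(\<integral>z. f z \<partial>\<kappa> t x) = (\<integral>\<omega>. f (X t \<omega>) \<partial>density (P x) (\<lambda>\<omega>. ennreal (exp (- cost I \<rho> X 0 t \<omega>))))"
    unfolding \<kappa>_def by (rule integral_distr[OF Xd f])
  also have "\<dots> = p t f x"
    unfolding p_eq[OF t] using exp_cost_meas[OF cost_measurable_P zero_I t t0] measurable_compose[OF Xm f]
    by (subst integral_density) auto
  finally show ?thesis .
qed

lemma finite_\<kappa>: assumes t: "t \<in> I" shows "finite_measure (\<kappa> t x)"
proof (rule finite_measureI)
  interpret Px: prob_space "P x" by (rule X.prob_P)
  have t0: "0 \<le> t" using time_nonneg' t .
  have Xm: "X t \<in> measurable (P x) borel" using X.measurable_X[OF t] by (simp only: X.measurable_P)
  have "emeasure (\<kappa> t x) (space (\<kappa> t x)) = emeasure (density (P x) (\<lambda>\<omega>. ennreal (exp (- cost I \<rho> X 0 t \<omega>)))) (space (P x))"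
    unfolding \<kappa>_def using Xm by (subst emeasure_distr) auto
  also have "\<dots> = (\<integral>\<^sup>+\<omega>. ennreal (exp (- cost I \<rho> X 0 t \<omega>)) * indicator (space (P x)) \<omega> \<partial>P x)"
    using exp_cost_meas[OF cost_measurable_P zero_I t t0] by (intro emeasure_density) auto
  also have "\<dots> \<le> (\<integral>\<^sup>+\<omega>. 1 \<partial>P x)"
    using exp_cost_bounds(2)[OF zero_I t t0, of X] by (intro nn_integral_mono) (auto simp: indicator_def ennreal_le_1)
  finally have "emeasure (\<kappa> t x) (space (\<kappa> t x)) \<le> 1" using Px.emeasure_space_1 by simp
  then show "emeasure (\<kappa> t x) (space (\<kappa> t x)) \<noteq> \<infinity>" by (auto simp: top_unique)
qed

lemma measure_\<kappa>: assumes t: "t \<in> I" shows "measure (\<kappa> t x) UNIV = mass t x"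
proof -
  have "(\<integral>z. 1 \<partial>\<kappa> t x) = mass t x" unfolding mass_def using t by (intro integral_\<kappa>) auto
  then show ?thesis using sets_eq_imp_space_eq[OF sets_\<kappa>[of t x]] by simp
qed

lemma mass_le_top: "mass (real n) x \<le> top_mass \<kappa> (real n)"
  unfolding top_mass_def measure_\<kappa>[OF nat_I, symmetric]
  by (rule cSUP_upper) (auto intro!: bdd_aboveI2[where M = 1] simp: measure_\<kappa> mass_bounds(2))

lemma mass_antimono:
  assumes "s \<in> I" "t \<in> I" "s \<le> t" shows "mass t x \<le> mass s x"
proof -
  interpret Px: prob_space "P x" by (rule X.prob_P)
  have s0: "0 \<le> s" and t0: "0 \<le> t" using time_nonneg' assms by auto
  have int: "integrable (P x) (\<lambda>\<omega>. exp (- cost I \<rho> X 0 r \<omega>))" if "r \<in> I" "0 \<le> r" for r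
    using exp_cost_bounds(2)[OF zero_I that, of X] by (intro integrable_P[where b = 1] exp_cost_meas[OF cost_measurable_X zero_I that]) auto
  have "exp (- cost I \<rho> X 0 t \<omega>) \<le> exp (- cost I \<rho> X 0 s \<omega>)" if "\<omega> \<in> space (P x)" for \<omega>
    using cost_split'[OF cost_measurable_P that zero_I assms(1,2) s0 assms(3)] cost_nonneg'[of X s t \<omega>] by simp
  then show ?thesis unfolding mass_def p_eq[OF assms(1)] p_eq[OF assms(2)]
    using int[OF assms(1) s0] int[OF assms(2) t0] by (auto intro!: integral_mono)
qed

section \<open>Discrepancy of the two penalizations over unit steps\<close>

definition gap :: "nat \<Rightarrow> 'v \<Rightarrow> real" where
  "gap k \<omega> = \<bar>cost I \<rho> X' (real k) (real k + 1) \<omega> - cost I \<rho> Y' (real k) (real k + 1) \<omega>\<bar>"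

lemma step_in_I [simp]: "real k + 1 \<in> I" using nat_I[of "Suc k"] by (simp add: add.commute)

lemma gap_measurable: "gap k \<in> borel_measurable N"
  unfolding gap_def[abs_def]
  by (intro borel_measurable_abs borel_measurable_diff measurable_cost'[OF cost_measurable_X'] measurable_cost'[OF cost_measurable_Y']) auto

lemma gap_bounds: "0 \<le> gap k \<omega>" "gap k \<omega> \<le> R"
  using cost_nonneg'[of X' "real k" "real k + 1" \<omega>] cost_nonneg'[of Y' "real k" "real k + 1" \<omega>]
    cost_le'[of "real k" "real k + 1" X' \<omega>] cost_le'[of "real k" "real k + 1" Y' \<omega>]
  unfolding gap_def by auto

text \<open>The weight stops at the beginning of the step, so the product has a version determined
  by the past of time \<open>k + 1\<close>, and the Markov property remains available from there
  on.\<close>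

definition weighted_gap :: "nat \<Rightarrow> 'v \<Rightarrow> real" where
  "weighted_gap k \<omega> = exp (- cost I \<rho> X' 0 (real k) \<omega>) * gap k \<omega>"

lemma weighted_gap_measurable: "weighted_gap k \<in> borel_measurable N"
  unfolding weighted_gap_def[abs_def]
  by (intro borel_measurable_times gap_measurable exp_cost_meas[OF cost_measurable_X']) auto

lemma weighted_gap_bounds: "0 \<le> weighted_gap k \<omega>" "weighted_gap k \<omega> \<le> R"
proof -
  show "0 \<le> weighted_gap k \<omega>" unfolding weighted_gap_def using gap_bounds by simp
  have "exp (- cost I \<rho> X' 0 (real k) \<omega>) * gap k \<omega> \<le> 1 * R"
    using exp_cost_bounds(2)[OF zero_I nat_I, of k X' \<omega>] gap_bounds[of k \<omega>] by (intro mult_mono) auto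
  then show "weighted_gap k \<omega> \<le> R" unfolding weighted_gap_def by simp
qed

lemma weighted_gap_integrable: "integrable (Q z) (weighted_gap k)"
  using weighted_gap_bounds by (intro integrable_Q[where b = R] weighted_gap_measurable) auto

lemma weighted_gap_version:
  obtains H' where "H' \<in> borel_measurable (G (real k + 1))" "AE \<omega> in Q z. weighted_gap k \<omega> = H' \<omega>"
proof -
  have adX: "X' r \<in> measurable (G (real k + 1)) borel" if "r \<in> I" "r \<le> real k + 1" for r
    by (rule measurable_G_mono[OF that(1) step_in_I that(2) adapted_X'[OF that(1)]])
  have adY: "Y' r \<in> measurable (G (real k + 1)) borel" if "r \<in> I" "r \<le> real k + 1" for r
    by (rule measurable_G_mono[OF that(1) step_in_I that(2) adapted_Y'[OF that(1)]])
  have k0: "0 \<le> real k" "real k \<le> real k + 1" by auto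
  obtain A1 where A1: "A1 \<in> borel_measurable (G (real k))" "AE \<omega> in Q z. cost I \<rho> X' 0 (real k) \<omega> = A1 \<omega>"
    by (rule cost_version'[OF cost_measurable_QX XY.prob_P subalgebra_Q[OF nat_I] zero_I nat_I k0(1) measurable_G_mono[OF _ nat_I _ adapted_X'] rho_meas])
  obtain A2 where A2: "A2 \<in> borel_measurable (G (real k + 1))" "AE \<omega> in Q z. cost I \<rho> X' (real k) (real k + 1) \<omega> = A2 \<omega>"
    by (rule cost_version'[OF cost_measurable_QX XY.prob_P subalgebra_Q[OF step_in_I] nat_I step_in_I k0(2) adX rho_meas])
  obtain A3 where A3: "A3 \<in> borel_measurable (G (real k + 1))" "AE \<omega> in Q z. cost I \<rho> Y' (real k) (real k + 1) \<omega> = A3 \<omega>"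
    by (rule cost_version'[OF cost_measurable_QY XY.prob_P subalgebra_Q[OF step_in_I] nat_I step_in_I k0(2) adY rho_meas])
  have A1': "A1 \<in> borel_measurable (G (real k + 1))" by (rule measurable_G_mono[OF nat_I step_in_I k0(2) A1(1)])
  show ?thesis
  proof (rule that[of "\<lambda>\<omega>. exp (- A1 \<omega>) * \<bar>A2 \<omega> - A3 \<omega>\<bar>"])
    show "(\<lambda>\<omega>. exp (- A1 \<omega>) * \<bar>A2 \<omega> - A3 \<omega>\<bar>) \<in> borel_measurable (G (real k + 1))" using A1' A2(1) A3(1) by measurable
    show "AE \<omega> in Q z. weighted_gap k \<omega> = exp (- A1 \<omega>) * \<bar>A2 \<omega> - A3 \<omega>\<bar>"
      using A1(2) A2(2) A3(2) by eventually_elim (simp add: weighted_gap_def gap_def)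
  qed
qed

text \<open>Conditioning at time \<open>k + 1\<close> turns the remaining penalization into a mass
  at time \<open>n - 1 - k\<close>, which is bounded by its supremum. The case \<open>Y'\<close>
  serves the Lasota-Yorke inequality, the case \<open>X'\<close> the comparison of masses.\<close>

lemma weighted_gap_future:
  assumes "\<xi> = X' \<or> \<xi> = Y'" "k < n"
  shows "(\<integral>\<omega>. weighted_gap k \<omega> * exp (- cost I \<rho> \<xi> (real k + 1) (real n) \<omega>) \<partial>Q z) \<le> top_mass \<kappa> (real (n - 1 - k)) * (\<integral>\<omega>. weighted_gap k \<omega> \<partial>Q z)"
proof -
  let ?u = "real (n - 1 - k)"
  have n: "real k + 1 + ?u = real n" using assms(2) by simp
  have \<xi>: "cost_measurable I \<rho> (Q z) \<xi>" "markov_at I K (Q z) (G (real k + 1)) \<xi> (real k + 1)"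
    using assms(1) cost_measurable_QX[of z] cost_measurable_QY[of z]
      markov_at_X'[OF step_in_I, of z k] markov_at_Y'[OF step_in_I, of z k] by auto
  have \<xi>m: "\<xi> t \<in> measurable (Q z) borel" if "t \<in> I" for t
    using assms(1) measurable_X'[OF that] measurable_Y'[OF that] by (auto simp only: XY.measurable_P)
  obtain H' where H': "H' \<in> borel_measurable (G (real k + 1))" "AE \<omega> in Q z. weighted_gap k \<omega> = H' \<omega>"
    by (rule weighted_gap_version)
  have one_bound: "\<bar>1 :: real\<bar> \<le> 1" for z :: 'e by simp
  have "(\<integral>\<omega>. weighted_gap k \<omega> * (exp (- cost I \<rho> \<xi> (real k + 1) (real k + 1 + ?u) \<omega>) * 1) \<partial>Q z) = (\<integral>\<omega>. weighted_gap k \<omega> * p ?u (\<lambda>_. 1) (\<xi> (real k + 1) \<omega>) \<partial>Q z)"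
  proof (rule penalized_markov_version[where b = 1, OF XY.prob_P \<xi>(1) \<xi>m \<xi>(2) subalgebra_Q[OF step_in_I] _ _ pos(4) H' step_in_I nat_I lipschitz_one one_bound])
    show "weighted_gap k \<in> borel_measurable (Q z)" using weighted_gap_measurable by (simp only: XY.measurable_P)
    show "0 \<le> weighted_gap k \<omega> \<and> weighted_gap k \<omega> \<le> R" for \<omega> using weighted_gap_bounds by simp
  qed
  also have "\<dots> \<le> (\<integral>\<omega>. weighted_gap k \<omega> * top_mass \<kappa> ?u \<partial>Q z)"
  proof (rule integral_mono')
    show "integrable (Q z) (\<lambda>\<omega>. weighted_gap k \<omega> * top_mass \<kappa> ?u)" using weighted_gap_integrable by simp
    fix \<omega>
    show "weighted_gap k \<omega> * p ?u (\<lambda>_. 1) (\<xi> (real k + 1) \<omega>) \<le> weighted_gap k \<omega> * top_mass \<kappa> ?u"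
      using mass_le_top[of "n - 1 - k" "\<xi> (real k + 1) \<omega>"] weighted_gap_bounds unfolding mass_def by (intro mult_left_mono) auto
    have "0 \<le> top_mass \<kappa> ?u" using mass_le_top[of "n - 1 - k"] mass_pos[OF nat_I] by (meson less_imp_le order_trans)
    then show "0 \<le> weighted_gap k \<omega> * top_mass \<kappa> ?u" using weighted_gap_bounds by simp
  qed
  finally show ?thesis unfolding n by (simp add: mult.commute)
qed

text \<open>The gap is at most \<open>L\<close> times the integral of the distance over the unit
  step. Moving the weight from time \<open>k\<close> to the current time \<open>r\<close> costs at
  most \<open>exp R\<close>, after which the contraction applies at time \<open>r\<close>.\<close>

lemma weighted_gap_le:
  "(\<integral>\<omega>. weighted_gap k \<omega> \<partial>Q (x, y)) \<le> exp R * L * C * exp (- \<gamma> * real k) * mass (real k) x * dist x y"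
proof -
  interpret Qz: prob_space "Q (x, y)" by (rule XY.prob_P)
  let ?U = "window I (real k) (real k + 1)"
  interpret U: finite_measure ?U by (rule finite_window[OF tI]) auto
  interpret UQ: pair_sigma_finite ?U "Q (x, y)" by unfold_locales
  have finUQ: "finite_measure (?U \<Otimes>\<^sub>M Q (x, y))" by (rule finite_measure_pair_measure) unfold_locales
  interpret UQf: finite_measure "?U \<Otimes>\<^sub>M Q (x, y)" by (rule finUQ)
  let ?Z = "\<lambda>t \<omega>. exp (- cost I \<rho> X' 0 t \<omega>)"
  define d where "d r \<omega> = \<bar>indicator I r * \<rho> (X' r \<omega>) - indicator I r * \<rho> (Y' r \<omega>)\<bar>" for r \<omega>
  have spN: "space (Q (x, y)) = space N" by (rule XY.space_P)
  have dm: "(\<lambda>(r, \<omega>). d r \<omega>) \<in> borel_measurable (?U \<Otimes>\<^sub>M Q (x, y))"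
  proof -
    have "(\<lambda>(r, \<omega>). d r \<omega>) \<in> borel_measurable (borel \<Otimes>\<^sub>M Q (x, y))"
      using cost_measurable_QX[of "(x, y)"] cost_measurable_QY[of "(x, y)"]
      unfolding cost_measurable_def d_def case_prod_beta by (intro borel_measurable_abs borel_measurable_diff)
    then show ?thesis by (subst measurable_cong_sets[OF sets_pair_measure_cong[OF sets_window refl] refl])
  qed
  have Zm: "(\<lambda>\<omega>. ?Z (real k) \<omega>) \<in> borel_measurable (Q (x, y))" by (rule exp_cost_meas[OF cost_measurable_QX]) auto
  have Z1: "?Z (real k) \<omega> \<le> 1" for \<omega> by (rule exp_cost_bounds(2)[OF zero_I nat_I]) simp
  have d_bounds: "0 \<le> d r \<omega>" "d r \<omega> \<le> R" for r \<omega>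
    unfolding d_def using rho_nonneg[of "X' r \<omega>"] rho_nonneg[of "Y' r \<omega>"] rho_le[of "X' r \<omega>"] rho_le[of "Y' r \<omega>"] pos
    by (auto simp: indicator_def)
  have secd: "(\<lambda>r. d r \<omega>) \<in> borel_measurable borel" if "\<omega> \<in> space N" for \<omega>
    unfolding d_def using cost_section'[OF cost_measurable_X' that] cost_section'[OF cost_measurable_Y' that] by measurable
  have gap_le: "gap k \<omega> \<le> (\<integral>r. d r \<omega> \<partial>?U)" if \<omega>: "\<omega> \<in> space N" for \<omega>
  proof -
    have i1: "integrable ?U (\<lambda>r. indicator I r * \<rho> (X' r \<omega>))" "integrable ?U (\<lambda>r. indicator I r * \<rho> (Y' r \<omega>))"
      using cost_section'[OF cost_measurable_X' \<omega>] cost_section'[OF cost_measurable_Y' \<omega>] rate_bound'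
      by (auto intro!: integrable_window[OF tI, where B = R])
    have "gap k \<omega> = \<bar>\<integral>r. indicator I r * \<rho> (X' r \<omega>) - indicator I r * \<rho> (Y' r \<omega>) \<partial>?U\<bar>"
      unfolding gap_def cost_def using i1 by simp
    also have "\<dots> \<le> (\<integral>r. d r \<omega> \<partial>?U)" unfolding d_def by (rule integral_abs_bound)
    finally show ?thesis .
  qed
  have id: "integrable ?U (\<lambda>r. d r \<omega>)" if "\<omega> \<in> space N" for \<omega>
    using secd[OF that] d_bounds by (intro integrable_window[OF tI, where B = R]) auto
  have joint: "integrable (?U \<Otimes>\<^sub>M Q (x, y)) (\<lambda>(r, \<omega>). ?Z (real k) \<omega> * d r \<omega>)"
  proof (rule UQf.integrable_const_bound[where B = "1 * R"])
    have "(\<lambda>z. ?Z (real k) (snd z) * (case z of (r, \<omega>) \<Rightarrow> d r \<omega>)) \<in> borel_measurable (?U \<Otimes>\<^sub>M Q (x, y))"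
      by (intro borel_measurable_times dm measurable_compose[OF measurable_snd Zm])
    then show "(\<lambda>(r, \<omega>). ?Z (real k) \<omega> * d r \<omega>) \<in> borel_measurable (?U \<Otimes>\<^sub>M Q (x, y))" by (simp add: case_prod_beta)
    have "?Z (real k) \<omega> * d r \<omega> \<le> 1 * R" for r \<omega> using Z1 d_bounds by (intro mult_mono) auto
    then show "AE z in ?U \<Otimes>\<^sub>M Q (x, y). norm (case z of (r, \<omega>) \<Rightarrow> ?Z (real k) \<omega> * d r \<omega>) \<le> 1 * R"
      using d_bounds by (intro always_eventually) auto
  qed
  let ?B = "exp R * L * C * exp (- \<gamma> * real k) * mass (real k) x * dist x y"
  have inner: "(\<integral>\<omega>. ?Z (real k) \<omega> * d r \<omega> \<partial>Q (x, y)) \<le> ?B" if r: "r \<in> I" "real k \<le> r" "r < real k + 1" for r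
  proof -
    have r0: "0 \<le> r" using r by linarith
    have ptw: "?Z (real k) \<omega> * d r \<omega> \<le> exp R * L * (?Z r \<omega> * dist (X' r \<omega>) (Y' r \<omega>))" if \<omega>: "\<omega> \<in> space (Q (x, y))" for \<omega>
    proof -
      have "cost I \<rho> X' 0 r \<omega> = cost I \<rho> X' 0 (real k) \<omega> + cost I \<rho> X' (real k) r \<omega>"
        using r by (intro cost_split'[OF cost_measurable_QX \<omega>]) auto
      moreover have "cost I \<rho> X' (real k) r \<omega> \<le> R * (r - real k)" using r by (intro cost_le') auto
      moreover have "R * (r - real k) \<le> R * 1" using r pos by (intro mult_left_mono) auto
      ultimately have "- cost I \<rho> X' 0 (real k) \<omega> \<le> R + - cost I \<rho> X' 0 r \<omega>" by linarith
      then have Z: "?Z (real k) \<omega> \<le> exp R * ?Z r \<omega>" unfolding exp_add[symmetric] by simp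
      have "\<bar>\<rho> (X' r \<omega>) - \<rho> (Y' r \<omega>)\<bar> \<le> L * dist (X' r \<omega>) (Y' r \<omega>)"
        using rho_lip by (auto simp: lipschitz_on_def dist_real_def)
      then have "d r \<omega> \<le> L * dist (X' r \<omega>) (Y' r \<omega>)" unfolding d_def using r by simp
      then have "?Z (real k) \<omega> * d r \<omega> \<le> (exp R * ?Z r \<omega>) * (L * dist (X' r \<omega>) (Y' r \<omega>))"
        using Z d_bounds by (intro mult_mono) auto
      then show ?thesis by (simp add: mult_ac)
    qed
    have "?Z r \<omega> * dist (X' r \<omega>) (Y' r \<omega>) \<le> 1 * D" for \<omega>
      using exp_cost_bounds(2)[OF zero_I r(1) r0, of X' \<omega>] dist_le by (intro mult_mono) auto
    then have int: "integrable (Q (x, y)) (\<lambda>\<omega>. ?Z r \<omega> * dist (X' r \<omega>) (Y' r \<omega>))"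
      by (intro integrable_Q[where b = D] borel_measurable_times dist_meas[OF r(1)] exp_cost_meas[OF cost_measurable_X' zero_I r(1) r0]) auto
    have "(\<integral>\<omega>. ?Z (real k) \<omega> * d r \<omega> \<partial>Q (x, y)) \<le> (\<integral>\<omega>. exp R * L * (?Z r \<omega> * dist (X' r \<omega>) (Y' r \<omega>)) \<partial>Q (x, y))"
      using int ptw pos by (intro integral_mono') auto
    also have "\<dots> = exp R * L * (\<integral>\<omega>. ?Z r \<omega> * dist (X' r \<omega>) (Y' r \<omega>) \<partial>Q (x, y))" by simp
    also have "\<dots> \<le> exp R * L * (C * exp (- \<gamma> * r) * mass r x * dist x y)"
      using weighted_contraction[OF r(1)] pos by (intro mult_left_mono) auto
    \<comment> \<open>Both the exponential and the mass decrease in time, so \<open>r\<close> may be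
      replaced by the beginning of the step.\<close>
    also have "\<dots> \<le> exp R * L * (C * exp (- \<gamma> * real k) * mass (real k) x * dist x y)"
      using mass_antimono[OF nat_I r(1,2)] mass_pos[OF r(1), of x] pos r by (intro mult_left_mono mult_right_mono mult_mono) auto
    finally show ?thesis by (simp add: mult_ac)
  qed
  have "(\<integral>\<omega>. weighted_gap k \<omega> \<partial>Q (x, y)) \<le> (\<integral>\<omega>. (\<integral>r. ?Z (real k) \<omega> * d r \<omega> \<partial>?U) \<partial>Q (x, y))"
  proof (rule integral_mono)
    show "integrable (Q (x, y)) (\<lambda>\<omega>. \<integral>r. ?Z (real k) \<omega> * d r \<omega> \<partial>?U)" using UQ.integrable_snd[OF joint] by simp
    fix \<omega> assume "\<omega> \<in> space (Q (x, y))"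
    then have \<omega>: "\<omega> \<in> space N" using spN by simp
    have "(\<integral>r. ?Z (real k) \<omega> * d r \<omega> \<partial>?U) = ?Z (real k) \<omega> * (\<integral>r. d r \<omega> \<partial>?U)" by simp
    then show "weighted_gap k \<omega> \<le> (\<integral>r. ?Z (real k) \<omega> * d r \<omega> \<partial>?U)"
      unfolding weighted_gap_def using gap_le[OF \<omega>] by (simp only: mult_left_mono exp_ge_zero)
  qed (rule weighted_gap_integrable)
  also have "\<dots> = (\<integral>r. (\<integral>\<omega>. ?Z (real k) \<omega> * d r \<omega> \<partial>Q (x, y)) \<partial>?U)"
    by (rule UQ.Fubini_integral[OF joint])
  also have "\<dots> \<le> (\<integral>r. ?B \<partial>?U)"
  proof (rule integral_mono_AE)
    show "integrable ?U (\<lambda>r. \<integral>\<omega>. ?Z (real k) \<omega> * d r \<omega> \<partial>Q (x, y))" using UQ.integrable_fst[OF joint] by simp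
    show "AE r in ?U. (\<integral>\<omega>. ?Z (real k) \<omega> * d r \<omega> \<partial>Q (x, y)) \<le> ?B"
      using AE_window[OF tI nat_I] by eventually_elim (rule inner, auto)
  qed simp
  also have "\<dots> = ?B" using emeasure_window[OF tI nat_I step_in_I, of k] by (simp add: measure_def)
  finally show ?thesis .
qed

lemma weighted_gap_sum_le:
  assumes "\<xi> = X' \<or> \<xi> = Y'"
  shows "(\<Sum>k<n. \<integral>\<omega>. weighted_gap k \<omega> * exp (- cost I \<rho> \<xi> (real k + 1) (real n) \<omega>) \<partial>Q (x, y))
    \<le> exp R * L * C * dist x y * mass_convolution \<kappa> \<gamma> n x"
proof -
  have "(\<Sum>k<n. \<integral>\<omega>. weighted_gap k \<omega> * exp (- cost I \<rho> \<xi> (real k + 1) (real n) \<omega>) \<partial>Q (x, y))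
    \<le> (\<Sum>k<n. exp R * L * C * dist x y * (exp (- \<gamma> * real k) * measure (\<kappa> (real k) x) UNIV * top_mass \<kappa> (real (n - 1 - k))))"
  proof (rule sum_mono)
    fix k assume "k \<in> {..<n}"
    then have k: "k < n" by simp
    have top0: "0 \<le> top_mass \<kappa> (real (n - 1 - k))" using mass_le_top[of "n - 1 - k"] mass_pos[OF nat_I] by (meson less_imp_le order_trans)
    have "(\<integral>\<omega>. weighted_gap k \<omega> * exp (- cost I \<rho> \<xi> (real k + 1) (real n) \<omega>) \<partial>Q (x, y))
      \<le> top_mass \<kappa> (real (n - 1 - k)) * (\<integral>\<omega>. weighted_gap k \<omega> \<partial>Q (x, y))" by (rule weighted_gap_future[OF assms k])
    also have "\<dots> \<le> top_mass \<kappa> (real (n - 1 - k)) * (exp R * L * C * exp (- \<gamma> * real k) * mass (real k) x * dist x y)"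
      by (intro mult_left_mono weighted_gap_le top0)
    finally show "(\<integral>\<omega>. weighted_gap k \<omega> * exp (- cost I \<rho> \<xi> (real k + 1) (real n) \<omega>) \<partial>Q (x, y))
      \<le> exp R * L * C * dist x y * (exp (- \<gamma> * real k) * measure (\<kappa> (real k) x) UNIV * top_mass \<kappa> (real (n - 1 - k)))"
      unfolding measure_\<kappa>[OF nat_I] by (simp add: mult_ac)
  qed
  then show ?thesis unfolding mass_convolution_def sum_distrib_left .
qed

section \<open>Lasota-Yorke inequality, comparison of masses and mixing\<close>

abbreviation ZX :: "nat \<Rightarrow> 'v \<Rightarrow> real" where "ZX n \<omega> \<equiv> exp (- cost I \<rho> X' 0 (real n) \<omega>)"
abbreviation ZY :: "nat \<Rightarrow> 'v \<Rightarrow> real" where "ZY n \<omega> \<equiv> exp (- cost I \<rho> Y' 0 (real n) \<omega>)"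

lemma ZX_meas: "ZX n \<in> borel_measurable N" and ZY_meas: "ZY n \<in> borel_measurable N"
  by (intro exp_cost_meas[OF cost_measurable_X' zero_I nat_I] exp_cost_meas[OF cost_measurable_Y' zero_I nat_I]; simp)+

lemma ZX_bounds: "exp (- R * real n) \<le> ZX n \<omega>" "ZX n \<omega> \<le> 1"
  and ZY_bounds: "exp (- R * real n) \<le> ZY n \<omega>" "ZY n \<omega> \<le> 1"
  using exp_cost_bounds[OF zero_I nat_I, of n] by auto

lemma integrable_Z:
  fixes g :: "'v \<Rightarrow> real"
  assumes "g \<in> borel_measurable N" "\<And>\<omega>. \<bar>g \<omega>\<bar> \<le> b"
  shows "integrable (Q z) (\<lambda>\<omega>. ZX n \<omega> * g \<omega>)" "integrable (Q z) (\<lambda>\<omega>. ZY n \<omega> * g \<omega>)"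
proof -
  have "ZX n \<omega> * \<bar>g \<omega>\<bar> \<le> 1 * b" "ZY n \<omega> * \<bar>g \<omega>\<bar> \<le> 1 * b" for \<omega>
    by (intro mult_mono ZX_bounds ZY_bounds assms(2); simp)+
  then have "\<bar>ZX n \<omega> * g \<omega>\<bar> \<le> 1 * b" "\<bar>ZY n \<omega> * g \<omega>\<bar> \<le> 1 * b" for \<omega> by (simp_all add: abs_mult)
  then show "integrable (Q z) (\<lambda>\<omega>. ZX n \<omega> * g \<omega>)" "integrable (Q z) (\<lambda>\<omega>. ZY n \<omega> * g \<omega>)"
    using assms(1) ZX_meas ZY_meas by (auto intro!: integrable_Q[where b = "1 * b"] borel_measurable_times)
qed

lemma cost_step:
  assumes "cost_measurable I \<rho> N \<xi>" "\<omega> \<in> space N" "k < n"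
  shows "cost I \<rho> \<xi> (real k) (real n) \<omega> = cost I \<rho> \<xi> (real k) (real k + 1) \<omega> + cost I \<rho> \<xi> (real k + 1) (real n) \<omega>"
  using assms(3) by (intro cost_split'[OF assms(1,2)]) (auto simp: Suc_le_eq[symmetric] simp flip: of_nat_Suc)

lemma exp_diff_le:
  fixes a b :: real
  assumes "0 \<le> a" "0 \<le> b" shows "\<bar>exp (- a) - exp (- b)\<bar> \<le> \<bar>a - b\<bar>"
proof -
  have *: "exp (- a) - exp (- b) \<le> b - a" if "0 \<le> a" "a \<le> b" for a b :: real
  proof -
    have "1 - exp (a - b) \<le> b - a" using exp_ge_add_one_self[of "a - b"] by linarith
    then have "exp (- a) * (1 - exp (a - b)) \<le> 1 * (b - a)" using that by (intro mult_mono) auto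
    then show ?thesis by (simp add: right_diff_distrib exp_add[symmetric])
  qed
  show ?thesis
  proof (cases "a \<le> b")
    case True
    then show ?thesis using *[OF assms(1) True] by simp
  next
    case False
    then show ?thesis using *[OF assms(2), of a] by simp
  qed
qed

text \<open>\<open>T k\<close> lets the first process pay up to time \<open>k\<close> and the second
  one afterwards, which interpolates between \<open>ZY n\<close> and \<open>ZX n\<close>.
  Consecutive terms differ in a single unit step and are compared through its gap.\<close>

lemma Z_difference:
  assumes \<omega>: "\<omega> \<in> space N"
  shows "\<bar>ZX n \<omega> - ZY n \<omega>\<bar> \<le> (\<Sum>k<n. weighted_gap k \<omega> * exp (- cost I \<rho> Y' (real k + 1) (real n) \<omega>))"
proof -
  define T where "T k = ZX k \<omega> * exp (- cost I \<rho> Y' (real k) (real n) \<omega>)" for k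
  have "cost I \<rho> \<xi> s s \<omega> = 0" if "s \<in> I" for \<xi> :: "real \<Rightarrow> 'v \<Rightarrow> 'e" and s
    using cost_nonneg'[of \<xi> s s \<omega>] cost_le'[OF that that order_refl, of \<xi> \<omega>] by simp
  then have T: "T n = ZX n \<omega>" "T 0 = ZY n \<omega>" unfolding T_def by simp_all
  have "T n - T 0 = (\<Sum>k<n. T (Suc k) - T k)" by (rule sum_lessThan_telescope[symmetric])
  then have "\<bar>T n - T 0\<bar> \<le> (\<Sum>k<n. \<bar>T (Suc k) - T k\<bar>)" by (simp only: sum_abs)
  also have "\<dots> \<le> (\<Sum>k<n. weighted_gap k \<omega> * exp (- cost I \<rho> Y' (real k + 1) (real n) \<omega>))"
  proof (rule sum_mono)
    fix k assume "k \<in> {..<n}"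
    then have k: "k < n" by simp
    let ?a = "cost I \<rho> X' (real k) (real k + 1) \<omega>" and ?b = "cost I \<rho> Y' (real k) (real k + 1) \<omega>"
      and ?W = "exp (- cost I \<rho> Y' (real k + 1) (real n) \<omega>)"
    have "cost I \<rho> X' 0 (real (Suc k)) \<omega> = cost I \<rho> X' 0 (real k) \<omega> + ?a"
      using cost_split'[OF cost_measurable_X' \<omega> zero_I nat_I step_in_I, of k k] by (simp add: add.commute)
    then have "T (Suc k) - T k = ZX k \<omega> * ?W * (exp (- ?a) - exp (- ?b))"
      unfolding T_def cost_step[OF cost_measurable_Y' \<omega> k] by (simp add: exp_add[symmetric] exp_diff[symmetric] algebra_simps mult_exp_exp)
    then have "\<bar>T (Suc k) - T k\<bar> = ZX k \<omega> * ?W * \<bar>exp (- ?a) - exp (- ?b)\<bar>" by (simp add: abs_mult)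
    also have "\<dots> \<le> ZX k \<omega> * ?W * gap k \<omega>"
      unfolding gap_def using cost_nonneg' by (intro mult_left_mono exp_diff_le) auto
    finally show "\<bar>T (Suc k) - T k\<bar> \<le> weighted_gap k \<omega> * ?W" unfolding weighted_gap_def by (simp add: mult_ac)
  qed
  finally show ?thesis unfolding T .
qed

lemma weighted_gap_future_integrable:
  assumes "\<xi> = X' \<or> \<xi> = Y'" "k < n"
  shows "integrable (Q z) (\<lambda>\<omega>. weighted_gap k \<omega> * exp (- cost I \<rho> \<xi> (real k + 1) (real n) \<omega>))"
proof (rule integrable_Q[where b = "R * 1"])
  have k: "real k + 1 \<le> real n" using assms(2) by simp
  have "cost_measurable I \<rho> N \<xi>" using assms(1) cost_measurable_X' cost_measurable_Y' by auto
  then show "(\<lambda>\<omega>. weighted_gap k \<omega> * exp (- cost I \<rho> \<xi> (real k + 1) (real n) \<omega>)) \<in> borel_measurable N"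
    using k by (intro borel_measurable_times weighted_gap_measurable exp_cost_meas) auto
  fix \<omega>
  have "weighted_gap k \<omega> * exp (- cost I \<rho> \<xi> (real k + 1) (real n) \<omega>) \<le> R * 1"
    using weighted_gap_bounds[of k \<omega>] exp_cost_bounds(2)[OF step_in_I nat_I k, of \<xi> \<omega>] pos by (intro mult_mono) auto
  then show "\<bar>weighted_gap k \<omega> * exp (- cost I \<rho> \<xi> (real k + 1) (real n) \<omega>)\<bar> \<le> R * 1"
    using weighted_gap_bounds(1)[of k \<omega>] by simp
qed

text \<open>A product rule: the variation of \<open>f\<close> is paid by the contraction at time
  \<open>n\<close>, the variation of the penalization by the sum of the gaps.\<close>

lemma lasota_yorke:
  assumes f: "l-lipschitz_on UNIV f" and b: "\<And>z. \<bar>f z\<bar> \<le> b"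
  shows "\<bar>p (real n) f x - p (real n) f y\<bar> \<le> dist x y *
    (C * l * exp (- \<gamma> * real n) * mass (real n) x + b * (exp R * L * C) * mass_convolution \<kappa> \<gamma> n x)"
proof -
  have l0: "0 \<le> l" using f by (simp add: lipschitz_on_def)
  have b0: "0 \<le> b" using b[of undefined] by linarith
  have fX: "(\<lambda>\<omega>. f (X' (real n) \<omega>)) \<in> borel_measurable N" by (rule measurable_compose[OF measurable_X'[OF nat_I] lipschitz_meas[OF f]])
  have fY: "(\<lambda>\<omega>. f (Y' (real n) \<omega>)) \<in> borel_measurable N" by (rule measurable_compose[OF measurable_Y'[OF nat_I] lipschitz_meas[OF f]])
  let ?d = "\<lambda>\<omega>. dist (X' (real n) \<omega>) (Y' (real n) \<omega>)"
  let ?S = "\<lambda>\<omega>. \<Sum>k<n. weighted_gap k \<omega> * exp (- cost I \<rho> Y' (real k + 1) (real n) \<omega>)"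
  have iX: "integrable (Q (x, y)) (\<lambda>\<omega>. ZX n \<omega> * f (X' (real n) \<omega>))" by (rule integrable_Z(1)[OF fX b])
  have iY: "integrable (Q (x, y)) (\<lambda>\<omega>. ZY n \<omega> * f (Y' (real n) \<omega>))" by (rule integrable_Z(2)[OF fY b])
  have iS: "integrable (Q (x, y)) ?S"
    by (intro Bochner_Integration.integrable_sum weighted_gap_future_integrable) auto
  have id: "integrable (Q (x, y)) (\<lambda>\<omega>. ZX n \<omega> * ?d \<omega>)"
    using dist_le by (intro integrable_Z(1)[where b = D] dist_meas) auto
  have "\<bar>p (real n) f x - p (real n) f y\<bar> = \<bar>\<integral>\<omega>. ZX n \<omega> * f (X' (real n) \<omega>) - ZY n \<omega> * f (Y' (real n) \<omega>) \<partial>Q (x, y)\<bar>"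
    unfolding transfer_X'[where x = x and y = y, OF nat_I[of n] f, symmetric] transfer_Y'[where x = x and y = y, OF nat_I[of n] f, symmetric] using iX iY by simp
  also have "\<dots> \<le> (\<integral>\<omega>. \<bar>ZX n \<omega> * f (X' (real n) \<omega>) - ZY n \<omega> * f (Y' (real n) \<omega>)\<bar> \<partial>Q (x, y))" by (rule integral_abs_bound)
  also have "\<dots> \<le> (\<integral>\<omega>. l * (ZX n \<omega> * ?d \<omega>) + b * ?S \<omega> \<partial>Q (x, y))"
  proof (rule integral_mono)
    fix \<omega> assume "\<omega> \<in> space (Q (x, y))"
    then have \<omega>: "\<omega> \<in> space N" by (simp add: XY.space_P)
    have "ZX n \<omega> * f (X' (real n) \<omega>) - ZY n \<omega> * f (Y' (real n) \<omega>)
      = ZX n \<omega> * (f (X' (real n) \<omega>) - f (Y' (real n) \<omega>)) + (ZX n \<omega> - ZY n \<omega>) * f (Y' (real n) \<omega>)" by (simp add: algebra_simps)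
    then have "\<bar>ZX n \<omega> * f (X' (real n) \<omega>) - ZY n \<omega> * f (Y' (real n) \<omega>)\<bar>
      \<le> \<bar>ZX n \<omega> * (f (X' (real n) \<omega>) - f (Y' (real n) \<omega>))\<bar> + \<bar>(ZX n \<omega> - ZY n \<omega>) * f (Y' (real n) \<omega>)\<bar>" by (simp only: abs_triangle_ineq)
    also have "\<dots> = ZX n \<omega> * \<bar>f (X' (real n) \<omega>) - f (Y' (real n) \<omega>)\<bar> + \<bar>ZX n \<omega> - ZY n \<omega>\<bar> * \<bar>f (Y' (real n) \<omega>)\<bar>" by (simp add: abs_mult)
    also have "\<dots> \<le> ZX n \<omega> * (l * ?d \<omega>) + ?S \<omega> * b"
      using f Z_difference[OF \<omega>, of n] b[of "Y' (real n) \<omega>"] b0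
      by (intro add_mono mult_left_mono mult_mono) (auto simp: lipschitz_on_def dist_real_def intro: order_trans[OF abs_ge_zero])
    finally show "\<bar>ZX n \<omega> * f (X' (real n) \<omega>) - ZY n \<omega> * f (Y' (real n) \<omega>)\<bar> \<le> l * (ZX n \<omega> * ?d \<omega>) + b * ?S \<omega>" by (simp add: mult_ac)
  qed (use iX iY iS id in auto)
  also have "\<dots> = l * (\<integral>\<omega>. ZX n \<omega> * ?d \<omega> \<partial>Q (x, y)) + b * (\<Sum>k<n. \<integral>\<omega>. weighted_gap k \<omega> * exp (- cost I \<rho> Y' (real k + 1) (real n) \<omega>) \<partial>Q (x, y))"
    using id iS weighted_gap_future_integrable[of Y'] by (simp add: Bochner_Integration.integral_sum)
  also have "\<dots> \<le> l * (C * exp (- \<gamma> * real n) * mass (real n) x * dist x y) + b * (exp R * L * C * dist x y * mass_convolution \<kappa> \<gamma> n x)"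
    by (intro add_mono mult_left_mono weighted_contraction weighted_gap_sum_le nat_I l0 b0) simp
  finally show ?thesis by (simp add: algebra_simps)
qed

lemma mass_transfer: "mass (real n) x = (\<integral>\<omega>. ZX n \<omega> \<partial>Q (x, y))" "mass (real n) y = (\<integral>\<omega>. ZY n \<omega> \<partial>Q (x, y))"
  unfolding mass_def transfer_X'[where x = x and y = y, OF nat_I[of n] lipschitz_one, symmetric] transfer_Y'[where x = x and y = y, OF nat_I[of n] lipschitz_one, symmetric] by simp_all

text \<open>Jensen's inequality for the law of the coupling weighted by the penalization of the first process.\<close>

lemma mass_ratio:
  "mass (real n) x * exp (- (exp R * L * C * D * mass_convolution \<kappa> \<gamma> n x / mass (real n) x)) \<le> mass (real n) y"
proof -
  let ?W = "\<lambda>k \<omega>. weighted_gap k \<omega> * exp (- cost I \<rho> X' (real k + 1) (real n) \<omega>)"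
  let ?S = "\<lambda>\<omega>. \<Sum>k<n. gap k \<omega>"
  let ?c = "exp R * L * C * D * mass_convolution \<kappa> \<gamma> n x / mass (real n) x"
  have mpos: "0 < mass (real n) x" using mass_pos by simp
  have S_meas: "?S \<in> borel_measurable N" by (intro borel_measurable_sum gap_measurable)
  have S_bound: "\<bar>?S \<omega>\<bar> \<le> real n * R" for \<omega>
  proof -
    have "?S \<omega> \<le> (\<Sum>k<n. R)" by (intro sum_mono gap_bounds)
    moreover have "0 \<le> ?S \<omega>" by (intro sum_nonneg gap_bounds)
    ultimately show ?thesis by simp
  qed
  have iZS: "integrable (Q (x, y)) (\<lambda>\<omega>. ZX n \<omega> * ?S \<omega>)" by (rule integrable_Z(1)[OF S_meas S_bound])
  have iZX: "integrable (Q (x, y)) (ZX n)" and iZY: "integrable (Q (x, y)) (ZY n)"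
    using integrable_Z[of "\<lambda>_. 1" 1 "(x, y)" n] by simp_all
  have iW: "integrable (Q (x, y)) (\<lambda>\<omega>. \<Sum>k<n. ?W k \<omega>)"
    by (intro Bochner_Integration.integrable_sum weighted_gap_future_integrable) auto
  have conv0: "0 \<le> mass_convolution \<kappa> \<gamma> n x"
  proof -
    have "0 \<le> top_mass \<kappa> (real j)" for j using mass_le_top[of j] mass_pos[OF nat_I] by (meson less_imp_le order_trans)
    note top0 = this
    show ?thesis unfolding mass_convolution_def
      by (intro sum_nonneg mult_nonneg_nonneg) (simp_all only: exp_ge_zero measure_nonneg top0)
  qed
  \<comment> \<open>Dropping the nonnegative cost of the step from \<open>k\<close> to
    \<open>k + 1\<close> splits \<open>ZX n\<close> into a weight before the step and a weight after
    it, as \<open>weighted_gap_future\<close> requires.\<close>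
  have "(\<integral>\<omega>. ZX n \<omega> * ?S \<omega> \<partial>Q (x, y)) \<le> (\<integral>\<omega>. (\<Sum>k<n. ?W k \<omega>) \<partial>Q (x, y))"
  proof (rule integral_mono[OF iZS iW])
    fix \<omega> assume "\<omega> \<in> space (Q (x, y))"
    then have \<omega>: "\<omega> \<in> space N" by (simp add: XY.space_P)
    show "ZX n \<omega> * ?S \<omega> \<le> (\<Sum>k<n. ?W k \<omega>)"
      unfolding sum_distrib_left
    proof (rule sum_mono)
      fix k assume "k \<in> {..<n}"
      then have k: "k < n" by simp
      have "cost I \<rho> X' 0 (real n) \<omega> = cost I \<rho> X' 0 (real k) \<omega> + cost I \<rho> X' (real k) (real n) \<omega>"
        using k by (intro cost_split'[OF cost_measurable_X' \<omega>]) auto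
      then have "- cost I \<rho> X' 0 (real n) \<omega> \<le> - cost I \<rho> X' 0 (real k) \<omega> + - cost I \<rho> X' (real k + 1) (real n) \<omega>"
        using cost_step[OF cost_measurable_X' \<omega> k] cost_nonneg'[of X' "real k" "real k + 1" \<omega>] by linarith
      then have "ZX n \<omega> \<le> ZX k \<omega> * exp (- cost I \<rho> X' (real k + 1) (real n) \<omega>)" unfolding exp_add[symmetric] by simp
      then have "ZX n \<omega> * gap k \<omega> \<le> ZX k \<omega> * exp (- cost I \<rho> X' (real k + 1) (real n) \<omega>) * gap k \<omega>"
        using gap_bounds by (intro mult_right_mono) auto
      then show "ZX n \<omega> * gap k \<omega> \<le> ?W k \<omega>" unfolding weighted_gap_def by (simp add: mult_ac)
    qed
  qed
  also have "\<dots> = (\<Sum>k<n. \<integral>\<omega>. ?W k \<omega> \<partial>Q (x, y))"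
    by (intro Bochner_Integration.integral_sum weighted_gap_future_integrable) auto
  also have "\<dots> \<le> exp R * L * C * dist x y * mass_convolution \<kappa> \<gamma> n x" by (rule weighted_gap_sum_le) simp
  also have "\<dots> \<le> exp R * L * C * D * mass_convolution \<kappa> \<gamma> n x"
    using dist_le[of x y] pos conv0 by (intro mult_right_mono mult_left_mono) auto
  also have "\<dots> = ?c * mass (real n) x" using mpos by simp
  finally have ZS: "(\<integral>\<omega>. ZX n \<omega> * ?S \<omega> \<partial>Q (x, y)) \<le> ?c * mass (real n) x" .
  \<comment> \<open>Jensen's inequality in tangent form, by
    \<open>exp (?c - ?S) \<ge> 1 + ?c - ?S\<close>. By \<open>ZS\<close> the number
    \<open>?c\<close> bounds the mean of \<open>?S\<close> under the weighted law, so the linear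
    term \<open>?c - ?S\<close> has a nonnegative mean.\<close>
  have "exp (- ?c) * ((1 + ?c) * ZX n \<omega> - ZX n \<omega> * ?S \<omega>) \<le> ZY n \<omega>" if "\<omega> \<in> space (Q (x, y))" for \<omega>
  proof -
    have \<omega>: "\<omega> \<in> space N" using that by (simp add: XY.space_P)
    have sum_cost: "cost I \<rho> \<xi> 0 (real j) \<omega> = (\<Sum>k<j. cost I \<rho> \<xi> (real k) (real k + 1) \<omega>)" if "cost_measurable I \<rho> N \<xi>" for \<xi> j
    proof (induction j)
      case 0
      show ?case using cost_nonneg'[of \<xi> 0 0 \<omega>] cost_le'[OF zero_I zero_I order_refl, of \<xi> \<omega>] by simp
    next
      case (Suc j)
      have "cost I \<rho> \<xi> 0 (real j + 1) \<omega> = cost I \<rho> \<xi> 0 (real j) \<omega> + cost I \<rho> \<xi> (real j) (real j + 1) \<omega>"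
        by (rule cost_split'[OF that \<omega> zero_I nat_I step_in_I]) auto
      then show ?case using Suc by (simp add: add.commute)
    qed
    have "cost I \<rho> Y' 0 (real n) \<omega> - cost I \<rho> X' 0 (real n) \<omega> = (\<Sum>k<n. cost I \<rho> Y' (real k) (real k + 1) \<omega> - cost I \<rho> X' (real k) (real k + 1) \<omega>)"
      unfolding sum_cost[OF cost_measurable_X'] sum_cost[OF cost_measurable_Y'] by (simp add: sum_subtractf)
    also have "\<dots> \<le> ?S \<omega>" by (intro sum_mono) (auto simp: gap_def)
    finally have "ZX n \<omega> * exp (- ?S \<omega>) \<le> ZY n \<omega>" unfolding exp_add[symmetric] by simp
    moreover have "exp (- ?c) * (1 + (?c - ?S \<omega>)) \<le> exp (- ?c) * exp (?c - ?S \<omega>)"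
      by (intro mult_left_mono exp_ge_add_one_self) simp
    then have "exp (- ?c) * (1 + (?c - ?S \<omega>)) \<le> exp (- ?S \<omega>)" by (simp add: exp_add[symmetric] mult_exp_exp)
    then have "ZX n \<omega> * (exp (- ?c) * (1 + (?c - ?S \<omega>))) \<le> ZX n \<omega> * exp (- ?S \<omega>)" by (intro mult_left_mono) auto
    ultimately have "ZX n \<omega> * (exp (- ?c) * (1 + (?c - ?S \<omega>))) \<le> ZY n \<omega>" by linarith
    moreover have "ZX n \<omega> * (exp (- ?c) * (1 + (?c - ?S \<omega>))) = exp (- ?c) * ((1 + ?c) * ZX n \<omega> - ZX n \<omega> * ?S \<omega>)" by (simp add: algebra_simps)
    ultimately show ?thesis by simp
  qed
  then have "(\<integral>\<omega>. exp (- ?c) * ((1 + ?c) * ZX n \<omega> - ZX n \<omega> * ?S \<omega>) \<partial>Q (x, y)) \<le> (\<integral>\<omega>. ZY n \<omega> \<partial>Q (x, y))"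
    using iZX iZY iZS by (intro integral_mono) auto
  also have "\<dots> = mass (real n) y" by (rule mass_transfer(2)[symmetric])
  also have "(\<integral>\<omega>. exp (- ?c) * ((1 + ?c) * ZX n \<omega> - ZX n \<omega> * ?S \<omega>) \<partial>Q (x, y))
    = exp (- ?c) * ((1 + ?c) * mass (real n) x - (\<integral>\<omega>. ZX n \<omega> * ?S \<omega> \<partial>Q (x, y)))"
    unfolding mass_transfer(1)[of n x y] using iZX iZS by simp
  finally have le_y: "exp (- ?c) * ((1 + ?c) * mass (real n) x - (\<integral>\<omega>. ZX n \<omega> * ?S \<omega> \<partial>Q (x, y))) \<le> mass (real n) y" .
  have "exp (- ?c) * mass (real n) x \<le> exp (- ?c) * ((1 + ?c) * mass (real n) x - (\<integral>\<omega>. ZX n \<omega> * ?S \<omega> \<partial>Q (x, y)))"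
    using ZS by (intro mult_left_mono) (auto simp: distrib_right)
  from order_trans[OF this le_y] show ?thesis by (simp only: mult.commute)
qed

text \<open>Along the coupling \<open>f\<close> drops by at most \<open>l\<close> times the
  distance, and the second penalization is at least \<open>exp (- R * n)\<close>. This crude factor
  is harmless because minorization uses a fixed number of steps.\<close>

lemma mixing:
  assumes f: "l-lipschitz_on UNIV f" and f0: "\<And>z. 0 \<le> f z"
  shows "exp (- R * real n) * (p (real n) f x - C * l * D * exp (- \<gamma> * real n) * mass (real n) x) \<le> p (real n) f y"
proof -
  have l0: "0 \<le> l" using f by (simp add: lipschitz_on_def)
  note b = lipschitz_bound[OF f]
  have fX: "(\<lambda>\<omega>. f (X' (real n) \<omega>)) \<in> borel_measurable N" by (rule measurable_compose[OF measurable_X'[OF nat_I] lipschitz_meas[OF f]])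
  have fY: "(\<lambda>\<omega>. f (Y' (real n) \<omega>)) \<in> borel_measurable N" by (rule measurable_compose[OF measurable_Y'[OF nat_I] lipschitz_meas[OF f]])
  let ?d = "\<lambda>\<omega>. dist (X' (real n) \<omega>) (Y' (real n) \<omega>)"
  have iX: "integrable (Q (x, y)) (\<lambda>\<omega>. ZX n \<omega> * f (X' (real n) \<omega>))" by (rule integrable_Z(1)[OF fX b])
  have iY: "integrable (Q (x, y)) (\<lambda>\<omega>. ZY n \<omega> * f (Y' (real n) \<omega>))" by (rule integrable_Z(2)[OF fY b])
  have id: "integrable (Q (x, y)) (\<lambda>\<omega>. ZX n \<omega> * ?d \<omega>)"
    using dist_le by (intro integrable_Z(1)[where b = D] dist_meas) auto
  have "l * (\<integral>\<omega>. ZX n \<omega> * ?d \<omega> \<partial>Q (x, y)) \<le> l * (C * exp (- \<gamma> * real n) * mass (real n) x * dist x y)"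
    using weighted_contraction[OF nat_I] l0 by (intro mult_left_mono) auto
  also have "\<dots> \<le> l * (C * exp (- \<gamma> * real n) * mass (real n) x * D)"
    using dist_le[of x y] mass_pos[OF nat_I, of n x] pos l0 by (intro mult_left_mono) auto
  finally have "exp (- R * real n) * (p (real n) f x - C * l * D * exp (- \<gamma> * real n) * mass (real n) x)
    \<le> exp (- R * real n) * (p (real n) f x - l * (\<integral>\<omega>. ZX n \<omega> * ?d \<omega> \<partial>Q (x, y)))"
    by (intro mult_left_mono) (simp_all add: mult_ac)
  also have "\<dots> = (\<integral>\<omega>. exp (- R * real n) * (ZX n \<omega> * f (X' (real n) \<omega>) - l * (ZX n \<omega> * ?d \<omega>)) \<partial>Q (x, y))"
    unfolding transfer_X'[where x = x and y = y, OF nat_I[of n] f, symmetric] using iX id by simp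
  also have "\<dots> \<le> (\<integral>\<omega>. ZY n \<omega> * f (Y' (real n) \<omega>) \<partial>Q (x, y))"
  proof (rule integral_mono)
    fix \<omega>
    have "f (X' (real n) \<omega>) - l * ?d \<omega> \<le> f (Y' (real n) \<omega>)"
      using f unfolding lipschitz_on_def dist_real_def by (smt (verit) UNIV_I)
    then have "ZX n \<omega> * (f (X' (real n) \<omega>) - l * ?d \<omega>) \<le> ZX n \<omega> * f (Y' (real n) \<omega>)" by (intro mult_left_mono) auto
    also have "\<dots> \<le> 1 * f (Y' (real n) \<omega>)" using ZX_bounds(2) f0 by (intro mult_right_mono) auto
    finally have "exp (- R * real n) * (ZX n \<omega> * (f (X' (real n) \<omega>) - l * ?d \<omega>)) \<le> exp (- R * real n) * f (Y' (real n) \<omega>)"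
      by (intro mult_left_mono) auto
    also have "\<dots> \<le> ZY n \<omega> * f (Y' (real n) \<omega>)" using ZY_bounds(1) f0 by (intro mult_right_mono) auto
    finally show "exp (- R * real n) * (ZX n \<omega> * f (X' (real n) \<omega>) - l * (ZX n \<omega> * ?d \<omega>)) \<le> ZY n \<omega> * f (Y' (real n) \<omega>)"
      by (simp add: right_diff_distrib mult_ac)
  qed (use iX iY id in auto)
  also have "\<dots> = p (real n) f y" by (rule transfer_Y'[OF nat_I f])
  finally show ?thesis .
qed

text \<open>The constant \<open>exp R * L * C\<close> is that of \<open>weighted_gap_le\<close>:
  moving the weight within a unit step, the Lipschitz constant of \<rho>, and the contraction
  constant.\<close>

lemma contracting: "contracting_kernels I \<kappa> R C (exp R * L * C) \<gamma> D"
proof (rule contracting_kernels.intro)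
  show "I = {0..} \<or> I = \<nat>" by (rule tI)
  show "dist x y \<le> D" for x y :: 'e by (rule dist_le)
  show "0 < R" "0 < C" "0 < exp R * L * C" "0 < \<gamma>" "0 < D" using pos by simp_all
  fix t assume t: "t \<in> I"
  show "sets (\<kappa> t x) = sets borel" for x by (rule sets_\<kappa>)
  show "finite_measure (\<kappa> t x)" for x by (rule finite_\<kappa>[OF t])
  show "exp (- R * t) \<le> measure (\<kappa> t x) UNIV" "measure (\<kappa> t x) UNIV \<le> 1" for x
    unfolding measure_\<kappa>[OF t] by (rule mass_bounds[OF t])+
  fix l and f :: "'e \<Rightarrow> real" assume f: "l-lipschitz_on UNIV f"
  show "\<exists>L'. L'-lipschitz_on UNIV (\<lambda>x. \<integral>z. f z \<partial>\<kappa> t x)"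
    unfolding integral_\<kappa>[OF t lipschitz_meas[OF f]] using p_lipschitz[OF t f lipschitz_bound[OF f]] by blast
  fix s x assume s: "s \<in> I"
  show "(\<integral>z. f z \<partial>\<kappa> (s + t) x) = (\<integral>y. (\<integral>z. f z \<partial>\<kappa> t y) \<partial>\<kappa> s x)"
    unfolding integral_\<kappa>[OF t lipschitz_meas[OF f]] integral_\<kappa>[OF add_I[OF s t] lipschitz_meas[OF f]]
      integral_\<kappa>[OF s lipschitz_meas[OF p_lipschitz[OF t f lipschitz_bound[OF f]]]]
    by (rule p_semigroup[OF s t f])
next
  fix l b n x y and f :: "'e \<Rightarrow> real" assume f: "l-lipschitz_on UNIV f" "\<And>z. \<bar>f z\<bar> \<le> b"
  show "\<bar>(\<integral>z. f z \<partial>\<kappa> (real n) x) - (\<integral>z. f z \<partial>\<kappa> (real n) y)\<bar> \<le> dist x y *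
        (C * l * exp (- \<gamma> * real n) * measure (\<kappa> (real n) x) UNIV + b * (exp R * L * C) * mass_convolution \<kappa> \<gamma> n x)"
    unfolding integral_\<kappa>[OF nat_I lipschitz_meas[OF f(1)]] measure_\<kappa>[OF nat_I] by (rule lasota_yorke[OF f])
next
  fix n x y
  show "measure (\<kappa> (real n) x) UNIV * exp (- (exp R * L * C * D * mass_convolution \<kappa> \<gamma> n x / measure (\<kappa> (real n) x) UNIV)) \<le> measure (\<kappa> (real n) y) UNIV"
    unfolding measure_\<kappa>[OF nat_I] by (rule mass_ratio)
next
  fix l n x y and f :: "'e \<Rightarrow> real" assume f: "l-lipschitz_on UNIV f" "\<And>z. 0 \<le> f z"
  show "exp (- R * real n) * ((\<integral>z. f z \<partial>\<kappa> (real n) x) - C * l * D * exp (- \<gamma> * real n) * measure (\<kappa> (real n) x) UNIV) \<le> (\<integral>z. f z \<partial>\<kappa> (real n) y)"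
    unfolding integral_\<kappa>[OF nat_I lipschitz_meas[OF f(1)]] measure_\<kappa>[OF nat_I] by (rule mixing[OF f])
qed

end

theorem theorem2p3:
  fixes I :: "real set"
    and M :: "'w measure" and F :: "real \<Rightarrow> 'w measure"
    and P :: "'e::polish_space \<Rightarrow> 'w measure" and X :: "real \<Rightarrow> 'w \<Rightarrow> 'e"
    and \<rho> :: "'e \<Rightarrow> real" and dbar :: real
    and N :: "'v measure" and Q :: "'e \<times> 'e \<Rightarrow> 'v measure"
    and X' Y' :: "real \<Rightarrow> 'v \<Rightarrow> 'e"
    and C\<^sub>A \<gamma>\<^sub>A :: real
  defines "Z \<equiv> penalization I \<rho> X"
    and "\<nu> \<equiv> qsd I \<rho> P X"
    and "l0 \<equiv> absorption_rate I \<rho> P X (qsd I \<rho> P X)"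
  assumes bounded_dist: "\<And>x y :: 'e. dist x y \<le> dbar"
    and process: "markov_process I M F P X"
    and rho_nonneg: "\<And>x. 0 \<le> \<rho> x"
    and rho_lipschitz: "\<exists>L. L-lipschitz_on UNIV \<rho>"
    and well_defined: "penalization_well_defined I \<rho> M X"
    and coupling: "markovian_coupling I P X N Q X' Y'"
    and coupling_well_defined:
      "penalization_well_defined I \<rho> N X'" "penalization_well_defined I \<rho> N Y'"
    and A_pos: "C\<^sub>A > 0" "\<gamma>\<^sub>A > 0"
    and A: "\<And>x y t. t \<in> I \<Longrightarrow>
      (\<integral>\<omega>. penalization I \<rho> X' t \<omega> / (\<integral>\<omega>'. Z t \<omega>' \<partial>P x) * dist (X' t \<omega>) (Y' t \<omega>) \<partial>Q (x, y))
        \<le> C\<^sub>A * exp (- \<gamma>\<^sub>A * t) * dist x y"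
  shows "\<exists>\<eta> :: 'e \<Rightarrow> real.
      (\<exists>L. L-lipschitz_on UNIV \<eta>) \<and>
      (\<forall>x. 0 < \<eta> x) \<and>
      (\<forall>x. ((\<lambda>t. exp (l0 * t) * (\<integral>\<omega>. Z t \<omega> \<partial>P x)) \<longlongrightarrow> \<eta> x) (inf at_top (principal I))) \<and>
      (\<exists>C>0. \<exists>\<gamma>>0. \<forall>t\<in>I. \<forall>x.
         \<bar>exp (l0 * t) * (\<integral>\<omega>. Z t \<omega> \<partial>P x) - \<eta> x\<bar> \<le> C * exp (- \<gamma> * t)) \<and>
      (\<integral>x. \<eta> x \<partial>\<nu>) = 1 \<and>
      (\<forall>t\<in>I. \<forall>x. penalized_semigroup I \<rho> P X t \<eta> x = exp (- l0 * t) * \<eta> x) \<and>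
      (\<exists>c>0. \<forall>x. c \<le> \<eta> x)"
proof -
  obtain L0 where L0: "L0-lipschitz_on UNIV \<rho>" using rho_lipschitz by blast
  \<comment> \<open>One is added to make the constants strictly positive even if \<rho> is constant
    or the space is a single point.\<close>
  define L where "L = L0 + 1"
  define D where "D = dbar + 1"
  define R where "R = \<rho> undefined + L * D + 1"
  have L0_nonneg: "0 \<le> L0" using L0 by (simp add: lipschitz_on_def)
  have dbar: "0 \<le> dbar" using bounded_dist[of undefined undefined] by simp
  have L: "L-lipschitz_on UNIV \<rho>" by (rule lipschitz_on_le[OF L0]) (simp add: L_def)
  have D: "dist x y \<le> D" for x y :: 'e using bounded_dist[of x y] unfolding D_def by simp
  have LD: "0 \<le> L * D" unfolding L_def D_def using L0_nonneg dbar by simp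
  have R: "\<rho> x \<le> R" for x
  proof -
    have "\<rho> x - \<rho> undefined \<le> L * dist x undefined" using L by (auto simp: lipschitz_on_def dist_real_def abs_le_iff)
    also have "\<dots> \<le> L * D" using D L by (intro mult_left_mono) (auto simp: lipschitz_on_def)
    finally show ?thesis unfolding R_def by simp
  qed
  have Rpos: "0 < R" unfolding R_def using rho_nonneg[of undefined] LD by linarith
  interpret penalized_coupling I M F P X \<rho> N Q X' Y' C\<^sub>A \<gamma>\<^sub>A L R D
  proof (rule penalized_coupling.intro)
    show "0 < L" "0 < D" unfolding L_def D_def using L0_nonneg dbar by simp_all
    show "(\<integral>\<omega>. penalization I \<rho> X' t \<omega> / (\<integral>\<omega>'. penalization I \<rho> X t \<omega>' \<partial>P x) * dist (X' t \<omega>) (Y' t \<omega>) \<partial>Q (x, y))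
        \<le> C\<^sub>A * exp (- \<gamma>\<^sub>A * t) * dist x y" if "t \<in> I" for x y t
      using A[OF that, of x y] unfolding Z_def .
  qed (fact process D rho_nonneg R L well_defined coupling coupling_well_defined A_pos Rpos)+
  interpret K: contracting_kernels I \<kappa> R C\<^sub>A "exp R * L * C\<^sub>A" \<gamma>\<^sub>A D by (rule contracting)
  obtain l H where lH: "0 \<le> l" "1 \<le> H" "\<And>n. exp (- l * real n) \<le> K.M n" "\<And>n. K.M n \<le> H * exp (- l * real n)"
    "\<And>n x. K.M n \<le> H * K.m (real n) x" using K.harnack by blast
  interpret S: contracting_kernels_rate I \<kappa> R C\<^sub>A "exp R * L * C\<^sub>A" \<gamma>\<^sub>A D l H
    by unfold_locales (use lH in auto)
  \<comment> \<open>The identification holds for all Borel functions and so covers the test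
    functions in the definition of a quasi-stationary distribution.\<close>
  have pK: "K.p t f = penalized_semigroup I \<rho> P X t f" if "t \<in> I" "f \<in> borel_measurable borel" for t f
    unfolding K.p_def integral_\<kappa>[OF that] p_def by (rule ext) simp
  have pK1: "K.p t (\<lambda>_. 1) = penalized_semigroup I \<rho> P X t (\<lambda>_. 1)" if "t \<in> I" for t using pK[OF that, of "\<lambda>_. 1"] by simp
  have mK: "K.m t x = (\<integral>\<omega>. Z t \<omega> \<partial>P x)" if "t \<in> I" for t x
    unfolding K.m_def measure_\<kappa>[OF that] mass_def p_def penalized_semigroup_def Z_def by simp
  obtain \<nu>' \<eta> where sp: "prob_space \<nu>'" "sets \<nu>' = sets borel"
    "\<forall>t\<in>I. \<forall>f\<in>borel_measurable borel. bounded (range f) \<longrightarrow> (\<integral>x. K.p t f x \<partial>\<nu>') = exp (- l * t) * (\<integral>x. f x \<partial>\<nu>')"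
    "\<forall>\<mu>. prob_space \<mu> \<and> sets \<mu> = sets borel \<and>
      (\<forall>t\<in>I. \<forall>f\<in>borel_measurable borel. bounded (range f) \<longrightarrow>
        (\<integral>x. K.p t f x \<partial>\<mu>) / (\<integral>x. K.p t (\<lambda>_. 1) x \<partial>\<mu>) = (\<integral>x. f x \<partial>\<mu>)) \<longrightarrow> \<mu> = \<nu>'"
    and \<eta>: "\<exists>L. L-lipschitz_on UNIV \<eta>" "\<exists>c>0. \<forall>x. c \<le> \<eta> x"
    "\<exists>C>0. \<exists>\<delta>>0. \<forall>t\<in>I. \<forall>x. \<bar>exp (l * t) * K.m t x - \<eta> x\<bar> \<le> C * exp (- \<delta> * t)"
    "(\<integral>x. \<eta> x \<partial>\<nu>') = 1" "\<forall>t\<in>I. \<forall>x. K.p t \<eta> x = exp (- l * t) * \<eta> x"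
    by (rule S.spectral)
  interpret \<nu>': prob_space \<nu>' by (rule sp(1))
  have act: "penalized_action I \<rho> P X \<nu>' t f = exp (- l * t) * (\<integral>x. f x \<partial>\<nu>')"
    if "t \<in> I" "f \<in> borel_measurable borel" "bounded (range f)" for t f
    unfolding penalized_action_def pK[OF that(1,2), symmetric] using sp(3) that by blast
  have act1: "penalized_action I \<rho> P X \<nu>' t (\<lambda>_. 1) = exp (- l * t)" if "t \<in> I" for t
    using act[OF that, of "\<lambda>_. 1"] \<nu>'.prob_space by simp
  have qs: "quasi_stationary I \<rho> P X \<nu>'"
    unfolding quasi_stationary_def using sp(1,2) act act1 by auto
  have unique: "\<mu> = \<nu>'" if "quasi_stationary I \<rho> P X \<mu>" for \<mu>
  proof -
    have "(\<integral>x. K.p t f x \<partial>\<mu>) / (\<integral>x. K.p t (\<lambda>_. 1) x \<partial>\<mu>) = (\<integral>x. f x \<partial>\<mu>)"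
      if "t \<in> I" "f \<in> borel_measurable borel" "bounded (range f)" for t f
      using \<open>quasi_stationary I \<rho> P X \<mu>\<close> that unfolding quasi_stationary_def penalized_action_def pK[OF that(1,2)] pK1[OF that(1)] by blast
    then show ?thesis using sp(4) that unfolding quasi_stationary_def by blast
  qed
  \<comment> \<open>Existence and uniqueness together make the definite description in
    \<open>qsd\<close> denote \<nu>'.\<close>
  have \<nu>: "\<nu> = \<nu>'" unfolding \<nu>_def qsd_def by (rule the_equality) (rule qs, rule unique)
  have l0: "l0 = l"
    unfolding l0_def \<nu>_def[symmetric] \<nu> absorption_rate_def
  proof (rule the_equality)
    show "0 \<le> l \<and> (\<forall>t\<in>I. \<forall>f\<in>borel_measurable borel. bounded (range f) \<longrightarrow>
           penalized_action I \<rho> P X \<nu>' t f = exp (- l * t) * (\<integral>x. f x \<partial>\<nu>'))" using lH(1) act by blast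
    \<comment> \<open>The constant function \<open>1\<close> at time \<open>1\<close>, which belongs
      to both time sets, already determines the rate.\<close>
    fix l' assume "0 \<le> l' \<and> (\<forall>t\<in>I. \<forall>f\<in>borel_measurable borel. bounded (range f) \<longrightarrow>
           penalized_action I \<rho> P X \<nu>' t f = exp (- l' * t) * (\<integral>x. f x \<partial>\<nu>'))"
    then have "penalized_action I \<rho> P X \<nu>' 1 (\<lambda>_. 1) = exp (- l' * 1) * (\<integral>x. 1 \<partial>\<nu>')"
      using nat_I[of 1] by auto
    then have "exp (- l) = exp (- l')" using act1[of 1] nat_I[of 1] \<nu>'.prob_space by simp
    then show "l' = l" by simp
  qed
  obtain C \<delta> where C: "0 < C" and \<delta>: "0 < \<delta>" and C\<delta>: "\<forall>t\<in>I. \<forall>x. \<bar>exp (l * t) * K.m t x - \<eta> x\<bar> \<le> C * exp (- \<delta> * t)"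
    using \<eta>(3) by blast
  have conv: "\<bar>exp (l0 * t) * (\<integral>\<omega>. Z t \<omega> \<partial>P x) - \<eta> x\<bar> \<le> C * exp (- \<delta> * t)" if "t \<in> I" for t x
    using C\<delta> that mK[OF that, of x] unfolding l0 by metis
  show ?thesis
  proof (intro exI[of _ \<eta>] conjI)
    show "\<exists>L. L-lipschitz_on UNIV \<eta>" "\<exists>c>0. \<forall>x. c \<le> \<eta> x" by fact+
    show "\<forall>x. 0 < \<eta> x" using \<eta>(2) less_le_trans by blast
    show "(\<integral>x. \<eta> x \<partial>\<nu>) = 1" unfolding \<nu> by (rule \<eta>(4))
    have "\<eta> \<in> borel_measurable borel" using \<eta>(1) lipschitz_meas by blast
    then show "\<forall>t\<in>I. \<forall>x. penalized_semigroup I \<rho> P X t \<eta> x = exp (- l0 * t) * \<eta> x"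
      using \<eta>(5) pK unfolding l0 by metis
    show "\<exists>C>0. \<exists>\<gamma>>0. \<forall>t\<in>I. \<forall>x. \<bar>exp (l0 * t) * (\<integral>\<omega>. Z t \<omega> \<partial>P x) - \<eta> x\<bar> \<le> C * exp (- \<gamma> * t)"
      using C \<delta> conv by blast
    \<comment> \<open>The exponential bound is available only at times in \<open>I\<close>, and
      these are the times along which the filter \<open>inf at_top (principal I)\<close> tends to
      infinity.\<close>
    show "\<forall>x. ((\<lambda>t. exp (l0 * t) * (\<integral>\<omega>. Z t \<omega> \<partial>P x)) \<longlongrightarrow> \<eta> x) (inf at_top (principal I))"
    proof
      fix x
      have "LIM t at_top. \<delta> * t :> at_top"
        by (rule filterlim_tendsto_pos_mult_at_top[OF tendsto_const \<delta> filterlim_ident])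
      then have "((\<lambda>t. exp (- (\<delta> * t))) \<longlongrightarrow> 0) at_top"
        by (intro filterlim_compose[OF exp_at_bot]) (simp add: filterlim_uminus_at_bot)
      then have "((\<lambda>t. C * exp (- \<delta> * t)) \<longlongrightarrow> 0) at_top" using tendsto_mult_left[of _ 0 at_top C] by simp
      then have "((\<lambda>t. C * exp (- \<delta> * t)) \<longlongrightarrow> 0) (inf at_top (principal I))" by (rule tendsto_mono[OF inf_le1])
      moreover have "\<forall>\<^sub>F t in inf at_top (principal I). norm (exp (l0 * t) * (\<integral>\<omega>. Z t \<omega> \<partial>P x) - \<eta> x) \<le> C * exp (- \<delta> * t)"
        using conv by (simp add: eventually_inf_principal)
      ultimately have "((\<lambda>t. exp (l0 * t) * (\<integral>\<omega>. Z t \<omega> \<partial>P x) - \<eta> x) \<longlongrightarrow> 0) (inf at_top (principal I))"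
        by (rule Lim_null_comparison[rotated])
      then show "((\<lambda>t. exp (l0 * t) * (\<integral>\<omega>. Z t \<omega> \<partial>P x)) \<longlongrightarrow> \<eta> x) (inf at_top (principal I))" by (rule LIM_zero_cancel)
    qed
  qed
qed

end
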